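(* Suppose $A<0$ and $L_2\neq0$ (with $L_2>-1$). Then for every $\lambda>0$ the symmetric critical point $(q_1^s,q_2^s,q_3^s)$ of $J$ in $\mathcal{A}_0$, constructed by minimization on $\Omega_q$ and reflection as described in the context, has non-constant $q_2^s$ on $\Omega$.
   Context: Parameters: $A<0$, $B,C,L,\lambda>0$ and $L_2\in(-1,\infty)$ are real constants, and $s_+=\frac{B+\sqrt{B^2+24|A|C}}{4C}>0$. Domain: for a fixed small $\epsilon>0$ ($\epsilon\ll1$), $\Omega=\{(x,y)\in\mathbb{R}^2:|x|<1,|y|<1,|x+y|<2-\epsilon,|x-y|<2-\epsilon\}$. Its boundary consists of four long edges, labelled clockwise, $C_1$ (on $y=1$), $C_2$ (on $x=1$), $C_3$ (on $y=-1$), $C_4$ (on $x=-1$), and four short edges, labelled clockwise from the top left, $S_1$ (on $y-x=2-\epsilon$), $S_2$ (on $x+y=2-\epsilon$), $S_3$ (on $x-y=2-\epsilon$), $S_4$ (on $x+y=-(2-\epsilon)$). Boundary function: with $g(l)=\frac{s_+}{2\epsilon}l$ for $-\epsilon\le l\le\epsilon$, define $q_b=s_+/2$ on $C_1\cup C_3$, $q_b=-s_+/2$ on $C_2\cup C_4$, $q_b=g(x+y)$ on $S_1$, $q_b=g(y-x)$ on $S_2$, $q_b=g(-x-y)$ on $S_3$, $q_b=g(x-y)$ on $S_4$. Energy: $J[q_1,q_2,q_3]=\int_\Omega f_{el}(q_1,q_2,q_3)+\frac{\lambda^2}{L}f_b(q_1,q_2,q_3)\,\mathrm{dA}$, where \begin{align*}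 f_{el}=&\Big(1+\tfrac{L_2}{2}\Big)|\nabla q_1|^2+\Big(1+\tfrac{L_2}{2}\Big)|\nabla q_2|^2+\Big(3+\tfrac{L_2}{2}\Big)|\nabla q_3|^2\\&+L_2(q_{1,y}q_{3,y}-q_{1,x}q_{3,x}-q_{2,y}q_{3,x}-q_{2,x}q_{3,y})+|L_2|(q_{2,y}q_{1,x}-q_{1,y}q_{2,x}),\\ f_b=&A(q_1^2+q_2^2+3q_3^2)+C(q_1^2+q_2^2+3q_3^2)^2+2Bq_3(q_1^2+q_2^2-q_3^2). \end{align*} The admissible space is $\mathcal{A}_0=\{(q_1,q_2,q_3)\in W^{1,2}(\Omega;\mathbb{R}^3):q_1=q_b,\ q_2=0,\ q_3=-s_+/6\text{ on }\partial\Omega\}$. A critical point of $J$ in $\mathcal{A}_0$ is a (weak) solution in $\mathcal{A}_0$ of the Euler-Lagrange equations of $J$. Construction of the symmetric critical point: let $\Omega_q=\{(x,y)\in\Omega:0<y<x,\ 0<x<1\}$. Let $(q_1^*,q_2^*,q_3^* )\in W^{1,2}(\Omega_q;\mathbb{R}^3)$ be a minimizer of $\int_{\Omega_q}f_{el}+\frac{\lambda^2}{L}f_b\,\mathrm{dA}$ subject to the conditions: $q_1=q_b$, $q_2=0$, $q_3=-s_+/6$ on $\partial\Omega_q\cap\partial\Omega$; $q_1=\partial_\nu q_2=\partial_\nu q_3=0$ on $\partial\Omega_q\cap\{y=x\}$; $\partial_\nu q_1=q_2=\partial_\nu q_3=0$ on $\partial\Omega_q\cap\{y=0\}$ (where $\partial_\nu$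 is the outward normal derivative; the Neumann conditions are understood as natural boundary conditions). Define $q_1^s$ on $\Omega$ by odd reflection of $q_1^*$ about the diagonals $y=\pm x$ and even reflection about the $x$- and $y$-axes; $q_2^s$ by even reflection of $q_2^*$ about the diagonals and odd reflection about the axes; $q_3^s$ by even reflection of $q_3^*$ about the diagonals and the axes. The triple $(q_1^s,q_2^s,q_3^s)$ is a critical point of $J$ in $\mathcal{A}_0$ with $q_1^s=0$ on $y=\pm x$ and $q_2^s=0$ on $x=0$ and $y=0$. *)

theory Defs
  imports "HOL-Analysis.Analysis"
begin

section \<open>Smooth functions and Sobolev functions in the plane\<close>

definition dx :: "(real \<times> real \<Rightarrow> real) \<Rightarrow> real \<times> real \<Rightarrow> real" where
  "dx f p = deriv (\<lambda>t. f (t, snd p)) (fst p)"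

definition dy :: "(real \<times> real \<Rightarrow> real) \<Rightarrow> real \<times> real \<Rightarrow> real" where
  "dy f p = deriv (\<lambda>t. f (fst p, t)) (snd p)"

primrec C_k :: "nat \<Rightarrow> (real \<times> real \<Rightarrow> real) \<Rightarrow> bool" where
  "C_k 0 f \<longleftrightarrow> continuous_on UNIV f"
| "C_k (Suc k) f \<longleftrightarrow> (\<forall>p. f differentiable (at p)) \<and> C_k k (dx f) \<and> C_k k (dy f)"

definition smooth :: "(real \<times> real \<Rightarrow> real) \<Rightarrow> bool" where
  "smooth f \<longleftrightarrow> (\<forall>k. C_k k f)"

definition test_function :: "(real \<times> real) set \<Rightarrow> (real \<times> real \<Rightarrow> real) \<Rightarrow> bool" where
  "test_function U \<phi> \<longleftrightarrow>
     smooth \<phi> \<and> compact (closure {p. \<phi> p \<noteq> 0}) \<and> closure {p. \<phi> p \<noteq> 0} \<subseteq> U"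

definition L2_on :: "(real \<times> real) set \<Rightarrow> (real \<times> real \<Rightarrow> real) \<Rightarrow> bool" where
  "L2_on U f \<longleftrightarrow>
     f \<in> borel_measurable (lebesgue_on U) \<and> integrable (lebesgue_on U) (\<lambda>p. (f p)\<^sup>2)"

definition weak_dx_on ::
  "(real \<times> real) set \<Rightarrow> (real \<times> real \<Rightarrow> real) \<Rightarrow> (real \<times> real \<Rightarrow> real) \<Rightarrow> bool" where
  "weak_dx_on U u v \<longleftrightarrow> L2_on U v \<and>
     (\<forall>\<phi>. test_function U \<phi> \<longrightarrow>
        (LINT p|lebesgue_on U. u p * dx \<phi> p) = - (LINT p|lebesgue_on U. v p * \<phi> p))"

definition weak_dy_on ::
  "(real \<times> real) set \<Rightarrow> (real \<times> real \<Rightarrow> real) \<Rightarrow> (real \<times> real \<Rightarrow> real) \<Rightarrow> bool" where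
  "weak_dy_on U u v \<longleftrightarrow> L2_on U v \<and>
     (\<forall>\<phi>. test_function U \<phi> \<longrightarrow>
        (LINT p|lebesgue_on U. u p * dy \<phi> p) = - (LINT p|lebesgue_on U. v p * \<phi> p))"

definition W12 :: "(real \<times> real) set \<Rightarrow> (real \<times> real \<Rightarrow> real) \<Rightarrow> bool" where
  "W12 U u \<longleftrightarrow> L2_on U u \<and> (\<exists>v. weak_dx_on U u v) \<and> (\<exists>v. weak_dy_on U u v)"

text \<open>On an open set \<open>U\<close> weak derivatives are unique up to null sets, so the choice made here
  is immaterial in integrals.\<close>

definition wdx :: "(real \<times> real) set \<Rightarrow> (real \<times> real \<Rightarrow> real) \<Rightarrow> real \<times> real \<Rightarrow> real" where
  "wdx U u = (SOME v. weak_dx_on U u v)"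

definition wdy :: "(real \<times> real) set \<Rightarrow> (real \<times> real \<Rightarrow> real) \<Rightarrow> real \<times> real \<Rightarrow> real" where
  "wdy U u = (SOME v. weak_dy_on U u v)"

text \<open>The trace operator of a polygonal domain \<open>U\<close> is the continuous extension to
  \<open>W\<^sup>1\<^sup>,\<^sup>2(U)\<close> of the restriction of smooth functions to the boundary.  Accordingly, \<open>u\<close> has
  trace \<open>g\<close> on a part \<open>\<Gamma>\<close> of the boundary if functions smooth up to the boundary
  converge to \<open>u\<close> in \<open>W\<^sup>1\<^sup>,\<^sup>2(U)\<close> and to \<open>g\<close> in \<open>L\<^sup>2\<close> of every nondegenerate segment in \<open>\<Gamma>\<close>;
  the parts \<open>\<Gamma>\<close> used below are finite unions of segments.  The segments are parametrised
  over \<open>[0, 1]\<close>, which differs from arc length by a constant factor.  The nonnegative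
  integral keeps the condition meaningful without an integrability assumption on \<open>g\<close>.\<close>

definition trace_on ::
  "(real \<times> real) set \<Rightarrow> (real \<times> real \<Rightarrow> real) \<Rightarrow> (real \<times> real) set \<Rightarrow> (real \<times> real \<Rightarrow> real) \<Rightarrow> bool"
where
  "trace_on U u \<Gamma> g \<longleftrightarrow> (\<exists>\<phi> :: nat \<Rightarrow> real \<times> real \<Rightarrow> real.
     (\<forall>n. smooth (\<phi> n)) \<and>
     (\<lambda>n. LINT p|lebesgue_on U.
        (\<phi> n p - u p)\<^sup>2 + (dx (\<phi> n) p - wdx U u p)\<^sup>2 + (dy (\<phi> n) p - wdy U u p)\<^sup>2)
       \<longlonglongrightarrow> 0 \<and>
     (\<forall>a b. a \<noteq> b \<and> closed_segment a b \<subseteq> \<Gamma> \<longrightarrow>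
        (\<lambda>n. \<integral>\<^sup>+ t\<in>{0..1}.
           ennreal ((\<phi> n (a + t *\<^sub>R (b - a)) - g (a + t *\<^sub>R (b - a)))\<^sup>2) \<partial>lborel)
          \<longlonglongrightarrow> 0))"


section \<open>Domain, boundary data and energy\<close>

definition s_plus :: "real \<Rightarrow> real \<Rightarrow> real \<Rightarrow> real" where
  "s_plus A B C = (B + sqrt (B\<^sup>2 + 24 * \<bar>A\<bar> * C)) / (4 * C)"

definition Omega :: "real \<Rightarrow> (real \<times> real) set" where
  "Omega \<epsilon> = {(x, y). \<bar>x\<bar> < 1 \<and> \<bar>y\<bar> < 1 \<and> \<bar>x + y\<bar> < 2 - \<epsilon> \<and> \<bar>x - y\<bar> < 2 - \<epsilon>}"

definition Omega_q :: "real \<Rightarrow> (real \<times> real) set" where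
  "Omega_q \<epsilon> = {(x, y). (x, y) \<in> Omega \<epsilon> \<and> 0 < y \<and> y < x \<and> 0 < x \<and> x < 1}"

definition g_short :: "real \<Rightarrow> real \<Rightarrow> real \<Rightarrow> real" where
  "g_short \<epsilon> s l = s / (2 * \<epsilon>) * l"

text \<open>Only the values on \<open>frontier (Omega \<epsilon>)\<close> matter.  There the successive cases are the
  edges \<open>C\<^sub>1 \<union> C\<^sub>3\<close>, \<open>C\<^sub>2 \<union> C\<^sub>4\<close>, \<open>S\<^sub>1\<close>, \<open>S\<^sub>2\<close>, \<open>S\<^sub>3\<close>, \<open>S\<^sub>4\<close>; the formulas agree at the corners.\<close>

definition q_b :: "real \<Rightarrow> real \<Rightarrow> real \<times> real \<Rightarrow> real" where
  "q_b \<epsilon> s = (\<lambda>(x, y).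
     if \<bar>y\<bar> = 1 then s / 2
     else if \<bar>x\<bar> = 1 then - s / 2
     else if y - x = 2 - \<epsilon> then g_short \<epsilon> s (x + y)
     else if x + y = 2 - \<epsilon> then g_short \<epsilon> s (y - x)
     else if x - y = 2 - \<epsilon> then g_short \<epsilon> s (- x - y)
     else if x + y = - (2 - \<epsilon>) then g_short \<epsilon> s (x - y)
     else 0)"

text \<open>The arguments \<open>qix\<close> and \<open>qiy\<close> are the values of the partial derivatives of \<open>q\<^sub>i\<close>.\<close>

definition f_el ::
  "real \<Rightarrow> real \<Rightarrow> real \<Rightarrow> real \<Rightarrow> real \<Rightarrow> real \<Rightarrow> real \<Rightarrow> real" where
  "f_el L2 q1x q1y q2x q2y q3x q3y =
     (1 + L2 / 2) * (q1x\<^sup>2 + q1y\<^sup>2) + (1 + L2 / 2) * (q2x\<^sup>2 + q2y\<^sup>2)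
     + (3 + L2 / 2) * (q3x\<^sup>2 + q3y\<^sup>2)
     + L2 * (q1y * q3y - q1x * q3x - q2y * q3x - q2x * q3y)
     + \<bar>L2\<bar> * (q2y * q1x - q1y * q2x)"

definition f_b :: "real \<Rightarrow> real \<Rightarrow> real \<Rightarrow> real \<Rightarrow> real \<Rightarrow> real \<Rightarrow> real" where
  "f_b A B C q1 q2 q3 =
     A * (q1\<^sup>2 + q2\<^sup>2 + 3 * q3\<^sup>2) + C * (q1\<^sup>2 + q2\<^sup>2 + 3 * q3\<^sup>2)\<^sup>2
     + 2 * B * q3 * (q1\<^sup>2 + q2\<^sup>2 - q3\<^sup>2)"

text \<open>The functional \<open>J\<close> is the case \<open>U = Omega \<epsilon>\<close>.  For \<open>W\<^sup>1\<^sup>,\<^sup>2\<close> functions on a bounded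
  Lipschitz domain of the plane the integrand is integrable.\<close>

definition energy ::
  "real \<Rightarrow> real \<Rightarrow> real \<Rightarrow> real \<Rightarrow> real \<Rightarrow> real \<Rightarrow> (real \<times> real) set \<Rightarrow>
   (real \<times> real \<Rightarrow> real) \<Rightarrow> (real \<times> real \<Rightarrow> real) \<Rightarrow> (real \<times> real \<Rightarrow> real) \<Rightarrow> real" where
  "energy A B C L L2 lam U q1 q2 q3 = (LINT p|lebesgue_on U.
     f_el L2 (wdx U q1 p) (wdy U q1 p) (wdx U q2 p) (wdy U q2 p) (wdx U q3 p) (wdy U q3 p)
     + lam\<^sup>2 / L * f_b A B C (q1 p) (q2 p) (q3 p))"


section \<open>The symmetric critical point\<close>

text \<open>Only the essential (Dirichlet) conditions are imposed on competitors; the Neumann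
  conditions on the diagonal and on the axis are the natural ones.\<close>

definition admissible_q ::
  "real \<Rightarrow> real \<Rightarrow> (real \<times> real \<Rightarrow> real) \<Rightarrow> (real \<times> real \<Rightarrow> real) \<Rightarrow> (real \<times> real \<Rightarrow> real) \<Rightarrow> bool"
where
  "admissible_q \<epsilon> s q1 q2 q3 \<longleftrightarrow>
     W12 (Omega_q \<epsilon>) q1 \<and> W12 (Omega_q \<epsilon>) q2 \<and> W12 (Omega_q \<epsilon>) q3 \<and>
     trace_on (Omega_q \<epsilon>) q1 (frontier (Omega_q \<epsilon>) \<inter> frontier (Omega \<epsilon>)) (q_b \<epsilon> s) \<and>
     trace_on (Omega_q \<epsilon>) q2 (frontier (Omega_q \<epsilon>) \<inter> frontier (Omega \<epsilon>)) (\<lambda>_. 0) \<and>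
     trace_on (Omega_q \<epsilon>) q3 (frontier (Omega_q \<epsilon>) \<inter> frontier (Omega \<epsilon>)) (\<lambda>_. - s / 6) \<and>
     trace_on (Omega_q \<epsilon>) q1 (frontier (Omega_q \<epsilon>) \<inter> {(x, y). y = x}) (\<lambda>_. 0) \<and>
     trace_on (Omega_q \<epsilon>) q2 (frontier (Omega_q \<epsilon>) \<inter> {(x, y). y = 0}) (\<lambda>_. 0)"

definition minimizer_q ::
  "real \<Rightarrow> real \<Rightarrow> real \<Rightarrow> real \<Rightarrow> real \<Rightarrow> real \<Rightarrow> real \<Rightarrow>
   (real \<times> real \<Rightarrow> real) \<Rightarrow> (real \<times> real \<Rightarrow> real) \<Rightarrow> (real \<times> real \<Rightarrow> real) \<Rightarrow> bool" where
  "minimizer_q A B C L L2 lam \<epsilon> q1 q2 q3 \<longleftrightarrow>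
     admissible_q \<epsilon> (s_plus A B C) q1 q2 q3 \<and>
     (\<forall>r1 r2 r3. admissible_q \<epsilon> (s_plus A B C) r1 r2 r3 \<longrightarrow>
        energy A B C L L2 lam (Omega_q \<epsilon>) q1 q2 q3 \<le> energy A B C L L2 lam (Omega_q \<epsilon>) r1 r2 r3)"

text \<open>The point \<open>(max \<bar>x\<bar> \<bar>y\<bar>, min \<bar>x\<bar> \<bar>y\<bar>)\<close> is the image of \<open>(x, y)\<close> in the closure of
  \<open>Omega_q \<epsilon>\<close> under the reflections about the axes and the diagonals.  The factor
  \<open>sgn (\<bar>x\<bar> - \<bar>y\<bar>)\<close> is odd about both diagonals and even about both axes, and \<open>sgn x * sgn y\<close>
  is even about both diagonals and odd about both axes; both equal 1 on \<open>Omega_q \<epsilon>\<close>.\<close>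

definition reflect1 :: "(real \<times> real \<Rightarrow> real) \<Rightarrow> real \<times> real \<Rightarrow> real" where
  "reflect1 q = (\<lambda>(x, y). sgn (\<bar>x\<bar> - \<bar>y\<bar>) * q (max \<bar>x\<bar> \<bar>y\<bar>, min \<bar>x\<bar> \<bar>y\<bar>))"

definition reflect2 :: "(real \<times> real \<Rightarrow> real) \<Rightarrow> real \<times> real \<Rightarrow> real" where
  "reflect2 q = (\<lambda>(x, y). sgn x * sgn y * q (max \<bar>x\<bar> \<bar>y\<bar>, min \<bar>x\<bar> \<bar>y\<bar>))"

definition reflect3 :: "(real \<times> real \<Rightarrow> real) \<Rightarrow> real \<times> real \<Rightarrow> real" where
  "reflect3 q = (\<lambda>(x, y). q (max \<bar>x\<bar> \<bar>y\<bar>, min \<bar>x\<bar> \<bar>y\<bar>))"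

text \<open>That such a triple solves the Euler-Lagrange equations of \<open>J\<close> on all of \<open>Omega \<epsilon>\<close> and
  satisfies the boundary conditions there is a consequence of the construction and is not
  imposed as an additional requirement.\<close>

definition symmetric_critical_point ::
  "real \<Rightarrow> real \<Rightarrow> real \<Rightarrow> real \<Rightarrow> real \<Rightarrow> real \<Rightarrow> real \<Rightarrow>
   (real \<times> real \<Rightarrow> real) \<Rightarrow> (real \<times> real \<Rightarrow> real) \<Rightarrow> (real \<times> real \<Rightarrow> real) \<Rightarrow> bool" where
  "symmetric_critical_point A B C L L2 lam \<epsilon> q1s q2s q3s \<longleftrightarrow>
     (\<exists>q1 q2 q3. minimizer_q A B C L L2 lam \<epsilon> q1 q2 q3 \<and>
        q1s = reflect1 q1 \<and> q2s = reflect2 q2 \<and> q3s = reflect3 q3)"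

text \<open>Sobolev functions are determined up to null sets, hence so is constancy.\<close>

definition ae_constant_on :: "(real \<times> real) set \<Rightarrow> (real \<times> real \<Rightarrow> real) \<Rightarrow> bool" where
  "ae_constant_on U f \<longleftrightarrow> (\<exists>c. AE p in lebesgue_on U. f p = c)"

end

theory Submission
 imports Defs
begin

text \<open>
 If \<open>q2s\<close> were constant, it would be 0, being odd about the axes; then the minimizer
 \<open>(u, 0, v)\<close> on \<open>Omega_q \<epsilon>\<close> satisfies the Euler-Lagrange equation of the second component with
 vanishing second component.  This extra equation makes the system overdetermined, and the
 proof shows that it has no solution with the prescribed value \<open>u = - s / 2\<close> on the right edge.

 The terms with the factor \<open>\<bar>L2\<bar>\<close> are a null Lagrangian and cancel, so the extra equation says
 \<open>\<partial>\<^sub>x \<partial>\<^sub>y v = 0\<close>.  As \<open>v\<close> is constant on \<open>x = 1\<close>, it depends on \<open>x\<close> alone for \<open>y < 1 - \<epsilon>\<close>, and the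
 natural boundary condition on the diagonal makes it constant in the corner triangle
 \<open>0 < y < x < 1 - \<epsilon>\<close> (\<open>vx_rows\<close>, \<open>vx_zero\<close>, \<open>v_constant\<close>).  There the other two equations
 decouple (\<open>EL_corner\<close>) into \<open>u\<^sub>y\<^sub>y = H(u)\<close> and \<open>u\<^sub>x\<^sub>x = - H(- u)\<close> for a cubic
 \<open>H(z) = a0 + a1 z + a2 z\<^sup>2 + a3 z\<^sup>3\<close> with \<open>a3 > 0\<close>.  On each column \<open>u\<close> solves \<open>Y'' = H(Y)\<close>, \<open>Y'(0) = 0\<close>,
 \<open>Y(x) = 0\<close>, the last condition because \<open>u = 0\<close> on the diagonal.  Hence
 \<open>u = (a0 / 2) (y\<^sup>2 - x\<^sup>2) + O(x\<^sup>4)\<close> (\<open>column_bounds\<close>, \<open>corner_expansion\<close>).  The row and the column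
 equation give two expressions for \<open>\<partial>\<^sub>x\<^sup>2 \<partial>\<^sub>y\<^sup>2 u\<close>; comparing their leading terms at the corner with
 rescaled test functions yields \<open>a0 a1 = 0\<close>, and \<open>a0\<^sup>2 a2 = 0\<close> if \<open>a1 = 0\<close>.  Since \<open>A < 0\<close>, the
 coefficients \<open>a1\<close> and \<open>a2\<close> are not both 0, whence \<open>a0 = 0\<close> (\<open>a0_zero\<close>) and \<open>u = 0\<close> near the corner
 (\<open>corner_vanishing\<close>).  From there \<open>u = 0\<close> propagates along the rows up to \<open>x = 1\<close>, a contradiction
 (\<open>contradiction\<close>).

 All equations are understood in the sense of distributions with
 products \<open>f(x) g(y)\<close> as test functions, so that they can be integrated along almost every row and column.
 The passage from the minimizer to these weak equations needs two facts about Sobolev functions.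
 By Gagliardo's inequality they have integrable fourth powers (\<open>W12_L4\<close>), which allows the
 energy to be varied (\<open>first_variation\<close>), and by the definition of the trace they can be
 integrated by parts up to the right edge and the diagonal (\<open>trace_right\<close>, \<open>trace_diag\<close>).
\<close>

section \<open>Smooth functions of one variable\<close>

text \<open>Quantifying over the derivative, rather than using \<open>deriv\<close>, makes the closure properties below
 direct inductions.\<close>

primrec C1_k :: "nat \<Rightarrow> (real \<Rightarrow> real) \<Rightarrow> bool" where
 "C1_k 0 f \<longleftrightarrow> continuous_on UNIV f"
| "C1_k (Suc k) f \<longleftrightarrow> (\<exists>f'. (\<forall>x. (f has_real_derivative f' x) (at x)) \<and> C1_k k f')"

definition smooth1 :: "(real \<Rightarrow> real) \<Rightarrow> bool" where
 "smooth1 f \<longleftrightarrow> (\<forall>k. C1_k k f)"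

lemma C1_k_const: "C1_k k (\<lambda>_. c)"
proof (induction k arbitrary: c)
 case (Suc k)
 have "\<forall>x. ((\<lambda>_. c) has_real_derivative 0) (at x)" by auto
 with Suc[of 0] show ?case by (auto intro!: exI[of _ "\<lambda>_. 0"])
qed auto

lemma C1_k_decr: "C1_k (Suc k) f \<Longrightarrow> C1_k k f"
proof (induction k arbitrary: f)
 case 0
 then obtain f' where "\<forall>x. (f has_real_derivative f' x) (at x)" by auto
 then have "\<forall>x. isCont f x" using DERIV_isCont by blast
 then show ?case by (simp add: continuous_at_imp_continuous_on)
next
 case (Suc k)
 then obtain f' where "\<forall>x. (f has_real_derivative f' x) (at x)" "C1_k (Suc k) f'"
  by (metis C1_k.simps(2))
 then show ?case using Suc.IH[of f'] by auto
qed

lemma C1_k_add: "C1_k k f \<Longrightarrow> C1_k k g \<Longrightarrow> C1_k k (\<lambda>x. f x + g x)"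
proof (induction k arbitrary: f g)
 case 0 then show ?case by (auto intro: continuous_on_add)
next
 case (Suc k)
 then obtain f' g' where "\<forall>x. (f has_real_derivative f' x) (at x)" "C1_k k f'"
  "\<forall>x. (g has_real_derivative g' x) (at x)" "C1_k k g'" by auto
 then show ?case using Suc.IH[of f' g'] by (auto intro!: exI[of _ "\<lambda>x. f' x + g' x"] DERIV_add)
qed

lemma C1_k_mult: "C1_k k f \<Longrightarrow> C1_k k g \<Longrightarrow> C1_k k (\<lambda>x. f x * g x)"
proof (induction k arbitrary: f g)
 case 0 then show ?case by (auto intro: continuous_on_mult)
next
 case (Suc k)
 then obtain f' g' where *: "\<forall>x. (f has_real_derivative f' x) (at x)" "C1_k k f'"
  "\<forall>x. (g has_real_derivative g' x) (at x)" "C1_k k g'" by auto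
 have "C1_k k (\<lambda>x. f' x * g x + g' x * f x)"
  using Suc * C1_k_decr by (intro C1_k_add Suc.IH) auto
 then show ?case using * by (auto intro!: exI[of _ "\<lambda>x. f' x * g x + g' x * f x"] DERIV_mult)
qed

lemma C1_k_affine: "C1_k k f \<Longrightarrow> C1_k k (\<lambda>x. f (a * x + b))"
proof (induction k arbitrary: f)
 case 0
 then have "continuous_on UNIV (\<lambda>x. f (a * x + b))"
  by (auto intro!: continuous_on_compose2[of UNIV f] continuous_intros)
 then show ?case by simp
next
 case (Suc k)
 then obtain f' where *: "\<forall>x. (f has_real_derivative f' x) (at x)" "C1_k k f'" by auto
 have "((\<lambda>x. f (a * x + b)) has_real_derivative a * f' (a * x + b)) (at x)" for x
 proof -
  have "((\<lambda>x. a * x + b) has_real_derivative a) (at x)" by (auto intro!: derivative_eq_intros)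
  then show ?thesis using DERIV_chain2[of f "f' (a*x+b)" "\<lambda>x. a*x+b" x a] * by (simp add: mult.commute)
 qed
 moreover have "C1_k k (\<lambda>x. a * f' (a * x + b))"
  by (intro C1_k_mult C1_k_const Suc.IH *)
 ultimately show ?case by (auto intro!: exI[of _ "\<lambda>x. a * f' (a * x + b)"])
qed

lemma smooth1_const [simp]: "smooth1 (\<lambda>_. c)" by (simp add: smooth1_def C1_k_const)
lemma smooth1_add: "smooth1 f \<Longrightarrow> smooth1 g \<Longrightarrow> smooth1 (\<lambda>x. f x + g x)"
 by (simp add: smooth1_def C1_k_add)
lemma smooth1_mult: "smooth1 f \<Longrightarrow> smooth1 g \<Longrightarrow> smooth1 (\<lambda>x. f x * g x)"
 by (simp add: smooth1_def C1_k_mult)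
lemma smooth1_cmult: "smooth1 f \<Longrightarrow> smooth1 (\<lambda>x. c * f x)"
 by (simp add: smooth1_mult)
lemma smooth1_diff: "smooth1 f \<Longrightarrow> smooth1 g \<Longrightarrow> smooth1 (\<lambda>x. f x - g x)"
 using smooth1_add[of f "\<lambda>x. (-1) * g x", OF _ smooth1_cmult] by simp
lemma smooth1_affine: "smooth1 f \<Longrightarrow> smooth1 (\<lambda>x. f (a * x + b))"
 by (simp add: smooth1_def C1_k_affine)

lemma smooth1_deriv:
 assumes "smooth1 f"
 shows "(f has_real_derivative deriv f x) (at x)" "smooth1 (deriv f)"
proof -
 have *: "\<exists>f'. (\<forall>x. (f has_real_derivative f' x) (at x)) \<and> C1_k k f'" for k
  using assms[unfolded smooth1_def, rule_format, of "Suc k"] by simp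
 then obtain f' where "\<forall>x. (f has_real_derivative f' x) (at x)" by blast
 then show "(f has_real_derivative deriv f x) (at x)" by (metis DERIV_imp_deriv)
 show "smooth1 (deriv f)" unfolding smooth1_def
 proof
  fix k obtain f' where f': "\<forall>x. (f has_real_derivative f' x) (at x)" "C1_k k f'" using * by blast
  then have "deriv f = f'" by (auto simp: DERIV_imp_deriv)
  with f' show "C1_k k (deriv f)" by simp
 qed
qed

lemma smooth1_antideriv:
 assumes "smooth1 f'" "\<And>x. (f has_real_derivative f' x) (at x)"
 shows "smooth1 f"
 unfolding smooth1_def
proof
 fix k have "C1_k (Suc k) f" using assms by (auto simp: smooth1_def)
 then show "C1_k k f" by (rule C1_k_decr)
qed

lemma smooth1_cont: "smooth1 f \<Longrightarrow> continuous_on S f"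
 using continuous_on_subset[of UNIV f S] unfolding smooth1_def by (metis C1_k.simps(1) subset_UNIV)

lemma smooth1_isCont: "smooth1 f \<Longrightarrow> isCont f x"
 using smooth1_deriv(1) DERIV_isCont by blast

lemma smooth1_borel [measurable (raw)]: "smooth1 f \<Longrightarrow> f \<in> borel_measurable borel"
 by (intro borel_measurable_continuous_onI smooth1_cont)

text \<open>Every derivative of \<open>x \<mapsto> exp (- 1 / x)\<close>, extended by 0 to \<open>x \<le> 0\<close>, is a linear
 combination of the functions below, so it suffices to differentiate these once.\<close>

definition flat :: "nat \<Rightarrow> real \<Rightarrow> real" where
 "flat n x = (if x > 0 then exp (- (1 / x)) / x ^ n else 0)"

lemma flat_tendsto_0: "((\<lambda>x. exp (- (1 / x)) / x ^ n) \<longlongrightarrow> 0) (at_right (0::real))"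
proof -
 have "((\<lambda>y::real. y ^ n / exp y) \<longlongrightarrow> 0) at_top" by (rule tendsto_power_div_exp_0)
 moreover have "filterlim (\<lambda>x::real. 1 / x) at_top (at_right 0)"
  by (simp add: filterlim_inverse_at_top_right flip: inverse_eq_divide)
 ultimately have "((\<lambda>x::real. (1 / x) ^ n / exp (1 / x)) \<longlongrightarrow> 0) (at_right 0)"
  by (rule filterlim_compose)
 then show ?thesis by (simp add: exp_minus power_divide field_simps)
qed

lemma flat_DERIV: "(flat n has_real_derivative flat (n + 2) x - n * flat (n + 1) x) (at x)"
proof -
 consider "x > 0" | "x < 0" | "x = 0" by linarith
 then show ?thesis
 proof cases
  case 1
  have "((\<lambda>x. exp (- (1 / x)) / x ^ n) has_real_derivative flat (n + 2) x - n * flat (n + 1) x) (at x)"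
  proof (cases n)
   case (Suc m)
   have "x ^ m * x ^ m = x ^ (m + m)" by (simp add: power_add)
   moreover have "m = 0 \<or> x ^ m = x * x ^ (m - Suc 0)" by (cases m) auto
   ultimately show ?thesis using 1 Suc
    by (auto intro!: derivative_eq_intros simp: flat_def divide_simps) (auto simp: algebra_simps)
  qed (use 1 in \<open>auto intro!: derivative_eq_intros simp: flat_def field_simps power2_eq_square\<close>)
  then show ?thesis
   by (rule has_field_derivative_transform_within_open[where S = "{0<..}"]) (use 1 in \<open>auto simp: flat_def\<close>)
 next
  case 2
  have "((\<lambda>_. 0) has_real_derivative 0) (at x)" by auto
  then have "(flat n has_real_derivative 0) (at x)"
   by (rule has_field_derivative_transform_within_open[where S = "{..<0}"]) (use 2 in \<open>auto simp: flat_def\<close>)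
  then show ?thesis using 2 by (simp add: flat_def)
 next
  case 3
  have "((\<lambda>h. (flat n h - flat n 0) / (h - 0)) \<longlongrightarrow> 0) (at_right 0)"
  proof (rule tendsto_cong[THEN iffD2, OF _ flat_tendsto_0[of "Suc n"]])
   show "\<forall>\<^sub>F h in at_right 0. (flat n h - flat n 0) / (h - 0) = exp (- (1 / h)) / h ^ Suc n"
    by (auto simp: flat_def eventually_at_right_field intro!: exI[of _ 1])
  qed
  moreover have "((\<lambda>h. (flat n h - flat n 0) / (h - 0)) \<longlongrightarrow> 0) (at_left 0)"
   by (rule tendsto_eventually) (auto simp: flat_def eventually_at_left_field intro!: exI[of _ "-1"])
  ultimately have "(flat n has_real_derivative 0) (at 0)"
   by (simp add: has_field_derivative_iff filterlim_split_at)
  then show ?thesis using 3 by (simp add: flat_def)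
 qed
qed

lemma C1_k_flat: "C1_k k (flat n)"
proof (induction k arbitrary: n)
 case 0
 have "isCont (flat n) x" for x using flat_DERIV DERIV_isCont by blast
 then show ?case by (simp add: continuous_at_imp_continuous_on)
next
 case (Suc k)
 have "C1_k k (\<lambda>x. flat (n + 2) x + (- real n) * flat (n + 1) x)"
  by (intro C1_k_add C1_k_mult C1_k_const Suc)
 moreover have "(\<lambda>x. flat (n + 2) x + (- real n) * flat (n + 1) x) = (\<lambda>x. flat (n + 2) x - n * flat (n + 1) x)"
  by auto
 ultimately have "C1_k k (\<lambda>x. flat (n + 2) x - n * flat (n + 1) x)" by (rule subst[rotated])
 with flat_DERIV[of n] show ?case unfolding C1_k.simps
  by (intro exI[of _ "\<lambda>x. flat (n + 2) x - n * flat (n + 1) x"]) auto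
qed

lemma smooth1_flat: "smooth1 (flat n)" by (simp add: smooth1_def C1_k_flat)

section \<open>Bumps\<close>

text \<open>The zero set contains a neighbourhood of the complement of \<open>(a, b)\<close>: this makes products of
 bumps test functions, and it lets a bump on an interval that exceeds a domain see the boundary.\<close>

definition bump :: "real \<Rightarrow> real \<Rightarrow> (real \<Rightarrow> real) \<Rightarrow> bool" where
 "bump a b f \<longleftrightarrow> smooth1 f \<and> (\<exists>a' b'. a < a' \<and> b' < b \<and> (\<forall>x. x \<notin> {a'..b'} \<longrightarrow> f x = 0))"

lemma bump_smooth: "bump a b f \<Longrightarrow> smooth1 f" by (simp add: bump_def)

lemma bumpE:
 assumes "bump a b f"
 obtains a' b' where "a < a'" "b' < b" "\<And>x. x < a' \<Longrightarrow> f x = 0" "\<And>x. x > b' \<Longrightarrow> f x = 0"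
 using assms unfolding bump_def by (metis atLeastAtMost_iff not_less)

lemma bumpI:
 assumes "smooth1 f" "a < a'" "b' < b" "\<And>x. x < a' \<Longrightarrow> f x = 0" "\<And>x. x > b' \<Longrightarrow> f x = 0"
 shows "bump a b f"
 using assms unfolding bump_def by (metis atLeastAtMost_iff not_less)

lemma bump_zero: assumes "bump a b f" "x \<notin> {a<..<b}" shows "f x = 0"
 using assms(2) bumpE[OF assms(1)]
 by (metis greaterThanLessThan_iff not_less order_le_less_trans order_less_le_trans)

lemma bump_indicator: assumes "bump a b f" shows "(\<lambda>x. indicator {a..b} x *\<^sub>R (g x * f x)) = (\<lambda>x. g x * f x)"
proof
 fix x show "indicator {a..b} x *\<^sub>R (g x * f x) = g x * f x"
 proof (cases "x \<in> {a..b}")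
  case False
  then have "f x = 0" by (intro bump_zero[OF assms]) auto
  then show ?thesis by simp
 qed simp
qed

lemma bump_mono: "bump a b f \<Longrightarrow> c \<le> a \<Longrightarrow> b \<le> d \<Longrightarrow> bump c d f"
 unfolding bump_def by (meson order_le_less_trans order_less_le_trans)

lemma deriv_zero_on_open:
 assumes "open S" "\<And>x. x \<in> S \<Longrightarrow> f x = 0" "x \<in> S"
 shows "deriv f x = (0::real)"
proof (rule DERIV_imp_deriv)
 have "((\<lambda>_. 0) has_real_derivative 0) (at x)" by auto
 then show "(f has_real_derivative 0) (at x)"
  by (rule has_field_derivative_transform_within_open[OF _ assms(1)]) (use assms in auto)
qed

lemma bump_deriv: assumes "bump a b f" shows "bump a b (deriv f)"
proof -
 obtain a' b' where "a < a'" "b' < b" "\<And>x. x < a' \<Longrightarrow> f x = 0" "\<And>x. x > b' \<Longrightarrow> f x = 0"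
  using bumpE[OF assms] by metis
 then show ?thesis
  using deriv_zero_on_open[of "{..<a'}" f] deriv_zero_on_open[of "{b'<..}" f] assms
  by (intro bumpI[of _ a a' b' b] smooth1_deriv(2) bump_smooth) auto
qed

lemma bump_diff: assumes "bump a b f" "bump a b g" shows "bump a b (\<lambda>x. f x - g x)"
proof -
 obtain a1 b1 where "a < a1" "b1 < b" "\<And>x. x < a1 \<Longrightarrow> f x = 0" "\<And>x. x > b1 \<Longrightarrow> f x = 0"
  using bumpE[OF assms(1)] by metis
 moreover obtain a2 b2 where "a < a2" "b2 < b" "\<And>x. x < a2 \<Longrightarrow> g x = 0" "\<And>x. x > b2 \<Longrightarrow> g x = 0"
  using bumpE[OF assms(2)] by metis
 ultimately show ?thesis using assms
  by (intro bumpI[of _ a "min a1 a2" "max b1 b2" b] smooth1_diff bump_smooth) auto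
qed

lemma bump_cmult: "bump a b f \<Longrightarrow> bump a b (\<lambda>x. c * f x)"
 unfolding bump_def by (metis mult_zero_right smooth1_cmult)

text \<open>Smooth functions supported on \<open>[a, b]\<close> that increase to the indicator of \<open>(a, b)\<close>.\<close>

definition plateau :: "real \<Rightarrow> real \<Rightarrow> nat \<Rightarrow> real \<Rightarrow> real" where
 "plateau a b n x = flat 0 (real (Suc n) * (x - a)) * flat 0 (real (Suc n) * (b - x))"

lemma smooth1_plateau: "smooth1 (plateau a b n)"
proof -
 have "smooth1 (\<lambda>x. flat 0 (real (Suc n) * x + - real (Suc n) * a) * flat 0 (- real (Suc n) * x + real (Suc n) * b))"
  by (intro smooth1_mult smooth1_affine smooth1_flat)
 then show ?thesis unfolding plateau_def by (simp add: algebra_simps)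
qed

lemma plateau_zero: "x \<notin> {a<..<b} \<Longrightarrow> plateau a b n x = 0"
 by (auto simp: plateau_def flat_def zero_less_mult_iff)

lemma flat_01: "0 \<le> flat 0 x" "flat 0 x \<le> 1" by (auto simp: flat_def)

lemma plateau_01: "0 \<le> plateau a b n x" "plateau a b n x \<le> 1"
 unfolding plateau_def using flat_01 by (auto intro: mult_le_one mult_nonneg_nonneg)

lemma plateau_pos: "a < x \<Longrightarrow> x < b \<Longrightarrow> 0 < plateau a b n x"
 by (auto simp: plateau_def flat_def)

lemma plateau_tendsto: "(\<lambda>n. plateau a b n x) \<longlonglongrightarrow> indicator {a<..<b} x"
proof (cases "x \<in> {a<..<b}")
 case True
 have *: "(\<lambda>n. flat 0 (real (Suc n) * d)) \<longlonglongrightarrow> 1" if "d > 0" for d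
 proof -
  have "(\<lambda>n. exp (- (1 / d * inverse (real (Suc n))))) \<longlonglongrightarrow> exp (- (1 / d * 0))"
   by (intro tendsto_intros LIMSEQ_inverse_real_of_nat)
  moreover have "exp (- (1 / d * inverse (real (Suc n)))) = flat 0 (real (Suc n) * d)" for n
   using that by (simp add: flat_def zero_less_mult_iff field_simps del: of_nat_Suc)
  ultimately show ?thesis by simp
 qed
 have "(\<lambda>n. plateau a b n x) \<longlonglongrightarrow> 1 * 1"
  unfolding plateau_def by (intro tendsto_mult *) (use True in auto)
 then show ?thesis using True by simp
qed (simp add: plateau_zero)

lemma plateau_bump: "a' < a \<Longrightarrow> b < b' \<Longrightarrow> bump a' b' (plateau a b n)"
 by (rule bumpI[of _ _ a b]) (auto simp: smooth1_plateau plateau_zero)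

lemma bump_bounded:
 assumes "bump a b f" obtains M where "M > 0" "\<And>x. \<bar>f x\<bar> \<le> M"
proof -
 obtain a' b' where *: "a < a'" "b' < b" "\<And>x. x < a' \<Longrightarrow> f x = 0" "\<And>x. x > b' \<Longrightarrow> f x = 0"
  using bumpE[OF assms] by metis
 have "compact (f ` {a'..b'})"
  using assms by (intro compact_continuous_image smooth1_cont bump_smooth) auto
 then obtain M where M: "\<And>x. x \<in> {a'..b'} \<Longrightarrow> \<bar>f x\<bar> \<le> M"
  by (metis bounded_iff compact_imp_bounded imageI real_norm_def)
 have "\<bar>f x\<bar> \<le> max M 1" for x
  using M[of x] *(3,4)[of x] by (cases "x \<in> {a'..b'}") (auto simp: not_le)
 then show ?thesis by (intro that[of "max M 1"]) auto
qed

lemma bump_integrable: assumes "bump a b f" shows "integrable lborel f"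
proof -
 have "integrable lborel (\<lambda>x. indicator {a..b} x *\<^sub>R f x)"
  using assms by (intro borel_integrable_compact smooth1_cont bump_smooth) auto
 moreover have "(\<lambda>x. indicator {a..b} x *\<^sub>R f x) = f"
  using bump_indicator[OF assms, of "\<lambda>_. 1"] by (simp only: mult_1)
 ultimately show ?thesis by simp
qed

lemma bump_integral_deriv:
 assumes "bump a b f" "smooth1 w"
 shows "(LINT x|lborel. w x * deriv f x) = - (LINT x|lborel. deriv w x * f x)"
proof (cases "a \<le> b")
 case True
 have sm: "smooth1 f" "smooth1 w" using assms bump_smooth by blast+
 then have d: "(f has_real_derivative deriv f x) (at x)" "(w has_real_derivative deriv w x) (at x)" for x
  by (auto intro: smooth1_deriv(1))
 have i1: "integrable lborel (\<lambda>x. w x * deriv f x)"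
 proof -
  have "integrable lborel (\<lambda>x. indicator {a..b} x *\<^sub>R (w x * deriv f x))"
   using sm by (intro borel_integrable_compact continuous_intros smooth1_cont smooth1_deriv(2)) auto
  moreover have "(\<lambda>x. indicator {a..b} x *\<^sub>R (w x * deriv f x)) = (\<lambda>x. w x * deriv f x)"
   by (rule bump_indicator[OF bump_deriv[OF assms(1)]])
  ultimately show ?thesis by simp
 qed
 have i2: "integrable lborel (\<lambda>x. deriv w x * f x)"
 proof -
  have "integrable lborel (\<lambda>x. indicator {a..b} x *\<^sub>R (deriv w x * f x))"
   using sm by (intro borel_integrable_compact continuous_intros smooth1_cont smooth1_deriv(2)) auto
  moreover have "(\<lambda>x. indicator {a..b} x *\<^sub>R (deriv w x * f x)) = (\<lambda>x. deriv w x * f x)"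
   by (rule bump_indicator[OF assms(1)])
  ultimately show ?thesis by simp
 qed
 have "((\<lambda>x. w x * deriv f x + deriv w x * f x) has_integral (w b * f b - w a * f a)) {a..b}"
  using True d by (intro fundamental_theorem_of_calculus)
   (auto intro!: derivative_eq_intros simp: has_real_derivative_iff_has_vector_derivative[symmetric] DERIV_subset
    intro: has_field_derivative_at_within)
 then have h: "((\<lambda>x. w x * deriv f x + deriv w x * f x) has_integral 0) {a..b}"
  using bump_zero[OF assms(1)] by simp
 have "((\<lambda>x. w x * deriv f x + deriv w x * f x) has_integral 0) UNIV"
  by (rule has_integral_on_superset[OF h])
   (use bump_zero[OF assms(1)] bump_zero[OF bump_deriv[OF assms(1)]] in auto)
 moreover have "((\<lambda>x. w x * deriv f x + deriv w x * f x) has_integral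
   (LINT x|lborel. w x * deriv f x + deriv w x * f x)) UNIV"
  using i1 i2 by (intro has_integral_integral_lborel) auto
 ultimately have "(LINT x|lborel. w x * deriv f x + deriv w x * f x) = 0"
  using has_integral_unique by blast
 then show ?thesis using i1 i2 by simp
next
 case False
 then have "f = (\<lambda>_. 0)" using bump_zero[OF assms(1)] by auto
 then show ?thesis by simp
qed

text \<open>The primitive from the left vanishes again beyond the support because the total integral is 0.\<close>

lemma bump_antideriv:
 assumes "bump a b f" "(LINT x|lborel. f x) = 0"
 obtains F where "bump a b F" "deriv F = f"
proof -
 obtain a' b' where *: "a < a'" "b' < b" "\<And>x. x < a' \<Longrightarrow> f x = 0" "\<And>x. x > b' \<Longrightarrow> f x = 0"
  using bumpE[OF assms(1)] by metis
 have cf: "continuous_on S f" for S using assms smooth1_cont bump_smooth by blast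
 have "\<exists>G. \<forall>x. - \<infinity> < ereal x \<longrightarrow> ereal x < \<infinity> \<longrightarrow> (G has_vector_derivative f x) (at x)"
  by (rule einterval_antiderivative[of "-\<infinity>" \<infinity> f])
   (rule smooth1_isCont[OF bump_smooth[OF assms(1)]] | simp)+
 then obtain G where G': "\<forall>x. - \<infinity> < ereal x \<longrightarrow> ereal x < \<infinity> \<longrightarrow> (G has_vector_derivative f x) (at x)" ..
 have G: "(G has_real_derivative f x) (at x)" for x
  unfolding has_real_derivative_iff_has_vector_derivative
  by (rule G'[rule_format]) simp_all
 define F where "F = (\<lambda>x. G x - G a')"
 have F: "(F has_real_derivative f x) (at x)" for x
  unfolding F_def using DERIV_diff[OF G[of x] DERIV_const[of "G a'"]] by simp
 have ftc: "(f has_integral (F y - F x)) {x..y}" if "x \<le> y" for x y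
  by (rule fundamental_theorem_of_calculus[OF that])
   (simp only: has_real_derivative_iff_has_vector_derivative[symmetric] has_field_derivative_at_within[OF F])
 have F0: "F x = 0" if "x < a'" for x
 proof -
  have "((\<lambda>_. 0) has_integral (0::real)) {x..a'}" by simp
  then have "(f has_integral 0) {x..a'}"
   by (rule has_integral_spike[OF negligible_sing[of a'], rotated]) (simp add: *(3))
  with ftc[of x a'] that have "F a' - F x = 0" by (meson has_integral_unique less_imp_le)
  then show ?thesis by (simp add: F_def)
 qed
 have F1: "F x = 0" if "x > b'" for x
 proof -
  define z where "z = min a' x - 1"
  have z: "z < a'" "z < x" by (auto simp: z_def)
  have "(f has_integral (F x - F z)) {z..x}" using ftc z by simp
  then have h: "(f has_integral (F x - F z)) UNIV"
  proof (rule has_integral_on_superset)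
   fix y assume "y \<notin> {z..x}"
   then show "f y = 0" using z that *(3)[of y] *(4)[of y] by force
  qed simp
  have "(f has_integral 0) UNIV"
   using has_integral_integral_lborel[OF bump_integrable[OF assms(1)]] assms(2) by simp
  with h have "F x - F z = 0" by (rule has_integral_unique)
  then show ?thesis using F0[OF z(1)] by simp
 qed
 have "smooth1 F" using smooth1_antideriv[OF bump_smooth[OF assms(1)] F] .
 then have "bump a b F" by (rule bumpI[OF _ *(1,2) F0 F1])
 moreover have "deriv F = f" by (rule ext) (rule DERIV_imp_deriv[OF F])
 ultimately show ?thesis using that by blast
qed

lemma bump_unit:
 assumes "a < b" obtains f where "bump a b f" "(LINT x|lborel. f x) = 1" "\<And>x. f x \<ge> 0"
proof -
 define a' b' where "a' = (2*a+b)/3" and "b' = (a+2*b)/3"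
 have ab: "a < a'" "a' < b'" "b' < b" using assms by (auto simp: a'_def b'_def)
 define p where "p = plateau a' b' 0"
 have bp: "bump a b p" using ab by (simp add: p_def plateau_bump)
 have p0: "p x \<ge> 0" for x by (simp add: p_def plateau_01)
 have "(LINT x|lborel. p x) \<noteq> 0"
 proof
  assume "(LINT x|lborel. p x) = 0"
  then have "AE x in lborel. p x = 0"
   using integral_nonneg_eq_0_iff_AE[OF bump_integrable[OF bp]] p0 by simp
  then have "AE x in lborel. x \<notin> {a'<..<b'}"
   by eventually_elim (use plateau_pos[of a' _ b' 0] in \<open>force simp: p_def\<close>)
  then have "emeasure lborel {a'<..<b'} = 0"
   by (simp add: AE_iff_measurable[OF _ refl] greaterThanLessThan_eq greaterThan_def lessThan_def Collect_conj_eq)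
  then show False using ab by simp
 qed
 then have pos: "(LINT x|lborel. p x) > 0"
  using p0 by (simp add: order_less_le)
 show ?thesis
 proof (rule that[of "\<lambda>x. (1 / (LINT x|lborel. p x)) * p x"])
  show "bump a b (\<lambda>x. (1 / (LINT x|lborel. p x)) * p x)" by (rule bump_cmult[OF bp])
  show "(LINT x|lborel. 1 / (LINT x|lborel. p x) * p x) = 1" using pos by simp
 qed (use p0 pos in auto)
qed

section \<open>Products of functions of one variable\<close>

definition tens :: "(real \<Rightarrow> real) \<Rightarrow> (real \<Rightarrow> real) \<Rightarrow> real \<times> real \<Rightarrow> real" where
 "tens f g p = f (fst p) * g (snd p)"

lemma C_k_differentiable: "C_k (Suc k) f \<Longrightarrow> f differentiable (at p)"
 unfolding C_k.simps by blast

lemma dx_DERIV: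
 assumes "f differentiable (at p)"
 shows "((\<lambda>t. f (t, snd p)) has_real_derivative dx f p) (at (fst p))"
proof -
 obtain D where "(f has_derivative D) (at p)" using assms differentiable_def by blast
 then have "((f \<circ> (\<lambda>t. (t, snd p))) has_derivative D \<circ> (\<lambda>t. (t, 0))) (at (fst p))"
  by (intro diff_chain_at) (auto intro!: derivative_eq_intros)
 then have "(\<lambda>t. f (t, snd p)) differentiable (at (fst p))"
  unfolding differentiable_def o_def by blast
 then show ?thesis
  by (simp add: dx_def DERIV_deriv_iff_real_differentiable)
qed

lemma dy_DERIV:
 assumes "f differentiable (at p)"
 shows "((\<lambda>t. f (fst p, t)) has_real_derivative dy f p) (at (snd p))"
proof -
 obtain D where "(f has_derivative D) (at p)" using assms differentiable_def by blast
 then have "((f \<circ> (\<lambda>t. (fst p, t))) has_derivative D \<circ> (\<lambda>t. (0, t))) (at (snd p))"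
  by (intro diff_chain_at) (auto intro!: derivative_eq_intros)
 then have "(\<lambda>t. f (fst p, t)) differentiable (at (snd p))"
  unfolding differentiable_def o_def by blast
 then show ?thesis
  by (simp add: dy_def DERIV_deriv_iff_real_differentiable)
qed

lemma dx_eqI: "((\<lambda>t. f (t, snd p)) has_real_derivative d) (at (fst p)) \<Longrightarrow> dx f p = d"
 by (simp add: dx_def DERIV_imp_deriv)
lemma dy_eqI: "((\<lambda>t. f (fst p, t)) has_real_derivative d) (at (snd p)) \<Longrightarrow> dy f p = d"
 by (simp add: dy_def DERIV_imp_deriv)

lemma dx_add: "f differentiable (at p) \<Longrightarrow> g differentiable (at p) \<Longrightarrow>
  dx (\<lambda>q. f q + c * g q) p = dx f p + c * dx g p"
 using dx_DERIV[of f p] dx_DERIV[of g p] by (intro dx_eqI) (auto intro!: derivative_eq_intros)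
lemma dy_add: "f differentiable (at p) \<Longrightarrow> g differentiable (at p) \<Longrightarrow>
  dy (\<lambda>q. f q + c * g q) p = dy f p + c * dy g p"
 using dy_DERIV[of f p] dy_DERIV[of g p] by (intro dy_eqI) (auto intro!: derivative_eq_intros)

lemma C_k_add: "C_k k f \<Longrightarrow> C_k k g \<Longrightarrow> C_k k (\<lambda>p. f p + c * g p)"
proof (induction k arbitrary: f g)
 case 0 then show ?case by (auto intro!: continuous_intros)
next
 case (Suc k)
 then have d: "\<forall>p. f differentiable (at p)" "\<forall>p. g differentiable (at p)" by auto
 have "dx (\<lambda>q. f q + c * g q) = (\<lambda>p. dx f p + c * dx g p)"
  "dy (\<lambda>q. f q + c * g q) = (\<lambda>p. dy f p + c * dy g p)"
  using d dx_add dy_add by blast+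
 with Suc d show ?case by (auto intro!: differentiable_add differentiable_mult)
qed

lemma dx_mult: "f differentiable (at p) \<Longrightarrow> g differentiable (at p) \<Longrightarrow>
  dx (\<lambda>q. f q * g q) p = dx f p * g p + f p * dx g p"
 using dx_DERIV[of f p] dx_DERIV[of g p] by (intro dx_eqI) (auto intro!: derivative_eq_intros)
lemma dy_mult: "f differentiable (at p) \<Longrightarrow> g differentiable (at p) \<Longrightarrow>
  dy (\<lambda>q. f q * g q) p = dy f p * g p + f p * dy g p"
 using dy_DERIV[of f p] dy_DERIV[of g p] by (intro dy_eqI) (auto intro!: derivative_eq_intros)

lemma smooth_add: "smooth f \<Longrightarrow> smooth g \<Longrightarrow> smooth (\<lambda>p. f p + c * g p)"
 by (simp add: smooth_def C_k_add)
lemma smooth_differentiable: "smooth f \<Longrightarrow> f differentiable (at p)"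
 unfolding smooth_def using C_k_differentiable by blast
lemma smooth_dx: "smooth f \<Longrightarrow> smooth (dx f)"
 unfolding smooth_def using C_k.simps(2) by blast
lemma smooth_dy: "smooth f \<Longrightarrow> smooth (dy f)"
 unfolding smooth_def using C_k.simps(2) by blast
lemma smooth_cont: "smooth f \<Longrightarrow> continuous_on S f"
 unfolding smooth_def by (metis C_k.simps(1) continuous_on_subset subset_UNIV)
lemma smooth_borel: "smooth f \<Longrightarrow> f \<in> borel_measurable borel"
 by (intro borel_measurable_continuous_onI smooth_cont)

lemma tens_differentiable:
 assumes "smooth1 f" "smooth1 g" shows "tens f g differentiable (at p)"
proof -
 have "((\<lambda>p. f (fst p)) has_derivative (\<lambda>h. fst h * deriv f (fst p))) (at p)"
  by (rule DERIV_compose_FDERIV[OF smooth1_deriv(1)[OF assms(1)]]) (rule has_derivative_fst[OF has_derivative_ident])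
 moreover have "((\<lambda>p. g (snd p)) has_derivative (\<lambda>h. snd h * deriv g (snd p))) (at p)"
  by (rule DERIV_compose_FDERIV[OF smooth1_deriv(1)[OF assms(2)]]) (rule has_derivative_snd[OF has_derivative_ident])
 ultimately have "((\<lambda>p. f (fst p) * g (snd p)) has_derivative
   (\<lambda>h. f (fst p) * (snd h * deriv g (snd p)) + (fst h * deriv f (fst p)) * g (snd p))) (at p)"
  by (rule has_derivative_mult)
 then show ?thesis unfolding tens_def[abs_def] differentiable_def by - (rule exI, assumption)
qed

lemma dx_tens: assumes "smooth1 f" shows "dx (tens f g) = tens (deriv f) g"
proof
 fix p show "dx (tens f g) p = tens (deriv f) g p"
  using smooth1_deriv(1)[OF assms, of "fst p"]
  by (intro dx_eqI) (auto simp: tens_def intro!: derivative_eq_intros)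
qed

lemma dy_tens: assumes "smooth1 g" shows "dy (tens f g) = tens f (deriv g)"
proof
 fix p show "dy (tens f g) p = tens f (deriv g) p"
  using smooth1_deriv(1)[OF assms, of "snd p"]
  by (intro dy_eqI) (auto simp: tens_def intro!: derivative_eq_intros)
qed

lemma smooth_tens: assumes "smooth1 f" "smooth1 g" shows "smooth (tens f g)"
proof -
 have "C_k k (tens f g)" if "smooth1 f" "smooth1 g" for k f g
  using that
 proof (induction k arbitrary: f g)
  case 0
  then have "continuous_on UNIV (\<lambda>p. f (fst p) * g (snd p))"
   by (intro continuous_on_mult continuous_on_compose2[of UNIV f UNIV fst] continuous_on_compose2[of UNIV g UNIV snd] smooth1_cont)
    (auto intro: continuous_intros)
  then show ?case by (simp add: tens_def[abs_def])
 next
  case (Suc k)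
  then show ?case by (simp add: tens_differentiable dx_tens dy_tens smooth1_deriv)
 qed
 then show ?thesis using assms by (simp add: smooth_def)
qed

lemma test_function_tens:
 assumes "bump a b f" "bump c d g" "{a<..<b} \<times> {c<..<d} \<subseteq> U"
 shows "test_function U (tens f g)"
proof -
 obtain a' b' where 1: "a < a'" "b' < b" "\<And>x. x < a' \<Longrightarrow> f x = 0" "\<And>x. x > b' \<Longrightarrow> f x = 0"
  using bumpE[OF assms(1)] by metis
 obtain c' d' where 2: "c < c'" "d' < d" "\<And>x. x < c' \<Longrightarrow> g x = 0" "\<And>x. x > d' \<Longrightarrow> g x = 0"
  using bumpE[OF assms(2)] by metis
 have sub: "{p. tens f g p \<noteq> 0} \<subseteq> {a'..b'} \<times> {c'..d'}"
  using 1(3,4) 2(3,4) by (auto simp: tens_def not_less[symmetric])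
 have K: "compact ({a'..b'} \<times> {c'..d'})" by (intro compact_Times) auto
 have cl: "closure {p. tens f g p \<noteq> 0} \<subseteq> {a'..b'} \<times> {c'..d'}"
  using closure_minimal[OF sub] compact_imp_closed[OF K] by blast
 then have "compact (closure {p. tens f g p \<noteq> 0})"
  using compact_closure bounded_subset[OF compact_imp_bounded[OF K] sub] by blast
 moreover have "{a'..b'} \<times> {c'..d'} \<subseteq> {a<..<b} \<times> {c<..<d}" using 1 2 by auto
 ultimately show ?thesis
  using cl assms bump_smooth by (auto simp: test_function_def intro!: smooth_tens)
qed

section \<open>Integrals of products and the fundamental lemma\<close>

lemma borel_measurable_tens [measurable]:
 "f \<in> borel_measurable borel \<Longrightarrow> g \<in> borel_measurable borel \<Longrightarrow> tens f g \<in> borel_measurable borel"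
 unfolding tens_def[abs_def]
 by (intro borel_measurable_times measurable_compose[of fst borel borel f borel]
   measurable_compose[of snd borel borel g borel])
  (auto intro!: borel_measurable_continuous_onI continuous_on_fst continuous_on_snd continuous_on_id)

lemma integrable_prod_real:
 fixes f g :: "real \<Rightarrow> real"
 assumes "integrable lborel f" "integrable lborel g"
 shows "integrable lborel (tens f g)" "(LINT p|lborel. tens f g p) = (LINT x|lborel. f x) * (LINT y|lborel. g y)"
proof -
 interpret lborel_pair: pair_sigma_finite "lborel :: real measure" "lborel :: real measure" ..
 have "integrable (lborel \<Otimes>\<^sub>M lborel) (\<lambda>(x, y). f x * g y)"
 proof (rule lborel_pair.Fubini_integrable)
  show "(\<lambda>(x, y). f x * g y) \<in> borel_measurable (lborel \<Otimes>\<^sub>M lborel)" using assms by measurable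
  have "integrable lborel (\<lambda>x. norm (f x) * (LINT y|lborel. norm (g y)))" using assms by auto
  then show "integrable lborel (\<lambda>x. LINT y|lborel. norm (case (x, y) of (x, y) \<Rightarrow> f x * g y))"
   by (simp add: norm_mult abs_mult)
  show "AE x in lborel. integrable lborel (\<lambda>y. case (x, y) of (x, y) \<Rightarrow> f x * g y)" using assms by simp
 qed
 moreover have "tens f g = (\<lambda>(x, y). f x * g y)" by (auto simp: tens_def)
 ultimately show 1: "integrable lborel (tens f g)" by (simp add: lborel_prod)
 have "(LINT p|(lborel \<Otimes>\<^sub>M lborel). tens f g p) = (LINT x|lborel. LINT y|lborel. tens f g (x, y))"
  using 1 by (intro lborel_pair.integral_fst'[symmetric]) (simp add: lborel_prod)
 then show "(LINT p|lborel. tens f g p) = (LINT x|lborel. f x) * (LINT y|lborel. g y)"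
  by (simp add: lborel_prod tens_def mult.commute)
qed

lemma enn2real_inj: "x \<noteq> \<infinity> \<Longrightarrow> y \<noteq> \<infinity> \<Longrightarrow> enn2real x = enn2real y \<Longrightarrow> x = y"
 by (cases x; cases y) auto

text \<open>Rectangles generate the Borel sets, so the two finite measures with densities \<open>w\<^sup>+\<close> and \<open>w\<^sup>-\<close> agree.\<close>

lemma AE_zero_of_integral_rect:
 fixes w :: "real \<times> real \<Rightarrow> real"
 assumes w: "integrable lborel w"
  and z: "\<And>a b c d. (LINT p|lborel. indicator ({a<..<b} \<times> {c<..<d}) p * w p) = 0"
 shows "AE p in lborel. w p = 0"
proof -
 have [measurable]: "w \<in> borel_measurable borel" using w by auto
 define fp fm where "fp p = ennreal (w p)" and "fm p = ennreal (- w p)" for p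
 have [measurable]: "fp \<in> borel_measurable borel" "fm \<in> borel_measurable borel"
  unfolding fp_def fm_def by measurable
 have fin: "(\<integral>\<^sup>+p. fp p \<partial>lborel) \<noteq> \<infinity>" "(\<integral>\<^sup>+p. fm p \<partial>lborel) \<noteq> \<infinity>"
  using w unfolding fp_def fm_def real_integrable_def by auto
 have box: "(\<integral>\<^sup>+p. fp p * indicator (box l u) p \<partial>lborel) = (\<integral>\<^sup>+p. fm p * indicator (box l u) p \<partial>lborel)" for l u
 proof -
  obtain a c where l: "l = (a, c)" by (cases l)
  obtain b d where u: "u = (b, d)" by (cases u)
  have bx: "box l u = {a<..<b} \<times> {c<..<d}" unfolding l u by (simp add: box_prod box_real)
  have m: "box l u \<in> sets lborel" by simp
  have iw: "integrable lborel (\<lambda>p. indicator (box l u) p * w p)"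
   using integrable_mult_indicator[OF m w] by simp
  have e1: "(\<integral>\<^sup>+p. fp p * indicator (box l u) p \<partial>lborel) = (\<integral>\<^sup>+p. ennreal (indicator (box l u) p * w p) \<partial>lborel)"
   by (intro nn_integral_cong) (auto simp: fp_def indicator_def)
  have e2: "(\<integral>\<^sup>+p. fm p * indicator (box l u) p \<partial>lborel) = (\<integral>\<^sup>+p. ennreal (- (indicator (box l u) p * w p)) \<partial>lborel)"
   by (intro nn_integral_cong) (auto simp: fm_def indicator_def)
  have "enn2real (\<integral>\<^sup>+p. ennreal (indicator (box l u) p * w p) \<partial>lborel)
    = enn2real (\<integral>\<^sup>+p. ennreal (- (indicator (box l u) p * w p)) \<partial>lborel)"
   using z[of a b c d] real_lebesgue_integral_def[OF iw] unfolding bx by simp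
  moreover have "(\<integral>\<^sup>+p. ennreal (indicator (box l u) p * w p) \<partial>lborel) \<noteq> \<infinity>"
   "(\<integral>\<^sup>+p. ennreal (- (indicator (box l u) p * w p)) \<partial>lborel) \<noteq> \<infinity>"
   using iw unfolding real_integrable_def by auto
  ultimately show ?thesis unfolding e1 e2
   by (rule enn2real_inj[rotated 2])
 qed
 have "density lborel fp = density lborel fm"
 proof (rule measure_eqI_generator_eq[where E = "range (\<lambda>(a, b). box a b)" and \<Omega> = UNIV
   and A = "\<lambda>n::nat. box (- (real n *\<^sub>R One)) (real n *\<^sub>R One)"])
  show "Int_stable (range (\<lambda>(a, b). box a b :: (real \<times> real) set))"
   by (auto simp: Int_stable_def box_Int_box)
  show "sets (density lborel fp) = sigma_sets UNIV (range (\<lambda>(a, b). box a b))"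
   "sets (density lborel fm) = sigma_sets UNIV (range (\<lambda>(a, b). box a b))"
   by (simp_all add: borel_eq_box)
  show "(\<Union>n::nat. box (- (real n *\<^sub>R One)) (real n *\<^sub>R One)) = (UNIV :: (real \<times> real) set)"
   by (rule UN_box_eq_UNIV)
  fix X :: "(real \<times> real) set" assume "X \<in> range (\<lambda>(a, b). box a b)"
  then obtain l u where "X = box l u" by auto
  then show "emeasure (density lborel fp) X = emeasure (density lborel fm) X"
   using box by (simp add: emeasure_density)
 next
  fix i :: nat
  have "emeasure (density lborel fp) (box (- (real i *\<^sub>R One)) (real i *\<^sub>R One)) \<le> (\<integral>\<^sup>+p. fp p \<partial>lborel)"
   by (subst emeasure_density) (auto intro!: nn_integral_mono simp: indicator_def)
  then show "emeasure (density lborel fp) (box (- (real i *\<^sub>R One)) (real i *\<^sub>R One)) \<noteq> \<infinity>"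
   using fin(1) by (auto simp: top_unique)
 qed auto
 then have "AE p in lborel. fp p = fm p"
  using finite_density_unique[of fp lborel fm] fin by simp
 then show ?thesis
 proof eventually_elim
  case (elim p)
  then show ?case unfolding fp_def fm_def
   by (cases "w p \<ge> 0") (auto simp: ennreal_neg ennreal_eq_0_iff dest: sym)
 qed
qed

text \<open>The fundamental lemma of the calculus of variations; products of bumps suffice because
 they approximate the indicators of rectangles.\<close>

lemma fundamental_lemma:
 fixes w :: "real \<times> real \<Rightarrow> real"
 assumes w: "integrable lborel (\<lambda>p. indicator ({a<..<b} \<times> {c<..<d}) p * w p)"
  and z: "\<And>f g. bump a b f \<Longrightarrow> bump c d g \<Longrightarrow>
   (LINT p|lborel. indicator ({a<..<b} \<times> {c<..<d}) p * w p * tens f g p) = 0"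
 shows "AE p in lborel. p \<in> {a<..<b} \<times> {c<..<d} \<longrightarrow> w p = 0"
proof -
 define R where "R = {a<..<b} \<times> {c<..<d}"
 define W where "W p = indicator R p * w p" for p
 have W: "integrable lborel W" using w by (simp add: W_def[abs_def] R_def)
 have [measurable]: "W \<in> borel_measurable borel" using W by auto
 have inner: "(LINT p|lborel. indicator ({a'<..<b'} \<times> {c'<..<d'}) p * W p) = 0"
  if "a < a'" "b' < b" "c < c'" "d' < d" for a' b' c' d'
 proof -
  have "(\<lambda>n. LINT p|lborel. W p * tens (plateau a' b' n) (plateau c' d' n) p)
    \<longlonglongrightarrow> (LINT p|lborel. W p * (indicator {a'<..<b'} (fst p) * indicator {c'<..<d'} (snd p)))"
  proof (rule integral_dominated_convergence[where w = "\<lambda>p. norm (W p)"])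
   show "(\<lambda>p. W p * (indicator {a'<..<b'} (fst p) * indicator {c'<..<d'} (snd p))) \<in> borel_measurable lborel"
    by (simp, subst borel_prod[symmetric]) (use \<open>W \<in> borel_measurable borel\<close> in \<open>simp add: borel_prod[symmetric]; measurable\<close>)
   show "(\<lambda>p. W p * tens (plateau a' b' n) (plateau c' d' n) p) \<in> borel_measurable lborel" for n
    by (simp add: borel_measurable_times borel_measurable_tens smooth1_borel smooth1_plateau)
   show "integrable lborel (\<lambda>p. norm (W p))" using W by simp
   show "AE x in lborel. norm (W x * tens (plateau a' b' n) (plateau c' d' n) x) \<le> norm (W x)" for n
    using plateau_01 by (auto simp: tens_def abs_mult intro!: mult_left_le mult_le_one)
   show "AE x in lborel. (\<lambda>i. W x * tens (plateau a' b' i) (plateau c' d' i) x) \<longlonglongrightarrow>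
     W x * (indicator {a'<..<b'} (fst x) * indicator {c'<..<d'} (snd x))"
    unfolding tens_def by (intro AE_I2 tendsto_intros plateau_tendsto)
  qed
  moreover have "(LINT p|lborel. W p * tens (plateau a' b' n) (plateau c' d' n) p) = 0" for n
   using z[of "plateau a' b' n" "plateau c' d' n"] that by (simp add: plateau_bump W_def R_def)
  ultimately have "(LINT p|lborel. W p * (indicator {a'<..<b'} (fst p) * indicator {c'<..<d'} (snd p))) = 0"
   by (simp add: LIMSEQ_const_iff)
  then show ?thesis by (simp add: indicator_times mult.commute)
 qed
 have "AE p in lborel. W p = 0"
 proof (rule AE_zero_of_integral_rect[OF W])
  fix a' b' c' d'
  define e where "e n = inverse (real (Suc n))" for n
  have e0: "e \<longlonglongrightarrow> 0" unfolding e_def by (rule LIMSEQ_inverse_real_of_nat)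
  define S where "S n = {max a' (a + e n)<..<min b' (b - e n)} \<times> {max c' (c + e n)<..<min d' (d - e n)}" for n
  have [measurable]: "S n \<in> sets borel" for n unfolding S_def by (intro borel_open open_Times) auto
  have mr: "({a'<..<b'} \<times> {c'<..<d'}) \<in> sets borel" by (intro borel_open open_Times) auto
  have "(\<lambda>n. LINT p|lborel. indicator (S n) p * W p) \<longlonglongrightarrow> (LINT p|lborel. indicator ({a'<..<b'} \<times> {c'<..<d'}) p * W p)"
  proof (rule integral_dominated_convergence[where w = "\<lambda>p. norm (W p)"])
   show "(\<lambda>p. indicator ({a'<..<b'} \<times> {c'<..<d'}) p * W p) \<in> borel_measurable lborel"
    using mr by simp
   show "AE p in lborel. (\<lambda>n. indicator (S n) p * W p) \<longlonglongrightarrow> indicator ({a'<..<b'} \<times> {c'<..<d'}) p * W p"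
   proof (rule AE_I2)
    fix p :: "real \<times> real"
    obtain x y where p: "p = (x, y)" by (cases p)
    show "(\<lambda>n. indicator (S n) p * W p) \<longlonglongrightarrow> indicator ({a'<..<b'} \<times> {c'<..<d'}) p * W p"
    proof (cases "p \<in> R")
     case True
     then have pos: "x - a > 0" "b - x > 0" "y - c > 0" "d - y > 0" by (auto simp: R_def p)
     have "\<forall>\<^sub>F n in sequentially. e n < x - a" "\<forall>\<^sub>F n in sequentially. e n < b - x"
      "\<forall>\<^sub>F n in sequentially. e n < y - c" "\<forall>\<^sub>F n in sequentially. e n < d - y"
      using order_tendstoD(2)[OF e0] pos by auto
     then have "\<forall>\<^sub>F n in sequentially. indicator (S n) p * W p = indicator ({a'<..<b'} \<times> {c'<..<d'}) p * W p"
      by eventually_elim (auto simp: S_def p indicator_def)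
     then show ?thesis by (rule tendsto_eventually)
    qed (simp add: W_def)
   qed
  qed (use W in \<open>auto simp: indicator_def\<close>)
  moreover have "(LINT p|lborel. indicator (S n) p * W p) = 0" for n
   unfolding S_def by (rule inner) (auto simp: e_def min_less_iff_disj less_max_iff_disj)
  ultimately show "(LINT p|lborel. indicator ({a'<..<b'} \<times> {c'<..<d'}) p * W p) = 0"
   by (simp add: LIMSEQ_const_iff)
 qed
 then show ?thesis by eventually_elim (auto simp: W_def R_def)
qed

section \<open>Fubini in the plane\<close>

lemma fub_fst:
 fixes h :: "real \<times> real \<Rightarrow> real"
 assumes "integrable lborel h"
 shows "(LINT x|lborel. LINT y|lborel. h (x, y)) = (LINT p|lborel. h p)"
  and "integrable lborel (\<lambda>x. LINT y|lborel. h (x, y))"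
  and "AE x in lborel. integrable lborel (\<lambda>y. h (x, y))"
proof -
 interpret lborel_pair: pair_sigma_finite "lborel :: real measure" "lborel :: real measure" ..
 have h: "integrable (lborel \<Otimes>\<^sub>M lborel) h" using assms by (simp add: lborel_prod)
 show "(LINT x|lborel. LINT y|lborel. h (x, y)) = (LINT p|lborel. h p)"
  using lborel_pair.integral_fst'[OF h] by (simp add: lborel_prod)
 show "integrable lborel (\<lambda>x. LINT y|lborel. h (x, y))" by (rule lborel_pair.integrable_fst'[OF h])
 show "AE x in lborel. integrable lborel (\<lambda>y. h (x, y))" by (rule lborel_pair.AE_integrable_fst'[OF h])
qed

lemma integrable_swap:
 fixes h :: "real \<times> real \<Rightarrow> real"
 assumes "integrable lborel h"
 shows "integrable lborel (\<lambda>p. h (prod.swap p))"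
  and "(LINT p|lborel. h (prod.swap p)) = (LINT p|lborel. h p)"
proof -
 interpret lborel_pair: pair_sigma_finite "lborel :: real measure" "lborel :: real measure" ..
 have h: "integrable (lborel \<Otimes>\<^sub>M lborel) h" using assms by (simp add: lborel_prod)
 have e: "(\<lambda>(x, y). h (y, x)) = (\<lambda>p. h (prod.swap p))" by auto
 show "integrable lborel (\<lambda>p. h (prod.swap p))"
  using lborel_pair.integrable_product_swap[OF h] by (simp add: lborel_prod e)
 show "(LINT p|lborel. h (prod.swap p)) = (LINT p|lborel. h p)"
  using lborel_pair.integral_product_swap[of h] h by (simp add: lborel_prod e)
qed

lemma AE_swap:
 assumes "AE p in (lborel :: (real \<times> real) measure). Q p"
 shows "AE p in lborel. Q (prod.swap p)"
proof -
 interpret lborel_pair: pair_sigma_finite "lborel :: real measure" "lborel :: real measure" ..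
 have "AE p in distr lborel lborel (\<lambda>(x, y). (y, x :: real)). Q p"
  using assms lborel_pair.distr_pair_swap unfolding lborel_prod by metis
 moreover have "(\<lambda>(x, y). (y, x :: real)) \<in> (lborel :: (real \<times> real) measure) \<rightarrow>\<^sub>M lborel"
  using measurable_pair_swap'[of "lborel :: real measure" "lborel :: real measure"] unfolding lborel_prod .
 ultimately have "AE p in lborel. Q (case p of (x, y) \<Rightarrow> (y, x))" by (rule AE_distrD[rotated])
 then show ?thesis by (rule AE_mp) (simp add: split_beta prod.swap_def)
qed

lemma fub_snd:
 fixes h :: "real \<times> real \<Rightarrow> real"
 assumes "integrable lborel h"
 shows "(LINT y|lborel. LINT x|lborel. h (x, y)) = (LINT p|lborel. h p)"
  and "integrable lborel (\<lambda>y. LINT x|lborel. h (x, y))"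
  and "AE y in lborel. integrable lborel (\<lambda>x. h (x, y))"
 using fub_fst[OF integrable_swap(1)[OF assms]] integrable_swap(2)[OF assms] by auto

lemma AE_sections_fst:
 assumes "AE p in (lborel :: (real \<times> real) measure). Q p"
 shows "AE x in lborel. AE y in lborel. Q (x, y)"
proof -
 interpret lborel_pair: pair_sigma_finite "lborel :: real measure" "lborel :: real measure" ..
 have "AE p in (lborel :: real measure) \<Otimes>\<^sub>M (lborel :: real measure). Q p"
  using assms unfolding lborel_prod .
 then show ?thesis by (rule lborel_pair.AE_pair)
qed

lemma AE_sections_snd:
 assumes "AE p in (lborel :: (real \<times> real) measure). Q p"
 shows "AE y in lborel. AE x in lborel. Q (x, y)"
 using AE_sections_fst[OF AE_swap[OF assms]] by simp

lemma AE_from_sections: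
 assumes "{p. Q p} \<in> sets (borel :: (real \<times> real) measure)"
  and "AE x in lborel. AE y in lborel. Q (x, y)"
 shows "AE p in lborel. Q p"
proof -
 interpret lborel_pair: pair_sigma_finite "lborel :: real measure" "lborel :: real measure" ..
 have "AE p in lborel \<Otimes>\<^sub>M lborel. Q p"
 proof (rule lborel_pair.AE_pair_measure)
  show "{p \<in> space (lborel \<Otimes>\<^sub>M lborel). Q p} \<in> sets (lborel \<Otimes>\<^sub>M lborel)"
   unfolding lborel_prod using assms(1) by simp
 qed (rule assms(2))
 then show ?thesis unfolding lborel_prod .
qed

lemma tens_swap: "tens f g (prod.swap p) = tens g f p" by (simp add: tens_def)

lemma integrable_mult_tens:
 fixes h :: "real \<times> real \<Rightarrow> real"
 assumes "integrable lborel h" "f \<in> borel_measurable borel" "g \<in> borel_measurable borel"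
  and "\<And>x. \<bar>f x\<bar> \<le> M" "\<And>y. \<bar>g y\<bar> \<le> N"
 shows "integrable lborel (\<lambda>p. h p * tens f g p)"
proof (rule Bochner_Integration.integrable_bound[of _ "\<lambda>p. (M * N) * h p"])
 show "integrable lborel (\<lambda>p. M * N * h p)" using assms by simp
 show "(\<lambda>p. h p * tens f g p) \<in> borel_measurable lborel"
  using assms borel_measurable_tens by simp
 have M: "0 \<le> M" using assms(4)[of 0] by simp
 have "\<bar>h p\<bar> * (\<bar>f (fst p)\<bar> * \<bar>g (snd p)\<bar>) \<le> \<bar>h p\<bar> * (M * N)" for p
  using assms M by (intro mult_left_mono mult_mono) auto
 moreover have "0 \<le> M * N" using M assms(5)[of 0] by simp
 ultimately show "AE p in lborel. norm (h p * tens f g p) \<le> norm (M * N * h p)"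
  using M assms(5)[of 0] by (simp add: tens_def abs_mult mult.commute mult.left_commute)
qed

lemma integrable_mult_bumps:
 assumes "integrable lborel h" "bump a b f" "bump c d g"
 shows "integrable lborel (\<lambda>p. h p * tens f g p)"
proof -
 obtain M N where "\<And>x. \<bar>f x\<bar> \<le> M" "\<And>y. \<bar>g y\<bar> \<le> N" using bump_bounded assms by metis
 then show ?thesis using assms by (intro integrable_mult_tens[where M = M and N = N]) (auto intro: smooth1_borel bump_smooth)
qed

section \<open>Functions with a vanishing distributional derivative\<close>

text \<open>A test function \<open>h(y)\<close> differs from a derivative of a test function by a multiple of a
 fixed bump \<open>\<rho>\<close>, so \<open>D\<close> agrees with its \<open>\<rho>\<close>-weighted mean in \<open>y\<close>.\<close>

lemma indep_snd:
 fixes D :: "real \<times> real \<Rightarrow> real"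
 assumes D: "integrable lborel D" and cd: "c < d"
  and zero: "\<And>p. p \<notin> {a<..<b} \<times> {c<..<d} \<Longrightarrow> D p = 0"
  and test: "\<And>f g. bump a b f \<Longrightarrow> bump c d g \<Longrightarrow> (LINT p|lborel. D p * tens f (deriv g) p) = 0"
 obtains P where "integrable lborel P" "\<forall>x. x \<notin> {a<..<b} \<longrightarrow> P x = 0"
  "AE p in lborel. p \<in> {a<..<b} \<times> {c<..<d} \<longrightarrow> D p = P (fst p)"
proof -
 obtain \<rho> where \<rho>: "bump c d \<rho>" "(LINT x|lborel. \<rho> x) = 1" using bump_unit[OF cd] by metis
 obtain M where M: "\<And>x. \<bar>\<rho> x\<bar> \<le> M" using bump_bounded[OF \<rho>(1)] by metis
 have [measurable]: "D \<in> borel_measurable borel" using D by auto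
 have D\<rho>: "integrable lborel (\<lambda>p. D p * tens (\<lambda>_. 1) \<rho> p)"
  using D M \<rho> by (intro integrable_mult_tens[where M = 1 and N = M]) (auto intro: smooth1_borel bump_smooth)
 define P where "P x = (LINT y|lborel. D (x, y) * \<rho> y)" for x
 have P: "integrable lborel P" using fub_fst(2)[OF D\<rho>] by (simp add: P_def[abs_def] tens_def)
 have P0: "P x = 0" if "x \<notin> {a<..<b}" for x
 proof -
  have "D (x, y) = 0" for y using zero[of "(x, y)"] that by blast
  then show ?thesis by (simp add: P_def)
 qed
 define R where "R = {a<..<b} \<times> {c<..<d}"
 have PR: "integrable lborel (tens P (indicator {c<..<d}))"
  using P by (intro integrable_prod_real) (auto simp: emeasure_lborel_Ioo less_imp_le[OF cd])
 have w: "indicator R p * (D p - P (fst p)) = D p - tens P (indicator {c<..<d}) p" for p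
 proof (cases "p \<in> R")
  case True
  then show ?thesis by (auto simp: R_def tens_def)
 next
  case False
  then have "D p = 0" using zero by (simp add: R_def)
  with False P0[of "fst p"] show ?thesis by (cases p) (auto simp: R_def tens_def indicator_def)
 qed
 have "AE p in lborel. p \<in> {a<..<b} \<times> {c<..<d} \<longrightarrow> D p - P (fst p) = 0"
 proof (rule fundamental_lemma)
  show "integrable lborel (\<lambda>p. indicator ({a<..<b} \<times> {c<..<d}) p * (D p - P (fst p)))"
   using D PR by (simp add: w R_def[symmetric])
 next
  fix f h assume f: "bump a b f" and h: "bump c d h"
  define I where "I = (LINT y|lborel. h y)"
  have h0: "bump c d (\<lambda>y. h y - I * \<rho> y)" by (intro bump_diff bump_cmult h \<rho>)
  moreover have "(LINT y|lborel. h y - I * \<rho> y) = 0"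
   using bump_integrable[OF h] bump_integrable[OF \<rho>(1)] \<rho>(2) by (simp add: I_def)
  ultimately obtain g where g: "bump c d g" "deriv g = (\<lambda>y. h y - I * \<rho> y)"
   using bump_antideriv by metis
  have Df\<rho>: "integrable lborel (\<lambda>p. D p * tens f \<rho> p)" by (rule integrable_mult_bumps[OF D f \<rho>(1)])
  have Dfh: "integrable lborel (\<lambda>p. D p * tens f h p)" by (rule integrable_mult_bumps[OF D f h])
  have "0 = (LINT p|lborel. D p * tens f h p - I * (D p * tens f \<rho> p))"
   using test[OF f g(1)] unfolding g(2) by (simp add: tens_def algebra_simps)
  also have "\<dots> = (LINT p|lborel. D p * tens f h p) - I * (LINT p|lborel. D p * tens f \<rho> p)"
   using Df\<rho> Dfh by simp
  finally have 1: "(LINT p|lborel. D p * tens f h p) = I * (LINT p|lborel. D p * tens f \<rho> p)" by simp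
  have "(LINT p|lborel. D p * tens f \<rho> p) = (LINT x|lborel. f x * P x)"
   using fub_fst(1)[OF Df\<rho>] by (simp add: tens_def P_def mult.assoc mult.left_commute)
  moreover have "(LINT p|lborel. tens P (indicator {c<..<d}) p * tens f h p)
    = (LINT x|lborel. f x * P x) * I"
  proof -
   obtain Mf where Mf: "\<And>x. \<bar>f x\<bar> \<le> Mf" using bump_bounded[OF f] by metis
   have fP: "integrable lborel (\<lambda>x. f x * P x)"
    using P Mf by (intro Bochner_Integration.integrable_bound[of _ "\<lambda>x. Mf * P x" "\<lambda>x. f x * P x"])
     (auto simp: abs_mult intro!: mult_right_mono borel_measurable_times smooth1_borel[OF bump_smooth[OF f]] order_trans[OF Mf])
   have "tens P (indicator {c<..<d}) p * tens f h p = tens (\<lambda>x. f x * P x) h p" for p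
    using bump_zero[OF h, of "snd p"] by (auto simp: tens_def indicator_def)
   then show ?thesis using integrable_prod_real(2)[OF fP bump_integrable[OF h]] by (simp add: I_def)
  qed
  moreover have "integrable lborel (\<lambda>p. tens P (indicator {c<..<d}) p * tens f h p)"
   by (rule integrable_mult_bumps[OF PR f h])
  ultimately show "(LINT p|lborel. indicator ({a<..<b} \<times> {c<..<d}) p * (D p - P (fst p)) * tens f h p) = 0"
   using Dfh 1 by (simp add: w R_def[symmetric] left_diff_distrib)
 qed
 then have "AE p in lborel. p \<in> {a<..<b} \<times> {c<..<d} \<longrightarrow> D p = P (fst p)" by eventually_elim simp
 with P P0 show ?thesis using that by blast
qed

lemma indep_fst:
 fixes D :: "real \<times> real \<Rightarrow> real"
 assumes D: "integrable lborel D" and ab: "a < b"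
  and zero: "\<And>p. p \<notin> {a<..<b} \<times> {c<..<d} \<Longrightarrow> D p = 0"
  and test: "\<And>f g. bump a b f \<Longrightarrow> bump c d g \<Longrightarrow> (LINT p|lborel. D p * tens (deriv f) g p) = 0"
 obtains P where "integrable lborel P" "\<forall>x. x \<notin> {c<..<d} \<longrightarrow> P x = 0"
  "AE p in lborel. p \<in> {a<..<b} \<times> {c<..<d} \<longrightarrow> D p = P (snd p)"
proof -
 have t: "(LINT p|lborel. D (prod.swap p) * tens g (deriv f) p) = 0" if f: "bump a b f" and g: "bump c d g" for f g
  using integrable_swap(2)[OF integrable_mult_bumps[OF D bump_deriv[OF f] g]] test[OF that]
  by (simp add: tens_swap)
 have zero': "D (prod.swap p) = 0" if "p \<notin> {c<..<d} \<times> {a<..<b}" for p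
  using that zero[of "prod.swap p"] by (cases p) auto
 obtain P where P: "integrable lborel P" "\<forall>x. x \<notin> {c<..<d} \<longrightarrow> P x = 0"
  "AE p in lborel. p \<in> {c<..<d} \<times> {a<..<b} \<longrightarrow> D (prod.swap p) = P (fst p)"
  by (rule indep_snd[of "\<lambda>p. D (prod.swap p)" a b c d, OF integrable_swap(1)[OF D] ab zero' t])
 from AE_swap[OF P(3)] have "AE p in lborel. p \<in> {a<..<b} \<times> {c<..<d} \<longrightarrow> D p = P (snd p)"
  by eventually_elim (auto simp: prod.swap_def)
 with P that show ?thesis by blast
qed

section \<open>Primitives along rows and columns\<close>

definition primx :: "(real \<times> real \<Rightarrow> real) \<Rightarrow> real \<times> real \<Rightarrow> real" where
 "primx k p = (LINT t|lborel. indicator {..<fst p} t * k (t, snd p))"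

definition primy :: "(real \<times> real \<Rightarrow> real) \<Rightarrow> real \<times> real \<Rightarrow> real" where
 "primy k p = (LINT t|lborel. indicator {..<snd p} t * k (fst p, t))"

lemma primx_measurable [measurable]:
 assumes "k \<in> borel_measurable borel" shows "primx k \<in> borel_measurable borel"
proof -
 have k[measurable]: "k \<in> borel_measurable (borel \<Otimes>\<^sub>M borel)" using assms by (simp add: borel_prod)
 have e: "(indicator {..<fst p} t :: real) = (if t < fst p then 1 else 0)" for p :: "real \<times> real" and t
  by auto
 have "(\<lambda>p. LINT t|lborel. (if t < fst p then 1 else 0) * k (t, snd p)) \<in> borel_measurable (borel \<Otimes>\<^sub>M borel)"
  by measurable
 then show ?thesis by (simp add: primx_def[abs_def] borel_prod e)
qed

lemma primx_swap: "primx (\<lambda>p. k (prod.swap p)) p = primy k (prod.swap p)"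
 by (simp add: primx_def primy_def)

lemma primx_bound: "\<bar>primx k (x, y)\<bar> \<le> (LINT t|lborel. \<bar>k (t, y)\<bar>)" if "integrable lborel (\<lambda>t. k (t, y))"
proof -
 have "\<bar>primx k (x, y)\<bar> \<le> (LINT t|lborel. \<bar>indicator {..<x} t * k (t, y)\<bar>)"
  unfolding primx_def using integral_norm_bound[of lborel "\<lambda>t. indicator {..<x} t * k (t, y)"] by simp
 also have "\<dots> \<le> (LINT t|lborel. \<bar>k (t, y)\<bar>)"
 proof (rule integral_mono)
  show "integrable lborel (\<lambda>t. \<bar>indicator {..<x} t * k (t, y)\<bar>)"
   using that by (intro integrable_abs integrable_real_mult_indicator[of _ _ "\<lambda>t. k (t, y)", simplified mult.commute]) auto
  show "integrable lborel (\<lambda>t. \<bar>k (t, y)\<bar>)" using that by simp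
 qed (auto simp: indicator_def)
 finally show ?thesis .
qed

lemma prim_test_1d:
 fixes \<kappa> :: "real \<Rightarrow> real"
 assumes \<kappa>: "integrable lborel \<kappa>" and f: "bump a b f"
 shows "(LINT x|lborel. deriv f x * (LINT t|lborel. indicator {..<x} t * \<kappa> t)) = - (LINT t|lborel. f t * \<kappa> t)"
proof -
 have [measurable]: "\<kappa> \<in> borel_measurable borel" "deriv f \<in> borel_measurable borel" "f \<in> borel_measurable borel"
  using \<kappa> f by (auto intro: smooth1_borel bump_smooth bump_deriv)
 define h where "h = (\<lambda>p::real\<times>real. (if snd p < fst p then 1 else 0) * tens (deriv f) \<kappa> p)"
 have h: "integrable lborel h"
 proof (rule Bochner_Integration.integrable_bound)
  show "integrable lborel (tens (deriv f) \<kappa>)"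
   by (rule integrable_prod_real[OF bump_integrable[OF bump_deriv[OF f]] \<kappa>])
  have "(\<lambda>p::real\<times>real. (if snd p < fst p then 1 else 0) * tens (deriv f) \<kappa> p) \<in> borel_measurable (borel \<Otimes>\<^sub>M borel)"
   unfolding tens_def by measurable
  then show "h \<in> borel_measurable lborel" by (simp add: h_def borel_prod)
 qed (simp add: h_def)
 have inner: "(LINT x|lborel. (if t < x then 1 else 0) * deriv f x) = - f t" for t
 proof -
  obtain a' b' where b: "a < a'" "b' < b" "\<And>x. x < a' \<Longrightarrow> f x = 0" "\<And>x. x > b' \<Longrightarrow> f x = 0"
   using bumpE[OF f] by metis
  define u where "u = max b' t + 1"
  have "(LINT x|lborel. indicator {t..u} x *\<^sub>R deriv f x) = f u - f t"
  proof (rule integral_FTC_atLeastAtMost)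
   show "(f has_vector_derivative deriv f x) (at x within {t..u})" for x
    using smooth1_deriv(1)[OF bump_smooth[OF f]]
    by (simp add: has_real_derivative_iff_has_vector_derivative[symmetric] has_field_derivative_at_within)
  qed (auto simp: u_def intro: smooth1_cont smooth1_deriv(2)[OF bump_smooth[OF f]])
  moreover have "f u = 0" using b(4)[of u] by (simp add: u_def)
  moreover have "(LINT x|lborel. (if t < x then 1 else 0) * deriv f x) = (LINT x|lborel. indicator {t..u} x *\<^sub>R deriv f x)"
  proof (rule integral_cong_AE)
   have d0: "deriv f x = 0" if "x > u" for x
    using that b(4) by (intro deriv_zero_on_open[of "{b'<..}"]) (auto simp: u_def)
   have "AE x in lborel. x \<noteq> t" by (rule AE_lborel_singleton)
   then show "AE x in lborel. (if t < x then 1 else 0) * deriv f x = indicator {t..u} x *\<^sub>R deriv f x"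
    by eventually_elim (use d0 in \<open>auto simp: indicator_def not_le\<close>)
  qed auto
  ultimately show ?thesis by simp
 qed
 have "(LINT x|lborel. deriv f x * (LINT t|lborel. indicator {..<x} t * \<kappa> t)) = (LINT x|lborel. LINT t|lborel. h (x, t))"
 proof -
  have e: "h (x, t) = deriv f x * (indicator {..<x} t * \<kappa> t)" for x t
   by (simp add: h_def tens_def)
  show ?thesis unfolding e by (simp only: integral_mult_right_zero)
 qed
 also have "\<dots> = (LINT t|lborel. LINT x|lborel. h (x, t))"
  using fub_fst(1)[OF h] fub_snd(1)[OF h] by simp
 also have "\<dots> = (LINT t|lborel. \<kappa> t * (LINT x|lborel. (if t < x then 1 else 0) * deriv f x))"
  by (simp add: h_def tens_def mult.assoc mult.left_commute mult.commute flip: integral_mult_right_zero)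
 finally show ?thesis unfolding inner by (simp add: mult.commute)
qed

text \<open>If \<open>\<partial>\<^sub>x z = k\<close> in the sense of distributions, then \<open>z\<close> is a primitive of \<open>k\<close> on almost
 every row, up to a constant depending on the row.\<close>

lemma row_primitive:
 fixes z k :: "real \<times> real \<Rightarrow> real"
 assumes z: "integrable lborel z" and k: "integrable lborel k" and ab: "a < b"
  and z0: "\<And>p. p \<notin> {a<..<b} \<times> {c<..<d} \<Longrightarrow> z p = 0"
  and k0: "\<And>p. p \<notin> {a<..<b} \<times> {c<..<d} \<Longrightarrow> k p = 0"
  and test: "\<And>f g. bump a b f \<Longrightarrow> bump c d g \<Longrightarrow>
   (LINT p|lborel. z p * tens (deriv f) g p) = - (LINT p|lborel. k p * tens f g p)"
 obtains P where "P \<in> borel_measurable borel"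
  "AE p in lborel. p \<in> {a<..<b} \<times> {c<..<d} \<longrightarrow> z p = P (snd p) + primx k p"
proof -
 have [measurable]: "z \<in> borel_measurable borel" "k \<in> borel_measurable borel" using z k by auto
 define R where "R = {a<..<b} \<times> {c<..<d}"
 have [measurable]: "R \<in> sets borel" unfolding R_def by (intro borel_open open_Times) auto
 define K where "K p = indicator R p * primx k p" for p
 define N where "N y = (LINT t|lborel. \<bar>k (t, y)\<bar>)" for y
 have N: "integrable lborel N" using fub_snd(2)[OF integrable_abs[OF k]] by (simp add: N_def[abs_def])
 have ae: "AE y in lborel. integrable lborel (\<lambda>x. k (x, y))" using fub_snd(3)[OF k] .
 have aep: "AE p in lborel. \<bar>primx k p\<bar> \<le> N (snd p)"
 proof -
  have "{p. \<bar>primx k p\<bar> \<le> N (snd p)} \<in> sets borel"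
  proof -
   have "N \<in> borel_measurable borel" using N by auto
   then have "(\<lambda>p::real\<times>real. N (snd p)) \<in> borel_measurable borel"
    using borel_measurable_tens[of "\<lambda>_. 1" N] by (simp add: tens_def[abs_def])
   then show ?thesis by measurable
  qed
  moreover from ae have "AE y in lborel. AE x in lborel. \<bar>primx k (x, y)\<bar> \<le> N y"
   by eventually_elim (simp add: N_def primx_bound)
  ultimately have "AE p in lborel. \<bar>primx k (prod.swap p)\<bar> \<le> N (snd (prod.swap p))"
  proof (intro AE_from_sections)
   assume m: "{p. \<bar>primx k p\<bar> \<le> N (snd p)} \<in> sets borel"
   have "prod.swap \<in> borel \<rightarrow>\<^sub>M (borel :: (real\<times>real) measure)"
    by (intro borel_measurable_continuous_onI continuous_on_swap)
   from measurable_sets[OF this m] show "{p. \<bar>primx k (prod.swap p)\<bar> \<le> N (snd (prod.swap p))} \<in> sets borel"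
    by (simp add: vimage_def)
  qed simp
  from AE_swap[OF this] show ?thesis by simp
 qed
 have K: "integrable lborel K"
 proof (rule Bochner_Integration.integrable_bound)
  show "integrable lborel (tens (indicator {a<..<b}) N)"
   using N by (intro integrable_prod_real) (auto simp: emeasure_lborel_Ioo less_imp_le[OF ab])
  show "K \<in> borel_measurable lborel" unfolding K_def by measurable
  from aep show "AE p in lborel. norm (K p) \<le> norm (tens (indicator {a<..<b}) N p)"
   by eventually_elim (auto simp: K_def tens_def R_def indicator_def)
 qed
 have Ktest: "(LINT p|lborel. K p * tens (deriv f) g p) = - (LINT p|lborel. k p * tens f g p)"
  if f: "bump a b f" and g: "bump c d g" for f g
 proof -
  have e: "K (x, y) * tens (deriv f) g (x, y) = g y * (deriv f x * (LINT t|lborel. indicator {..<x} t * k (t, y)))" for x y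
   using bump_zero[OF bump_deriv[OF f], of x] bump_zero[OF g, of y]
   by (auto simp: K_def tens_def R_def primx_def indicator_def)
  have "(LINT p|lborel. K p * tens (deriv f) g p) = (LINT y|lborel. LINT x|lborel. K (x, y) * tens (deriv f) g (x, y))"
   using fub_snd(1)[OF integrable_mult_bumps[OF K bump_deriv[OF f] g]] by simp
  also have "\<dots> = (LINT y|lborel. g y * (LINT x|lborel. deriv f x * (LINT t|lborel. indicator {..<x} t * k (t, y))))"
   unfolding e by (simp only: integral_mult_right_zero)
  also have "\<dots> = (LINT y|lborel. g y * (- (LINT t|lborel. f t * k (t, y))))"
  proof (rule integral_cong_AE)
   have i: "integrable lborel (\<lambda>p. K p * tens (deriv f) g p)" by (rule integrable_mult_bumps[OF K bump_deriv[OF f] g])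
   from borel_measurable_integrable[OF fub_snd(2)[OF i]]
   show "(\<lambda>y. g y * (LINT x|lborel. deriv f x * (LINT t|lborel. indicator {..<x} t * k (t, y)))) \<in> borel_measurable lborel"
    unfolding e by (simp only: integral_mult_right_zero)
   have i2: "integrable lborel (\<lambda>p. k p * tens f g p)" by (rule integrable_mult_bumps[OF k f g])
   have e2: "k (t, y) * tens f g (t, y) = g y * (f t * k (t, y))" for t y by (simp add: tens_def)
   from borel_measurable_integrable[OF fub_snd(2)[OF i2]]
   have "(\<lambda>y. - (g y * (LINT t|lborel. f t * k (t, y)))) \<in> borel_measurable lborel"
    unfolding e2 by (intro borel_measurable_uminus) (simp only: integral_mult_right_zero)
   then show "(\<lambda>y. g y * (- (LINT t|lborel. f t * k (t, y)))) \<in> borel_measurable lborel" by simp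
   from ae show "AE y in lborel. g y * (LINT x|lborel. deriv f x * (LINT t|lborel. indicator {..<x} t * k (t, y)))
     = g y * (- (LINT t|lborel. f t * k (t, y)))"
   proof eventually_elim
    case (elim y)
    show ?case by (subst prim_test_1d[OF elim f]) simp
   qed
  qed
  also have "\<dots> = - (LINT y|lborel. LINT t|lborel. k (t, y) * tens f g (t, y))"
  proof -
   have e2: "k (t, y) * tens f g (t, y) = g y * (f t * k (t, y))" for t y by (simp add: tens_def)
   show ?thesis unfolding e2 by (simp only: integral_mult_right_zero mult_minus_right Bochner_Integration.integral_minus)
  qed
  also have "\<dots> = - (LINT p|lborel. k p * tens f g p)"
   using fub_snd(1)[OF integrable_mult_bumps[OF k f g]] by simp
  finally show ?thesis .
 qed
 obtain P where P: "integrable lborel P"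
  "AE p in lborel. p \<in> {a<..<b} \<times> {c<..<d} \<longrightarrow> z p - K p = P (snd p)"
 proof (rule indep_fst[of "\<lambda>p. z p - K p" a b c d])
  show "integrable lborel (\<lambda>p. z p - K p)" using z K by simp
  show "z p - K p = 0" if "p \<notin> {a<..<b} \<times> {c<..<d}" for p
   using z0[OF that] that by (simp add: K_def R_def)
  show "(LINT p|lborel. (z p - K p) * tens (deriv f) g p) = 0" if "bump a b f" "bump c d g" for f g
   using that test Ktest integrable_mult_bumps[OF z bump_deriv, of a b f c d g]
    integrable_mult_bumps[OF K bump_deriv, of a b f c d g] by (simp add: left_diff_distrib)
 qed (use ab in auto)
 show ?thesis
 proof (rule that[of P])
  show "P \<in> borel_measurable borel" using P(1) by auto
  from P(2) show "AE p in lborel. p \<in> {a<..<b} \<times> {c<..<d} \<longrightarrow> z p = P (snd p) + primx k p"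
   by eventually_elim (auto simp: K_def R_def)
 qed
qed

lemma AE_fst: assumes "AE x in lborel. Q x" shows "AE p in (lborel :: (real \<times> real) measure). Q (fst p)"
proof -
 obtain N where N: "{x. \<not> Q x} \<subseteq> N" "emeasure lborel N = 0" "N \<in> sets lborel"
  using AE_E[OF assms] by auto
 have "AE p in (lborel :: (real \<times> real) measure). fst p \<notin> N"
 proof (rule AE_from_sections)
  have "fst -` (- N) \<inter> space borel \<in> sets (borel :: (real \<times> real) measure)"
   using N(3) by (intro measurable_sets[of fst borel borel] borel_measurable_continuous_onI continuous_on_fst continuous_on_id) auto
  then show "{p :: real \<times> real. fst p \<notin> N} \<in> sets borel" by (simp add: vimage_def)
  have "N \<in> null_sets lborel" using N by auto
  then have "AE x in lborel. x \<notin> N" by (rule AE_not_in)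
  then show "AE x in lborel. AE y in lborel. fst (x, y :: real) \<notin> N"
   by eventually_elim simp
 qed
 then show ?thesis by eventually_elim (use N(1) in auto)
qed

lemma AE_snd: assumes "AE x in lborel. Q x" shows "AE p in (lborel :: (real \<times> real) measure). Q (snd p)"
 using AE_swap[OF AE_fst[OF assms]] by simp

lemma AE_lborel_witness:
 assumes "AE x in lborel. Q x" "a < (b::real)" obtains x where "a < x" "x < b" "Q x"
proof -
 have "\<not> (AE x in lborel. x \<notin> {a<..<b})"
 proof
  assume "AE x in lborel. x \<notin> {a<..<b}"
  then have "emeasure lborel {x \<in> space lborel. \<not> x \<notin> {a<..<b}} = 0"
   by (subst (asm) AE_iff_measurable[OF _ refl]) auto
  moreover have "{x \<in> space lborel. \<not> x \<notin> {a<..<b}} = {a<..<b}" by auto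
  ultimately show False using assms(2) by simp
 qed
 moreover have "AE x in lborel. x \<notin> {a<..<b}" if "\<And>x. a < x \<Longrightarrow> x < b \<Longrightarrow> \<not> Q x"
  using assms(1) by eventually_elim (use that in auto)
 ultimately show ?thesis using that by blast
qed

text \<open>Since \<open>z\<close> and \<open>k\<close> vanish for small \<open>x\<close>, the constant of integration of \<open>row_primitive\<close> is 0.
 A boundary value 0 enters in this way: \<open>z\<close> is extended by 0 across the edge and satisfies the
 weak equation with test functions that cross it.  The next three lemmas do the same at the
 other edges.\<close>

lemma row_from_left:
 fixes z k :: "real \<times> real \<Rightarrow> real"
 assumes z: "integrable lborel z" and k: "integrable lborel k" and ab: "a < b0" "b0 \<le> b"
  and z0: "\<And>p. p \<notin> {a<..<b} \<times> {c<..<d} \<Longrightarrow> z p = 0"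
  and k0: "\<And>p. p \<notin> {a<..<b} \<times> {c<..<d} \<Longrightarrow> k p = 0"
  and test: "\<And>f g. bump a b f \<Longrightarrow> bump c d g \<Longrightarrow>
   (LINT p|lborel. z p * tens (deriv f) g p) = - (LINT p|lborel. k p * tens f g p)"
  and left: "AE p in lborel. fst p < b0 \<longrightarrow> z p = 0 \<and> k p = 0"
 shows "AE p in lborel. p \<in> {a<..<b} \<times> {c<..<d} \<longrightarrow> z p = primx k p"
proof -
 have "a < b" using ab by simp
 then obtain P where P: "AE p in lborel. p \<in> {a<..<b} \<times> {c<..<d} \<longrightarrow> z p = P (snd p) + primx k p"
  by (rule row_primitive[OF z k _ z0 k0 test])
 from AE_sections_snd[OF P] AE_sections_snd[OF left]
 have "AE y in lborel. c < y \<and> y < d \<longrightarrow> P y = 0"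
 proof eventually_elim
  case (elim y)
  show ?case
  proof
   assume y: "c < y \<and> y < d"
   from elim have "AE x in lborel. (a < x \<and> x < b \<longrightarrow> z (x, y) = P y + primx k (x, y)) \<and> (x < b0 \<longrightarrow> z (x, y) = 0)"
    by eventually_elim (use y in auto)
   then obtain x where x: "a < x" "x < b0" "(a < x \<and> x < b \<longrightarrow> z (x, y) = P y + primx k (x, y)) \<and> (x < b0 \<longrightarrow> z (x, y) = 0)"
    by (rule AE_lborel_witness[OF _ ab(1)])
   have "primx k (x, y) = (LINT t::real|lborel. 0)"
    unfolding primx_def
   proof (rule integral_cong_AE)
    have "k \<in> borel_measurable borel" using k by auto
    then have "k \<in> borel_measurable (borel \<Otimes>\<^sub>M borel)" by (simp add: borel_prod)
    then show "(\<lambda>t. indicator {..<fst (x, y)} t * k (t, snd (x, y))) \<in> borel_measurable lborel" by simp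
    from elim(2) show "AE t in lborel. indicator {..<fst (x, y)} t * k (t, snd (x, y)) = 0"
     by eventually_elim (use x in \<open>auto simp: indicator_def\<close>)
   qed simp
   with x ab show "P y = 0" by auto
  qed
 qed
 from P AE_snd[OF this] show ?thesis by eventually_elim auto
qed

lemma row_from_right:
 fixes z k :: "real \<times> real \<Rightarrow> real"
 assumes z: "integrable lborel z" and k: "integrable lborel k" and ab: "a \<le> b0" "b0 < b"
  and z0: "\<And>p. p \<notin> {a<..<b} \<times> {c<..<d} \<Longrightarrow> z p = 0"
  and k0: "\<And>p. p \<notin> {a<..<b} \<times> {c<..<d} \<Longrightarrow> k p = 0"
  and test: "\<And>f g. bump a b f \<Longrightarrow> bump c d g \<Longrightarrow>
   (LINT p|lborel. z p * tens (deriv f) g p) = - (LINT p|lborel. k p * tens f g p)"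
  and right: "AE p in lborel. fst p > b0 \<longrightarrow> z p = 0 \<and> k p = 0"
 shows "AE p in lborel. p \<in> {a<..<b} \<times> {c<..<d} \<longrightarrow> z p = - (LINT t|lborel. indicator {fst p..} t * k (t, snd p))"
proof -
 have "a < b" using ab by simp
 then obtain P where P: "AE p in lborel. p \<in> {a<..<b} \<times> {c<..<d} \<longrightarrow> z p = P (snd p) + primx k p"
  by (rule row_primitive[OF z k _ z0 k0 test])
 have "k \<in> borel_measurable borel" using k by auto
 then have km: "k \<in> borel_measurable (borel \<Otimes>\<^sub>M borel)" by (simp add: borel_prod)
 from AE_sections_snd[OF P] AE_sections_snd[OF right]
 have "AE y in lborel. c < y \<and> y < d \<longrightarrow> P y = - (LINT t|lborel. k (t, y))"
 proof eventually_elim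
  case (elim y)
  show ?case
  proof
   assume y: "c < y \<and> y < d"
   from elim have "AE x in lborel. (a < x \<and> x < b \<longrightarrow> z (x, y) = P y + primx k (x, y)) \<and> (x > b0 \<longrightarrow> z (x, y) = 0)"
    by eventually_elim (use y in auto)
   then obtain x where x: "b0 < x" "x < b" "(a < x \<and> x < b \<longrightarrow> z (x, y) = P y + primx k (x, y)) \<and> (x > b0 \<longrightarrow> z (x, y) = 0)"
    by (rule AE_lborel_witness[OF _ ab(2)])
   have "primx k (x, y) = (LINT t|lborel. k (t, y))"
    unfolding primx_def
   proof (rule integral_cong_AE)
    show "(\<lambda>t. indicator {..<fst (x, y)} t * k (t, snd (x, y))) \<in> borel_measurable lborel"
     "(\<lambda>t. k (t, y)) \<in> borel_measurable lborel" using km by simp_all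
    from elim(2) show "AE t in lborel. indicator {..<fst (x, y)} t * k (t, snd (x, y)) = k (t, y)"
     by eventually_elim (use x in \<open>auto simp: indicator_def\<close>)
   qed
   with x ab show "P y = - (LINT t|lborel. k (t, y))" by auto
  qed
 qed
 from P AE_snd[OF this] AE_snd[OF fub_snd(3)[OF k]] show ?thesis
 proof eventually_elim
  case (elim p)
  show ?case
  proof
   assume p: "p \<in> {a<..<b} \<times> {c<..<d}"
   have i: "integrable lborel (\<lambda>t. indicator {..<fst p} t * k (t, snd p))"
    "integrable lborel (\<lambda>t. indicator {fst p..} t * k (t, snd p))"
    using elim(3) integrable_real_mult_indicator[of "{..<fst p}" lborel "\<lambda>t. k (t, snd p)"]
     integrable_real_mult_indicator[of "{fst p..}" lborel "\<lambda>t. k (t, snd p)"] by (simp_all add: mult.commute)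
   have "(LINT t|lborel. k (t, snd p)) = (LINT t|lborel. indicator {..<fst p} t * k (t, snd p) + indicator {fst p..} t * k (t, snd p))"
    by (intro Bochner_Integration.integral_cong) (auto simp: indicator_def)
   also have "\<dots> = primx k p + (LINT t|lborel. indicator {fst p..} t * k (t, snd p))"
    using i by (simp add: primx_def)
   finally show "z p = - (LINT t|lborel. indicator {fst p..} t * k (t, snd p))"
    using elim(1,2) p by (auto simp: mem_Times_iff)
  qed
 qed
qed

lemma column_from_bottom:
 fixes z k :: "real \<times> real \<Rightarrow> real"
 assumes z: "integrable lborel z" and k: "integrable lborel k" and cd: "c < d0" "d0 \<le> d"
  and z0: "\<And>p. p \<notin> {a<..<b} \<times> {c<..<d} \<Longrightarrow> z p = 0"
  and k0: "\<And>p. p \<notin> {a<..<b} \<times> {c<..<d} \<Longrightarrow> k p = 0"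
  and test: "\<And>f g. bump a b f \<Longrightarrow> bump c d g \<Longrightarrow>
   (LINT p|lborel. z p * tens f (deriv g) p) = - (LINT p|lborel. k p * tens f g p)"
  and bot: "AE p in lborel. snd p < d0 \<longrightarrow> z p = 0 \<and> k p = 0"
 shows "AE p in lborel. p \<in> {a<..<b} \<times> {c<..<d} \<longrightarrow> z p = primy k p"
proof -
 have t: "(LINT p|lborel. z (prod.swap p) * tens (deriv g) f p) = - (LINT p|lborel. k (prod.swap p) * tens g f p)"
  if g: "bump c d g" and f: "bump a b f" for f g
  using integrable_swap(2)[OF integrable_mult_bumps[OF z f bump_deriv[OF g]]]
   integrable_swap(2)[OF integrable_mult_bumps[OF k f g]] test[OF f g]
  by (simp add: tens_swap)
 have z0': "z (prod.swap p) = 0" "k (prod.swap p) = 0" if "p \<notin> {c<..<d} \<times> {a<..<b}" for p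
  using that z0[of "prod.swap p"] k0[of "prod.swap p"] by (cases p; auto)+
 have "AE p in lborel. p \<in> {c<..<d} \<times> {a<..<b} \<longrightarrow> z (prod.swap p) = primx (\<lambda>p. k (prod.swap p)) p"
  using AE_swap[OF bot]
  by (intro row_from_left[OF integrable_swap(1)[OF z] integrable_swap(1)[OF k] cd z0' t]) auto
 from AE_swap[OF this] show ?thesis by eventually_elim (auto simp: primx_swap)
qed

lemma column_from_top:
 fixes z k :: "real \<times> real \<Rightarrow> real"
 assumes z: "integrable lborel z" and k: "integrable lborel k" and cd: "c \<le> d0" "d0 < d"
  and z0: "\<And>p. p \<notin> {a<..<b} \<times> {c<..<d} \<Longrightarrow> z p = 0"
  and k0: "\<And>p. p \<notin> {a<..<b} \<times> {c<..<d} \<Longrightarrow> k p = 0"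
  and test: "\<And>f g. bump a b f \<Longrightarrow> bump c d g \<Longrightarrow>
   (LINT p|lborel. z p * tens f (deriv g) p) = - (LINT p|lborel. k p * tens f g p)"
  and top: "AE p in lborel. snd p > d0 \<longrightarrow> z p = 0 \<and> k p = 0"
 shows "AE p in lborel. p \<in> {a<..<b} \<times> {c<..<d} \<longrightarrow> z p = - (LINT t|lborel. indicator {snd p..} t * k (fst p, t))"
proof -
 have t: "(LINT p|lborel. z (prod.swap p) * tens (deriv g) f p) = - (LINT p|lborel. k (prod.swap p) * tens g f p)"
  if g: "bump c d g" and f: "bump a b f" for f g
  using integrable_swap(2)[OF integrable_mult_bumps[OF z f bump_deriv[OF g]]]
   integrable_swap(2)[OF integrable_mult_bumps[OF k f g]] test[OF f g]
  by (simp add: tens_swap)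
 have z0': "z (prod.swap p) = 0" "k (prod.swap p) = 0" if "p \<notin> {c<..<d} \<times> {a<..<b}" for p
  using that z0[of "prod.swap p"] k0[of "prod.swap p"] by (cases p; auto)+
 have "AE p in lborel. p \<in> {c<..<d} \<times> {a<..<b} \<longrightarrow>
   z (prod.swap p) = - (LINT t|lborel. indicator {fst p..} t * k (prod.swap (t, snd p)))"
  using AE_swap[OF top]
  by (intro row_from_right[OF integrable_swap(1)[OF z] integrable_swap(1)[OF k] cd z0' t]) auto
 from AE_swap[OF this] show ?thesis by eventually_elim auto
qed

section \<open>Ordinary differential equations on rows and columns\<close>

lemma gronwall_zero:
 fixes N :: "real \<Rightarrow> real"
 assumes cont: "continuous_on {a..b} N" and nn: "\<And>x. x \<in> {a..b} \<Longrightarrow> N x \<ge> 0"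
  and le: "\<And>x. x \<in> {a..b} \<Longrightarrow> N x \<le> K * integral {a..x} N" and K: "K \<ge> 0"
  and x: "x \<in> {a..b}"
 shows "N x = 0"
proof -
 define G where "G x = integral {a..x} N" for x
 have G: "(G has_real_derivative N t) (at t within {a..b})" if "t \<in> {a..b}" for t
  unfolding G_def using cont that by (intro integral_has_real_derivative)
 have der: "((\<lambda>t. exp (- K * t) * G t) has_real_derivative exp (- K * t) * (N t - K * G t)) (at t within {a..b})"
  if "t \<in> {a..b}" for t
  using G[OF that] by (auto intro!: derivative_eq_intros simp: algebra_simps)
 have "exp (- K * a) * G a \<ge> exp (- K * x) * G x"
 proof (rule DERIV_nonpos_imp_decreasing_open[where f = "\<lambda>t. exp (- K * t) * G t"])
  show "a \<le> x" using x by simp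
  show "\<exists>y. DERIV (\<lambda>t. exp (- K * t) * G t) t :> y \<and> y \<le> 0" if "a < t" "t < x" for t
  proof (intro exI conjI)
   show "DERIV (\<lambda>t. exp (- K * t) * G t) t :> exp (- K * t) * (N t - K * G t)"
    using der[of t] that x by (simp add: at_within_Icc_at)
   show "exp (- K * t) * (N t - K * G t) \<le> 0"
    using le[of t] that x by (intro mult_nonneg_nonpos) (auto simp: G_def)
  qed
  have "continuous_on {a..b} (\<lambda>t. exp (- K * t) * G t)"
   by (rule DERIV_continuous_on[OF der])
  then show "continuous_on {a..x} (\<lambda>t. exp (- K * t) * G t)"
   by (rule continuous_on_subset) (use x in auto)
 qed
 then have "G x \<le> 0" by (simp add: G_def mult_le_0_iff)
 then have "K * G x \<le> 0" using K by (simp add: mult_nonneg_nonpos)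
 then show ?thesis using le[OF x] nn[OF x] by (simp add: G_def)
qed

lemma lborel_integral_eq_integral:
 fixes \<kappa> :: "real \<Rightarrow> real"
 assumes "integrable lborel \<kappa>" "S \<in> sets borel"
 shows "(LINT t|lborel. indicator S t * \<kappa> t) = integral S \<kappa>" "\<kappa> integrable_on S"
proof -
 have "set_integrable lborel S \<kappa>"
  using assms integrable_real_mult_indicator[of S lborel \<kappa>] by (simp add: set_integrable_def mult.commute)
 from set_borel_integral_eq_integral[OF this]
 show "(LINT t|lborel. indicator S t * \<kappa> t) = integral S \<kappa>" "\<kappa> integrable_on S"
  by (simp_all add: set_lebesgue_integral_def)
qed

lemma prim_eq_integral:
 fixes \<kappa> :: "real \<Rightarrow> real"
 assumes \<kappa>: "integrable lborel \<kappa>" and z: "\<And>t. t \<le> a \<Longrightarrow> \<kappa> t = 0" and y: "a \<le> y"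
 shows "(LINT t|lborel. indicator {..<y} t * \<kappa> t) = integral {a..y} \<kappa>"
proof -
 have "AE t in lborel. t \<noteq> y" by (rule AE_lborel_singleton)
 then have "AE t in lborel. indicator {..<y} t * \<kappa> t = indicator {a..y} t * \<kappa> t"
  by eventually_elim (use z in \<open>auto simp: indicator_def not_le\<close>)
 then have "(LINT t|lborel. indicator {..<y} t * \<kappa> t) = (LINT t|lborel. indicator {a..y} t * \<kappa> t)"
  using \<kappa> by (intro integral_cong_AE) auto
 then show ?thesis using lborel_integral_eq_integral(1)[OF \<kappa>, of "{a..y}"] by simp
qed

lemma suffix_eq_integral:
 fixes \<kappa> :: "real \<Rightarrow> real"
 assumes \<kappa>: "integrable lborel \<kappa>" and z: "\<And>t. t \<ge> b \<Longrightarrow> \<kappa> t = 0"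
 shows "(LINT t|lborel. indicator {y..} t * \<kappa> t) = integral {y..b} \<kappa>"
proof -
 have "(LINT t|lborel. indicator {y..} t * \<kappa> t) = (LINT t|lborel. indicator {y..b} t * \<kappa> t)"
  using z by (intro Bochner_Integration.integral_cong) (auto simp: indicator_def)
 then show ?thesis using lborel_integral_eq_integral(1)[OF \<kappa>, of "{y..b}"] by simp
qed

lemma AE_integral_cong:
 fixes f g :: "real \<Rightarrow> real"
 assumes ae: "AE t in lborel. a < t \<and> t < b \<longrightarrow> f t = g t" and "a \<le> c" "d \<le> b"
 shows "integral {c..d} f = integral {c..d} g"
proof -
 obtain N where N: "{t. \<not> (a < t \<and> t < b \<longrightarrow> f t = g t)} \<subseteq> N" "emeasure lborel N = 0" "N \<in> sets lborel"
  using AE_E[OF ae] by auto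
 then have "N \<in> null_sets lborel" by auto
 then have "negligible N" by (simp add: negligible_iff_null_sets null_sets_completionI)
 then have n: "negligible (insert a (insert b N))" by simp
 have "g t = f t" if "t \<in> {c..d} - insert a (insert b N)" for t
 proof -
  have "a < t" "t < b" "t \<notin> N" using that assms(2,3) by auto
  with N(1) show ?thesis by auto
 qed
 from integral_spike[OF n this] show ?thesis .
qed

text \<open>Two integrations in the sense of Lebesgue produce a classical solution of the boundary
 value problem \<open>Y'' = H(Y)\<close>, \<open>Y'(0) = 0\<close>, \<open>Y(x) = 0\<close>.\<close>

lemma column_solution:
 fixes U W G :: "real \<Rightarrow> real"
 assumes x: "0 < x" and H: "continuous_on UNIV H"
  and W: "integrable lborel W" "\<And>t. t \<ge> x \<Longrightarrow> W t = 0"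
  and G: "integrable lborel G" "\<And>t. t \<le> 0 \<Longrightarrow> G t = 0"
  and UW: "AE y in lborel. 0 < y \<and> y < x \<longrightarrow> U y = - (LINT t|lborel. indicator {y..} t * W t)"
  and WG: "AE y in lborel. 0 < y \<and> y < x \<longrightarrow> W y = (LINT t|lborel. indicator {..<y} t * G t)"
  and GU: "AE y in lborel. 0 < y \<and> y < x \<longrightarrow> G y = H (U y)"
 obtains Y V where
  "\<And>y. y \<in> {0..x} \<Longrightarrow> (Y has_real_derivative V y) (at y within {0..x})"
  "\<And>y. y \<in> {0..x} \<Longrightarrow> (V has_real_derivative H (Y y)) (at y within {0..x})"
  "V 0 = 0" "Y x = 0" "AE y in lborel. 0 < y \<and> y < x \<longrightarrow> U y = Y y"
proof -
 define V where "V y = integral {0..y} G" for y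
 define Y where "Y y = integral {0..y} V - integral {0..x} V" for y
 have Gi: "G integrable_on {0..x}" using lborel_integral_eq_integral(2)[OF G(1)] by simp
 have Vc: "continuous_on {0..x} V" unfolding V_def by (rule indefinite_integral_continuous_1[OF Gi])
 then have Vi: "V integrable_on {c..d}" if "0 \<le> c" "d \<le> x" for c d
  using that by (intro integrable_continuous_real) (auto intro: continuous_on_subset)
 have YV: "(Y has_real_derivative V y) (at y within {0..x})" if "y \<in> {0..x}" for y
 proof -
  have "((\<lambda>y. integral {0..y} V) has_real_derivative V y) (at y within {0..x})"
   by (rule integral_has_real_derivative[OF Vc that])
  from DERIV_diff[OF this DERIV_const] show ?thesis unfolding Y_def[abs_def] by simp
 qed
 have WV: "AE y in lborel. 0 < y \<and> y < x \<longrightarrow> W y = V y"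
  using WG by eventually_elim (auto simp: V_def prim_eq_integral[OF G])
 have UY: "AE y in lborel. 0 < y \<and> y < x \<longrightarrow> U y = Y y"
  using UW
 proof eventually_elim
  case (elim y)
  show ?case
  proof
   assume y: "0 < y \<and> y < x"
   have "U y = - integral {y..x} W" using elim y suffix_eq_integral[of W x y, OF W] by simp
   also have "integral {y..x} W = integral {y..x} V" using y by (intro AE_integral_cong[OF WV]) auto
   finally have "U y = - integral {y..x} V" .
   moreover have "integral {0..y} V + integral {y..x} V = integral {0..x} V"
    using y Vi by (intro Henstock_Kurzweil_Integration.integral_combine) auto
   ultimately show "U y = Y y" by (simp add: Y_def)
  qed
 qed
 have Yc: "continuous_on {0..x} Y" by (rule DERIV_continuous_on[OF YV])
 have HYc: "continuous_on {0..x} (\<lambda>t. H (Y t))"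
  by (rule continuous_on_compose2[OF H Yc]) auto
 have VH: "V y = integral {0..y} (\<lambda>t. H (Y t))" if y: "y \<in> {0..x}" for y
 proof -
  from GU UY have ae: "AE t in lborel. 0 < t \<and> t < x \<longrightarrow> G t = H (Y t)" by eventually_elim auto
  then show ?thesis unfolding V_def using y by (intro AE_integral_cong) auto
 qed
 have VHd: "(V has_real_derivative H (Y y)) (at y within {0..x})" if "y \<in> {0..x}" for y
 proof -
  have "((\<lambda>y. integral {0..y} (\<lambda>t. H (Y t))) has_real_derivative H (Y y)) (at y within {0..x})"
   by (rule integral_has_real_derivative[OF HYc that])
  then show ?thesis
   by (rule has_field_derivative_transform_within[where d = 1]) (use that VH in auto)
 qed
 show ?thesis
  by (rule that[OF YV VHd _ _ UY]) (simp_all add: V_def Y_def)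
qed

definition cubic :: "real \<Rightarrow> real \<Rightarrow> real \<Rightarrow> real \<Rightarrow> real \<Rightarrow> real" where
 "cubic a0 a1 a2 a3 z = a0 + a1 * z + a2 * z\<^sup>2 + a3 * z ^ 3"

lemma cubic_coercive:
 assumes "a3 > 0" obtains K where "K \<ge> 0" "\<And>z. z * cubic a0 a1 a2 a3 z \<ge> - K"
proof -
 define S where "S = \<bar>a0\<bar> + \<bar>a1\<bar> + \<bar>a2\<bar>"
 define R where "R = 1 + S / a3"
 have S: "S \<ge> 0" by (simp add: S_def)
 then have R: "R \<ge> 1" "a3 * R \<ge> S" using assms by (auto simp: R_def field_simps)
 have low: "\<bar>a0 * z + a1 * z\<^sup>2 + a2 * z ^ 3\<bar> \<le> S * r ^ 3" if "\<bar>z\<bar> \<le> r" "r \<ge> 1" for z r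
 proof -
  have p: "r \<le> r ^ 3" "r ^ 2 \<le> r ^ 3" using that(2) by (auto intro: self_le_power power_increasing)
  have z: "\<bar>z\<bar> \<le> r ^ 3" "\<bar>z\<bar> ^ 2 \<le> r ^ 3" "\<bar>z\<bar> ^ 3 \<le> r ^ 3"
   using that p power_mono[OF that(1), of 2] power_mono[OF that(1), of 3] by auto
  have "\<bar>a0 * z + a1 * z\<^sup>2 + a2 * z ^ 3\<bar> \<le> \<bar>a0\<bar> * \<bar>z\<bar> + \<bar>a1\<bar> * \<bar>z\<bar> ^ 2 + \<bar>a2\<bar> * \<bar>z\<bar> ^ 3"
   by (intro order_trans[OF abs_triangle_ineq] add_mono) (auto simp: abs_mult power_abs)
  also have "\<dots> \<le> \<bar>a0\<bar> * r ^ 3 + \<bar>a1\<bar> * r ^ 3 + \<bar>a2\<bar> * r ^ 3"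
   using z by (intro add_mono mult_left_mono) auto
  finally show ?thesis by (simp add: S_def algebra_simps)
 qed
 have e: "z * cubic a0 a1 a2 a3 z = a3 * z ^ 4 + (a0 * z + a1 * z\<^sup>2 + a2 * z ^ 3)" for z
  by (simp add: cubic_def algebra_simps power2_eq_square power3_eq_cube power4_eq_xxxx)
 show thesis
 proof (rule that[of "S * R ^ 3"])
  show "S * R ^ 3 \<ge> 0" using S R by simp
  fix z
  show "z * cubic a0 a1 a2 a3 z \<ge> - (S * R ^ 3)"
  proof (cases "\<bar>z\<bar> \<le> R")
   case True
   have "a3 * z ^ 4 \<ge> 0" using assms by simp
   then show ?thesis using low[OF True R(1)] unfolding e by linarith
  next
   case False
   then have z: "\<bar>z\<bar> \<ge> 1" "\<bar>z\<bar> \<ge> R" using R by auto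
   have "S * \<bar>z\<bar> ^ 3 \<le> (a3 * \<bar>z\<bar>) * \<bar>z\<bar> ^ 3"
    using order_trans[OF R(2) mult_left_mono[OF z(2), of a3]] assms by (intro mult_right_mono) auto
   also have "\<dots> = a3 * z ^ 4" by (simp add: power_even_abs flip: power_Suc numeral_eq_Suc)
   finally have "a3 * z ^ 4 \<ge> S * \<bar>z\<bar> ^ 3" .
   moreover have "0 \<le> S * R ^ 3" using S R by simp
   ultimately show ?thesis using low[OF order_refl z(1)] unfolding e by linarith
  qed
 qed
qed

lemma abs_diff_le_of_deriv:
 fixes f :: "real \<Rightarrow> real"
 assumes "\<And>t. t \<in> {a..b} \<Longrightarrow> (f has_real_derivative f' t) (at t within {a..b})"
  and "\<And>t. t \<in> {a..b} \<Longrightarrow> \<bar>f' t\<bar> \<le> B" "s \<in> {a..b}" "t \<in> {a..b}"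
 shows "\<bar>f s - f t\<bar> \<le> B * \<bar>s - t\<bar>"
 using field_differentiable_bound[of "{a..b}" f f' B s t] assms by auto

definition column_bvp :: "(real \<Rightarrow> real) \<Rightarrow> real \<Rightarrow> (real \<Rightarrow> real) \<Rightarrow> bool" where
 "column_bvp H x Y \<longleftrightarrow> (\<exists>V. (\<forall>y\<in>{0..x}. (Y has_real_derivative V y) (at y within {0..x})) \<and>
   (\<forall>y\<in>{0..x}. (V has_real_derivative H (Y y)) (at y within {0..x})) \<and> V 0 = 0 \<and> Y x = 0)"

text \<open>Testing the equation with the solution bounds \<open>\<integral> Y'\<^sup>2\<close> on short intervals because \<open>z H(z)\<close> is
 bounded below; the equation then gives the expansion of \<open>Y\<close> in powers of \<open>x\<close>.\<close>

lemma column_bounds: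
 assumes a3: "a3 > 0"
 obtains M L where "M \<ge> 0" "L \<ge> 0"
  "\<And>x Y y. 0 < x \<Longrightarrow> x \<le> 1 \<Longrightarrow> column_bvp (cubic a0 a1 a2 a3) x Y \<Longrightarrow> y \<in> {0..x} \<Longrightarrow>
   \<bar>Y y\<bar> \<le> M * x\<^sup>2 \<and> \<bar>Y y - a0 / 2 * (y\<^sup>2 - x\<^sup>2)\<bar> \<le> M * x ^ 4"
  "\<And>x Y y. 0 < x \<Longrightarrow> x \<le> 1 \<Longrightarrow> column_bvp (cubic a0 a1 a2 a3) x Y \<Longrightarrow> y \<in> {0..x} \<Longrightarrow>
   a0 = 0 \<Longrightarrow> L * x\<^sup>2 < 1 \<Longrightarrow> Y y = 0"
proof -
 obtain K where K: "K \<ge> 0" "\<And>z. z * cubic a0 a1 a2 a3 z \<ge> - K" using cubic_coercive[OF a3] by metis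
 define H where "H = cubic a0 a1 a2 a3"
 define M1 where "M1 = (1 + K) / 2"
 define L where "L = \<bar>a1\<bar> + \<bar>a2\<bar> * M1 + \<bar>a3\<bar> * M1\<^sup>2"
 define M2 where "M2 = \<bar>a0\<bar> + L * M1"
 have M1: "M1 \<ge> 0" using K by (simp add: M1_def)
 have L: "L \<ge> 0" using M1 by (simp add: L_def)
 have M2: "M2 \<ge> 0" using L M1 by (simp add: M2_def)
 have HL: "\<bar>H z - a0\<bar> \<le> L * \<bar>z\<bar>" if "\<bar>z\<bar> \<le> M1" for z
 proof -
  have "H z - a0 = z * (a1 + a2 * z + a3 * z\<^sup>2)"
   by (simp add: H_def cubic_def algebra_simps power2_eq_square power3_eq_cube)
  moreover have "\<bar>a1 + a2 * z + a3 * z\<^sup>2\<bar> \<le> L"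
  proof -
   have "\<bar>a1 + a2 * z + a3 * z\<^sup>2\<bar> \<le> \<bar>a1\<bar> + \<bar>a2\<bar> * \<bar>z\<bar> + \<bar>a3\<bar> * \<bar>z\<bar>\<^sup>2"
    by (intro order_trans[OF abs_triangle_ineq] add_mono) (auto simp: abs_mult)
   also have "\<dots> \<le> L" unfolding L_def using that power_mono[OF that, of 2]
    by (intro add_mono mult_left_mono) auto
   finally show ?thesis .
  qed
  ultimately show ?thesis
   using mult_left_mono[of "\<bar>a1 + a2 * z + a3 * z\<^sup>2\<bar>" L "\<bar>z\<bar>"] by (simp add: abs_mult mult.commute)
 qed
 have main: "\<bar>Y y\<bar> \<le> M1 \<and> \<bar>Y y\<bar> \<le> M2 * x\<^sup>2 \<and> \<bar>Y y - a0 / 2 * (y\<^sup>2 - x\<^sup>2)\<bar> \<le> L * M2 * x ^ 4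
   \<and> (a0 = 0 \<longrightarrow> L * x\<^sup>2 < 1 \<longrightarrow> Y y = 0)"
  if x: "0 < x" "x \<le> 1" and bvp: "column_bvp H x Y" and y: "y \<in> {0..x}" for x Y y
 proof -
  obtain V where dY: "\<And>y. y \<in> {0..x} \<Longrightarrow> (Y has_real_derivative V y) (at y within {0..x})"
   and dV: "\<And>y. y \<in> {0..x} \<Longrightarrow> (V has_real_derivative H (Y y)) (at y within {0..x})"
   and V0: "V 0 = 0" and Yx: "Y x = 0" using bvp unfolding column_bvp_def by metis
  have cY: "continuous_on {0..x} Y" by (rule DERIV_continuous_on[OF dY])
  have cV: "continuous_on {0..x} V" by (rule DERIV_continuous_on[OF dV])
  have "((\<lambda>t. V t * V t + Y t * H (Y t)) has_integral (Y x * V x - Y 0 * V 0)) {0..x}"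
  proof (rule fundamental_theorem_of_calculus)
   fix t assume "t \<in> {0..x}"
   then have "((\<lambda>t. Y t * V t) has_real_derivative V t * V t + Y t * H (Y t)) (at t within {0..x})"
    using dY dV by (auto intro!: derivative_eq_intros)
   then show "((\<lambda>t. Y t * V t) has_vector_derivative V t * V t + Y t * H (Y t)) (at t within {0..x})"
    by (simp add: has_real_derivative_iff_has_vector_derivative)
  qed (use x in simp)
  then have "((\<lambda>t. V t * V t + Y t * H (Y t) + (1 + K)) has_integral 0 + (1 + K) * x) {0..x}"
   using x V0 Yx has_integral_const_real[of "1 + K" 0 x] by (intro has_integral_add) (auto simp: mult.commute)
  then have i1: "((\<lambda>t. (V t * V t + Y t * H (Y t) + (1 + K)) / 2) has_integral M1 * x) {0..x}"
   using has_integral_divide[of "\<lambda>t. V t * V t + Y t * H (Y t) + (1 + K)" "0 + (1 + K) * x" "{0..x}" 2]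
   by (simp add: M1_def)
  have Vle: "\<bar>V t\<bar> \<le> (V t * V t + Y t * H (Y t) + (1 + K)) / 2" for t
  proof -
   have "2 * \<bar>V t\<bar> \<le> V t * V t + 1" using zero_le_power2[of "\<bar>V t\<bar> - 1"] by (simp add: power2_eq_square algebra_simps flip: abs_mult)
   moreover have "Y t * H (Y t) \<ge> - K" using K(2) by (simp add: H_def)
   ultimately show ?thesis by simp
  qed
  have Ybd: "\<bar>Y t\<bar> \<le> M1 * x" if t: "t \<in> {0..x}" for t
  proof -
   have "(V has_integral (Y x - Y t)) {t..x}"
   proof (rule fundamental_theorem_of_calculus)
    fix r assume "r \<in> {t..x}"
    then have "(Y has_real_derivative V r) (at r within {t..x})" using t
     by (intro DERIV_subset[OF dY]) auto
    then show "(Y has_vector_derivative V r) (at r within {t..x})"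
     by (simp add: has_real_derivative_iff_has_vector_derivative)
   qed (use t in simp)
   then have "\<bar>Y t\<bar> = \<bar>integral {t..x} V\<bar>" using Yx by (simp add: integral_unique)
   also have "\<dots> \<le> integral {t..x} (\<lambda>r. \<bar>V r\<bar>)"
   proof -
    have "continuous_on {t..x} V" using cV t by (auto intro: continuous_on_subset)
    then have "norm (integral {t..x} V) \<le> integral {t..x} (\<lambda>r. \<bar>V r\<bar>)"
     by (intro integral_norm_bound_integral integrable_continuous_real continuous_intros) auto
    then show ?thesis by simp
   qed
   also have "\<dots> \<le> integral {0..x} (\<lambda>r. \<bar>V r\<bar>)"
    using cV t by (intro integral_subset_le integrable_continuous_real continuous_intros)
     (auto intro: continuous_on_subset)
   also have "\<dots> \<le> integral {0..x} (\<lambda>t. (V t * V t + Y t * H (Y t) + (1 + K)) / 2)"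
    using cV by (intro integral_le[OF _ has_integral_integrable[OF i1] Vle] integrable_continuous_real continuous_intros)
   also have "\<dots> = M1 * x" by (rule integral_unique[OF i1])
   finally show ?thesis .
  qed
  have Y1: "\<bar>Y t\<bar> \<le> M1" if "t \<in> {0..x}" for t
   using Ybd[OF that] mult_left_mono[OF x(2) M1] by simp
  \<comment> \<open>A bound for the right-hand side gives bounds for the solution after two integrations.\<close>
  have twice: "\<bar>Z t\<bar> \<le> B * x\<^sup>2" if B: "\<And>t. t \<in> {0..x} \<Longrightarrow> \<bar>E t\<bar> \<le> B"
   and Z: "\<And>t. t \<in> {0..x} \<Longrightarrow> (Z has_real_derivative W t) (at t within {0..x})"
   and W: "\<And>t. t \<in> {0..x} \<Longrightarrow> (W has_real_derivative E t) (at t within {0..x})"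
   and W0: "W 0 = 0" and Zx: "Z x = 0" and t: "t \<in> {0..x}" for E Z W B t
  proof -
   have B0: "B \<ge> 0" using B[OF t] by simp
   have Wb: "\<bar>W r\<bar> \<le> B * x" if "r \<in> {0..x}" for r
   proof -
    have "\<bar>W r - W 0\<bar> \<le> B * \<bar>r - 0\<bar>"
     using x that by (intro abs_diff_le_of_deriv[OF W B]) auto
    also have "\<dots> \<le> B * x" using that B0 by (intro mult_left_mono) auto
    finally show ?thesis using W0 by simp
   qed
   have "\<bar>Z t - Z x\<bar> \<le> (B * x) * \<bar>t - x\<bar>"
    using x t by (intro abs_diff_le_of_deriv[OF Z Wb]) auto
   also have "\<dots> \<le> (B * x) * x" using t B0 x by (intro mult_left_mono) auto
   finally show ?thesis using Zx by (simp add: power2_eq_square mult.assoc)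
  qed
  have H2: "\<bar>H (Y t)\<bar> \<le> M2" if "t \<in> {0..x}" for t
  proof -
   have "L * \<bar>Y t\<bar> \<le> L * M1" using Y1[OF that] L by (intro mult_left_mono) auto
   then show ?thesis using HL[OF Y1[OF that]] by (simp add: M2_def)
  qed
  have Y2: "\<bar>Y t\<bar> \<le> M2 * x\<^sup>2" if "t \<in> {0..x}" for t
   by (rule twice[OF H2 dY dV V0 Yx that])
  have Y3: "\<bar>Y t - a0 / 2 * (t\<^sup>2 - x\<^sup>2)\<bar> \<le> (L * M2 * x\<^sup>2) * x\<^sup>2" if t: "t \<in> {0..x}" for t
  proof (rule twice[where Z = "\<lambda>t. Y t - a0 / 2 * (t\<^sup>2 - x\<^sup>2)" and W = "\<lambda>t. V t - a0 * t" and E = "\<lambda>t. H (Y t) - a0"])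
   show "\<bar>H (Y t) - a0\<bar> \<le> L * M2 * x\<^sup>2" if "t \<in> {0..x}" for t
    using HL[OF Y1[OF that]] mult_left_mono[OF Y2[OF that] L] by simp
   show "((\<lambda>t. Y t - a0 / 2 * (t\<^sup>2 - x\<^sup>2)) has_real_derivative V t - a0 * t) (at t within {0..x})"
    if "t \<in> {0..x}" for t using dY[OF that] by (auto intro!: derivative_eq_intros)
   show "((\<lambda>t. V t - a0 * t) has_real_derivative H (Y t) - a0) (at t within {0..x})"
    if "t \<in> {0..x}" for t using dV[OF that] by (auto intro!: derivative_eq_intros)
  qed (use V0 Yx t in auto)
  have Y4: "Y y = 0" if a0: "a0 = 0" and small: "L * x\<^sup>2 < 1"
  proof -
   have "continuous_on {0..x} (\<lambda>t. \<bar>Y t\<bar>)" using cY by (intro continuous_intros)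
   then obtain t0 where t0: "t0 \<in> {0..x}" "\<And>t. t \<in> {0..x} \<Longrightarrow> \<bar>Y t\<bar> \<le> \<bar>Y t0\<bar>"
    using continuous_attains_sup[of "{0..x}" "\<lambda>t. \<bar>Y t\<bar>"] x by force
   have "\<bar>H (Y t)\<bar> \<le> L * \<bar>Y t0\<bar>" if "t \<in> {0..x}" for t
    using HL[OF Y1[OF that]] a0 mult_left_mono[OF t0(2)[OF that] L] by simp
   from twice[OF this dY dV V0 Yx t0(1)] have "\<bar>Y t0\<bar> * (1 - L * x\<^sup>2) \<le> 0"
    by (simp add: algebra_simps)
   then have "\<bar>Y t0\<bar> \<le> 0" using small by (simp add: mult_le_0_iff)
   then show ?thesis using t0(2)[OF y] by simp
  qed
  show ?thesis using Y1[OF y] Y2[OF y] Y3[OF y] Y4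
   by (auto simp: algebra_simps power2_eq_square power4_eq_xxxx)
 qed
 define M where "M = max M2 (L * M2)"
 show ?thesis
 proof (rule that[of M L])
  show "M \<ge> 0" using M2 by (simp add: M_def)
  show "L \<ge> 0" by (rule L)
  fix x Y y assume x: "0 < x" "x \<le> 1" "column_bvp (cubic a0 a1 a2 a3) x Y" "y \<in> {0..x}"
  have "M2 * x\<^sup>2 \<le> M * x\<^sup>2" "L * M2 * x ^ 4 \<le> M * x ^ 4"
   using x by (auto intro!: mult_right_mono simp: M_def)
  with main[OF x(1,2) x(3)[folded H_def] x(4)]
  show "\<bar>Y y\<bar> \<le> M * x\<^sup>2 \<and> \<bar>Y y - a0 / 2 * (y\<^sup>2 - x\<^sup>2)\<bar> \<le> M * x ^ 4" by linarith
  show "Y y = 0" if "a0 = 0" "L * x\<^sup>2 < 1"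
   using main[OF x(1,2) x(3)[folded H_def] x(4)] that by blast
 qed
qed

section \<open>The domain\<close>

lemma Omega_q_open: "open (Omega_q \<epsilon>)"
proof -
 have "Omega_q \<epsilon> = {p. \<bar>fst p\<bar> < 1} \<inter> {p. \<bar>snd p\<bar> < 1} \<inter> {p. \<bar>fst p + snd p\<bar> < 2 - \<epsilon>} \<inter> {p. \<bar>fst p - snd p\<bar> < 2 - \<epsilon>}
   \<inter> {p. 0 < snd p} \<inter> {p. snd p < fst p} \<inter> {p. 0 < fst p} \<inter> {p. fst p < 1}"
  by (auto simp: Omega_q_def Omega_def)
 moreover have "open \<dots>" by (intro open_Int open_Collect_less continuous_intros)
 ultimately show ?thesis by metis
qed

lemma Omega_open: "open (Omega \<epsilon>)"
proof -
 have "Omega \<epsilon> = {p. \<bar>fst p\<bar> < 1} \<inter> {p. \<bar>snd p\<bar> < 1} \<inter> {p. \<bar>fst p + snd p\<bar> < 2 - \<epsilon>} \<inter> {p. \<bar>fst p - snd p\<bar> < 2 - \<epsilon>}"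
  by (auto simp: Omega_def)
 moreover have "open \<dots>" by (intro open_Int open_Collect_less continuous_intros)
 ultimately show ?thesis by metis
qed

lemma mem_Omega_q:
 assumes "0 < \<epsilon>" "\<epsilon> < 1"
 shows "(x, y) \<in> Omega_q \<epsilon> \<longleftrightarrow> 0 < y \<and> y < x \<and> x < 1 \<and> x + y < 2 - \<epsilon>"
 using assms by (auto simp: Omega_q_def Omega_def abs_if)

lemma Omega_q_bounded: "bounded (Omega_q \<epsilon>)"
 by (rule bounded_subset[of "cbox (0, 0) (1, 1)"]) (auto simp: Omega_q_def bounded_cbox)

lemma Omega_q_sub_Omega: "Omega_q \<epsilon> \<subseteq> Omega \<epsilon>" by (auto simp: Omega_q_def)

lemma Omega_q_borel [measurable]: "Omega_q \<epsilon> \<in> sets borel" using Omega_q_open by simp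

text \<open>The closed polygon is the closure of the open one because it is star-shaped about an interior
 point.\<close>

lemma closure_Omega_q:
 assumes e: "0 < \<epsilon>" "\<epsilon> < 1" and p: "0 \<le> y" "y \<le> x" "x \<le> 1" "x + y \<le> 2 - \<epsilon>"
 shows "(x, y) \<in> closure (Omega_q \<epsilon>)"
proof -
 \<comment> \<open>The segment from an interior point to \<open>(x, y)\<close>.\<close>
 define c where "c = ((1 :: real) / 2, (1 :: real) / 4)"
 have "(\<lambda>n. (x, y) + inverse (real (Suc n)) *\<^sub>R (c - (x, y))) \<longlonglongrightarrow> (x, y) + 0 *\<^sub>R (c - (x, y))"
  by (intro tendsto_intros LIMSEQ_inverse_real_of_nat)
 moreover have "(x, y) + inverse (real (Suc n)) *\<^sub>R (c - (x, y)) \<in> Omega_q \<epsilon>" for n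
 proof -
  define t where "t = inverse (real (Suc n))"
  have t: "0 < t" "t \<le> 1" by (auto simp: t_def inverse_eq_divide)
  have lt: "(1 - t) * a + t * b < d" if "a \<le> d" "b < d" for a b d
  proof -
   have "(1 - t) * a \<le> (1 - t) * d" "t * b < t * d" using that t by (auto intro: mult_left_mono)
   then show ?thesis by (simp add: algebra_simps)
  qed
  have gt: "d < (1 - t) * a + t * b" if "d \<le> a" "d < b" for a b d
  proof -
   have "(1 - t) * d \<le> (1 - t) * a" "t * d < t * b" using that t by (auto intro: mult_left_mono)
   then show ?thesis by (simp add: algebra_simps)
  qed
  have "(x, y) + t *\<^sub>R (c - (x, y)) = ((1 - t) * x + t * (1 / 2), (1 - t) * y + t * (1 / 4))"
   by (simp add: c_def algebra_simps)
  moreover have "0 < (1 - t) * y + t * (1 / 4)" using gt[of 0 y "1/4"] p by simp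
  moreover have "0 < (1 - t) * (x - y) + t * (1 / 4)" using gt[of 0 "x - y" "1/4"] p by simp
  moreover have "(1 - t) * x + t * (1 / 2) < 1" using lt[of x 1 "1/2"] p by simp
  moreover have "(1 - t) * (x + y) + t * (3 / 4) < 2 - \<epsilon>" using lt[of "x + y" "2 - \<epsilon>" "3/4"] p e by simp
  ultimately show ?thesis unfolding t_def[symmetric] mem_Omega_q[OF e]
   by (simp add: mem_Omega_q[OF e] algebra_simps)
 qed
 ultimately show ?thesis unfolding closure_sequential by (intro exI[of _ "\<lambda>n. (x, y) + inverse (real (Suc n)) *\<^sub>R (c - (x, y))"]) simp
qed

lemma frontier_outer:
 assumes e: "0 < \<epsilon>" "\<epsilon> < 1" and p: "0 \<le> y" "y \<le> x" "x \<le> 1" "x + y \<le> 2 - \<epsilon>" and b: "x = 1 \<or> x + y = 2 - \<epsilon>"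
 shows "(x, y) \<in> frontier (Omega_q \<epsilon>) \<inter> frontier (Omega \<epsilon>)"
proof -
 have "(x, y) \<notin> Omega \<epsilon>" using b by (auto simp: Omega_def)
 moreover have "(x, y) \<in> closure (Omega_q \<epsilon>)" by (rule closure_Omega_q[OF e p])
 moreover have "closure (Omega_q \<epsilon>) \<subseteq> closure (Omega \<epsilon>)" by (rule closure_mono[OF Omega_q_sub_Omega])
 ultimately show ?thesis using Omega_open[of \<epsilon>] Omega_q_open[of \<epsilon>] Omega_q_sub_Omega[of \<epsilon>]
  by (auto simp: frontier_def interior_open)
qed

lemma frontier_diag:
 assumes e: "0 < \<epsilon>" "\<epsilon> < 1" and p: "0 \<le> x" "x \<le> 1 - \<epsilon>"
 shows "(x, x) \<in> frontier (Omega_q \<epsilon>) \<inter> {(x, y). y = x}"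
 using closure_Omega_q[OF e, of x x] p e Omega_q_open
 by (auto simp: frontier_def interior_open Omega_q_def)

lemma closure_Omega_q_D:
 assumes "(x, y) \<in> closure (Omega_q \<epsilon>)" "0 < \<epsilon>" "\<epsilon> < 1"
 shows "0 \<le> y \<and> y \<le> x \<and> x \<le> 1 \<and> x + y \<le> 2 - \<epsilon>"
proof -
 define S where "S = {p :: real \<times> real. 0 \<le> snd p} \<inter> {p. snd p \<le> fst p} \<inter> {p. fst p \<le> 1} \<inter> {p. fst p + snd p \<le> 2 - \<epsilon>}"
 have "closed S" unfolding S_def by (intro closed_Int closed_Collect_le continuous_intros)
 moreover have "Omega_q \<epsilon> \<subseteq> S" using mem_Omega_q[OF assms(2,3)] by (auto simp: S_def)
 ultimately have "closure (Omega_q \<epsilon>) \<subseteq> S" by (simp add: closure_minimal)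
 then show ?thesis using assms(1) by (auto simp: S_def)
qed

lemma frontier_outer_D:
 assumes "(x, y) \<in> frontier (Omega_q \<epsilon>) \<inter> frontier (Omega \<epsilon>)" "0 < \<epsilon>" "\<epsilon> < 1"
 shows "0 \<le> y \<and> y \<le> x \<and> x \<le> 1 \<and> (x = 1 \<or> x + y = 2 - \<epsilon>)"
proof -
 have c: "0 \<le> y \<and> y \<le> x \<and> x \<le> 1 \<and> x + y \<le> 2 - \<epsilon>"
  using assms by (intro closure_Omega_q_D) (auto simp: frontier_def)
 have "(x, y) \<notin> Omega \<epsilon>" using assms Omega_open by (auto simp: frontier_def interior_open)
 with c assms(2,3) show ?thesis by (auto simp: Omega_def abs_if split: if_splits)
qed

lemma rational_between: "(a::real) < b \<Longrightarrow> \<exists>q::rat. a < of_rat q \<and> of_rat q < b"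
 using of_rat_dense by blast

section \<open>The Euler-Lagrange system of a critical point with vanishing second component\<close>

text \<open>With products as test functions every integration below separates into rows and columns.\<close>

definition tst :: "(real \<times> real \<Rightarrow> real) \<Rightarrow> (real \<Rightarrow> real) \<Rightarrow> (real \<Rightarrow> real) \<Rightarrow> real" where
 "tst w f g = (LINT p|lborel. w p * tens f g p)"

text \<open>\<open>Phi1\<close> and \<open>Phi3\<close> are the partial derivatives of \<open>f_b A B C u 0 v\<close> with respect to \<open>u\<close> and \<open>v\<close>.\<close>

definition Phi1 :: "real \<Rightarrow> real \<Rightarrow> real \<Rightarrow> real \<Rightarrow> real \<Rightarrow> real" where
 "Phi1 A B C u v = 2 * A * u + 4 * C * (u\<^sup>2 + 3 * v\<^sup>2) * u + 4 * B * v * u"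

definition Phi3 :: "real \<Rightarrow> real \<Rightarrow> real \<Rightarrow> real \<Rightarrow> real \<Rightarrow> real" where
 "Phi3 A B C u v = 6 * A * v + 12 * C * (u\<^sup>2 + 3 * v\<^sup>2) * v + 2 * B * (u\<^sup>2 - 3 * v\<^sup>2)"

lemma monomial_bound: "i + j \<le> 4 \<Longrightarrow> \<bar>a ^ i * b ^ j\<bar> \<le> 1 + a ^ 4 + (b::real) ^ 4"
proof -
 assume ij: "i + j \<le> (4::nat)"
 define m where "m = max 1 (max \<bar>a\<bar> \<bar>b\<bar>)"
 have m: "m \<ge> 1" "\<bar>a\<bar> \<le> m" "\<bar>b\<bar> \<le> m" by (auto simp: m_def)
 have "\<bar>a ^ i * b ^ j\<bar> = \<bar>a\<bar> ^ i * \<bar>b\<bar> ^ j" by (simp add: abs_mult power_abs)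
 also have "\<dots> \<le> m ^ i * m ^ j" using m by (intro mult_mono power_mono) auto
 also have "\<dots> \<le> m ^ 4" using m ij by (simp add: power_add[symmetric] power_increasing)
 also have "m ^ 4 \<le> 1 + a ^ 4 + b ^ 4"
  unfolding m_def max_def by (auto simp: power_even_abs)
 finally show ?thesis .
qed

lemma tst_cong_AE:
 assumes "AE p in lborel. tens f g p \<noteq> 0 \<longrightarrow> w p = w' p" "integrable lborel w" "integrable lborel w'"
  "bump a b f" "bump c d g"
 shows "tst w f g = tst w' f g"
 unfolding tst_def
proof (rule integral_cong_AE)
 show "(\<lambda>p. w p * tens f g p) \<in> borel_measurable lborel" "(\<lambda>p. w' p * tens f g p) \<in> borel_measurable lborel"
  using borel_measurable_integrable[OF integrable_mult_bumps] assms by blast+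
 show "AE p in lborel. w p * tens f g p = w' p * tens f g p"
  using assms(1) by eventually_elim auto
qed

lemma tst_zero: "tst (\<lambda>_. 0) f g = 0" by (simp add: tst_def)

lemma tens_nz:
 assumes "tens f g p \<noteq> 0" "bump a b f" "bump c d g" shows "p \<in> {a<..<b} \<times> {c<..<d}"
 using assms bump_zero[of a b f "fst p"] bump_zero[of c d g "snd p"]
 by (cases p) (auto simp: tens_def)

lemma tst_add: assumes "integrable lborel w" "integrable lborel w'" "bump a b f" "bump c d g"
 shows "tst (\<lambda>p. x * w p + y * w' p) f g = x * tst w f g + y * tst w' f g"
proof -
 have "integrable lborel (\<lambda>p. w p * tens f g p)" "integrable lborel (\<lambda>p. w' p * tens f g p)"
  using integrable_mult_bumps assms by blast+
 then show ?thesis by (simp add: tst_def distrib_right mult.assoc)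
qed

text \<open>The situation to be refuted: \<open>u\<close>, \<open>v\<close> are the first and third component of a minimizer with
 vanishing second component, extended by 0, and \<open>ux, uy, vx, vy\<close> are their weak derivatives.
 Boundary conditions are encoded in the supports of the test functions.  In \<open>EL1\<close> and \<open>EL3\<close> they
 may cross \<open>y = 0\<close>, which is the natural condition there.  The variations of the second
 component in \<open>EL2b\<close> may cross the diagonal.  In \<open>right_u\<close> and \<open>right_v\<close> the test functions cross
 \<open>x = 1\<close>, which expresses \<open>u = - s / 2\<close> and \<open>v = - s / 6\<close> on this edge, and in \<open>diag_u\<close> they cross
 the diagonal, where \<open>u = 0\<close>.\<close>

locale reduced_system =
 fixes \<epsilon> L2 k A B C s :: real and u ux uy v vx vy :: "real \<times> real \<Rightarrow> real"
 assumes eps: "0 < \<epsilon>" "\<epsilon> < 1" and A: "A < 0" and C: "C > 0" and k: "k > 0"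
  and L2: "L2 > - 1" "L2 \<noteq> 0" and s: "s \<noteq> 0"
  and meas [measurable]: "u \<in> borel_measurable borel" "v \<in> borel_measurable borel"
  and int: "integrable lborel ux" "integrable lborel uy" "integrable lborel vx" "integrable lborel vy"
  and int4: "integrable lborel (\<lambda>p. u p ^ 4)" "integrable lborel (\<lambda>p. v p ^ 4)"
  and supp: "\<And>p. p \<notin> Omega_q \<epsilon> \<Longrightarrow> u p = 0 \<and> v p = 0 \<and> ux p = 0 \<and> uy p = 0 \<and> vx p = 0 \<and> vy p = 0"
  and EL1: "\<And>b f g. 0 < b \<Longrightarrow> b \<le> 1 - \<epsilon> \<Longrightarrow> bump b 1 f \<Longrightarrow> bump (- 1) b g \<Longrightarrow>
   (2 + L2) * (tst ux (deriv f) g + tst uy f (deriv g)) + L2 * (tst vy f (deriv g) - tst vx (deriv f) g)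
   + k * tst (\<lambda>p. Phi1 A B C (u p) (v p)) f g = 0"
  and EL3: "\<And>b f g. 0 < b \<Longrightarrow> b \<le> 1 - \<epsilon> \<Longrightarrow> bump b 1 f \<Longrightarrow> bump (- 1) b g \<Longrightarrow>
   (6 + L2) * (tst vx (deriv f) g + tst vy f (deriv g)) + L2 * (tst uy f (deriv g) - tst ux (deriv f) g)
   + k * tst (\<lambda>p. Phi3 A B C (u p) (v p)) f g = 0"
  and EL2a: "\<And>b f g. 0 < b \<Longrightarrow> b \<le> 1 - \<epsilon> \<Longrightarrow> bump b 1 f \<Longrightarrow> bump 0 b g \<Longrightarrow>
   - L2 * (tst vx f (deriv g) + tst vy (deriv f) g) + \<bar>L2\<bar> * (tst ux f (deriv g) - tst uy (deriv f) g) = 0"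
  and EL2b: "\<And>f g. bump 0 (1 - \<epsilon>) f \<Longrightarrow> bump 0 1 g \<Longrightarrow>
   - L2 * (tst vx f (deriv g) + tst vy (deriv f) g) + \<bar>L2\<bar> * (tst ux f (deriv g) - tst uy (deriv f) g) = 0"
  and weak: "\<And>b f g. 0 < b \<Longrightarrow> b \<le> 1 - \<epsilon> \<Longrightarrow> bump b 1 f \<Longrightarrow> bump 0 b g \<Longrightarrow>
   tst ux f g = - tst u (deriv f) g \<and> tst uy f g = - tst u f (deriv g) \<and>
   tst vx f g = - tst v (deriv f) g \<and> tst vy f g = - tst v f (deriv g)"
  and right_u: "\<And>b f g. 0 < b \<Longrightarrow> b \<le> 1 - \<epsilon> \<Longrightarrow> bump b 2 f \<Longrightarrow> bump 0 b g \<Longrightarrow>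
   tst (\<lambda>p. indicator ({b<..<1} \<times> {0<..<b}) p * (u p + s / 2)) (deriv f) g
    = - tst (\<lambda>p. indicator ({b<..<1} \<times> {0<..<b}) p * ux p) f g"
  and right_v: "\<And>b f g. 0 < b \<Longrightarrow> b \<le> 1 - \<epsilon> \<Longrightarrow> bump b 2 f \<Longrightarrow> bump 0 b g \<Longrightarrow>
   tst (\<lambda>p. indicator ({b<..<1} \<times> {0<..<b}) p * (v p + s / 6)) (deriv f) g
    = - tst (\<lambda>p. indicator ({b<..<1} \<times> {0<..<b}) p * vx p) f g"
  and diag_u: "\<And>f g. bump 0 (1 - \<epsilon>) f \<Longrightarrow> bump 0 2 g \<Longrightarrow>
   tst u (deriv f) g = - tst ux f g \<and> tst u f (deriv g) = - tst uy f g"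
begin

definition h :: real where "h = 1 - \<epsilon>"

lemma h: "0 < h" "h < 1" using eps by (auto simp: h_def)

lemma mem_U_left: "x < h \<Longrightarrow> (x, y) \<in> Omega_q \<epsilon> \<longleftrightarrow> 0 < y \<and> y < x"
 using eps by (auto simp: Omega_q_def Omega_def h_def abs_if)

lemma mem_U_rect: "b \<le> h \<Longrightarrow> b < x \<Longrightarrow> x < 1 \<Longrightarrow> 0 < y \<Longrightarrow> y < b \<Longrightarrow> (x, y) \<in> Omega_q \<epsilon>"
 using eps by (auto simp: Omega_q_def Omega_def h_def abs_if)

lemma mem_U_D: "(x, y) \<in> Omega_q \<epsilon> \<Longrightarrow> 0 < y \<and> y < x \<and> x < 1"
 by (auto simp: Omega_q_def)

lemma U_sub: "Omega_q \<epsilon> \<subseteq> {0<..<1} \<times> {0<..<1}" by (auto simp: Omega_q_def)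

lemma rect_borel [measurable]: "{a<..<b} \<times> {c<..<d} \<in> sets (borel :: (real \<times> real) measure)"
 by (intro borel_open open_Times) auto

lemma int_indicator_rect: "integrable lborel (indicator ({a<..<b} \<times> {c<..<d}) :: real \<times> real \<Rightarrow> real)"
proof -
 have e: "indicator ({a<..<b} \<times> {c<..<d}) = tens (indicator {a<..<b}) (indicator {c<..<d} :: real \<Rightarrow> real)"
  by (auto simp: fun_eq_iff tens_def indicator_def)
 show ?thesis unfolding e by (rule integrable_prod_real) (auto simp: integrable_indicator_iff emeasure_lborel_box_eq box_real[symmetric] simp del: box_real)
qed

lemma int_monomial: assumes "i + j \<le> 4" "i + j > 0" shows "integrable lborel (\<lambda>p. u p ^ i * v p ^ j)"
proof (rule Bochner_Integration.integrable_bound)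
 show "integrable lborel (\<lambda>p. indicator ({0<..<1} \<times> {0<..<1}) p + u p ^ 4 + v p ^ 4)"
  by (intro Bochner_Integration.integrable_add int4 int_indicator_rect)
 show "(\<lambda>p. u p ^ i * v p ^ j) \<in> borel_measurable lborel" by measurable
 have "\<bar>u p ^ i * v p ^ j\<bar> \<le> indicator ({0<..<1} \<times> {0<..<1}) p + u p ^ 4 + v p ^ 4" for p
 proof (cases "p \<in> Omega_q \<epsilon>")
  case True
  then show ?thesis using monomial_bound[OF assms(1), of "u p" "v p"] U_sub by (auto simp: indicator_def)
 next
  case False
  then have "u p ^ i * v p ^ j = 0" using supp[of p] assms(2) by (cases "i = 0") auto
  then show ?thesis by (subst \<open>u p ^ i * v p ^ j = 0\<close>) (simp add: indicator_def)
 qed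
 then show "AE p in lborel. norm (u p ^ i * v p ^ j) \<le> norm (indicator ({0<..<1} \<times> {0<..<1}) p + u p ^ 4 + v p ^ 4 :: real)"
  by (intro AE_I2) (smt (verit) real_norm_def)
qed

lemma int_u: "integrable lborel u" "integrable lborel v"
 using int_monomial[of 1 0] int_monomial[of 0 1] by auto

lemma int_Phi: "integrable lborel (\<lambda>p. Phi1 A B C (u p) (v p))" "integrable lborel (\<lambda>p. Phi3 A B C (u p) (v p))"
proof -
 have "integrable lborel (\<lambda>p. 2 * A * (u p ^ 1 * v p ^ 0) + 4 * C * (u p ^ 3 * v p ^ 0) + 12 * C * (u p ^ 1 * v p ^ 2) + 4 * B * (u p ^ 1 * v p ^ 1))"
  by (intro Bochner_Integration.integrable_add integrable_mult_right int_monomial) auto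
 then show "integrable lborel (\<lambda>p. Phi1 A B C (u p) (v p))"
  by (simp add: Phi1_def algebra_simps power2_eq_square power3_eq_cube)
 have "integrable lborel (\<lambda>p. 6 * A * (u p ^ 0 * v p ^ 1) + 12 * C * (u p ^ 2 * v p ^ 1) + 36 * C * (u p ^ 0 * v p ^ 3)
   + 2 * B * (u p ^ 2 * v p ^ 0) + (- 6 * B) * (u p ^ 0 * v p ^ 2))"
  by (intro Bochner_Integration.integrable_add integrable_mult_right int_monomial) auto
 then show "integrable lborel (\<lambda>p. Phi3 A B C (u p) (v p))"
  by (simp add: Phi3_def algebra_simps power2_eq_square power3_eq_cube)
qed

text \<open>Once \<open>vy = 0\<close>, half the sum and half the difference of \<open>EL1 / (2 + L2)\<close> and \<open>EL3 / L2\<close> are the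
 equations \<open>u\<^sub>y\<^sub>y + ca v\<^sub>x\<^sub>x = Hf u v\<close> and \<open>u\<^sub>x\<^sub>x - cb v\<^sub>x\<^sub>x = Kf u v\<close>.\<close>

definition Hf :: "real \<Rightarrow> real \<Rightarrow> real" where
 "Hf a c = k / 2 * (Phi1 A B C a c / (2 + L2) + Phi3 A B C a c / L2)"

definition Kf :: "real \<Rightarrow> real \<Rightarrow> real" where
 "Kf a c = k / 2 * (Phi1 A B C a c / (2 + L2) - Phi3 A B C a c / L2)"

definition ca :: real where "ca = ((6 + L2) / L2 - L2 / (2 + L2)) / 2"
definition cb :: real where "cb = ((6 + L2) / L2 + L2 / (2 + L2)) / 2"

lemma ca_nz: "ca \<noteq> 0"
proof -
 have "ca = (12 + 8 * L2) / (2 * L2 * (2 + L2))"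
  using L2 by (simp add: ca_def field_simps)
 then show ?thesis using L2 by simp
qed

lemma int_HK: "integrable lborel (\<lambda>p. Hf (u p) (v p))" "integrable lborel (\<lambda>p. Kf (u p) (v p))"
 unfolding Hf_def Kf_def using int_Phi by auto

lemma HK_zero: "Hf 0 0 = 0" "Kf 0 0 = 0" by (simp_all add: Hf_def Kf_def Phi1_def Phi3_def)

subsection \<open>Consequences of the second equation\<close>

text \<open>The terms with \<open>\<bar>L2\<bar>\<close> form a null Lagrangian: mixed derivatives of \<open>u\<close> cancel, and the equation
 of the second component reduces to \<open>\<partial>\<^sub>x \<partial>\<^sub>y v = 0\<close>.\<close>

lemma vx_test: assumes b: "0 < b" "b \<le> h" and f: "bump b 1 f" and g: "bump 0 b g" shows "tst vx f (deriv g) = 0"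
proof -
 have b': "b \<le> 1 - \<epsilon>" using b by (simp add: h_def)
 have "tst ux f (deriv g) = - tst u (deriv f) (deriv g)" using weak[OF b(1) b' f bump_deriv[OF g]] by simp
 moreover have "tst uy (deriv f) g = - tst u (deriv f) (deriv g)" using weak[OF b(1) b' bump_deriv[OF f] g] by simp
 moreover have "tst vx f (deriv g) = - tst v (deriv f) (deriv g)" using weak[OF b(1) b' f bump_deriv[OF g]] by simp
 moreover have "tst vy (deriv f) g = - tst v (deriv f) (deriv g)" using weak[OF b(1) b' bump_deriv[OF f] g] by simp
 ultimately show ?thesis using EL2a[OF b(1) b' f g] L2 by simp
qed

text \<open>By \<open>vx_test\<close> the derivative \<open>vx\<close> is a function of \<open>x\<close> alone; integrating it from the edge \<open>x = 1\<close>,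
 where \<open>v\<close> is constant, shows that \<open>v\<close> is one, too.\<close>

lemma vx_rows: assumes b: "0 < b" "b \<le> h"
 obtains P where "integrable lborel P" "\<forall>x. x \<notin> {b<..<1} \<longrightarrow> P x = 0"
  "AE p in lborel. p \<in> {b<..<1} \<times> {0<..<b} \<longrightarrow> vx p = P (fst p)"
  "AE p in lborel. p \<in> {b<..<1} \<times> {0<..<b} \<longrightarrow> v p = - s / 6 - integral {fst p..1} P"
proof -
 define R where "R = {b<..<1} \<times> {0<..<b}"
 have [measurable]: "R \<in> sets borel" by (simp add: R_def rect_borel)
 define D where "D p = indicator R p * vx p" for p
 have D: "integrable lborel D"
  using integrable_real_mult_indicator[of R lborel vx] int by (simp add: D_def[abs_def] mult.commute)
 have D0: "D p = 0" if "p \<notin> {b<..<1} \<times> {0<..<b}" for p using that by (simp add: D_def R_def)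
 have Dt: "(LINT p|lborel. D p * tens f (deriv g) p) = 0" if f: "bump b 1 f" and g: "bump 0 b g" for f g
 proof -
  have "tst D f (deriv g) = tst vx f (deriv g)"
   by (rule tst_cong_AE[OF _ D int(3) f bump_deriv[OF g]])
    (use tens_nz[OF _ f bump_deriv[OF g]] in \<open>auto simp: D_def R_def\<close>)
  then show ?thesis using vx_test[OF b f g] by (simp add: tst_def)
 qed
 obtain P where P: "integrable lborel P" "\<forall>x. x \<notin> {b<..<1} \<longrightarrow> P x = 0"
  "AE p in lborel. p \<in> {b<..<1} \<times> {0<..<b} \<longrightarrow> D p = P (fst p)"
  by (rule indep_snd[OF D b(1) D0 Dt])
 have P3: "AE p in lborel. p \<in> {b<..<1} \<times> {0<..<b} \<longrightarrow> vx p = P (fst p)"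
  using P(3) by eventually_elim (auto simp: D_def R_def)
 define z where "z p = indicator R p * (v p + s / 6)" for p
 have z: "integrable lborel z"
 proof -
  have "integrable lborel (\<lambda>p. indicator R p * v p + indicator R p * (s / 6))"
   using integrable_real_mult_indicator[of R lborel v] int_u int_indicator_rect[of b 1 0 b]
   by (intro Bochner_Integration.integrable_add) (simp_all add: mult.commute R_def)
  then show ?thesis by (simp add: z_def[abs_def] distrib_left)
 qed
 have b1: "b < 1" using b h by simp
 have "AE p in lborel. p \<in> {b<..<2} \<times> {0<..<b} \<longrightarrow> z p = - (LINT t|lborel. indicator {fst p..} t * D (t, snd p))"
 proof (rule row_from_right[OF z D less_imp_le[OF b1]])
  show "(LINT p|lborel. z p * tens (deriv f) g p) = - (LINT p|lborel. D p * tens f g p)"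
   if "bump b 2 f" "bump 0 b g" for f g
   using right_v[OF b(1) _ that] b by (simp add: h_def tst_def z_def[abs_def] D_def[abs_def] R_def)
  show "z p = 0" if "p \<notin> {b<..<2} \<times> {0<..<b}" for p using that by (cases p) (auto simp: z_def R_def)
  show "D p = 0" if "p \<notin> {b<..<2} \<times> {0<..<b}" for p using that by (cases p) (auto simp: D_def R_def)
  show "AE p in lborel. 1 < fst p \<longrightarrow> z p = 0 \<and> D p = 0" by (auto simp: z_def D_def R_def)
 qed simp
 moreover have "AE p in (lborel :: (real \<times> real) measure). AE t in lborel. t \<in> {b<..<1} \<and> snd p \<in> {0<..<b} \<longrightarrow> D (t, snd p) = P t"
  using AE_snd[OF AE_sections_snd[OF P(3)]] by simp
 ultimately have "AE p in lborel. p \<in> {b<..<1} \<times> {0<..<b} \<longrightarrow> v p = - s / 6 - integral {fst p..1} P"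
 proof eventually_elim
  case (elim p)
  show ?case
  proof
   assume p: "p \<in> {b<..<1} \<times> {0<..<b}"
   have Dm: "D \<in> borel_measurable (borel \<Otimes>\<^sub>M borel)" using D by (simp add: borel_prod)
   have "(LINT t|lborel. indicator {fst p..} t * D (t, snd p)) = (LINT t|lborel. indicator {fst p..} t * P t)"
   proof (rule integral_cong_AE)
    show "(\<lambda>t. indicator {fst p..} t * D (t, snd p)) \<in> borel_measurable lborel" using Dm by simp
    show "(\<lambda>t. indicator {fst p..} t * P t) \<in> borel_measurable lborel" using P(1) by simp
    from elim(2) show "AE t in lborel. indicator {fst p..} t * D (t, snd p) = indicator {fst p..} t * P t"
    proof eventually_elim
     case (elim t)
     then show ?case using p P(2) D0[of "(t, snd p)"] by (cases "t \<in> {b<..<1}") auto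
    qed
   qed
   also have "\<dots> = integral {fst p..1} P" by (rule suffix_eq_integral[OF P(1)]) (use P(2) in auto)
   finally show "v p = - s / 6 - integral {fst p..1} P"
    using elim(1) p by (auto simp: z_def R_def mem_Times_iff)
  qed
 qed
 with P P3 show ?thesis using that by blast
qed

lemma vy_zero_rect: assumes b: "0 < b" "b \<le> h"
 shows "AE p in lborel. p \<in> {b<..<1} \<times> {0<..<b} \<longrightarrow> vy p = 0"
proof (rule fundamental_lemma)
 show "integrable lborel (\<lambda>p. indicator ({b<..<1} \<times> {0<..<b}) p * vy p)"
  using integrable_real_mult_indicator[of "{b<..<1} \<times> {0<..<b}" lborel vy] int rect_borel by (simp add: mult.commute)
 fix f g assume f: "bump b 1 f" and g: "bump 0 b g"
 obtain P where P': "integrable lborel P" "\<forall>x. x \<notin> {b<..<1} \<longrightarrow> P x = 0"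
  "AE p in lborel. p \<in> {b<..<1} \<times> {0<..<b} \<longrightarrow> vx p = P (fst p)"
  "AE p in lborel. p \<in> {b<..<1} \<times> {0<..<b} \<longrightarrow> v p = - s / 6 - integral {fst p..1} P"
  by (rule vx_rows[OF b])
 note P = P'(1,4)
 have "(LINT p|lborel. indicator ({b<..<1} \<times> {0<..<b}) p * vy p * tens f g p) = tst vy f g"
  unfolding tst_def using tens_nz[OF _ f g] by (intro Bochner_Integration.integral_cong) (auto simp: indicator_def)
 also have "\<dots> = - tst v f (deriv g)" using weak[OF b(1) _ f g] b by (simp add: h_def)
 also have "tst v f (deriv g) = (LINT p|lborel. tens (\<lambda>x. f x * (- s / 6 - integral {x..1} P)) (deriv g) p)"
  unfolding tst_def
 proof (rule integral_cong_AE)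
  show "(\<lambda>p. v p * tens f (deriv g) p) \<in> borel_measurable lborel"
   using borel_measurable_integrable[OF integrable_mult_bumps[OF int_u(2) f bump_deriv[OF g]]] .
  have "continuous_on {0..1} (\<lambda>x. - s / 6 - integral {x..1} P)"
   using lborel_integral_eq_integral(2)[OF P(1), of "{0..1}"]
   by (intro continuous_intros indefinite_integral_continuous_1') simp
  then have "(\<lambda>x. indicator {0..1} x *\<^sub>R (- s / 6 - integral {x..1} P)) \<in> borel_measurable borel"
   by (intro borel_measurable_continuous_on_indicator) auto
  then have "(\<lambda>x. f x * (indicator {0..1} x *\<^sub>R (- s / 6 - integral {x..1} P))) \<in> borel_measurable borel"
   by (rule borel_measurable_times[OF smooth1_borel[OF bump_smooth[OF f]]])
  also have "(\<lambda>x. f x * (indicator {0..1} x *\<^sub>R (- s / 6 - integral {x..1} P))) = (\<lambda>x. f x * (- s / 6 - integral {x..1} P))"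
  proof
   fix x show "f x * (indicator {0..1} x *\<^sub>R (- s / 6 - integral {x..1} P)) = f x * (- s / 6 - integral {x..1} P)"
    using bump_zero[OF f, of x] b by (cases "x \<in> {0..1}") auto
  qed
  finally show "tens (\<lambda>x. f x * (- s / 6 - integral {x..1} P)) (deriv g) \<in> borel_measurable lborel"
   using borel_measurable_tens[OF _ smooth1_borel[OF bump_smooth[OF bump_deriv[OF g]]]] by simp
  from P(2) show "AE p in lborel. v p * tens f (deriv g) p = tens (\<lambda>x. f x * (- s / 6 - integral {x..1} P)) (deriv g) p"
  proof eventually_elim
   case (elim p)
   then show ?case using tens_nz[OF _ f bump_deriv[OF g], of p]
    by (cases "tens f (deriv g) p = 0") (auto simp: tens_def)
  qed
 qed
 also have "\<dots> = 0"
 proof (cases "integrable lborel (tens (\<lambda>x. f x * (- s / 6 - integral {x..1} P)) (deriv g))")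
  case True
  have "(LINT y|lborel. deriv g y) = 0" using bump_integral_deriv[OF g, of "\<lambda>_. 1"] by simp
  then show ?thesis using fub_fst(1)[OF True] by (simp add: tens_def)
 qed (simp add: not_integrable_integral_eq)
 finally show "(LINT p|lborel. indicator ({b<..<1} \<times> {0<..<b}) p * vy p * tens f g p) = 0" by simp
qed

text \<open>These rectangles with rational \<open>b\<close> exhaust the corner triangle.\<close>

lemma AE_corner_from_rects:
 assumes "\<And>b. 0 < b \<Longrightarrow> b < h \<Longrightarrow> AE p in lborel. p \<in> {b<..<h} \<times> {0<..<b} \<longrightarrow> Q p"
 shows "AE p in lborel. p \<in> Omega_q \<epsilon> \<and> fst p < h \<longrightarrow> Q p"
proof -
 have "AE p in lborel. \<forall>q::rat. 0 < real_of_rat q \<and> real_of_rat q < h \<longrightarrow>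
   p \<in> {real_of_rat q<..<h} \<times> {0<..<real_of_rat q} \<longrightarrow> Q p"
  unfolding AE_all_countable using assms by auto
 then show ?thesis
 proof eventually_elim
  case (elim p)
  show ?case
  proof
   assume p: "p \<in> Omega_q \<epsilon> \<and> fst p < h"
   then have U: "0 < snd p" "snd p < fst p" "fst p < 1" using mem_U_D[of "fst p" "snd p"] by auto
   obtain q where q: "snd p < real_of_rat q" "real_of_rat q < fst p" using rational_between[OF U(2)] by blast
   with U p have "0 < real_of_rat q" "real_of_rat q < h" by linarith+
   then show "Q p" using elim[rule_format, of q] q p U by (auto simp: mem_Times_iff)
  qed
 qed
qed

lemma vy_zero: "AE p in lborel. snd p < h \<longrightarrow> vy p = 0"
proof -
 have "AE p in lborel. \<forall>q::rat. 0 < real_of_rat q \<and> real_of_rat q \<le> h \<longrightarrow>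
   p \<in> {real_of_rat q<..<1} \<times> {0<..<real_of_rat q} \<longrightarrow> vy p = 0"
  unfolding AE_all_countable using vy_zero_rect by auto
 then show ?thesis
 proof eventually_elim
  case (elim p)
  show ?case
  proof
   assume p: "snd p < h"
   show "vy p = 0"
   proof (cases "p \<in> Omega_q \<epsilon>")
    case True
    then have U: "0 < snd p" "snd p < fst p" "fst p < 1" using mem_U_D[of "fst p" "snd p"] by auto
    then have "snd p < min (fst p) h" using p by simp
    then obtain q where "snd p < real_of_rat q" "real_of_rat q < min (fst p) h" using rational_between by blast
    moreover from this U have "0 < real_of_rat q" by linarith
    ultimately show ?thesis using elim[rule_format, of q] U by (auto simp: mem_Times_iff)
   qed (use supp in blast)
  qed
 qed
qed

text \<open>With test functions across the diagonal the terms in \<open>u\<close> still cancel because \<open>u\<close> vanishes there.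
 Hence the extension of \<open>vx\<close> by 0 depends on \<open>x\<close> alone, and it is 0 above the diagonal.\<close>

lemma vx_zero: "AE p in lborel. fst p < h \<longrightarrow> vx p = 0"
proof -
 define D where "D p = indicator ({0<..<h} \<times> {0<..<1}) p * vx p" for p
 have D: "integrable lborel D"
  using integrable_real_mult_indicator[of "{0<..<h} \<times> {0<..<1}" lborel vx] int rect_borel
  by (simp add: D_def[abs_def] mult.commute)
 have Dt: "(LINT p|lborel. D p * tens f (deriv g) p) = 0" if f: "bump 0 h f" and g: "bump 0 1 g" for f g
 proof -
  have g2: "bump 0 2 g" using bump_mono[OF g] by simp
  have f': "bump 0 (1 - \<epsilon>) f" using f by (simp add: h_def)
  have "(LINT p|lborel. D p * tens f (deriv g) p) = tst vx f (deriv g)"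
   unfolding tst_def using tens_nz[OF _ f bump_deriv[OF g]]
   by (intro Bochner_Integration.integral_cong) (auto simp: D_def indicator_def)
  moreover have "tst vy (deriv f) g = tst (\<lambda>_. 0) (deriv f) g"
  proof (rule tst_cong_AE[OF _ int(4) _ bump_deriv[OF f] g])
   from vy_zero show "AE p in lborel. tens (deriv f) g p \<noteq> 0 \<longrightarrow> vy p = 0"
   proof eventually_elim
    case (elim p)
    show ?case
    proof
     assume "tens (deriv f) g p \<noteq> 0"
     from tens_nz[OF this bump_deriv[OF f] g] have "fst p < h" by (auto simp: mem_Times_iff)
     then show "vy p = 0" using elim supp[of p] mem_U_left[of "fst p" "snd p"] by (cases "snd p < h") auto
    qed
   qed
  qed simp
  moreover have "tst ux f (deriv g) = - tst u (deriv f) (deriv g)"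
   using diag_u[OF f' bump_deriv[OF g2]] by simp
  moreover have "tst uy (deriv f) g = - tst u (deriv f) (deriv g)"
   using diag_u[OF bump_deriv[OF f'] g2] by simp
  ultimately show ?thesis using EL2b[OF f' g] L2 by (simp add: tst_zero)
 qed
 obtain P where P: "integrable lborel P" "AE p in lborel. p \<in> {0<..<h} \<times> {0<..<1} \<longrightarrow> D p = P (fst p)"
  by (rule indep_snd[OF D _ _ Dt]) (auto simp: D_def)
 have "AE x in lborel. 0 < x \<and> x < h \<longrightarrow> P x = 0"
  using AE_sections_fst[OF P(2)]
 proof eventually_elim
  case (elim x)
  show ?case
  proof
   assume x: "0 < x \<and> x < h"
   then have "x < 1" using h by simp
   then obtain y where y: "x < y" "y < 1" "(x, y) \<in> {0<..<h} \<times> {0<..<1} \<longrightarrow> D (x, y) = P (fst (x, y))"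
    using AE_lborel_witness[OF elim] by metis
   moreover have "vx (x, y) = 0" using supp[of "(x, y)"] mem_U_left[of x y] x y by auto
   ultimately show "P x = 0" using x by (auto simp: D_def)
  qed
 qed
 from AE_fst[OF this] P(2) show ?thesis
 proof eventually_elim
  case (elim p)
  show ?case
  proof
   assume p: "fst p < h"
   show "vx p = 0"
   proof (cases "p \<in> Omega_q \<epsilon>")
    case True
    then have "p \<in> {0<..<h} \<times> {0<..<1}" using p mem_U_D[of "fst p" "snd p"] by (auto simp: mem_Times_iff)
    with elim p show ?thesis by (auto simp: D_def mem_Times_iff)
   qed (use supp in blast)
  qed
 qed
qed

lemma v_constant_rect: assumes b: "0 < b" "b < h"
 obtains c where "AE p in lborel. p \<in> {b<..<h} \<times> {0<..<b} \<longrightarrow> v p = c"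
proof -
 have b': "b \<le> h" using b by simp
 obtain P where P: "integrable lborel P" "\<forall>x. x \<notin> {b<..<1} \<longrightarrow> P x = 0"
  "AE p in lborel. p \<in> {b<..<1} \<times> {0<..<b} \<longrightarrow> vx p = P (fst p)"
  "AE p in lborel. p \<in> {b<..<1} \<times> {0<..<b} \<longrightarrow> v p = - s / 6 - integral {fst p..1} P"
  by (rule vx_rows[OF b(1) b'])
 have "AE p in lborel. p \<in> {b<..<1} \<times> {0<..<b} \<and> fst p < h \<longrightarrow> P (fst p) = 0"
  using P(3) vx_zero by eventually_elim auto
 from AE_lborel_witness[OF AE_sections_snd[OF this] b(1)] obtain y where y: "0 < y" "y < b"
  "AE x in lborel. (x, y) \<in> {b<..<1} \<times> {0<..<b} \<and> x < h \<longrightarrow> P x = 0" by auto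
 then have P0: "AE x in lborel. b < x \<and> x < h \<longrightarrow> P x = 0" using h by (auto elim!: eventually_mono)
 have "integral {x..1} P = integral {h..1} P" if "b < x" "x < h" for x
 proof -
  have "integral {x..1} P = integral {x..h} P + integral {h..1} P"
   using that h lborel_integral_eq_integral(2)[OF P(1), of "{x..1}"]
   by (intro Henstock_Kurzweil_Integration.integral_combine[symmetric]) auto
  also have "integral {x..h} P = integral {x..h} (\<lambda>_. 0)"
   using that by (intro AE_integral_cong[OF P0]) auto
  finally show ?thesis by simp
 qed
 then have "AE p in lborel. p \<in> {b<..<h} \<times> {0<..<b} \<longrightarrow> v p = - s / 6 - integral {h..1} P"
  using P(4) h by (auto elim!: eventually_mono)
 then show ?thesis using that by blast
qed

lemma v_constant: obtains c where "AE p in lborel. p \<in> Omega_q \<epsilon> \<and> fst p < h \<longrightarrow> v p = c"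
proof -
 have "\<exists>c. AE p in lborel. p \<in> {b<..<h} \<times> {0<..<b} \<longrightarrow> v p = c" if "0 < b" "b < h" for b
  by (rule v_constant_rect[OF that]) (rule exI)
 then have ex: "\<forall>b. \<exists>c. 0 < b \<and> b < h \<longrightarrow> (AE p in lborel. p \<in> {b<..<h} \<times> {0<..<b} \<longrightarrow> v p = c)"
  by blast
 obtain c where "\<forall>b. 0 < b \<and> b < h \<longrightarrow> (AE p in lborel. p \<in> {b<..<h} \<times> {0<..<b} \<longrightarrow> v p = c b)"
  using choice[OF ex] by blast
 then have c: "AE p in lborel. p \<in> {b<..<h} \<times> {0<..<b} \<longrightarrow> v p = c b" if "0 < b" "b < h" for b
  using that by blast
 have ceq: "c b = c b'" if b: "0 < b" "b < h" "0 < b'" "b' < h" for b b'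
 proof -
  have ae: "AE p in lborel. p \<in> {b<..<h} \<times> {0<..<b} \<and> p \<in> {b'<..<h} \<times> {0<..<b'} \<longrightarrow> c b = c b'"
   using c[OF b(1,2)] c[OF b(3,4)] by eventually_elim auto
  have m: "max b b' < h" "0 < min b b'" using b by auto
  obtain x where x: "max b b' < x" "x < h"
   "AE y in lborel. (x, y) \<in> {b<..<h} \<times> {0<..<b} \<and> (x, y) \<in> {b'<..<h} \<times> {0<..<b'} \<longrightarrow> c b = c b'"
   by (rule AE_lborel_witness[OF AE_sections_fst[OF ae] m(1)])
  obtain y where "0 < y" "y < min b b'"
   "(x, y) \<in> {b<..<h} \<times> {0<..<b} \<and> (x, y) \<in> {b'<..<h} \<times> {0<..<b'} \<longrightarrow> c b = c b'"
   by (rule AE_lborel_witness[OF x(3) m(2)])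
  then show ?thesis using x by auto
 qed
 define c0 where "c0 = c (h / 2)"
 have "AE p in lborel. p \<in> Omega_q \<epsilon> \<and> fst p < h \<longrightarrow> v p = c0"
 proof (rule AE_corner_from_rects)
  fix b assume b: "0 < b" "b < h"
  show "AE p in lborel. p \<in> {b<..<h} \<times> {0<..<b} \<longrightarrow> v p = c0"
   using c[OF b] ceq[OF b, of "h / 2"] h by (simp add: c0_def)
 qed
 then show ?thesis using that by blast
qed

end

section \<open>The equations near the corner\<close>

lemma bump_scale:
 assumes "bump a b f" "r > 0"
 shows "bump (r * a) (r * b) (\<lambda>x. f (x / r))"
  and "deriv (\<lambda>x. f (x / r)) = (\<lambda>x. deriv f (x / r) / r)"
proof -
 obtain a' b' where 1: "a < a'" "b' < b" "\<And>x. x < a' \<Longrightarrow> f x = 0" "\<And>x. x > b' \<Longrightarrow> f x = 0"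
  using bumpE[OF assms(1)] by metis
 have "smooth1 (\<lambda>x. f (1 / r * x + 0))" by (rule smooth1_affine[OF bump_smooth[OF assms(1)]])
 then have "smooth1 (\<lambda>x. f (x / r))" by simp
 then show "bump (r * a) (r * b) (\<lambda>x. f (x / r))"
 proof (rule bumpI[of _ _ "r * a'" "r * b'"])
  show "r * a < r * a'" "r * b' < r * b" using 1 assms(2) by simp_all
  show "f (x / r) = 0" if "x < r * a'" for x
   using that assms(2) by (intro 1(3)) (simp add: pos_divide_less_eq mult.commute)
  show "f (x / r) = 0" if "x > r * b'" for x
   using that assms(2) by (intro 1(4)) (simp add: pos_less_divide_eq mult.commute)
 qed
 show "deriv (\<lambda>x. f (x / r)) = (\<lambda>x. deriv f (x / r) / r)"
 proof
  fix x
  have "((\<lambda>x. x / r) has_real_derivative 1 / r) (at x)" using assms(2) by (auto intro!: derivative_eq_intros)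
  from DERIV_chain2[OF smooth1_deriv(1)[OF bump_smooth[OF assms(1)], of "x / r"] this]
  show "deriv (\<lambda>x. f (x / r)) x = deriv f (x / r) / r" by (intro DERIV_imp_deriv) simp
 qed
qed

lemma integral_scale:
 fixes f :: "real \<Rightarrow> real"
 assumes "r > 0" shows "(LINT x|lborel. f (x / r)) = r * (LINT x|lborel. f x)"
proof -
 have "1 / r \<noteq> 0" using assms by simp
 from lborel_integral_real_affine[OF this, of f 0] show ?thesis using assms by simp
qed

lemma smooth1_power: "smooth1 (\<lambda>x. x ^ n)"
proof -
 have "C1_k k (\<lambda>x. c * x ^ n)" for k c
 proof (induction k arbitrary: c n)
  case 0 show ?case by (auto intro!: continuous_intros)
 next
  case (Suc k)
  have "((\<lambda>x. c * x ^ n) has_real_derivative (c * real n) * x ^ (n - 1)) (at x)" for x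
   by (auto intro!: derivative_eq_intros)
  with Suc[of "c * real n" "n - 1"] show ?case unfolding C1_k.simps
   by (intro exI[of _ "\<lambda>x. (c * real n) * x ^ (n - 1)"]) auto
 qed
 from this[of _ 1] show ?thesis by (simp add: smooth1_def)
qed

lemma deriv_power: "deriv (\<lambda>x::real. x ^ n) = (\<lambda>x. real n * x ^ (n - 1))"
 by (rule ext, rule DERIV_imp_deriv) (auto intro!: derivative_eq_intros)

lemma moment_deriv2:
 assumes f: "bump a b f"
 shows "(LINT x|lborel. deriv (deriv f) x) = 0"
  and "(LINT x|lborel. x ^ 2 * deriv (deriv f) x) = 2 * (LINT x|lborel. f x)"
  and "(LINT x|lborel. x ^ 4 * deriv (deriv f) x) = 12 * (LINT x|lborel. x ^ 2 * f x)"
proof -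
 have 1: "(LINT x|lborel. x ^ n * deriv (deriv f) x) = real n * real (n - 1) * (LINT x|lborel. x ^ (n - 2) * f x)" for n
 proof -
  have "(LINT x|lborel. x ^ n * deriv (deriv f) x) = - (LINT x|lborel. (real n * x ^ (n - 1)) * deriv f x)"
   using bump_integral_deriv[OF bump_deriv[OF f] smooth1_power[of n]] by (simp add: deriv_power)
  also have "\<dots> = - (real n * (LINT x|lborel. x ^ (n - 1) * deriv f x))"
   by (simp add: mult.assoc)
  also have "(LINT x|lborel. x ^ (n - 1) * deriv f x) = - (LINT x|lborel. (real (n - 1) * x ^ (n - 2)) * f x)"
   using bump_integral_deriv[OF f smooth1_power[of "n - 1"]] by (simp add: deriv_power numeral_2_eq_2)
  finally show ?thesis by (simp add: mult.assoc)
 qed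
 show "(LINT x|lborel. deriv (deriv f) x) = 0" using 1[of 0] by simp
 show "(LINT x|lborel. x ^ 2 * deriv (deriv f) x) = 2 * (LINT x|lborel. f x)" using 1[of 2] by simp
 show "(LINT x|lborel. x ^ 4 * deriv (deriv f) x) = 12 * (LINT x|lborel. x ^ 2 * f x)" using 1[of 4] by simp
qed

lemma integrable_power_bump: assumes "bump a b f" shows "integrable lborel (\<lambda>x. x ^ n * f x)"
proof -
 have "integrable lborel (\<lambda>x. indicator {a..b} x *\<^sub>R (x ^ n * f x))"
  using assms by (intro borel_integrable_compact continuous_intros smooth1_cont bump_smooth) auto
 then show ?thesis by (simp only: bump_indicator[OF assms])
qed

lemma tst_monomial:
 assumes "bump a b f" "bump c d g"
 shows "integrable lborel (\<lambda>p. (fst p ^ i * snd p ^ j) * tens f g p)"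
  and "tst (\<lambda>p. fst p ^ i * snd p ^ j) f g = (LINT x|lborel. x ^ i * f x) * (LINT y|lborel. y ^ j * g y)"
proof -
 have e: "(\<lambda>p. (fst p ^ i * snd p ^ j) * tens f g p) = tens (\<lambda>x. x ^ i * f x) (\<lambda>y. y ^ j * g y)"
  by (auto simp: tens_def)
 show "integrable lborel (\<lambda>p. (fst p ^ i * snd p ^ j) * tens f g p)"
  unfolding e by (intro integrable_prod_real integrable_power_bump[OF assms(1)] integrable_power_bump[OF assms(2)])
 show "tst (\<lambda>p. fst p ^ i * snd p ^ j) f g = (LINT x|lborel. x ^ i * f x) * (LINT y|lborel. y ^ j * g y)"
  unfolding tst_def e
  by (intro integrable_prod_real integrable_power_bump[OF assms(1)] integrable_power_bump[OF assms(2)])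
qed

text \<open>The wave and Laplace operators acting on \<open>y\<^sup>2 - x\<^sup>2\<close> and its square, in the sense of
 distributions.\<close>

lemma wave_quadratic:
 assumes f: "bump a b f" and g: "bump c d g"
 shows "tst (\<lambda>p. snd p ^ 2 - fst p ^ 2) f (deriv (deriv g)) - tst (\<lambda>p. snd p ^ 2 - fst p ^ 2) (deriv (deriv f)) g
  = 4 * (LINT x|lborel. f x) * (LINT x|lborel. g x)"
proof -
 have e: "tst (\<lambda>p. snd p ^ 2 - fst p ^ 2) f g = (LINT x|lborel. f x) * (LINT y|lborel. y ^ 2 * g y)
   - (LINT x|lborel. x ^ 2 * f x) * (LINT y|lborel. g y)" if "bump a b f" "bump c d g" for f g
  using tst_monomial[OF that, of 0 2] tst_monomial[OF that, of 2 0]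
  by (simp add: tst_def left_diff_distrib)
 show ?thesis
  unfolding e[OF f bump_deriv[OF bump_deriv[OF g]]] e[OF bump_deriv[OF bump_deriv[OF f]] g]
  by (simp add: moment_deriv2[OF f] moment_deriv2[OF g])
qed

lemma laplace_quartic:
 assumes f: "bump a b f" and g: "bump c d g"
 shows "tst (\<lambda>p. (snd p ^ 2 - fst p ^ 2) ^ 2) f (deriv (deriv g)) + tst (\<lambda>p. (snd p ^ 2 - fst p ^ 2) ^ 2) (deriv (deriv f)) g
  = 8 * ((LINT x|lborel. x ^ 2 * f x) * (LINT x|lborel. g x) + (LINT x|lborel. f x) * (LINT x|lborel. x ^ 2 * g x))"
proof -
 have e: "tst (\<lambda>p. (snd p ^ 2 - fst p ^ 2) ^ 2) f g = (LINT x|lborel. f x) * (LINT y|lborel. y ^ 4 * g y)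
   - 2 * ((LINT x|lborel. x ^ 2 * f x) * (LINT y|lborel. y ^ 2 * g y))
   + (LINT x|lborel. x ^ 4 * f x) * (LINT y|lborel. g y)" if "bump a b f" "bump c d g" for f g
 proof -
  have "(\<lambda>p::real\<times>real. (snd p ^ 2 - fst p ^ 2) ^ 2 * tens f g p) = (\<lambda>p. (fst p ^ 0 * snd p ^ 4) * tens f g p
    - 2 * ((fst p ^ 2 * snd p ^ 2) * tens f g p) + (fst p ^ 4 * snd p ^ 0) * tens f g p)"
   by (auto simp: fun_eq_iff algebra_simps power2_eq_square power4_eq_xxxx)
  then show ?thesis
   using tst_monomial[OF that, of 0 4] tst_monomial[OF that, of 2 2] tst_monomial[OF that, of 4 0]
   by (simp add: tst_def)
 qed
 show ?thesis
  unfolding e[OF f bump_deriv[OF bump_deriv[OF g]]] e[OF bump_deriv[OF bump_deriv[OF f]] g]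
  by (simp add: moment_deriv2[OF f] moment_deriv2[OF g])
qed

lemma tst_bound:
 assumes i: "integrable lborel (\<lambda>p. w p * tens f g p)" and f: "bump a b f" and g: "bump c d g" and ab: "a \<le> b" "c \<le> d"
  and le: "AE p in lborel. p \<in> {a<..<b} \<times> {c<..<d} \<longrightarrow> \<bar>w p\<bar> \<le> E"
  and F: "\<And>x. \<bar>f x\<bar> \<le> F" and G: "\<And>x. \<bar>g x\<bar> \<le> G" and E: "E \<ge> 0"
 shows "\<bar>tst w f g\<bar> \<le> E * F * G * ((b - a) * (d - c))"
proof -
 have FG: "F \<ge> 0" "G \<ge> 0" using F[of 0] G[of 0] by auto
 define I where "I = tens (indicator {a<..<b}) (indicator {c<..<d} :: real \<Rightarrow> real)"
 have I: "integrable lborel I" "(LINT p|lborel. I p) = (b - a) * (d - c)"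
  using integrable_prod_real[of "indicator {a<..<b}" "indicator {c<..<d}"] ab
  by (auto simp: I_def integrable_indicator_iff)
 have "\<bar>tst w f g\<bar> \<le> (LINT p|lborel. \<bar>w p * tens f g p\<bar>)"
  unfolding tst_def using integral_norm_bound[of lborel "\<lambda>p. w p * tens f g p"] by simp
 also have "\<dots> \<le> (LINT p|lborel. E * F * G * I p)"
 proof (rule integral_mono_AE)
  show "integrable lborel (\<lambda>p. \<bar>w p * tens f g p\<bar>)" using i by simp
  show "integrable lborel (\<lambda>p. E * F * G * I p)" using I by simp
  from le show "AE p in lborel. \<bar>w p * tens f g p\<bar> \<le> E * F * G * I p"
  proof eventually_elim
   case (elim p)
   show ?case
   proof (cases "p \<in> {a<..<b} \<times> {c<..<d}")
    case True
    then have "\<bar>w p\<bar> * (\<bar>f (fst p)\<bar> * \<bar>g (snd p)\<bar>) \<le> E * (F * G)"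
     using elim F G FG E by (intro mult_mono) auto
    then show ?thesis using True by (auto simp: tens_def abs_mult I_def mult.assoc)
   next
    case False
    then have "tens f g p = 0" using tens_nz[OF _ f g] by blast
    moreover have "0 \<le> E * F * G * I p" using E FG by (simp add: I_def tens_def)
    ultimately show ?thesis by simp
   qed
  qed
 qed
 also have "\<dots> = E * F * G * ((b - a) * (d - c))" using I by simp
 finally show ?thesis .
qed

context reduced_system
begin

lemma EL_col:
 assumes b: "0 < b" "b \<le> h" and f: "bump b 1 f" and g: "bump (- 1) b g"
 shows "tst uy f (deriv g) + ca * tst vx (deriv f) g + tst (\<lambda>p. Hf (u p) (v p)) f g = 0"
  and "tst ux (deriv f) g - cb * tst vx (deriv f) g + tst (\<lambda>p. Kf (u p) (v p)) f g = 0"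
proof -
 have b': "b \<le> 1 - \<epsilon>" using b by (simp add: h_def)
 have vy: "tst vy f (deriv g) = 0"
 proof -
  have "tst vy f (deriv g) = tst (\<lambda>_. 0) f (deriv g)"
  proof (rule tst_cong_AE[OF _ int(4) _ f bump_deriv[OF g]])
   from vy_zero show "AE p in lborel. tens f (deriv g) p \<noteq> 0 \<longrightarrow> vy p = 0"
    by eventually_elim (use tens_nz[OF _ f bump_deriv[OF g]] b in \<open>force simp: mem_Times_iff\<close>)
  qed simp
  then show ?thesis by (simp add: tst_zero)
 qed
 define i1 where "i1 = tst (\<lambda>p. Phi1 A B C (u p) (v p)) f g"
 define i3 where "i3 = tst (\<lambda>p. Phi3 A B C (u p) (v p)) f g"
 have H: "tst (\<lambda>p. Hf (u p) (v p)) f g = k / 2 * (i1 / (2 + L2) + i3 / L2)"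
  using tst_add[OF int_Phi(1) int_Phi(2) f g, of "k / 2 / (2 + L2)" "k / 2 / L2"]
  by (simp add: Hf_def[abs_def] i1_def i3_def algebra_simps)
 have K: "tst (\<lambda>p. Kf (u p) (v p)) f g = k / 2 * (i1 / (2 + L2) - i3 / L2)"
  using tst_add[OF int_Phi(1) int_Phi(2) f g, of "k / 2 / (2 + L2)" "- (k / 2 / L2)"]
  by (simp add: Kf_def[abs_def] i1_def i3_def algebra_simps)
 have l: "2 + L2 \<noteq> 0" using L2 by simp
 define X where "X = tst ux (deriv f) g"
 define Y where "Y = tst uy f (deriv g)"
 define V where "V = tst vx (deriv f) g"
 have E1: "(2 + L2) * (X + Y) + L2 * (- V) + k * i1 = 0"
  using EL1[OF b(1) b' f g] by (simp add: vy i1_def X_def Y_def V_def)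
 have E3: "(6 + L2) * V + L2 * (Y - X) + k * i3 = 0"
  using EL3[OF b(1) b' f g] by (simp add: vy i3_def X_def Y_def V_def)
 have "k * i1 = L2 * V - (2 + L2) * (X + Y)" using E1 by (simp add: algebra_simps)
 then have F1: "k * i1 / (2 + L2) = L2 / (2 + L2) * V - (X + Y)"
  using l by (simp add: diff_divide_distrib)
 have "k * i3 = - (6 + L2) * V - L2 * (Y - X)" using E3 by (simp add: algebra_simps)
 then have F3: "k * i3 / L2 = - ((6 + L2) / L2) * V - (Y - X)"
  using L2 by (simp add: field_simps)
 have h1: "k / 2 * (i1 / (2 + L2) + i3 / L2) = (k * i1 / (2 + L2) + k * i3 / L2) / 2"
  "k / 2 * (i1 / (2 + L2) - i3 / L2) = (k * i1 / (2 + L2) - k * i3 / L2) / 2"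
  by (simp_all add: algebra_simps add_divide_distrib diff_divide_distrib)
 show "tst uy f (deriv g) + ca * tst vx (deriv f) g + tst (\<lambda>p. Hf (u p) (v p)) f g = 0"
  unfolding H h1 F1 F3 Y_def[symmetric] V_def[symmetric] ca_def by (simp add: algebra_simps add_divide_distrib diff_divide_distrib)
 show "tst ux (deriv f) g - cb * tst vx (deriv f) g + tst (\<lambda>p. Kf (u p) (v p)) f g = 0"
  unfolding K h1 F1 F3 X_def[symmetric] V_def[symmetric] cb_def by (simp add: algebra_simps add_divide_distrib diff_divide_distrib)
qed

text \<open>In the corner triangle \<open>vx = 0\<close> as well, and \<open>u\<close> solves \<open>u\<^sub>y\<^sub>y = Hf u v\<close>, \<open>u\<^sub>x\<^sub>x = Kf u v\<close>.\<close>

lemma EL_corner: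
 assumes b: "0 < b" "b < h" and f: "bump b h f" and g: "bump (- 1) b g"
 shows "tst uy f (deriv g) = - tst (\<lambda>p. Hf (u p) (v p)) f g"
  and "tst ux (deriv f) g = - tst (\<lambda>p. Kf (u p) (v p)) f g"
proof -
 have f1: "bump b 1 f" using bump_mono[OF f] h by simp
 have "tst vx (deriv f) g = tst (\<lambda>_. 0) (deriv f) g"
 proof (rule tst_cong_AE[OF _ int(3) _ bump_deriv[OF f] g])
  from vx_zero show "AE p in lborel. tens (deriv f) g p \<noteq> 0 \<longrightarrow> vx p = 0"
   by eventually_elim (use tens_nz[OF _ bump_deriv[OF f] g] b in \<open>force simp: mem_Times_iff\<close>)
 qed simp
 then have "tst vx (deriv f) g = 0" by (simp add: tst_zero)
 then show "tst uy f (deriv g) = - tst (\<lambda>p. Hf (u p) (v p)) f g"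
  "tst ux (deriv f) g = - tst (\<lambda>p. Kf (u p) (v p)) f g"
  using EL_col[OF b(1) less_imp_le[OF b(2)] f1 g] by simp_all
qed

lemma int_restrict: "integrable lborel w \<Longrightarrow> S \<in> sets borel \<Longrightarrow> integrable lborel (\<lambda>p. indicator S p * w p)" for w :: "real \<times> real \<Rightarrow> real"
 using integrable_real_mult_indicator[of S lborel w] by (simp add: mult.commute)

text \<open>The natural condition \<open>\<partial>\<^sub>y u = 0\<close> at \<open>y = 0\<close> fixes the constant of integration.\<close>

lemma uy_column_rect: assumes b: "0 < b" "b < h"
 shows "AE p in lborel. p \<in> {b<..<h} \<times> {0<..<b} \<longrightarrow>
  uy p = (LINT t|lborel. indicator {..<snd p} t * Hf (u (fst p, t)) (v (fst p, t)))"
proof -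
 define R where "R = {b<..<h} \<times> {-1<..<b}"
 have R: "R \<in> sets borel" by (simp add: R_def rect_borel)
 define z where "z p = indicator R p * uy p" for p
 define kk where "kk p = indicator R p * Hf (u p) (v p)" for p
 have z: "integrable lborel z" and kk: "integrable lborel kk"
  unfolding z_def[abs_def] kk_def[abs_def] using R int int_HK by (auto intro: int_restrict)
 have neg: "u p = 0 \<and> v p = 0 \<and> uy p = 0" if "snd p \<le> 0" for p
  using supp[of p] mem_U_D[of "fst p" "snd p"] that by auto
 have "AE p in lborel. p \<in> {b<..<h} \<times> {-1<..<b} \<longrightarrow> z p = primy kk p"
 proof (rule column_from_bottom[OF z kk, of "-1" 0 b])
  show "(LINT p|lborel. z p * tens f (deriv g) p) = - (LINT p|lborel. kk p * tens f g p)"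
   if f: "bump b h f" and g: "bump (- 1) b g" for f g
  proof -
   have "tst z f (deriv g) = tst uy f (deriv g)"
    by (rule tst_cong_AE[OF _ z int(2) f bump_deriv[OF g]])
     (use tens_nz[OF _ f bump_deriv[OF g]] in \<open>auto simp: z_def R_def\<close>)
   moreover have "tst kk f g = tst (\<lambda>p. Hf (u p) (v p)) f g"
    by (rule tst_cong_AE[OF _ kk int_HK(1) f g]) (use tens_nz[OF _ f g] in \<open>auto simp: kk_def R_def\<close>)
   ultimately show ?thesis using EL_corner(1)[OF b f g] by (simp add: tst_def)
  qed
  show "AE p in lborel. snd p < 0 \<longrightarrow> z p = 0 \<and> kk p = 0"
   using neg HK_zero by (auto simp: z_def kk_def)
 qed (use b in \<open>auto simp: z_def kk_def R_def\<close>)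
 then show ?thesis
 proof eventually_elim
  case (elim p)
  show ?case
  proof
   assume p: "p \<in> {b<..<h} \<times> {0<..<b}"
   have e: "indicator {..<snd p} t * kk (fst p, t) = indicator {..<snd p} t * Hf (u (fst p, t)) (v (fst p, t))" for t
    using p neg[of "(fst p, t)"] HK_zero by (cases "t \<le> 0") (auto simp: kk_def R_def indicator_def mem_Times_iff)
   then show "uy p = (LINT t|lborel. indicator {..<snd p} t * Hf (u (fst p, t)) (v (fst p, t)))"
    using elim p unfolding primy_def e by (auto simp: z_def R_def mem_Times_iff)
  qed
 qed
qed

text \<open>Here the constant of integration is fixed by \<open>u = 0\<close> on the diagonal.\<close>

lemma u_column:
 "AE p in lborel. p \<in> Omega_q \<epsilon> \<and> fst p < h \<longrightarrow> u p = - (LINT t|lborel. indicator {snd p..} t * uy (fst p, t))"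
proof -
 define R where "R = {0<..<h} \<times> {0<..<(2::real)}"
 have R: "R \<in> sets borel" by (simp add: R_def rect_borel)
 define z where "z p = indicator R p * u p" for p
 define kk where "kk p = indicator R p * uy p" for p
 have z: "integrable lborel z" and kk: "integrable lborel kk"
  unfolding z_def[abs_def] kk_def[abs_def] using R int int_u by (auto intro: int_restrict)
 have "AE p in lborel. p \<in> {0<..<h} \<times> {0<..<2} \<longrightarrow> z p = - (LINT t|lborel. indicator {snd p..} t * kk (fst p, t))"
 proof (rule column_from_top[OF z kk, of 0 1 2])
  show "(LINT p|lborel. z p * tens f (deriv g) p) = - (LINT p|lborel. kk p * tens f g p)"
   if f: "bump 0 h f" and g: "bump 0 2 g" for f g
  proof -
   have "tst z f (deriv g) = tst u f (deriv g)"
    by (rule tst_cong_AE[OF _ z int_u(1) f bump_deriv[OF g]])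
     (use tens_nz[OF _ f bump_deriv[OF g]] in \<open>auto simp: z_def R_def\<close>)
   moreover have "tst kk f g = tst uy f g"
    by (rule tst_cong_AE[OF _ kk int(2) f g]) (use tens_nz[OF _ f g] in \<open>auto simp: kk_def R_def\<close>)
   ultimately show ?thesis using diag_u[of f g] f g by (simp add: tst_def h_def)
  qed
  have "u p = 0 \<and> uy p = 0" if "1 < snd p" for p
   using supp[of p] mem_U_D[of "fst p" "snd p"] that by (cases "p \<in> Omega_q \<epsilon>") auto
  then show "AE p in lborel. 1 < snd p \<longrightarrow> z p = 0 \<and> kk p = 0" by (auto simp: z_def kk_def)
 qed (auto simp: z_def kk_def R_def)
 then show ?thesis
 proof eventually_elim
  case (elim p)
  show ?case
  proof
   assume p: "p \<in> Omega_q \<epsilon> \<and> fst p < h"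
   then have U: "0 < snd p" "snd p < fst p" "fst p < 1" using mem_U_D[of "fst p" "snd p"] by auto
   have "kk (fst p, t) = uy (fst p, t)" for t
    using p U supp[of "(fst p, t)"] mem_U_D[of "fst p" t] by (cases "(fst p, t) \<in> Omega_q \<epsilon>") (auto simp: kk_def R_def)
   then show "u p = - (LINT t|lborel. indicator {snd p..} t * uy (fst p, t))"
    using elim p U by (auto simp: z_def R_def mem_Times_iff)
  qed
 qed
qed

end

context reduced_system
begin

definition v0 :: real where
 "v0 = (SOME c. AE p in lborel. p \<in> Omega_q \<epsilon> \<and> fst p < h \<longrightarrow> v p = c)"

lemma v0: "AE p in lborel. p \<in> Omega_q \<epsilon> \<and> fst p < h \<longrightarrow> v p = v0"
proof -
 obtain c where c: "AE p in lborel. p \<in> Omega_q \<epsilon> \<and> fst p < h \<longrightarrow> v p = c" by (rule v_constant)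
 show ?thesis unfolding v0_def by (rule someI[of "\<lambda>c. AE p in lborel. p \<in> Omega_q \<epsilon> \<and> fst p < h \<longrightarrow> v p = c", OF c])
qed

text \<open>The coefficients of the cubic \<open>Hf z v0\<close>.  Those of \<open>Kf z v0\<close> differ only in the signs of \<open>a0\<close>
 and \<open>a2\<close>.\<close>

definition a0 where "a0 = k / 2 * (6 * A * v0 + 36 * C * v0 ^ 3 - 6 * B * v0\<^sup>2) / L2"
definition a1 where "a1 = k / 2 * (2 * A + 12 * C * v0\<^sup>2 + 4 * B * v0) / (2 + L2)"
definition a2 where "a2 = k / 2 * (12 * C * v0 + 2 * B) / L2"
definition a3 where "a3 = k / 2 * (4 * C) / (2 + L2)"

lemma a3_pos: "a3 > 0" using k C L2 by (simp add: a3_def)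

lemma Hf_v0: "Hf z v0 = cubic a0 a1 a2 a3 z"
 by (simp add: Hf_def Phi1_def Phi3_def cubic_def a0_def a1_def a2_def a3_def algebra_simps add_divide_distrib diff_divide_distrib
  power2_eq_square power3_eq_cube)

lemma Kf_v0: "Kf z v0 = cubic (- a0) a1 (- a2) a3 z"
 by (simp add: Kf_def Phi1_def Phi3_def cubic_def a0_def a1_def a2_def a3_def algebra_simps add_divide_distrib diff_divide_distrib
  power2_eq_square power3_eq_cube)

text \<open>The quadratic coefficient vanishes only at \<open>v0 = - B / (6 C)\<close>, where the linear one is negative.\<close>

lemma a1_a2: "\<not> (a1 = 0 \<and> a2 = 0)"
proof
 assume "a1 = 0 \<and> a2 = 0"
 then have "2 * A + 12 * C * v0\<^sup>2 + 4 * B * v0 = 0" and 2: "12 * C * v0 + 2 * B = 0"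
  using k L2 by (simp_all add: a1_def a2_def)
 moreover have "12 * C * v0\<^sup>2 + 4 * B * v0 = (12 * C * v0 + 2 * B) * v0 + 2 * B * v0"
  by (simp add: algebra_simps power2_eq_square)
 ultimately have "2 * A + 2 * B * v0 = 0" by simp
 moreover have "2 * B = - 12 * C * v0" using 2 by simp
 then have "2 * B * v0 = - 12 * (C * v0\<^sup>2)" by (simp add: power2_eq_square)
 moreover have "C * v0\<^sup>2 \<ge> 0" using C by simp
 ultimately show False using A by simp
qed

lemma cubic_cont: "continuous_on UNIV (cubic b0 b1 b2 b3)"
 unfolding cubic_def[abs_def] by (intro continuous_intros)

lemma columns:
 "AE x in lborel. 0 < x \<and> x < h \<longrightarrow>
  (\<exists>Y. column_bvp (cubic a0 a1 a2 a3) x Y \<and> (AE y in lborel. 0 < y \<and> y < x \<longrightarrow> u (x, y) = Y y))"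
proof -
 have uyc: "AE p in lborel. p \<in> Omega_q \<epsilon> \<and> fst p < h \<longrightarrow>
   uy p = (LINT t|lborel. indicator {..<snd p} t * Hf (u (fst p, t)) (v (fst p, t)))"
  by (rule AE_corner_from_rects[OF uy_column_rect])
 from AE_sections_fst[OF uyc] AE_sections_fst[OF u_column] AE_sections_fst[OF v0] fub_fst(3)[OF int(2)] fub_fst(3)[OF int_HK(1)]
 show ?thesis
 proof eventually_elim
  case (elim x)
  show ?case
  proof
   assume x: "0 < x \<and> x < h"
   have U: "(x, y) \<in> Omega_q \<epsilon> \<longleftrightarrow> 0 < y \<and> y < x" for y using mem_U_left x by simp
   have W0: "uy (x, t) = 0" if "t \<ge> x" for t using supp[of "(x, t)"] U that by auto
   have G0: "Hf (u (x, t)) (v (x, t)) = 0" if "t \<le> 0" for t using supp[of "(x, t)"] U that HK_zero by auto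
   obtain Y V where Y: "\<And>y. y \<in> {0..x} \<Longrightarrow> (Y has_real_derivative V y) (at y within {0..x})"
    "\<And>y. y \<in> {0..x} \<Longrightarrow> (V has_real_derivative cubic a0 a1 a2 a3 (Y y)) (at y within {0..x})"
    "V 0 = 0" "Y x = 0" "AE y in lborel. 0 < y \<and> y < x \<longrightarrow> u (x, y) = Y y"
   proof (rule column_solution[of x "cubic a0 a1 a2 a3" "\<lambda>t. uy (x, t)" "\<lambda>t. Hf (u (x, t)) (v (x, t))" "\<lambda>y. u (x, y)"])
    from elim(2) show "AE y in lborel. 0 < y \<and> y < x \<longrightarrow> u (x, y) = - (LINT t|lborel. indicator {y..} t * uy (x, t))"
     by eventually_elim (use U x in auto)
    from elim(1) show "AE y in lborel. 0 < y \<and> y < x \<longrightarrow> uy (x, y) = (LINT t|lborel. indicator {..<y} t * Hf (u (x, t)) (v (x, t)))"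
     by eventually_elim (use U x in auto)
    from elim(3) show "AE y in lborel. 0 < y \<and> y < x \<longrightarrow> Hf (u (x, y)) (v (x, y)) = cubic a0 a1 a2 a3 (u (x, y))"
     by eventually_elim (use U x Hf_v0 in auto)
   qed (use x elim W0 G0 cubic_cont in auto)
   then show "\<exists>Y. column_bvp (cubic a0 a1 a2 a3) x Y \<and> (AE y in lborel. 0 < y \<and> y < x \<longrightarrow> u (x, y) = Y y)"
    unfolding column_bvp_def by blast
  qed
 qed
qed

lemma AE_corner_from_columns:
 assumes m: "{p. p \<in> Omega_q \<epsilon> \<and> fst p < r \<longrightarrow> Q p} \<in> sets borel" and r: "r \<le> h"
  and ae: "AE x in lborel. 0 < x \<and> x < r \<longrightarrow> (AE y in lborel. 0 < y \<and> y < x \<longrightarrow> Q (x, y))"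
 shows "AE p in lborel. p \<in> Omega_q \<epsilon> \<and> fst p < r \<longrightarrow> Q p"
proof (rule AE_from_sections[OF m])
 from ae show "AE x in lborel. AE y in lborel. (x, y) \<in> Omega_q \<epsilon> \<and> fst (x, y) < r \<longrightarrow> Q (x, y)"
 proof eventually_elim
  case (elim x)
  show ?case
  proof (cases "0 < x \<and> x < r")
   case True
   with elim have "AE y in lborel. 0 < y \<and> y < x \<longrightarrow> Q (x, y)" by blast
   then show ?thesis by eventually_elim (use mem_U_D[of x] in auto)
  next
   case False
   then show ?thesis using mem_U_D[of x] by (intro AE_I2) (auto, fastforce)
  qed
 qed
qed

lemma fst_snd_borel [measurable]: "(fst :: real \<times> real \<Rightarrow> real) \<in> borel_measurable borel" "(snd :: real \<times> real \<Rightarrow> real) \<in> borel_measurable borel"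
 by (intro borel_measurable_continuous_onI continuous_on_fst continuous_on_snd continuous_on_id)+

text \<open>Almost every column of the corner triangle carries a solution of the boundary value problem of
 \<open>column_bounds\<close>, whose constants do not depend on the column.\<close>

lemma corner_expansion:
 obtains M where "M \<ge> 0" "AE p in lborel. p \<in> Omega_q \<epsilon> \<and> fst p < h \<longrightarrow>
   \<bar>u p\<bar> \<le> M * (fst p)\<^sup>2 \<and> \<bar>u p - a0 / 2 * ((snd p)\<^sup>2 - (fst p)\<^sup>2)\<bar> \<le> M * (fst p) ^ 4"
proof -
 obtain M L where M: "M \<ge> 0"
  "\<And>x Y y. 0 < x \<Longrightarrow> x \<le> 1 \<Longrightarrow> column_bvp (cubic a0 a1 a2 a3) x Y \<Longrightarrow> y \<in> {0..x} \<Longrightarrow>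
   \<bar>Y y\<bar> \<le> M * x\<^sup>2 \<and> \<bar>Y y - a0 / 2 * (y\<^sup>2 - x\<^sup>2)\<bar> \<le> M * x ^ 4"
  using column_bounds[OF a3_pos, of a0 a1 a2] by (metis (no_types, lifting))
 have "AE p in lborel. p \<in> Omega_q \<epsilon> \<and> fst p < h \<longrightarrow>
   \<bar>u p\<bar> \<le> M * (fst p)\<^sup>2 \<and> \<bar>u p - a0 / 2 * ((snd p)\<^sup>2 - (fst p)\<^sup>2)\<bar> \<le> M * (fst p) ^ 4"
 proof (rule AE_corner_from_columns)
  show "{p. p \<in> Omega_q \<epsilon> \<and> fst p < h \<longrightarrow>
   \<bar>u p\<bar> \<le> M * (fst p)\<^sup>2 \<and> \<bar>u p - a0 / 2 * ((snd p)\<^sup>2 - (fst p)\<^sup>2)\<bar> \<le> M * (fst p) ^ 4} \<in> sets borel"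
   by measurable
  from columns show "AE x in lborel. 0 < x \<and> x < h \<longrightarrow> (AE y in lborel. 0 < y \<and> y < x \<longrightarrow>
    \<bar>u (x, y)\<bar> \<le> M * (fst (x, y))\<^sup>2 \<and> \<bar>u (x, y) - a0 / 2 * ((snd (x, y))\<^sup>2 - (fst (x, y))\<^sup>2)\<bar> \<le> M * (fst (x, y)) ^ 4)"
  proof eventually_elim
   case (elim x)
   show ?case
   proof
    assume x: "0 < x \<and> x < h"
    with elim obtain Y where Y: "column_bvp (cubic a0 a1 a2 a3) x Y" "AE y in lborel. 0 < y \<and> y < x \<longrightarrow> u (x, y) = Y y" by blast
    from Y(2) show "AE y in lborel. 0 < y \<and> y < x \<longrightarrow>
     \<bar>u (x, y)\<bar> \<le> M * (fst (x, y))\<^sup>2 \<and> \<bar>u (x, y) - a0 / 2 * ((snd (x, y))\<^sup>2 - (fst (x, y))\<^sup>2)\<bar> \<le> M * (fst (x, y)) ^ 4"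
     by eventually_elim (use M(2)[OF _ _ Y(1)] x h in auto)
   qed
  qed
 qed simp
 with M(1) show ?thesis using that by blast
qed

lemma corner_vanishing:
 assumes "a0 = 0"
 obtains r where "0 < r" "r < h" "AE p in lborel. p \<in> Omega_q \<epsilon> \<and> fst p < r \<longrightarrow> u p = 0"
proof -
 obtain M L where L: "L \<ge> 0"
  "\<And>x Y y. 0 < x \<Longrightarrow> x \<le> 1 \<Longrightarrow> column_bvp (cubic a0 a1 a2 a3) x Y \<Longrightarrow> y \<in> {0..x} \<Longrightarrow>
   a0 = 0 \<Longrightarrow> L * x\<^sup>2 < 1 \<Longrightarrow> Y y = 0"
  using column_bounds[OF a3_pos, of a0 a1 a2] by (metis (no_types, lifting))
 define r where "r = min (h / 2) (1 / (L + 1))"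
 have r: "0 < r" "r < h" "r \<le> 1 / (L + 1)" using h L(1) by (auto simp: r_def)
 have Lx: "L * x\<^sup>2 < 1" if "0 < x" "x < r" for x
 proof -
  have "x < 1 / (L + 1)" using that r by linarith
  then have "(L + 1) * x < 1" using L(1) by (simp add: pos_less_divide_eq mult.commute)
  moreover have "x < 1" using that r h by simp
  then have "L * (x * x) \<le> L * (x * 1)" using that L(1) by (intro mult_left_mono) auto
  ultimately show ?thesis using that by (simp add: power2_eq_square algebra_simps)
 qed
 have "AE p in lborel. p \<in> Omega_q \<epsilon> \<and> fst p < r \<longrightarrow> u p = 0"
 proof (rule AE_corner_from_columns)
  show "{p. p \<in> Omega_q \<epsilon> \<and> fst p < r \<longrightarrow> u p = 0} \<in> sets borel" by measurable
  from columns show "AE x in lborel. 0 < x \<and> x < r \<longrightarrow> (AE y in lborel. 0 < y \<and> y < x \<longrightarrow> u (x, y) = 0)"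
  proof eventually_elim
   case (elim x)
   show ?case
   proof
    assume x: "0 < x \<and> x < r"
    with elim r obtain Y where Y: "column_bvp (cubic a0 a1 a2 a3) x Y" "AE y in lborel. 0 < y \<and> y < x \<longrightarrow> u (x, y) = Y y" by force
    from Y(2) show "AE y in lborel. 0 < y \<and> y < x \<longrightarrow> u (x, y) = 0"
     by eventually_elim (use L(2)[OF _ _ Y(1)] x h r assms Lx in auto)
   qed
  qed
 qed (use r in simp)
 with r show ?thesis using that by blast
qed

text \<open>The row and column equations compute \<open>\<partial>\<^sub>x\<^sup>2 \<partial>\<^sub>y\<^sup>2 u\<close> in two ways.\<close>

lemma compatibility:
 assumes b: "0 < b" "b < h" and f: "bump b h f" and g: "bump 0 b g"
 shows "tst (\<lambda>p. Kf (u p) (v p)) f (deriv (deriv g)) = tst (\<lambda>p. Hf (u p) (v p)) (deriv (deriv f)) g"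
proof -
 have b': "b \<le> 1 - \<epsilon>" and f1: "bump b 1 f" using b bump_mono[OF f, of b 1] h by (auto simp: h_def)
 have g1: "bump (- 1) b w" if "bump 0 b w" for w using bump_mono[OF that] by simp
 have "tst (\<lambda>p. Kf (u p) (v p)) f (deriv (deriv g)) = - tst ux (deriv f) (deriv (deriv g))"
  using EL_corner(2)[OF b f g1[OF bump_deriv[OF bump_deriv[OF g]]]] by simp
 also have "\<dots> = tst u (deriv (deriv f)) (deriv (deriv g))"
  using weak[OF b(1) b' bump_deriv[OF f1] bump_deriv[OF bump_deriv[OF g]]] by simp
 also have "\<dots> = - tst uy (deriv (deriv f)) (deriv g)"
  using weak[OF b(1) b' bump_deriv[OF bump_deriv[OF f1]] bump_deriv[OF g]] by simp
 also have "\<dots> = tst (\<lambda>p. Hf (u p) (v p)) (deriv (deriv f)) g"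
  using EL_corner(1)[OF b bump_deriv[OF bump_deriv[OF f]] g1[OF g]] by simp
 finally show ?thesis .
qed

end

section \<open>The leading term at the corner vanishes\<close>

lemma nonpos_if_le_square:
 fixes x K \<rho> :: real
 assumes "0 < \<rho>" "\<And>r. 0 < r \<Longrightarrow> r < \<rho> \<Longrightarrow> x \<le> K * r\<^sup>2"
 shows "x \<le> 0"
proof -
 have "((\<lambda>r. K * r\<^sup>2) \<longlongrightarrow> K * 0\<^sup>2) (at_right (0::real))" by (intro tendsto_intros)
 moreover have "\<forall>\<^sub>F r in at_right 0. x \<le> K * r\<^sup>2"
  using assms by (auto simp: eventually_at_right_field)
 ultimately have "x \<le> K * 0\<^sup>2" by (intro tendsto_lowerbound[of _ _ "at_right 0"]) auto
 then show ?thesis by simp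
qed

context reduced_system
begin

text \<open>Scaling the test functions to the corner, the leading term of each side of the
 compatibility identity is known explicitly, and their difference has to vanish.\<close>

lemma a0_zero: "a0 = 0"
proof (rule ccontr)
 assume a0: "a0 \<noteq> 0"
 obtain M where M: "M \<ge> 0" and uM: "AE p in lborel. p \<in> Omega_q \<epsilon> \<and> fst p < h \<longrightarrow>
   \<bar>u p\<bar> \<le> M * (fst p)\<^sup>2 \<and> \<bar>u p - a0 / 2 * ((snd p)\<^sup>2 - (fst p)\<^sup>2)\<bar> \<le> M * (fst p) ^ 4"
  by (rule corner_expansion)
 \<comment> \<open>The supports satisfy \<open>y < x\<close>, so the rescaled test functions live in the corner triangle.\<close>
 obtain f0 where f0: "bump 2 3 f0" "(LINT x|lborel. f0 x) = 1" "\<And>x. f0 x \<ge> 0" using bump_unit[of 2 3] by auto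
 obtain g0 where g0: "bump 0 1 g0" "(LINT x|lborel. g0 x) = 1" "\<And>x. g0 x \<ge> 0" using bump_unit[of 0 1] by auto
 define f2 where "f2 = deriv (deriv f0)"
 define g2 where "g2 = deriv (deriv g0)"
 have f2: "bump 2 3 f2" and g2: "bump 0 1 g2" unfolding f2_def g2_def by (intro bump_deriv f0 g0)+
 obtain Q1 Q2 Q3 Q4 where Q': "\<And>x. \<bar>f0 x\<bar> \<le> Q1" "\<And>x. \<bar>g0 x\<bar> \<le> Q2" "\<And>x. \<bar>f2 x\<bar> \<le> Q3" "\<And>x. \<bar>g2 x\<bar> \<le> Q4"
  using bump_bounded[OF f0(1)] bump_bounded[OF g0(1)] bump_bounded[OF f2] bump_bounded[OF g2] by metis
 define Q0 where "Q0 = max (max Q1 Q2) (max Q3 Q4)"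
 have Q0: "\<bar>f0 x\<bar> \<le> Q0" "\<bar>g0 x\<bar> \<le> Q0" "\<bar>f2 x\<bar> \<le> Q0" "\<bar>g2 x\<bar> \<le> Q0" for x
  using Q'[of x] by (auto simp: Q0_def)
 define m where "m = (LINT x|lborel. x ^ 2 * f0 x)"
 define m' where "m' = (LINT x|lborel. x ^ 2 * g0 x)"
 have "m \<ge> (LINT x|lborel. f0 x)" unfolding m_def
 proof (rule integral_mono)
  show "integrable lborel f0" by (rule bump_integrable[OF f0(1)])
  show "integrable lborel (\<lambda>x. x ^ 2 * f0 x)" by (rule integrable_power_bump[OF f0(1)])
  show "f0 x \<le> x ^ 2 * f0 x" for x
  proof (cases "x \<in> {2<..<3}")
   case True
   then have "1 \<le> x ^ 2" by (simp add: one_le_power)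
   from mult_right_mono[OF this f0(3)[of x]] show ?thesis by simp
  qed (use bump_zero[OF f0(1)] in simp)
 qed
 moreover have "m' \<ge> 0" unfolding m'_def using g0(3) by (intro integral_nonneg_AE) auto
 ultimately have mm: "m + m' \<ge> 1" using f0(2) by simp
 \<comment> \<open>The constants collect bounds of error terms; only their independence of \<open>r\<close> matters.\<close>
 define K1 where "K1 = (\<bar>a1\<bar> * (162 * M) + \<bar>a2\<bar> * (162 * M\<^sup>2) + \<bar>a3\<bar> * (1458 * M ^ 3)) * Q0\<^sup>2"
 define K2 where "K2 = (\<bar>a2\<bar> * (1458 * M * (M + \<bar>a0\<bar> / 2)) + \<bar>a3\<bar> * (1458 * M ^ 3)) * Q0\<^sup>2"
 have main: "\<bar>2 * a1 * a0\<bar> \<le> K1 * r\<^sup>2 \<and> (a1 = 0 \<longrightarrow> \<bar>a2\<bar> * (2 * a0\<^sup>2 * (m + m')) \<le> K2 * r\<^sup>2)"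
  if r: "0 < r" "r < h / 3" for r
 proof -
  have r1: "r < 1" "3 * r < h" "r * 2 < h" using r h by auto
  define S where "S = {2 * r<..<3 * r} \<times> {0<..<r}"
  define f where "f = (\<lambda>x. f0 (x / r))"
  define g where "g = (\<lambda>x. g0 (x / r))"
  have f: "bump (2 * r) (3 * r) f" and g: "bump 0 r g"
   using bump_scale(1)[OF f0(1) r(1)] bump_scale(1)[OF g0(1) r(1)] by (simp_all add: f_def g_def mult.commute)
  have dd: "deriv (deriv (\<lambda>x. w (x / r))) = (\<lambda>x. deriv (deriv w) (x / r) / r\<^sup>2)" if w: "bump a b w" for w a b
  proof -
   have "deriv (\<lambda>x. w (x / r)) = (\<lambda>x. (1 / r) * deriv w (x / r))"
    using bump_scale(2)[OF w r(1)] by simp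
   moreover have "deriv (\<lambda>x. (1 / r) * deriv w (x / r)) = (\<lambda>x. (1 / r) * (deriv (deriv w) (x / r) / r))"
   proof
    fix x
    have "smooth1 (\<lambda>x. deriv w (x / r))"
     using bump_smooth[OF bump_scale(1)[OF bump_deriv[OF w] r(1)]] .
    from smooth1_deriv(1)[OF this] have "((\<lambda>x. deriv w (x / r)) has_real_derivative deriv (deriv w) (x / r) / r) (at x)"
     unfolding bump_scale(2)[OF bump_deriv[OF w] r(1)] .
    from DERIV_cmult[OF this, of "1 / r"] show "deriv (\<lambda>x. (1 / r) * deriv w (x / r)) x = (1 / r) * (deriv (deriv w) (x / r) / r)"
     by (rule DERIV_imp_deriv)
   qed
   ultimately show ?thesis by (simp add: power2_eq_square)
  qed
  have df: "deriv (deriv f) = (\<lambda>x. f2 (x / r) / r\<^sup>2)" and dg: "deriv (deriv g) = (\<lambda>x. g2 (x / r) / r\<^sup>2)"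
   using dd[OF f0(1)] dd[OF g0(1)] by (simp_all add: f_def g_def f2_def g2_def)
  define F where "F = deriv (deriv f)"
  define G where "G = deriv (deriv g)"
  have F: "bump (2 * r) (3 * r) F" and G: "bump 0 r G" unfolding F_def G_def by (intro bump_deriv f g)+
  have fb: "\<bar>f x\<bar> \<le> Q0" "\<bar>g x\<bar> \<le> Q0" "\<bar>F x\<bar> \<le> Q0 / r\<^sup>2" "\<bar>G x\<bar> \<le> Q0 / r\<^sup>2" for x
  proof -
   have e: "F x = f2 (x / r) / r\<^sup>2" "G x = g2 (x / r) / r\<^sup>2" by (simp_all only: F_def G_def df dg)
   show "\<bar>f x\<bar> \<le> Q0" "\<bar>g x\<bar> \<le> Q0" using Q0 by (simp_all add: f_def g_def)
   show "\<bar>F x\<bar> \<le> Q0 / r\<^sup>2" "\<bar>G x\<bar> \<le> Q0 / r\<^sup>2" using Q0 r unfolding e by (simp_all add: divide_right_mono)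
  qed
  have SU: "p \<in> Omega_q \<epsilon> \<and> fst p < h" if "p \<in> S" for p
   using that r r1 mem_U_left[of "fst p" "snd p"] by (auto simp: S_def mem_Times_iff)
  have uS: "AE p in lborel. p \<in> S \<longrightarrow> \<bar>u p\<bar> \<le> 9 * M * r\<^sup>2 \<and> \<bar>u p - a0 / 2 * ((snd p)\<^sup>2 - (fst p)\<^sup>2)\<bar> \<le> 81 * M * r ^ 4"
   using uM
  proof eventually_elim
   case (elim p)
   show ?case
   proof
    assume p: "p \<in> S"
    then have x: "0 \<le> fst p" "fst p \<le> 3 * r" using r by (auto simp: S_def mem_Times_iff)
    have "M * (fst p)\<^sup>2 \<le> M * (3 * r)\<^sup>2" "M * (fst p) ^ 4 \<le> M * (3 * r) ^ 4"
     using x M by (intro mult_left_mono power_mono; simp)+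
    with elim SU[OF p] show "\<bar>u p\<bar> \<le> 9 * M * r\<^sup>2 \<and> \<bar>u p - a0 / 2 * ((snd p)\<^sup>2 - (fst p)\<^sup>2)\<bar> \<le> 81 * M * r ^ 4"
     by (simp add: power_mult_distrib)
   qed
  qed
  have bnd1: "\<bar>tst w f G\<bar> \<le> E * Q0\<^sup>2" if "integrable lborel (\<lambda>p. w p * tens f G p)"
   "AE p in lborel. p \<in> S \<longrightarrow> \<bar>w p\<bar> \<le> E" "E \<ge> 0" for w E
   using tst_bound[OF that(1) f G _ _ that(2)[unfolded S_def] fb(1) fb(4) that(3)] r
   by (simp add: power2_eq_square)
  have bnd2: "\<bar>tst w F g\<bar> \<le> E * Q0\<^sup>2" if "integrable lborel (\<lambda>p. w p * tens F g p)"
   "AE p in lborel. p \<in> S \<longrightarrow> \<bar>w p\<bar> \<le> E" "E \<ge> 0" for w E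
   using tst_bound[OF that(1) F g _ _ that(2)[unfolded S_def] fb(3) fb(2) that(3)] r
   by (simp add: power2_eq_square)
  have un: "integrable lborel (\<lambda>p. u p ^ n)" if "n \<in> {1, 2, 3}" for n
   using int_monomial[of n 0] that by auto
  have uf: "integrable lborel (\<lambda>p. u p ^ n * tens f G p)" "integrable lborel (\<lambda>p. u p ^ n * tens F g p)" if "n \<in> {1, 2, 3}" for n
   using integrable_mult_bumps[OF un[OF that] f G] integrable_mult_bumps[OF un[OF that] F g] .
  define T where "T n = tst (\<lambda>p. u p ^ n) f G" for n
  define R where "R n = tst (\<lambda>p. u p ^ n) F g" for n
  \<comment> \<open>The compatibility identity, expanded in powers of \<open>u\<close>.\<close>
  have expand: "tst (\<lambda>p. N (u p) (v p)) \<phi> \<psi> = c1 * tst (\<lambda>p. u p ^ 1) \<phi> \<psi> + c2 * tst (\<lambda>p. u p ^ 2) \<phi> \<psi> + c3 * tst (\<lambda>p. u p ^ 3) \<phi> \<psi>"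
   if N: "\<And>z. N z v0 = cubic c0 c1 c2 c3 z" and Ni: "integrable lborel (\<lambda>p. N (u p) (v p))"
    and \<phi>: "bump (2 * r) (3 * r) \<phi>" and \<psi>: "bump 0 r \<psi>"
    and 0: "(LINT x|lborel. \<phi> x) = 0 \<or> (LINT x|lborel. \<psi> x) = 0" for N c0 c1 c2 c3 \<phi> \<psi>
  proof -
   have i: "integrable lborel (\<lambda>p. u p ^ n * tens \<phi> \<psi> p)" if "n \<in> {1, 2, 3}" for n
    using integrable_mult_bumps[OF un[OF that] \<phi> \<psi>] .
   have i0: "integrable lborel (tens \<phi> \<psi>)" "(LINT p|lborel. tens \<phi> \<psi> p) = 0"
    using integrable_prod_real[OF bump_integrable[OF \<phi>] bump_integrable[OF \<psi>]] 0 by auto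
   have "tst (\<lambda>p. N (u p) (v p)) \<phi> \<psi> = (LINT p|lborel. c0 * tens \<phi> \<psi> p + c1 * (u p ^ 1 * tens \<phi> \<psi> p)
     + c2 * (u p ^ 2 * tens \<phi> \<psi> p) + c3 * (u p ^ 3 * tens \<phi> \<psi> p))"
    unfolding tst_def
   proof (rule integral_cong_AE)
    show "(\<lambda>p. N (u p) (v p) * tens \<phi> \<psi> p) \<in> borel_measurable lborel"
     using borel_measurable_integrable[OF integrable_mult_bumps[OF Ni \<phi> \<psi>]] .
    show "(\<lambda>p. c0 * tens \<phi> \<psi> p + c1 * (u p ^ 1 * tens \<phi> \<psi> p)
     + c2 * (u p ^ 2 * tens \<phi> \<psi> p) + c3 * (u p ^ 3 * tens \<phi> \<psi> p)) \<in> borel_measurable lborel"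
     using i[of 1] i[of 2] i[of 3] i0 by (intro borel_measurable_integrable Bochner_Integration.integrable_add integrable_mult_right) auto
    from v0 show "AE p in lborel. N (u p) (v p) * tens \<phi> \<psi> p = c0 * tens \<phi> \<psi> p + c1 * (u p ^ 1 * tens \<phi> \<psi> p)
     + c2 * (u p ^ 2 * tens \<phi> \<psi> p) + c3 * (u p ^ 3 * tens \<phi> \<psi> p)"
    proof eventually_elim
     case (elim p)
     show ?case
     proof (cases "tens \<phi> \<psi> p = 0")
      case False
      from tens_nz[OF False \<phi> \<psi>] SU have "p \<in> Omega_q \<epsilon> \<and> fst p < h" by (simp add: S_def)
      with elim N show ?thesis by (simp add: cubic_def algebra_simps)
     qed simp
    qed
   qed
   also have "\<dots> = c1 * tst (\<lambda>p. u p ^ 1) \<phi> \<psi> + c2 * tst (\<lambda>p. u p ^ 2) \<phi> \<psi> + c3 * tst (\<lambda>p. u p ^ 3) \<phi> \<psi>"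
    using i[of 1] i[of 2] i[of 3] i0 by (simp add: tst_def)
   finally show ?thesis .
  qed
  have F0: "(LINT x|lborel. F x) = 0" and G0: "(LINT x|lborel. G x) = 0"
   unfolding F_def G_def by (rule moment_deriv2(1)[OF f], rule moment_deriv2(1)[OF g])
  have bump_f: "bump (2 * r) h f" and bump_g: "bump 0 (2 * r) g" using bump_mono[OF f] bump_mono[OF g] r r1 by auto
  have "tst (\<lambda>p. Kf (u p) (v p)) f G = tst (\<lambda>p. Hf (u p) (v p)) F g"
   unfolding F_def G_def by (rule compatibility[OF _ _ bump_f bump_g]) (use r r1 in auto)
  then have id: "a1 * (T 1 - R 1) = a2 * (T 2 + R 2) + a3 * (R 3 - T 3)"
   using expand[of Kf "- a0" a1 "- a2" a3 f G, OF Kf_v0 int_HK(2) f G] G0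
    expand[of Hf a0 a1 a2 a3 F g, OF Hf_v0 int_HK(1) F g] F0
   by (simp add: T_def R_def algebra_simps)
  have ub: "AE p in lborel. p \<in> S \<longrightarrow> \<bar>u p ^ n\<bar> \<le> (9 * M * r\<^sup>2) ^ n" for n
   using uS by eventually_elim (auto simp: power_abs intro: power_mono)
  have TR: "\<bar>T n\<bar> \<le> (9 * M * r\<^sup>2) ^ n * Q0\<^sup>2" "\<bar>R n\<bar> \<le> (9 * M * r\<^sup>2) ^ n * Q0\<^sup>2" if "n \<in> {1, 2, 3}" for n
   unfolding T_def R_def using bnd1[OF uf(1)[OF that] ub] bnd2[OF uf(2)[OF that] ub] M by auto
  define q where "q p = (snd p)\<^sup>2 - (fst p)\<^sup>2" for p :: "real \<times> real"
  have qi: "integrable lborel (\<lambda>p. q p ^ n * tens \<phi> \<psi> p)" if "bump a b \<phi>" "bump c d \<psi>" "n \<in> {1, 2}" for n \<phi> \<psi> a b c d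
  proof -
   have "integrable lborel (\<lambda>p. (fst p ^ 0 * snd p ^ 2) * tens \<phi> \<psi> p - (fst p ^ 2 * snd p ^ 0) * tens \<phi> \<psi> p)"
    "integrable lborel (\<lambda>p. (fst p ^ 0 * snd p ^ 4) * tens \<phi> \<psi> p
      - 2 * ((fst p ^ 2 * snd p ^ 2) * tens \<phi> \<psi> p) + (fst p ^ 4 * snd p ^ 0) * tens \<phi> \<psi> p)"
    by (intro Bochner_Integration.integrable_add Bochner_Integration.integrable_diff integrable_mult_right tst_monomial(1)[OF that(1,2)])+
   then show ?thesis using that(3)
    by (auto simp: q_def algebra_simps power2_eq_square power4_eq_xxxx)
  qed
  have lead1: "T 1 - R 1 = 2 * a0 * r\<^sup>2 + (tst (\<lambda>p. u p - a0 / 2 * q p) f G - tst (\<lambda>p. u p - a0 / 2 * q p) F g)"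
  proof -
   have "tst (\<lambda>p. u p - a0 / 2 * q p) \<phi> \<psi> = tst (\<lambda>p. u p ^ 1) \<phi> \<psi> - a0 / 2 * tst q \<phi> \<psi>"
    if \<phi>: "bump a b \<phi>" and \<psi>: "bump c d \<psi>" for \<phi> \<psi> a b c d
    using integrable_mult_bumps[OF un[of 1] \<phi> \<psi>] qi[OF \<phi> \<psi>, of 1]
    by (simp add: tst_def left_diff_distrib mult.assoc)
   note e = this[OF f G] this[OF F g]
   have "tst q f G - tst q F g = 4 * r\<^sup>2"
    using wave_quadratic[OF f g] integral_scale[OF r(1), of f0] integral_scale[OF r(1), of g0] f0(2) g0(2)
    by (simp add: q_def[abs_def] F_def G_def f_def g_def power2_eq_square)
   then show ?thesis unfolding e T_def R_def by (simp add: algebra_simps)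
  qed
  have e1: "\<bar>tst (\<lambda>p. u p - a0 / 2 * q p) f G\<bar> \<le> 81 * M * r ^ 4 * Q0\<^sup>2" "\<bar>tst (\<lambda>p. u p - a0 / 2 * q p) F g\<bar> \<le> 81 * M * r ^ 4 * Q0\<^sup>2"
  proof -
   have i: "integrable lborel (\<lambda>p. (u p - a0 / 2 * q p) * tens \<phi> \<psi> p)"
    if \<phi>: "bump a b \<phi>" and \<psi>: "bump c d \<psi>" for \<phi> \<psi> a b c d
    using integrable_mult_bumps[OF un[of 1] \<phi> \<psi>] qi[OF \<phi> \<psi>, of 1]
    by (simp add: left_diff_distrib mult.assoc)
   have le: "AE p in lborel. p \<in> S \<longrightarrow> \<bar>u p - a0 / 2 * q p\<bar> \<le> 81 * M * r ^ 4"
    using uS by eventually_elim (simp add: q_def)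
   show "\<bar>tst (\<lambda>p. u p - a0 / 2 * q p) f G\<bar> \<le> 81 * M * r ^ 4 * Q0\<^sup>2" "\<bar>tst (\<lambda>p. u p - a0 / 2 * q p) F g\<bar> \<le> 81 * M * r ^ 4 * Q0\<^sup>2"
    using bnd1[OF i[OF f G] le] bnd2[OF i[OF F g] le] M by simp_all
  qed
  have r64: "r ^ 6 \<le> r ^ 4" using r r1 by (intro power_decreasing) auto
  have p6: "(9 * M * r\<^sup>2) ^ 3 = 729 * M ^ 3 * r ^ 6" "(9 * M * r\<^sup>2) ^ 2 = 81 * M\<^sup>2 * r ^ 4"
   by (simp_all add: power_mult_distrib flip: power_mult)
  have b2: "\<bar>T 2 + R 2\<bar> \<le> 162 * M\<^sup>2 * Q0\<^sup>2 * r ^ 4"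
   using TR[of 2] unfolding p6 by (simp add: algebra_simps)
  have b3: "\<bar>R 3 - T 3\<bar> \<le> 1458 * M ^ 3 * Q0\<^sup>2 * r ^ 6"
   using TR[of 3] unfolding p6 by (simp add: algebra_simps)
  have b3': "1458 * M ^ 3 * Q0\<^sup>2 * r ^ 6 \<le> 1458 * M ^ 3 * Q0\<^sup>2 * r ^ 4"
   using r64 M by (intro mult_left_mono) auto
  have r4: "r ^ 4 = r\<^sup>2 * r\<^sup>2" by (simp add: power4_eq_xxxx power2_eq_square)
  have r2: "r\<^sup>2 > 0" using r by simp
  have first: "\<bar>2 * a1 * a0\<bar> \<le> K1 * r\<^sup>2"
  proof -
   define e where "e = tst (\<lambda>p. u p - a0 / 2 * q p) f G - tst (\<lambda>p. u p - a0 / 2 * q p) F g"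
   have e: "\<bar>e\<bar> \<le> 162 * M * Q0\<^sup>2 * r ^ 4" using e1 unfolding e_def by (simp add: algebra_simps)
   have "2 * a1 * a0 * r\<^sup>2 = a1 * (T 1 - R 1) - a1 * e" unfolding lead1 e_def[symmetric] by (simp add: algebra_simps)
   also have "\<dots> = a2 * (T 2 + R 2) + a3 * (R 3 - T 3) - a1 * e" using id by simp
   finally have "\<bar>2 * a1 * a0 * r\<^sup>2\<bar> \<le> \<bar>a2\<bar> * \<bar>T 2 + R 2\<bar> + \<bar>a3\<bar> * \<bar>R 3 - T 3\<bar> + \<bar>a1\<bar> * \<bar>e\<bar>"
    by (simp flip: abs_mult)
   also have "\<dots> \<le> \<bar>a2\<bar> * (162 * M\<^sup>2 * Q0\<^sup>2 * r ^ 4) + \<bar>a3\<bar> * (1458 * M ^ 3 * Q0\<^sup>2 * r ^ 4) + \<bar>a1\<bar> * (162 * M * Q0\<^sup>2 * r ^ 4)"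
    using b2 b3 b3' e by (intro add_mono mult_left_mono) auto
   also have "\<dots> = K1 * r\<^sup>2 * r\<^sup>2" unfolding r4 K1_def by (simp add: algebra_simps)
   finally have "\<bar>2 * a1 * a0\<bar> * r\<^sup>2 \<le> K1 * r\<^sup>2 * r\<^sup>2" by (simp add: abs_mult)
   then show ?thesis using r2 by (simp only: mult_le_cancel_right_pos)
  qed
  have second: "\<bar>a2\<bar> * (2 * a0\<^sup>2 * (m + m')) \<le> K2 * r\<^sup>2" if a1: "a1 = 0"
  proof -
   define w where "w p = u p ^ 2 - (a0 / 2 * q p) ^ 2" for p
   have we: "w p = u p ^ 2 - (a0\<^sup>2 / 4) * q p ^ 2" for p by (simp add: w_def power_mult_distrib power_divide)
   have i: "integrable lborel (\<lambda>p. w p * tens \<phi> \<psi> p)"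
    if \<phi>: "bump a b \<phi>" and \<psi>: "bump c d \<psi>" for \<phi> \<psi> a b c d
    using integrable_mult_bumps[OF un[of 2] \<phi> \<psi>] qi[OF \<phi> \<psi>, of 2] unfolding we
    by (simp add: left_diff_distrib mult.assoc)
   have ts: "tst w \<phi> \<psi> = tst (\<lambda>p. u p ^ 2) \<phi> \<psi> - a0\<^sup>2 / 4 * tst (\<lambda>p. q p ^ 2) \<phi> \<psi>"
    if \<phi>: "bump a b \<phi>" and \<psi>: "bump c d \<psi>" for \<phi> \<psi> a b c d
    using integrable_mult_bumps[OF un[of 2] \<phi> \<psi>] qi[OF \<phi> \<psi>, of 2] unfolding tst_def we
    by (simp add: left_diff_distrib mult.assoc)
   define E where "E = 729 * M * (M + \<bar>a0\<bar> / 2) * r ^ 6"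
   have E0: "E \<ge> 0" using M by (simp add: E_def)
   have le: "AE p in lborel. p \<in> S \<longrightarrow> \<bar>w p\<bar> \<le> E"
    using uS
   proof eventually_elim
    case (elim p)
    show ?case
    proof
     assume p: "p \<in> S"
     then have x: "0 \<le> fst p" "fst p \<le> 3 * r" "0 \<le> snd p" "snd p \<le> fst p" using r by (auto simp: S_def mem_Times_iff)
     have "(fst p)\<^sup>2 \<le> (3 * r)\<^sup>2" "(snd p)\<^sup>2 \<le> (fst p)\<^sup>2" using x by (intro power_mono; simp)+
     moreover have "(snd p)\<^sup>2 \<ge> 0" "(3 * r)\<^sup>2 = 9 * r\<^sup>2" by (simp_all add: power_mult_distrib)
     ultimately have qb: "\<bar>q p\<bar> \<le> 9 * r\<^sup>2" unfolding q_def by linarith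
     have "\<bar>a0 / 2 * q p\<bar> \<le> \<bar>a0\<bar> / 2 * (9 * r\<^sup>2)" using qb by (simp add: abs_mult mult_left_mono)
     moreover have "\<bar>u p\<bar> \<le> 9 * M * r\<^sup>2" using elim p by blast
     moreover have "9 * (M + \<bar>a0\<bar> / 2) * r\<^sup>2 = 9 * M * r\<^sup>2 + \<bar>a0\<bar> / 2 * (9 * r\<^sup>2)" by (simp add: algebra_simps)
     ultimately have s: "\<bar>u p + a0 / 2 * q p\<bar> \<le> 9 * (M + \<bar>a0\<bar> / 2) * r\<^sup>2"
      using abs_triangle_ineq[of "u p" "a0 / 2 * q p"] by linarith
     have "w p = (u p - a0 / 2 * q p) * (u p + a0 / 2 * q p)" by (simp add: w_def algebra_simps power2_eq_square)
     then have "\<bar>w p\<bar> = \<bar>u p - a0 / 2 * q p\<bar> * \<bar>u p + a0 / 2 * q p\<bar>" by (simp add: abs_mult)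
     also have "\<dots> \<le> (81 * M * r ^ 4) * (9 * (M + \<bar>a0\<bar> / 2) * r\<^sup>2)"
      using elim p s M by (intro mult_mono) (auto simp: q_def)
     also have "\<dots> = 81 * M * (9 * (M + \<bar>a0\<bar> / 2)) * (r ^ 4 * r ^ 2)" by simp
     also have "r ^ 4 * r ^ 2 = r ^ 6" by (simp flip: power_add)
     finally show "\<bar>w p\<bar> \<le> E" by (simp add: E_def algebra_simps)
    qed
   qed
   have "tst (\<lambda>p. q p ^ 2) f G + tst (\<lambda>p. q p ^ 2) F g = 8 * (m + m') * r ^ 4"
   proof -
    have sc: "(LINT x|lborel. x ^ 2 * w (x / r)) = r ^ 3 * (LINT x|lborel. x ^ 2 * w x)" for w :: "real \<Rightarrow> real"
    proof -
     have "(LINT x|lborel. x ^ 2 * w (x / r)) = (LINT x|lborel. r ^ 2 * ((x / r) ^ 2 * w (x / r)))"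
      using r by (intro Bochner_Integration.integral_cong) (auto simp: power_divide)
     also have "\<dots> = r ^ 2 * (LINT x|lborel. ((x / r) ^ 2 * w (x / r)))" by simp
     also have "(LINT x|lborel. ((x / r) ^ 2 * w (x / r))) = r * (LINT x|lborel. x ^ 2 * w x)"
      by (rule integral_scale[OF r(1), of "\<lambda>x. x ^ 2 * w x"])
     finally show ?thesis by (simp add: power3_eq_cube power2_eq_square)
    qed
    show ?thesis
     using laplace_quartic[OF f g] integral_scale[OF r(1), of f0] integral_scale[OF r(1), of g0] f0(2) g0(2) sc[of f0] sc[of g0]
     by (simp add: q_def[abs_def] F_def G_def f_def g_def m_def m'_def power4_eq_xxxx power3_eq_cube algebra_simps)
   qed
   then have "a0\<^sup>2 / 4 * tst (\<lambda>p. q p ^ 2) f G + a0\<^sup>2 / 4 * tst (\<lambda>p. q p ^ 2) F g = 2 * a0\<^sup>2 * (m + m') * r ^ 4"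
    by (simp only: distrib_left[symmetric])
   then have "T 2 + R 2 = 2 * a0\<^sup>2 * (m + m') * r ^ 4 + (tst w f G + tst w F g)"
    unfolding T_def R_def ts[OF f G] ts[OF F g] by linarith
   then have "a2 * (2 * a0\<^sup>2 * (m + m')) * r ^ 4 = a3 * (T 3 - R 3) - a2 * (tst w f G + tst w F g)"
    using id a1 by (simp add: algebra_simps)
   then have "\<bar>a2 * (2 * a0\<^sup>2 * (m + m')) * r ^ 4\<bar> \<le> \<bar>a3\<bar> * \<bar>R 3 - T 3\<bar> + \<bar>a2\<bar> * \<bar>tst w f G + tst w F g\<bar>"
    using abs_triangle_ineq4[of "a3 * (T 3 - R 3)" "a2 * (tst w f G + tst w F g)"]
    by (simp add: abs_mult abs_minus_commute[of "T 3"])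
   also have "\<dots> \<le> \<bar>a3\<bar> * (1458 * M ^ 3 * Q0\<^sup>2 * r ^ 6) + \<bar>a2\<bar> * (2 * (E * Q0\<^sup>2))"
    using b3 bnd1[OF i[OF f G] le E0] bnd2[OF i[OF F g] le E0] by (intro add_mono mult_left_mono) auto
   also have "\<dots> = K2 * r\<^sup>2 * r ^ 4"
   proof -
    have "r ^ 6 = r\<^sup>2 * r ^ 4" by (simp flip: power_add)
    then show ?thesis unfolding E_def K2_def by (simp add: algebra_simps)
   qed
   finally have "(\<bar>a2\<bar> * (2 * a0\<^sup>2 * (m + m'))) * r ^ 4 \<le> K2 * r\<^sup>2 * r ^ 4" using mm by (simp add: abs_mult)
   moreover have "r ^ 4 > 0" using r by simp
   ultimately show ?thesis by (simp only: mult_le_cancel_right_pos)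
  qed
  show ?thesis using first second by blast
 qed
 have "\<bar>2 * a1 * a0\<bar> \<le> 0" by (rule nonpos_if_le_square[of "h / 3" _ K1]) (use main h in auto)
 then have a1: "a1 = 0" using a0 by simp
 have "\<bar>a2\<bar> * (2 * a0\<^sup>2 * (m + m')) \<le> 0" by (rule nonpos_if_le_square[of "h / 3" _ K2]) (use main a1 h in auto)
 moreover have "2 * a0\<^sup>2 * (m + m') > 0" using a0 mm by simp
 ultimately have "\<bar>a2\<bar> \<le> 0" by (meson mult_le_0_iff not_less)
 then have "a2 = 0" by simp
 with a1 a1_a2 show False by blast
qed

end

section \<open>Propagation to the right edge\<close>

text \<open>Functions of two variables that are Lipschitz continuous on bounded sets.\<close>

definition lip2 :: "(real \<Rightarrow> real \<Rightarrow> real) \<Rightarrow> bool" where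
 "lip2 N \<longleftrightarrow> (\<forall>M. \<exists>\<Lambda>\<ge>0. \<forall>a c a' c'. \<bar>a\<bar> \<le> M \<longrightarrow> \<bar>c\<bar> \<le> M \<longrightarrow> \<bar>a'\<bar> \<le> M \<longrightarrow> \<bar>c'\<bar> \<le> M \<longrightarrow>
   \<bar>N a c - N a' c'\<bar> \<le> \<Lambda> * (\<bar>a - a'\<bar> + \<bar>c - c'\<bar>))"

lemma lip2_const: "lip2 (\<lambda>_ _. x)" unfolding lip2_def by (auto intro!: exI[of _ 0])
lemma lip2_fst: "lip2 (\<lambda>a _. a)" unfolding lip2_def by (auto intro!: exI[of _ 1])
lemma lip2_snd: "lip2 (\<lambda>_ c. c)" unfolding lip2_def by (auto intro!: exI[of _ 1])

lemma lip2_add: assumes "lip2 N" "lip2 N'" shows "lip2 (\<lambda>a c. N a c + N' a c)"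
 unfolding lip2_def
proof
 fix M
 obtain L where L: "L \<ge> 0" "\<forall>a c a' c'. \<bar>a\<bar> \<le> M \<longrightarrow> \<bar>c\<bar> \<le> M \<longrightarrow> \<bar>a'\<bar> \<le> M \<longrightarrow> \<bar>c'\<bar> \<le> M \<longrightarrow>
   \<bar>N a c - N a' c'\<bar> \<le> L * (\<bar>a - a'\<bar> + \<bar>c - c'\<bar>)" using assms(1)[unfolded lip2_def, rule_format, of M] by blast
 obtain L' where L': "L' \<ge> 0" "\<forall>a c a' c'. \<bar>a\<bar> \<le> M \<longrightarrow> \<bar>c\<bar> \<le> M \<longrightarrow> \<bar>a'\<bar> \<le> M \<longrightarrow> \<bar>c'\<bar> \<le> M \<longrightarrow>
   \<bar>N' a c - N' a' c'\<bar> \<le> L' * (\<bar>a - a'\<bar> + \<bar>c - c'\<bar>)" using assms(2)[unfolded lip2_def, rule_format, of M] by blast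
 show "\<exists>\<Lambda>\<ge>0. \<forall>a c a' c'. \<bar>a\<bar> \<le> M \<longrightarrow> \<bar>c\<bar> \<le> M \<longrightarrow> \<bar>a'\<bar> \<le> M \<longrightarrow> \<bar>c'\<bar> \<le> M \<longrightarrow>
   \<bar>N a c + N' a c - (N a' c' + N' a' c')\<bar> \<le> \<Lambda> * (\<bar>a - a'\<bar> + \<bar>c - c'\<bar>)"
 proof (intro exI[of _ "L + L'"] conjI allI impI)
  fix a c a' c' assume *: "\<bar>a\<bar> \<le> M" "\<bar>c\<bar> \<le> M" "\<bar>a'\<bar> \<le> M" "\<bar>c'\<bar> \<le> M"
  have "\<bar>N a c + N' a c - (N a' c' + N' a' c')\<bar> \<le> \<bar>N a c - N a' c'\<bar> + \<bar>N' a c - N' a' c'\<bar>" by linarith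
  also have "\<dots> \<le> L * (\<bar>a - a'\<bar> + \<bar>c - c'\<bar>) + L' * (\<bar>a - a'\<bar> + \<bar>c - c'\<bar>)"
   by (rule add_mono[OF L(2)[rule_format, OF *] L'(2)[rule_format, OF *]])
  finally show "\<bar>N a c + N' a c - (N a' c' + N' a' c')\<bar> \<le> (L + L') * (\<bar>a - a'\<bar> + \<bar>c - c'\<bar>)" by (simp add: distrib_right)
 qed (use L L' in simp)
qed

lemma lip2_mult: assumes "lip2 N" "lip2 N'" shows "lip2 (\<lambda>a c. N a c * N' a c)"
 unfolding lip2_def
proof
 fix M
 obtain L where L: "L \<ge> 0" "\<forall>a c a' c'. \<bar>a\<bar> \<le> M \<longrightarrow> \<bar>c\<bar> \<le> M \<longrightarrow> \<bar>a'\<bar> \<le> M \<longrightarrow> \<bar>c'\<bar> \<le> M \<longrightarrow>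
   \<bar>N a c - N a' c'\<bar> \<le> L * (\<bar>a - a'\<bar> + \<bar>c - c'\<bar>)" using assms(1)[unfolded lip2_def, rule_format, of M] by blast
 obtain L' where L': "L' \<ge> 0" "\<forall>a c a' c'. \<bar>a\<bar> \<le> M \<longrightarrow> \<bar>c\<bar> \<le> M \<longrightarrow> \<bar>a'\<bar> \<le> M \<longrightarrow> \<bar>c'\<bar> \<le> M \<longrightarrow>
   \<bar>N' a c - N' a' c'\<bar> \<le> L' * (\<bar>a - a'\<bar> + \<bar>c - c'\<bar>)" using assms(2)[unfolded lip2_def, rule_format, of M] by blast
 have bd: "\<bar>T a c\<bar> \<le> \<bar>T 0 0\<bar> + K * (M + M)"
  if K: "K \<ge> 0" "\<forall>a c a' c'. \<bar>a\<bar> \<le> M \<longrightarrow> \<bar>c\<bar> \<le> M \<longrightarrow> \<bar>a'\<bar> \<le> M \<longrightarrow> \<bar>c'\<bar> \<le> M \<longrightarrow>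
   \<bar>T a c - T a' c'\<bar> \<le> K * (\<bar>a - a'\<bar> + \<bar>c - c'\<bar>)" and ac: "\<bar>a\<bar> \<le> M" "\<bar>c\<bar> \<le> M" for T K a c
 proof -
  have "\<bar>T a c - T 0 0\<bar> \<le> K * (\<bar>a\<bar> + \<bar>c\<bar>)" using K(2)[rule_format, of a c 0 0] ac by simp
  also have "\<dots> \<le> K * (M + M)" using K ac by (intro mult_left_mono) auto
  finally show ?thesis by linarith
 qed
 define B where "B = \<bar>N 0 0\<bar> + L * (M + M)"
 define B' where "B' = \<bar>N' 0 0\<bar> + L' * (M + M)"
 show "\<exists>\<Lambda>\<ge>0. \<forall>a c a' c'. \<bar>a\<bar> \<le> M \<longrightarrow> \<bar>c\<bar> \<le> M \<longrightarrow> \<bar>a'\<bar> \<le> M \<longrightarrow> \<bar>c'\<bar> \<le> M \<longrightarrow>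
   \<bar>N a c * N' a c - N a' c' * N' a' c'\<bar> \<le> \<Lambda> * (\<bar>a - a'\<bar> + \<bar>c - c'\<bar>)"
 proof (intro exI[of _ "L * \<bar>B'\<bar> + L' * \<bar>B\<bar>"] conjI allI impI)
  fix a c a' c' assume *: "\<bar>a\<bar> \<le> M" "\<bar>c\<bar> \<le> M" "\<bar>a'\<bar> \<le> M" "\<bar>c'\<bar> \<le> M"
  define D where "D = \<bar>a - a'\<bar> + \<bar>c - c'\<bar>"
  have "N a c * N' a c - N a' c' * N' a' c' = (N a c - N a' c') * N' a c + N a' c' * (N' a c - N' a' c')"
   by (simp add: algebra_simps)
  then have "\<bar>N a c * N' a c - N a' c' * N' a' c'\<bar> \<le> \<bar>N a c - N a' c'\<bar> * \<bar>N' a c\<bar> + \<bar>N a' c'\<bar> * \<bar>N' a c - N' a' c'\<bar>"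
   by (simp flip: abs_mult)
  also have "\<dots> \<le> (L * D) * \<bar>B'\<bar> + \<bar>B\<bar> * (L' * D)"
  proof (intro add_mono mult_mono)
   show "\<bar>N a c - N a' c'\<bar> \<le> L * D" "\<bar>N' a c - N' a' c'\<bar> \<le> L' * D"
    unfolding D_def by (rule L(2)[rule_format, OF *], rule L'(2)[rule_format, OF *])
   show "\<bar>N' a c\<bar> \<le> \<bar>B'\<bar>" using bd[OF L' *(1,2)] unfolding B'_def by (rule order_trans[OF _ abs_ge_self])
   show "\<bar>N a' c'\<bar> \<le> \<bar>B\<bar>" using bd[OF L *(3,4)] unfolding B_def by (rule order_trans[OF _ abs_ge_self])
  qed (use L(1) in \<open>auto simp: D_def\<close>)
  finally show "\<bar>N a c * N' a c - N a' c' * N' a' c'\<bar> \<le> (L * \<bar>B'\<bar> + L' * \<bar>B\<bar>) * (\<bar>a - a'\<bar> + \<bar>c - c'\<bar>)"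
   by (simp add: D_def algebra_simps)
 qed (use L L' in simp)
qed

lemma lip2_diff: assumes "lip2 N" "lip2 N'" shows "lip2 (\<lambda>a c. N a c - N' a c)"
 using lip2_add[OF assms(1) lip2_mult[OF lip2_const[of "-1"] assms(2)]] by simp

lemma lip2_bound:
 assumes "lip2 N" obtains \<Lambda> where "\<Lambda> \<ge> 0" "\<And>a c a' c'. \<bar>a\<bar> \<le> M \<Longrightarrow> \<bar>c\<bar> \<le> M \<Longrightarrow> \<bar>a'\<bar> \<le> M \<Longrightarrow> \<bar>c'\<bar> \<le> M \<Longrightarrow>
   \<bar>N a c - N a' c'\<bar> \<le> \<Lambda> * (\<bar>a - a'\<bar> + \<bar>c - c'\<bar>)"
 using assms[unfolded lip2_def, rule_format, of M] by blast

lemma double_integral_bound: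
 fixes f N :: "real \<Rightarrow> real"
 assumes f: "continuous_on {b..1} f" and N: "continuous_on {b..1} N" and b: "0 \<le> b"
  and le: "\<And>t. t \<in> {b..1} \<Longrightarrow> \<bar>f t\<bar> \<le> \<Lambda> * N t" and N0: "\<And>t. t \<in> {b..1} \<Longrightarrow> N t \<ge> 0" and L: "\<Lambda> \<ge> 0"
  and x: "x \<in> {b..1}"
 shows "\<bar>integral {b..x} (\<lambda>\<tau>. integral {b..\<tau>} f)\<bar> \<le> \<Lambda> * integral {b..x} N"
proof -
 have Ni: "N integrable_on {b..\<tau>}" and fi: "f integrable_on {b..\<tau>}" if "\<tau> \<le> 1" for \<tau>
  using that N f by (auto intro!: integrable_continuous_real intro: continuous_on_subset)
 have inner: "\<bar>integral {b..\<tau>} f\<bar> \<le> \<Lambda> * integral {b..x} N" if "\<tau> \<in> {b..x}" for \<tau>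
 proof -
  have t1: "\<tau> \<le> 1" using that x by simp
  have "norm (integral {b..\<tau>} f) \<le> integral {b..\<tau>} (\<lambda>t. \<Lambda> * N t)"
   using fi[OF t1] Ni[OF t1] le t1 by (intro integral_norm_bound_integral integrable_on_mult_right) auto
  also have "\<dots> = \<Lambda> * integral {b..\<tau>} N" by simp
  also have "integral {b..\<tau>} N \<le> integral {b..x} N"
   using that x N0 Ni by (intro integral_subset_le) auto
  finally show ?thesis using L by (simp add: mult_left_mono)
 qed
 have nn: "0 \<le> \<Lambda> * integral {b..x} N" using inner[of b] x by force
 have "continuous_on {b..1} (\<lambda>\<tau>. integral {b..\<tau>} f)"
  using fi[of 1] by (intro indefinite_integral_continuous_1) simp
 then have "(\<lambda>\<tau>. integral {b..\<tau>} f) integrable_on {b..x}"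
  using x by (intro integrable_continuous_real) (auto intro: continuous_on_subset)
 then have "norm (integral {b..x} (\<lambda>\<tau>. integral {b..\<tau>} f)) \<le> integral {b..x} (\<lambda>_. \<Lambda> * integral {b..x} N)"
  using inner by (intro integral_norm_bound_integral) auto
 also have "\<dots> = (x - b) * (\<Lambda> * integral {b..x} N)" using x by simp
 also have "\<dots> \<le> 1 * (\<Lambda> * integral {b..x} N)" using x b nn by (intro mult_right_mono) auto
 finally show ?thesis by simp
qed

context reduced_system
begin

lemma lip2_Phi: "lip2 (Phi1 A B C)" "lip2 (Phi3 A B C)"
 unfolding Phi1_def[abs_def] Phi3_def[abs_def] power2_eq_square
 by (intro lip2_add lip2_diff lip2_mult lip2_const lip2_fst lip2_snd)+

lemma lip2_HK: "lip2 Hf" "lip2 Kf"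
 unfolding Hf_def[abs_def] Kf_def[abs_def] divide_inverse
 by (intro lip2_add lip2_diff lip2_mult lip2_const lip2_Phi)+

lemma HK_cont: "continuous_on S f \<Longrightarrow> continuous_on S g \<Longrightarrow> continuous_on S (\<lambda>x. Hf (f x) (g x))"
 "continuous_on S f \<Longrightarrow> continuous_on S g \<Longrightarrow> continuous_on S (\<lambda>x. Kf (f x) (g x))"
 unfolding Hf_def Kf_def Phi1_def Phi3_def divide_inverse by (intro continuous_intros; assumption)+

lemma HK_v0: "Hf 0 v0 = 0" "Kf 0 v0 = 0"
 using a0_zero by (simp_all add: Hf_v0 Kf_v0 cubic_def)

text \<open>Left of \<open>r\<close> all data are trivial: \<open>u = 0\<close>, \<open>v = v0\<close>.  In the strip below, \<open>v\<close> depends on \<open>x\<close>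
 alone, so that \<open>u\<^sub>x\<^sub>x = cb v\<^sub>x\<^sub>x + Kf u v\<close> is an ordinary differential equation on each row, with the same initial
 values on all rows.  By uniqueness \<open>u\<close> depends on \<open>x\<close> alone.  Then \<open>ca v\<^sub>x\<^sub>x = Hf u v\<close>, and the pair
 \<open>(u, v)\<close> solves a system with equilibrium \<open>(0, v0)\<close>; it stays there up to \<open>x = 1\<close>, against
 \<open>u = - s / 2\<close> on the right edge.\<close>

lemma contradiction: False
proof -
 obtain r where r: "0 < r" "r < h" and ur: "AE p in lborel. p \<in> Omega_q \<epsilon> \<and> fst p < r \<longrightarrow> u p = 0"
  by (rule corner_vanishing[OF a0_zero])
 define b where "b = r / 2"
 have b: "0 < b" "b < r" "b < h" "b \<le> h" "b < 1" "b \<le> 1 - \<epsilon>" using r h by (auto simp: b_def h_def)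
 define R where "R = {b<..<1} \<times> {0<..<b}"
 have Rb: "R \<in> sets borel" by (simp add: R_def rect_borel)
 have RU: "p \<in> Omega_q \<epsilon>" if "p \<in> R" for p
  using mem_U_rect[of b "fst p" "snd p"] that b by (auto simp: R_def mem_Times_iff)
 obtain P where P: "integrable lborel P" "\<forall>x. x \<notin> {b<..<1} \<longrightarrow> P x = 0"
  "AE p in lborel. p \<in> {b<..<1} \<times> {0<..<b} \<longrightarrow> vx p = P (fst p)"
  "AE p in lborel. p \<in> {b<..<1} \<times> {0<..<b} \<longrightarrow> v p = - s / 6 - integral {fst p..1} P"
  by (rule vx_rows[OF b(1,4)])
 define F where "F x = - s / 6 - integral {x..1} P" for x
 have vF: "AE p in lborel. p \<in> R \<longrightarrow> v p = F (fst p)" using P(4) by (simp add: F_def R_def)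
 have Pi: "P integrable_on {x..y}" for x y using lborel_integral_eq_integral(2)[OF P(1)] by simp
 have Fc: "continuous_on {b..1} F"
  unfolding F_def by (intro continuous_intros indefinite_integral_continuous_1' Pi)
 have FP: "F x = F b + integral {b..x} P" if "x \<in> {b..1}" for x
  using Henstock_Kurzweil_Integration.integral_combine[of b x 1 P] that Pi by (simp add: F_def)
 have left: "AE p in lborel. p \<in> R \<and> fst p < r \<longrightarrow> u p = 0 \<and> v p = v0 \<and> vx p = 0"
  using ur v0 vx_zero by eventually_elim (use RU r in auto)
 have Fb: "F b = v0"
 proof -
  from left vF P(3) have "AE p in lborel. p \<in> R \<and> fst p < r \<longrightarrow> F (fst p) = v0 \<and> P (fst p) = 0"
   by eventually_elim (auto simp: R_def)
  from AE_lborel_witness[OF AE_sections_snd[OF this] b(1)] obtain y where y: "0 < y" "y < b"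
   "AE x in lborel. (x, y) \<in> R \<and> fst (x, y) < r \<longrightarrow> F (fst (x, y)) = v0 \<and> P (fst (x, y)) = 0" by auto
  from y(3) have ae: "AE x in lborel. b < x \<and> x < r \<longrightarrow> F x = v0 \<and> P x = 0"
   by eventually_elim (use y r h in \<open>auto simp: R_def\<close>)
  obtain x where x: "b < x" "x < r" "b < x \<and> x < r \<longrightarrow> F x = v0 \<and> P x = 0" by (rule AE_lborel_witness[OF ae b(2)])
  have "AE t in lborel. b < t \<and> t < r \<longrightarrow> P t = 0" using ae by eventually_elim auto
  then have "integral {b..x} P = integral {b..x} (\<lambda>_. 0)" using x by (intro AE_integral_cong) auto
  then show ?thesis using FP[of x] x r h by simp
 qed
 \<comment> \<open>Left of \<open>r\<close> the derivative of \<open>u\<close> vanishes as well.\<close>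
 have ux0: "AE p in lborel. p \<in> {b<..<x1} \<times> {0<..<b} \<longrightarrow> ux p = 0"
  if x1: "x1 \<le> 1" and z: "AE p in lborel. p \<in> R \<and> fst p < x1 \<longrightarrow> u p = 0" for x1
 proof (rule fundamental_lemma)
  show "integrable lborel (\<lambda>p. indicator ({b<..<x1} \<times> {0<..<b}) p * ux p)" by (intro int_restrict int rect_borel)
  fix f g assume f: "bump b x1 f" and g: "bump 0 b g"
  have f1: "bump b 1 f" using bump_mono[OF f] x1 by simp
  have "(LINT p|lborel. indicator ({b<..<x1} \<times> {0<..<b}) p * ux p * tens f g p) = tst ux f g"
   unfolding tst_def using tens_nz[OF _ f g] by (intro Bochner_Integration.integral_cong) (auto simp: indicator_def)
  also have "\<dots> = - tst u (deriv f) g" using weak[OF b(1,6) f1 g] by simp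
  also have "tst u (deriv f) g = tst (\<lambda>_. 0) (deriv f) g"
  proof (rule tst_cong_AE[OF _ int_u(1) _ bump_deriv[OF f] g])
   from z show "AE p in lborel. tens (deriv f) g p \<noteq> 0 \<longrightarrow> u p = 0"
    by eventually_elim (use tens_nz[OF _ bump_deriv[OF f] g] x1 in \<open>force simp: R_def mem_Times_iff\<close>)
  qed simp
  finally show "(LINT p|lborel. indicator ({b<..<x1} \<times> {0<..<b}) p * ux p * tens f g p) = 0" by (simp add: tst_zero)
 qed
 have uxl: "AE p in lborel. p \<in> {b<..<r} \<times> {0<..<b} \<longrightarrow> ux p = 0"
  by (rule ux0) (use left r h in \<open>auto elim: eventually_mono\<close>)
 have tR: "tst (\<lambda>p. indicator R p * w p) f g = tst w f g" if "bump b 1 f" "bump 0 b g" "integrable lborel w" for w f g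
  by (rule tst_cong_AE[OF _ int_restrict[OF that(3) Rb] that(3,1,2)]) (use tens_nz[OF _ that(1,2)] in \<open>auto simp: R_def\<close>)
 have g1: "bump (- 1) b g" if "bump 0 b g" for g using bump_mono[OF that] by simp
 define kk where "kk p = indicator R p * Kf (u p) (v p)" for p
 define zz where "zz p = indicator R p * (ux p - cb * vx p)" for p
 define ku where "ku p = indicator R p * ux p" for p
 define zu where "zu p = indicator R p * u p" for p
 have ki: "integrable lborel kk" "integrable lborel zz" "integrable lborel ku" "integrable lborel zu"
  unfolding kk_def[abs_def] zz_def[abs_def] ku_def[abs_def] zu_def[abs_def]
  using int int_HK int_u Rb by (auto intro!: int_restrict)
 have row1: "AE p in lborel. p \<in> {b<..<1} \<times> {0<..<b} \<longrightarrow> zz p = primx kk p"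
 proof (rule row_from_left[OF ki(2,1) b(2)])
  show "(LINT p|lborel. zz p * tens (deriv f) g p) = - (LINT p|lborel. kk p * tens f g p)"
   if f: "bump b 1 f" and g: "bump 0 b g" for f g
  proof -
   have "tst zz (deriv f) g = tst (\<lambda>p. ux p - cb * vx p) (deriv f) g"
    unfolding zz_def[abs_def] using int by (intro tR[OF bump_deriv[OF f] g]) auto
   also have "\<dots> = tst ux (deriv f) g - cb * tst vx (deriv f) g"
    using tst_add[OF int(1) int(3) bump_deriv[OF f] g, of 1 "- cb"] by simp
   also have "\<dots> = - tst (\<lambda>p. Kf (u p) (v p)) f g" using EL_col(2)[OF b(1,4) f g1[OF g]] by simp
   also have "\<dots> = - tst kk f g" unfolding kk_def[abs_def] using tR[OF f g int_HK(2)] by simp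
   finally show ?thesis by (simp add: tst_def)
  qed
  from left uxl show "AE p in lborel. fst p < r \<longrightarrow> zz p = 0 \<and> kk p = 0"
   by eventually_elim (use HK_v0 in \<open>auto simp: zz_def kk_def R_def indicator_def mem_Times_iff\<close>)
 qed (use r h in \<open>auto simp: zz_def kk_def R_def\<close>)
 have row2: "AE p in lborel. p \<in> {b<..<1} \<times> {0<..<b} \<longrightarrow> zu p = primx ku p"
 proof (rule row_from_left[OF ki(4,3) b(2)])
  show "(LINT p|lborel. zu p * tens (deriv f) g p) = - (LINT p|lborel. ku p * tens f g p)"
   if f: "bump b 1 f" and g: "bump 0 b g" for f g
   using tR[OF bump_deriv[OF f] g int_u(1)] tR[OF f g int(1)] weak[OF b(1,6) f g]
   by (simp add: tst_def zu_def[abs_def] ku_def[abs_def])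
  from left uxl show "AE p in lborel. fst p < r \<longrightarrow> zu p = 0 \<and> ku p = 0"
   by eventually_elim (auto simp: zu_def ku_def R_def indicator_def mem_Times_iff)
 qed (use r h in \<open>auto simp: zu_def ku_def R_def\<close>)
 \<comment> \<open>Almost every row is a classical solution of an integral equation with the same \<open>F\<close>.\<close>
 define row where "row Y \<longleftrightarrow> continuous_on {b..1} Y \<and> (\<forall>x\<in>{b..1}. Y x = cb * (F x - v0)
   + integral {b..x} (\<lambda>\<tau>. integral {b..\<tau>} (\<lambda>t. Kf (Y t) (F t))))" for Y
 have rows: "AE y in lborel. 0 < y \<and> y < b \<longrightarrow> (\<exists>Y. row Y \<and> (AE x in lborel. b < x \<and> x < 1 \<longrightarrow> u (x, y) = Y x))"
  using AE_sections_snd[OF row1] AE_sections_snd[OF row2] AE_sections_snd[OF vF] AE_sections_snd[OF P(3)]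
   fub_snd(3)[OF ki(1)] fub_snd(3)[OF ki(3)]
 proof eventually_elim
  case (elim y)
  show ?case
  proof
   assume y: "0 < y \<and> y < b"
   have z: "kk (t, y) = 0" "ku (t, y) = 0" if "t \<le> b" for t using that by (auto simp: kk_def ku_def R_def)
   have pk: "(LINT t|lborel. indicator {..<x} t * kk (t, y)) = integral {b..x} (\<lambda>t. kk (t, y))"
    "(LINT t|lborel. indicator {..<x} t * ku (t, y)) = integral {b..x} (\<lambda>t. ku (t, y))" if "b \<le> x" for x
    using prim_eq_integral[OF elim(5) z(1) that] prim_eq_integral[OF elim(6) z(2) that] by auto
   define K1 where "K1 x = integral {b..x} (\<lambda>t. kk (t, y))" for x
   define Y where "Y x = integral {b..x} (\<lambda>t. cb * P t + K1 t)" for x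
   have kki: "(\<lambda>t. kk (t, y)) integrable_on {b..1}" using lborel_integral_eq_integral(2)[OF elim(5)] by simp
   have K1c: "continuous_on {b..1} K1" unfolding K1_def by (rule indefinite_integral_continuous_1[OF kki])
   have K1i: "K1 integrable_on {b..x}" if "x \<le> 1" for x
    using that by (intro integrable_continuous_real continuous_on_subset[OF K1c]) auto
   have PKi: "(\<lambda>t. cb * P t + K1 t) integrable_on {b..x}" if "x \<le> 1" for x
    using Pi K1i[OF that] by (intro integrable_add integrable_on_mult_right)
   have Yc: "continuous_on {b..1} Y" unfolding Y_def by (rule indefinite_integral_continuous_1[OF PKi]) simp
   have kuK: "AE t in lborel. b < t \<and> t < 1 \<longrightarrow> ku (t, y) = cb * P t + K1 t"
    using elim(1,4)
   proof eventually_elim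
    case (elim t)
    then show ?case using y pk(1)[of t]
     by (auto simp: primx_def zz_def ku_def R_def K1_def)
   qed
   have uY: "AE x in lborel. b < x \<and> x < 1 \<longrightarrow> u (x, y) = Y x"
    using elim(2)
   proof eventually_elim
    case (elim x)
    show ?case
    proof
     assume x: "b < x \<and> x < 1"
     have "u (x, y) = integral {b..x} (\<lambda>t. ku (t, y))"
      using elim x y pk(2)[of x]
      by (auto simp: primx_def zu_def R_def)
     also have "\<dots> = Y x" unfolding Y_def using x by (intro AE_integral_cong[OF kuK]) auto
     finally show "u (x, y) = Y x" .
    qed
   qed
   have kkY: "AE t in lborel. b < t \<and> t < 1 \<longrightarrow> kk (t, y) = Kf (Y t) (F t)"
    using uY elim(3) by eventually_elim (use y in \<open>auto simp: kk_def R_def\<close>)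
   have "row Y" unfolding row_def
   proof (intro conjI ballI Yc)
    fix x assume x: "x \<in> {b..1}"
    have "Y x = cb * integral {b..x} P + integral {b..x} K1"
     unfolding Y_def using x integrable_on_mult_right[OF Pi[of b x], of cb] K1i
     by (subst Henstock_Kurzweil_Integration.integral_add) auto
    also have "integral {b..x} K1 = integral {b..x} (\<lambda>\<tau>. integral {b..\<tau>} (\<lambda>t. Kf (Y t) (F t)))"
     unfolding K1_def using x
     by (intro Henstock_Kurzweil_Integration.integral_cong AE_integral_cong[OF kkY]) auto
    finally show "Y x = cb * (F x - v0) + integral {b..x} (\<lambda>\<tau>. integral {b..\<tau>} (\<lambda>t. Kf (Y t) (F t)))"
     using FP[OF x] Fb by simp
   qed
   with uY show "\<exists>Y. row Y \<and> (AE x in lborel. b < x \<and> x < 1 \<longrightarrow> u (x, y) = Y x)" by blast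
  qed
 qed
 have bounded: "\<exists>M. \<forall>x\<in>{b..1}. \<bar>Y x\<bar> \<le> M" if "continuous_on {b..1} Y" for Y :: "real \<Rightarrow> real"
 proof -
  have "bounded (Y ` {b..1})" by (intro compact_imp_bounded compact_continuous_image that) simp
  then show ?thesis by (auto simp: bounded_iff)
 qed
 have unique: "Y1 x = Y2 x" if Y1: "row Y1" and Y2: "row Y2" and x: "x \<in> {b..1}" for Y1 Y2 x
 proof -
  have c: "continuous_on {b..1} Y1" "continuous_on {b..1} Y2" using Y1 Y2 by (auto simp: row_def)
  obtain M1 M2 M3 where M': "\<forall>x\<in>{b..1}. \<bar>Y1 x\<bar> \<le> M1" "\<forall>x\<in>{b..1}. \<bar>Y2 x\<bar> \<le> M2" "\<forall>x\<in>{b..1}. \<bar>F x\<bar> \<le> M3"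
   using bounded[OF c(1)] bounded[OF c(2)] bounded[OF Fc] by blast
  define M where "M = max M1 (max M2 M3)"
  have M: "\<bar>Y1 x\<bar> \<le> M" "\<bar>Y2 x\<bar> \<le> M" "\<bar>F x\<bar> \<le> M" if "x \<in> {b..1}" for x
   using M' that unfolding M_def by (auto simp: le_max_iff_disj)
  obtain L where L: "L \<ge> 0" "\<And>a c a' c'. \<bar>a\<bar> \<le> M \<Longrightarrow> \<bar>c\<bar> \<le> M \<Longrightarrow> \<bar>a'\<bar> \<le> M \<Longrightarrow> \<bar>c'\<bar> \<le> M \<Longrightarrow>
   \<bar>Kf a c - Kf a' c'\<bar> \<le> L * (\<bar>a - a'\<bar> + \<bar>c - c'\<bar>)" using lip2_bound[OF lip2_HK(2), of M] by metis
  define N where "N t = \<bar>Y1 t - Y2 t\<bar>" for t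
  define f where "f t = Kf (Y1 t) (F t) - Kf (Y2 t) (F t)" for t
  have Nc: "continuous_on {b..1} N" unfolding N_def by (intro continuous_intros c)
  have fc: "continuous_on {b..1} f" unfolding f_def by (intro continuous_intros HK_cont c Fc)
  have Kc: "continuous_on {b..1} (\<lambda>t. Kf (Y t) (F t))" if "continuous_on {b..1} Y" for Y by (intro HK_cont that Fc)
  have Ki: "(\<lambda>t. Kf (Y t) (F t)) integrable_on {b..\<tau>}" if "continuous_on {b..1} Y" "\<tau> \<le> 1" for Y \<tau>
   using that by (intro integrable_continuous_real continuous_on_subset[OF Kc]) auto
  have KKi: "(\<lambda>\<tau>. integral {b..\<tau>} (\<lambda>t. Kf (Y t) (F t))) integrable_on {b..x}" if "continuous_on {b..1} Y" "x \<le> 1" for Y x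
   using that by (intro integrable_continuous_real continuous_on_subset[OF indefinite_integral_continuous_1[OF Ki[of Y 1]]]) auto
  have "N x = 0"
  proof (rule gronwall_zero[OF Nc _ _ L(1) x])
   show "N t \<ge> 0" for t by (simp add: N_def)
   fix x assume x: "x \<in> {b..1}"
   have "Y1 x - Y2 x = integral {b..x} (\<lambda>\<tau>. integral {b..\<tau>} (\<lambda>t. Kf (Y1 t) (F t))) - integral {b..x} (\<lambda>\<tau>. integral {b..\<tau>} (\<lambda>t. Kf (Y2 t) (F t)))"
    using Y1 Y2 x by (simp add: row_def)
   also have "\<dots> = integral {b..x} (\<lambda>\<tau>. integral {b..\<tau>} (\<lambda>t. Kf (Y1 t) (F t)) - integral {b..\<tau>} (\<lambda>t. Kf (Y2 t) (F t)))"
    using KKi[OF c(1)] KKi[OF c(2)] x by (subst Henstock_Kurzweil_Integration.integral_diff) auto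
   also have "\<dots> = integral {b..x} (\<lambda>\<tau>. integral {b..\<tau>} f)"
    unfolding f_def using x Ki[OF c(1)] Ki[OF c(2)]
    by (intro Henstock_Kurzweil_Integration.integral_cong) (auto simp: Henstock_Kurzweil_Integration.integral_diff)
   finally have "N x = \<bar>integral {b..x} (\<lambda>\<tau>. integral {b..\<tau>} f)\<bar>" by (simp add: N_def)
   also have "\<dots> \<le> L * integral {b..x} N"
   proof (rule double_integral_bound[OF fc Nc _ _ _ L(1) x])
    show "\<bar>f t\<bar> \<le> L * N t" if "t \<in> {b..1}" for t
     using L(2)[OF M(1)[OF that] M(3)[OF that] M(2)[OF that] M(3)[OF that]] by (simp add: f_def N_def)
   qed (use b in \<open>auto simp: N_def\<close>)
   finally show "N x \<le> L * integral {b..x} N" .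
  qed
  then show ?thesis by (simp add: N_def)
 qed
 obtain Y where Y: "row Y"
 proof -
  obtain y where "0 < y" "y < b" "0 < y \<and> y < b \<longrightarrow> (\<exists>Y. row Y \<and> (AE x in lborel. b < x \<and> x < 1 \<longrightarrow> u (x, y) = Y x))"
   by (rule AE_lborel_witness[OF rows b(1)])
  then show ?thesis using that by blast
 qed
 have Yc: "continuous_on {b..1} Y" using Y by (simp add: row_def)
 have uY: "AE p in lborel. p \<in> R \<longrightarrow> u p = Y (fst p)"
 proof -
  define Y' where "Y' x = indicator {b..1} x *\<^sub>R Y x" for x
  have Y'm: "Y' \<in> borel_measurable borel"
   unfolding Y'_def by (intro borel_measurable_continuous_on_indicator Yc) auto
  have [measurable]: "(\<lambda>p::real\<times>real. Y' (snd p)) \<in> borel_measurable borel"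
   using borel_measurable_tens[of "\<lambda>_. 1" Y'] Y'm by (simp add: tens_def[abs_def])
  have [measurable]: "(\<lambda>p. u (prod.swap p)) \<in> borel_measurable borel"
   by (rule measurable_compose[OF _ meas(1)]) (intro borel_measurable_continuous_onI continuous_on_swap)
  have "AE p in lborel. p \<in> {0<..<b} \<times> {b<..<1} \<longrightarrow> u (prod.swap p) = Y' (snd p)"
  proof (rule AE_from_sections)
   have [measurable]: "{0<..<b} \<times> {b<..<1} \<in> sets (borel :: (real \<times> real) measure)" by (rule rect_borel)
   show "{p. p \<in> {0<..<b} \<times> {b<..<1} \<longrightarrow> u (prod.swap p) = Y' (snd p)} \<in> sets borel" by measurable
   from rows show "AE y in lborel. AE x in lborel. (y, x) \<in> {0<..<b} \<times> {b<..<1} \<longrightarrow> u (prod.swap (y, x)) = Y' (snd (y, x))"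
   proof eventually_elim
    case (elim y)
    show ?case
    proof (cases "0 < y \<and> y < b")
     case True
     with elim obtain Z where Z: "row Z" "AE x in lborel. b < x \<and> x < 1 \<longrightarrow> u (x, y) = Z x" by blast
     from Z(2) show ?thesis by eventually_elim (use unique[OF Z(1) Y] in \<open>auto simp: Y'_def\<close>)
    qed auto
   qed
  qed
  from AE_swap[OF this] show ?thesis by eventually_elim (auto simp: R_def Y'_def)
 qed
 \<comment> \<open>Since \<open>u\<close> does not depend on \<open>y\<close>, the column equation determines \<open>F''\<close>.\<close>
 define hh where "hh p = indicator R p * (Hf (u p) (v p) / ca)" for p
 define zv where "zv p = indicator R p * vx p" for p
 have hi: "integrable lborel hh" "integrable lborel zv"
  unfolding hh_def[abs_def] zv_def[abs_def] using int int_HK Rb by (auto intro!: int_restrict)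
 have row3: "AE p in lborel. p \<in> {b<..<1} \<times> {0<..<b} \<longrightarrow> zv p = primx hh p"
 proof (rule row_from_left[OF hi(2,1) b(2)])
  show "(LINT p|lborel. zv p * tens (deriv f) g p) = - (LINT p|lborel. hh p * tens f g p)"
   if f: "bump b 1 f" and g: "bump 0 b g" for f g
  proof -
   have "tst uy f (deriv g) = - tst u f (deriv (deriv g))" using weak[OF b(1,6) f bump_deriv[OF g]] by simp
   also have "tst u f (deriv (deriv g)) = 0"
   proof -
    define G where "G = deriv (deriv g)"
    have G: "bump 0 b G" "(LINT x|lborel. G x) = 0" unfolding G_def
     by (intro bump_deriv g) (rule moment_deriv2(1)[OF g])
    have i: "integrable lborel (\<lambda>p. u p * tens f G p)" by (rule integrable_mult_bumps[OF int_u(1) f G(1)])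
    have "(LINT y|lborel. LINT x|lborel. u (x, y) * tens f G (x, y)) = (LINT y|lborel. G y * (LINT x|lborel. f x * Y x))"
    proof (rule integral_cong_AE)
     show "(\<lambda>y. LINT x|lborel. u (x, y) * tens f G (x, y)) \<in> borel_measurable lborel"
      using borel_measurable_integrable[OF fub_snd(2)[OF i]] .
     show "(\<lambda>y. G y * (LINT x|lborel. f x * Y x)) \<in> borel_measurable lborel"
      using borel_measurable_times[OF smooth1_borel[OF bump_smooth[OF G(1)]] borel_measurable_const] by simp
     from AE_sections_snd[OF uY] fub_snd(3)[OF i] show "AE y in lborel. (LINT x|lborel. u (x, y) * tens f G (x, y)) = G y * (LINT x|lborel. f x * Y x)"
     proof eventually_elim
      case (elim y)
      have "(LINT x|lborel. u (x, y) * tens f G (x, y)) = (LINT x|lborel. G y * (f x * Y x))"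
      proof (rule integral_cong_AE)
       show "(\<lambda>x. u (x, y) * tens f G (x, y)) \<in> borel_measurable lborel" using elim(2) by auto
       have "(\<lambda>x. f x * (indicator {b..1} x *\<^sub>R Y x)) \<in> borel_measurable borel"
        using Yc by (intro borel_measurable_times borel_measurable_continuous_on_indicator smooth1_borel bump_smooth[OF f]) auto
       also have "(\<lambda>x. f x * (indicator {b..1} x *\<^sub>R Y x)) = (\<lambda>x. f x * Y x)"
       proof
        fix x show "f x * (indicator {b..1} x *\<^sub>R Y x) = f x * Y x" using bump_zero[OF f, of x] by (cases "x \<in> {b..1}") auto
       qed
       finally show "(\<lambda>x. G y * (f x * Y x)) \<in> borel_measurable lborel" by simp
       from elim(1) show "AE x in lborel. u (x, y) * tens f G (x, y) = G y * (f x * Y x)"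
       proof eventually_elim
        case (elim x)
        then show ?case using tens_nz[OF _ f G(1), of "(x, y)"]
         by (cases "tens f G (x, y) = 0") (auto simp: R_def tens_def)
       qed
      qed
      then show ?case by simp
     qed
    qed
    also have "\<dots> = 0" using G(2) by simp
    finally show ?thesis using fub_snd(1)[OF i] by (simp add: tst_def G_def)
   qed
   finally have "ca * tst vx (deriv f) g = - tst (\<lambda>p. Hf (u p) (v p)) f g" using EL_col(1)[OF b(1,4) f g1[OF g]] by simp
   then have "tst vx (deriv f) g = - tst (\<lambda>p. Hf (u p) (v p)) f g / ca" using ca_nz by (simp add: field_simps)
   moreover have "tst (\<lambda>p. Hf (u p) (v p) / ca) f g = tst (\<lambda>p. Hf (u p) (v p)) f g / ca"
    by (simp add: tst_def)
   moreover have "tst hh f g = tst (\<lambda>p. Hf (u p) (v p) / ca) f g" "tst zv (deriv f) g = tst vx (deriv f) g"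
    unfolding hh_def[abs_def] zv_def[abs_def]
    by (rule tR[OF f g], use int_HK in simp, rule tR[OF bump_deriv[OF f] g int(3)])
   ultimately show ?thesis by (simp add: tst_def)
  qed
  from left show "AE p in lborel. fst p < r \<longrightarrow> zv p = 0 \<and> hh p = 0"
   by eventually_elim (use HK_v0 in \<open>auto simp: zv_def hh_def indicator_def\<close>)
 qed (use r h in \<open>auto simp: zv_def hh_def R_def\<close>)
 define HH where "HH x = integral {b..x} (\<lambda>t. Hf (Y t) (F t))" for x
 have HHeq: "F x - v0 = integral {b..x} HH / ca" if x: "x \<in> {b..1}" for x
 proof -
  from AE_sections_snd[OF row3] AE_sections_snd[OF uY] AE_sections_snd[OF vF] AE_sections_snd[OF P(3)] fub_snd(3)[OF hi(1)]
  have "AE y in lborel. 0 < y \<and> y < b \<longrightarrow> (AE x in lborel. b < x \<and> x < 1 \<longrightarrow> P x = HH x / ca)"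
  proof eventually_elim
   case (elim y)
   show ?case
   proof
    assume y: "0 < y \<and> y < b"
    have z: "hh (t, y) = 0" if "t \<le> b" for t using that by (auto simp: hh_def R_def)
    have hY: "AE t in lborel. b < t \<and> t < 1 \<longrightarrow> hh (t, y) = Hf (Y t) (F t) / ca"
     using elim(2,3) by eventually_elim (use y in \<open>auto simp: hh_def R_def\<close>)
    have pk: "(LINT t|lborel. indicator {..<x} t * hh (t, y)) = integral {b..x} (\<lambda>t. hh (t, y))" if "b \<le> x" for x
     using prim_eq_integral[OF elim(5) z that] by auto
    from elim(1,4) show "AE x in lborel. b < x \<and> x < 1 \<longrightarrow> P x = HH x / ca"
    proof eventually_elim
     case (elim x)
     show ?case
     proof
      assume x: "b < x \<and> x < 1"
      have "P x = integral {b..x} (\<lambda>t. hh (t, y))"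
       using elim x y pk[of x]
       by (auto simp: primx_def zv_def R_def)
      also have "\<dots> = integral {b..x} (\<lambda>t. Hf (Y t) (F t) / ca)" using x by (intro AE_integral_cong[OF hY]) auto
      finally show "P x = HH x / ca" by (simp add: HH_def)
     qed
    qed
   qed
  qed
  then obtain y where "0 < y" "y < b" "0 < y \<and> y < b \<longrightarrow> (AE x in lborel. b < x \<and> x < 1 \<longrightarrow> P x = HH x / ca)"
   by (rule AE_lborel_witness[OF _ b(1)])
  then have "integral {b..x} P = integral {b..x} (\<lambda>x. HH x / ca)" using x by (intro AE_integral_cong) auto
  then show ?thesis using FP[OF x] Fb by simp
 qed
 have Y0: "Y x = 0" if x: "x \<in> {b..1}" for x
 proof -
  obtain M1 M2 where M': "\<forall>x\<in>{b..1}. \<bar>Y x\<bar> \<le> M1" "\<forall>x\<in>{b..1}. \<bar>F x\<bar> \<le> M2"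
   using bounded[OF Yc] bounded[OF Fc] by blast
  define M where "M = max M1 (max M2 \<bar>v0\<bar>)"
  have M: "\<bar>Y x\<bar> \<le> M" "\<bar>F x\<bar> \<le> M" if "x \<in> {b..1}" for x
   using M' that unfolding M_def by (auto simp: le_max_iff_disj)
  have M0: "\<bar>v0\<bar> \<le> M" "\<bar>0\<bar> \<le> M" unfolding M_def by (auto simp: le_max_iff_disj)
  obtain L1 where L1: "L1 \<ge> 0" "\<And>a c a' c'. \<bar>a\<bar> \<le> M \<Longrightarrow> \<bar>c\<bar> \<le> M \<Longrightarrow> \<bar>a'\<bar> \<le> M \<Longrightarrow> \<bar>c'\<bar> \<le> M \<Longrightarrow>
   \<bar>Kf a c - Kf a' c'\<bar> \<le> L1 * (\<bar>a - a'\<bar> + \<bar>c - c'\<bar>)" using lip2_bound[OF lip2_HK(2), of M] by metis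
  obtain L2' where L2': "L2' \<ge> 0" "\<And>a c a' c'. \<bar>a\<bar> \<le> M \<Longrightarrow> \<bar>c\<bar> \<le> M \<Longrightarrow> \<bar>a'\<bar> \<le> M \<Longrightarrow> \<bar>c'\<bar> \<le> M \<Longrightarrow>
   \<bar>Hf a c - Hf a' c'\<bar> \<le> L2' * (\<bar>a - a'\<bar> + \<bar>c - c'\<bar>)" using lip2_bound[OF lip2_HK(1), of M] by metis
  define N where "N t = \<bar>Y t\<bar> + \<bar>F t - v0\<bar>" for t
  have Nc: "continuous_on {b..1} N" unfolding N_def by (intro continuous_intros Yc Fc)
  have N0: "N t \<ge> 0" for t by (simp add: N_def)
  have Kle: "\<bar>Kf (Y t) (F t)\<bar> \<le> L1 * N t" and Hle: "\<bar>Hf (Y t) (F t)\<bar> \<le> L2' * N t" if "t \<in> {b..1}" for t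
   using L1(2)[OF M[OF that] M0(2,1)] L2'(2)[OF M[OF that] M0(2,1)] HK_v0 by (simp_all add: N_def)
  define T where "T = L1 + (1 + \<bar>cb\<bar>) * (L2' / \<bar>ca\<bar>)"
  have T: "T \<ge> 0" using L1 L2' by (simp add: T_def)
  have "N x = 0"
  proof (rule gronwall_zero[OF Nc N0 _ T x])
   fix x assume x: "x \<in> {b..1}"
   define I where "I = integral {b..x} N"
   have f1: "\<bar>integral {b..x} (\<lambda>\<tau>. integral {b..\<tau>} (\<lambda>t. Kf (Y t) (F t)))\<bar> \<le> L1 * I"
    unfolding I_def using b by (intro double_integral_bound[OF HK_cont(2)[OF Yc Fc] Nc _ Kle N0 L1(1) x]) auto
   have f2: "\<bar>integral {b..x} HH\<bar> \<le> L2' * I"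
    unfolding I_def HH_def using b by (intro double_integral_bound[OF HK_cont(1)[OF Yc Fc] Nc _ Hle N0 L2'(1) x]) auto
   have F1: "\<bar>F x - v0\<bar> \<le> (L2' / \<bar>ca\<bar>) * I"
    using f2 ca_nz unfolding HHeq[OF x] by (simp add: abs_divide divide_right_mono)
   have "Y x = cb * (F x - v0) + integral {b..x} (\<lambda>\<tau>. integral {b..\<tau>} (\<lambda>t. Kf (Y t) (F t)))"
    using Y x by (simp add: row_def)
   then have "\<bar>Y x\<bar> \<le> \<bar>cb\<bar> * \<bar>F x - v0\<bar> + L1 * I" using f1 by (simp flip: abs_mult)
   also have "\<dots> \<le> \<bar>cb\<bar> * ((L2' / \<bar>ca\<bar>) * I) + L1 * I" using mult_left_mono[OF F1, of "\<bar>cb\<bar>"] by simp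
   finally show "N x \<le> T * integral {b..x} N" using F1 unfolding I_def[symmetric] N_def T_def
    by (simp add: distrib_right mult.assoc add_divide_distrib)
  qed
  then show ?thesis by (simp add: N_def)
 qed
 have u0: "AE p in lborel. p \<in> R \<longrightarrow> u p = 0"
  using uY by eventually_elim (use Y0 in \<open>auto simp: R_def\<close>)
 have uxR: "AE p in lborel. p \<in> R \<longrightarrow> ux p = 0"
  unfolding R_def by (rule ux0[OF order_refl]) (use u0 in \<open>auto elim: eventually_mono\<close>)
 define zs where "zs p = indicator R p * (u p + s / 2)" for p
 have zs: "integrable lborel zs"
 proof -
  have "integrable lborel (\<lambda>p. indicator R p * u p + indicator R p * (s / 2))"
   using int_restrict[OF int_u(1) Rb] int_indicator_rect[of b 1 0 b]
   by (intro Bochner_Integration.integrable_add) (simp_all add: R_def)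
  then show ?thesis by (simp add: zs_def[abs_def] distrib_left)
 qed
 have "AE p in lborel. p \<in> {b<..<2} \<times> {0<..<b} \<longrightarrow> zs p = - (LINT t|lborel. indicator {fst p..} t * ku (t, snd p))"
 proof (rule row_from_right[OF zs ki(3) less_imp_le[OF b(5)]])
  show "(LINT p|lborel. zs p * tens (deriv f) g p) = - (LINT p|lborel. ku p * tens f g p)"
   if "bump b 2 f" "bump 0 b g" for f g
   using right_u[OF b(1,6) that] by (simp add: tst_def zs_def[abs_def] ku_def[abs_def] R_def)
  show "zs p = 0" "ku p = 0" if "p \<notin> {b<..<2} \<times> {0<..<b}" for p using that by (cases p; auto simp: zs_def ku_def R_def)+
  show "AE p in lborel. 1 < fst p \<longrightarrow> zs p = 0 \<and> ku p = 0" by (auto simp: zs_def ku_def R_def)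
 qed simp
 from AE_sections_snd[OF this] AE_sections_snd[OF u0] AE_sections_snd[OF uxR]
 have "AE y in lborel. 0 < y \<and> y < b \<longrightarrow> (AE x in lborel. b < x \<and> x < 1 \<longrightarrow> s = 0)"
 proof eventually_elim
  case (elim y)
  show ?case
  proof
   assume y: "0 < y \<and> y < b"
   have "AE t in lborel. ku (t, y) = 0" using elim(3) by eventually_elim (auto simp: ku_def indicator_def)
   then have i0: "(LINT t|lborel. indicator {x..} t * ku (t, y)) = 0" for x
    by (intro integral_eq_zero_AE) (auto elim: eventually_mono)
   from elim(1,2) show "AE x in lborel. b < x \<and> x < 1 \<longrightarrow> s = 0"
    by eventually_elim (use y i0 in \<open>auto simp: zs_def R_def\<close>)
  qed
 qed
 then obtain y where "0 < y" "y < b" "0 < y \<and> y < b \<longrightarrow> (AE x in lborel. b < x \<and> x < 1 \<longrightarrow> s = 0)"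
  by (rule AE_lborel_witness[OF _ b(1)])
 then have "AE x in lborel. b < x \<and> x < 1 \<longrightarrow> s = 0" by blast
 then obtain x where "b < x" "x < 1" "b < x \<and> x < 1 \<longrightarrow> s = 0" by (rule AE_lborel_witness[OF _ b(5)])
 then show False using s by simp
qed

end

section \<open>Borel representatives\<close>

text \<open>Functions that are Lebesgue measurable on \<open>U\<close> are replaced by Borel functions that vanish off \<open>U\<close>, so
 that the Fubini arguments can be carried out for Borel functions on the plane.\<close>

lemma borel_rep:
 fixes f :: "real \<times> real \<Rightarrow> real"
 assumes f: "f \<in> borel_measurable (lebesgue_on U)" and U: "U \<in> sets borel"
 obtains g where "g \<in> borel_measurable borel" "\<And>p. p \<notin> U \<Longrightarrow> g p = 0" "AE p in lborel. p \<in> U \<longrightarrow> f p = g p"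
proof -
 have "(\<lambda>p. if p \<in> U then f p else 0) \<in> borel_measurable lebesgue"
  using borel_measurable_if[of U f] f U by simp
 then obtain g where g: "g \<in> borel_measurable lborel" "AE p in lborel. (if p \<in> U then f p else 0) = g p"
  using completion_ex_borel_measurable_real[of "\<lambda>p. if p \<in> U then f p else 0" lborel] by auto
 show ?thesis
 proof (rule that[of "\<lambda>p. indicator U p * g p"])
  show "(\<lambda>p. indicator U p * g p) \<in> borel_measurable borel" using g(1) U by simp
  from g(2) show "AE p in lborel. p \<in> U \<longrightarrow> f p = indicator U p * g p" by eventually_elim auto
 qed simp
qed

lemma AE_lebesgue_on_iff:
 assumes U: "U \<in> sets borel"
 shows "(AE p in lebesgue_on U. Q p) \<longleftrightarrow> (AE p in lborel. p \<in> U \<longrightarrow> Q p)"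
 using U by (subst AE_restrict_space_iff) (auto simp: AE_completion_iff)

lemma integral_lebesgue_on:
 fixes F G :: "real \<times> real \<Rightarrow> real"
 assumes U: "U \<in> sets borel" and F: "F \<in> borel_measurable (lebesgue_on U)" and G: "G \<in> borel_measurable borel"
  and z: "\<And>p. p \<notin> U \<Longrightarrow> G p = 0" and ae: "AE p in lborel. p \<in> U \<longrightarrow> F p = G p"
 shows "(LINT p|lebesgue_on U. F p) = (LINT p|lborel. G p)"
  and "integrable (lebesgue_on U) F \<longleftrightarrow> integrable lborel G"
proof -
 have Gm: "G \<in> borel_measurable (lebesgue_on U)"
  by (intro measurable_restrict_space1 measurable_completion) (use G in simp)
 have ae': "AE p in lebesgue_on U. F p = G p" using ae by (simp add: AE_lebesgue_on_iff[OF U])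
 have Ul: "U \<inter> space lebesgue \<in> sets lebesgue" using U by simp
 have e: "(\<lambda>p. indicator U p *\<^sub>R G p) = G" using z by (auto simp: indicator_def fun_eq_iff)
 have "(LINT p|lebesgue_on U. F p) = (LINT p|lebesgue_on U. G p)" by (rule integral_cong_AE[OF F Gm ae'])
 also have "\<dots> = (LINT p|lebesgue. G p)" using integral_restrict_space[OF Ul, of G] by (simp only: e)
 also have "\<dots> = (LINT p|lborel. G p)" using G by (intro integral_completion) simp
 finally show "(LINT p|lebesgue_on U. F p) = (LINT p|lborel. G p)" .
 have "integrable (lebesgue_on U) F \<longleftrightarrow> integrable (lebesgue_on U) G" by (rule integrable_cong_AE[OF F Gm ae'])
 also have "\<dots> \<longleftrightarrow> integrable lebesgue G" using integrable_restrict_space[OF Ul, of G] by (simp only: e)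
 also have "\<dots> \<longleftrightarrow> integrable lborel G" using G by (intro integrable_completion) simp
 finally show "integrable (lebesgue_on U) F \<longleftrightarrow> integrable lborel G" .
qed

lemma borel_to_lebesgue_on: "G \<in> borel_measurable borel \<Longrightarrow> G \<in> borel_measurable (lebesgue_on U)"
 for G :: "real \<times> real \<Rightarrow> real"
 by (intro measurable_restrict_space1 measurable_completion) simp

section \<open>Weak derivatives\<close>

lemma integral_dx_compact:
 assumes \<psi>: "smooth \<psi>" and K: "compact (closure {p. \<psi> p \<noteq> 0})"
 shows "(LINT p|lborel. dx \<psi> p) = 0" "integrable lborel (dx \<psi>)"
  and "(LINT p|lborel. dy \<psi> p) = 0" "integrable lborel (dy \<psi>)"
proof -
 obtain N where N: "\<And>p. \<psi> p \<noteq> 0 \<Longrightarrow> norm p \<le> N"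
  using compact_imp_bounded[OF K] closure_subset[of "{p. \<psi> p \<noteq> 0}"] unfolding bounded_iff by blast
 have out: "\<psi> (x, y) = 0" if "\<bar>x\<bar> > N \<or> \<bar>y\<bar> > N" for x y
  using N[of "(x, y)"] norm_fst_le[of x y] norm_snd_le[of y x] that by fastforce
 have outx: "dx \<psi> (x, y) = 0" if "\<bar>x\<bar> > N \<or> \<bar>y\<bar> > N" for x y
 proof (cases "\<bar>y\<bar> > N")
  case True
  then have "(\<lambda>t. \<psi> (t, y)) = (\<lambda>_. 0)" using out by auto
  then show ?thesis by (simp add: dx_def)
 next
  case False
  have "open {t::real. \<bar>t\<bar> > N}" by (intro open_Collect_less continuous_intros)
  then show ?thesis unfolding dx_def
   by (simp, intro deriv_zero_on_open[of "{t::real. \<bar>t\<bar> > N}"]) (use out that False in auto)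
 qed
 have outy: "dy \<psi> (x, y) = 0" if "\<bar>x\<bar> > N \<or> \<bar>y\<bar> > N" for x y
 proof (cases "\<bar>x\<bar> > N")
  case True
  then have "(\<lambda>t. \<psi> (x, t)) = (\<lambda>_. 0)" using out by auto
  then show ?thesis by (simp add: dy_def)
 next
  case False
  have "open {t::real. \<bar>t\<bar> > N}" by (intro open_Collect_less continuous_intros)
  then show ?thesis unfolding dy_def
   by (simp, intro deriv_zero_on_open[of "{t::real. \<bar>t\<bar> > N}"]) (use out that False in auto)
 qed
 have int: "integrable lborel w" if w: "smooth w" and o: "\<And>x y. \<bar>x\<bar> > N \<or> \<bar>y\<bar> > N \<Longrightarrow> w (x, y) = 0" for w
 proof -
  have "integrable lborel (\<lambda>p. indicator ({-N..N} \<times> {-N..N}) p *\<^sub>R w p)"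
   by (intro borel_integrable_compact compact_Times smooth_cont[OF w]) auto
  moreover have "(\<lambda>p. indicator ({-N..N} \<times> {-N..N}) p *\<^sub>R w p) = w"
  proof
   fix p show "indicator ({-N..N} \<times> {-N..N}) p *\<^sub>R w p = w p"
   proof (cases "p \<in> {-N..N} \<times> {-N..N}")
    case False
    then have "\<bar>fst p\<bar> > N \<or> \<bar>snd p\<bar> > N" by (auto simp: mem_Times_iff abs_le_iff not_le)
    with o[of "fst p" "snd p"] show ?thesis by simp
   qed simp
  qed
  ultimately show ?thesis by simp
 qed
 show ix: "integrable lborel (dx \<psi>)" and iy: "integrable lborel (dy \<psi>)"
  by (rule int[OF smooth_dx[OF \<psi>] outx], assumption) (rule int[OF smooth_dy[OF \<psi>] outy], assumption)
 have one: "(LINT t|lborel. w t) = 0"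
  if d: "\<And>t. (W has_real_derivative w t) (at t)" and c: "continuous_on UNIV w"
   and o: "\<And>t. \<bar>t\<bar> > N \<Longrightarrow> W t = 0" "\<And>t. \<bar>t\<bar> > N \<Longrightarrow> w t = 0" for W w :: "real \<Rightarrow> real"
 proof -
  define M where "M = \<bar>N\<bar> + 1"
  have "(LINT x|lborel. indicator {- M..M} x *\<^sub>R w x) = W M - W (- M)"
  proof (rule integral_FTC_atLeastAtMost)
   show "(W has_vector_derivative w x) (at x within {- M..M})" for x
    using d by (simp add: has_real_derivative_iff_has_vector_derivative[symmetric] has_field_derivative_at_within)
   show "continuous_on {- M..M} w" using c by (rule continuous_on_subset) simp
  qed (simp add: M_def)
  moreover have "(\<lambda>x. indicator {- M..M} x *\<^sub>R w x) = w"
  proof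
   fix t show "indicator {- M..M} t *\<^sub>R w t = w t"
   proof (cases "t \<in> {- M..M}")
    case False
    then have "\<bar>t\<bar> > N" by (auto simp: M_def)
    then show ?thesis using o(2) by simp
   qed simp
  qed
  ultimately show ?thesis using o(1)[of M] o(1)[of "- M"] by (simp add: M_def)
 qed
 have "(LINT x|lborel. dx \<psi> (x, y)) = 0" for y
 proof (rule one)
  show "((\<lambda>t. \<psi> (t, y)) has_real_derivative dx \<psi> (t, y)) (at t)" for t
   using dx_DERIV[OF smooth_differentiable[OF \<psi>], of "(t, y)"] by simp
  show "continuous_on UNIV (\<lambda>t. dx \<psi> (t, y))"
   by (intro continuous_on_compose2[OF smooth_cont[OF smooth_dx[OF \<psi>], of UNIV]] continuous_intros) auto
 qed (use out outx in auto)
 then show "(LINT p|lborel. dx \<psi> p) = 0" using fub_snd(1)[OF ix] by simp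
 have "(LINT y|lborel. dy \<psi> (x, y)) = 0" for x
 proof (rule one)
  show "((\<lambda>t. \<psi> (x, t)) has_real_derivative dy \<psi> (x, t)) (at t)" for t
   using dy_DERIV[OF smooth_differentiable[OF \<psi>], of "(x, t)"] by simp
  show "continuous_on UNIV (\<lambda>t. dy \<psi> (x, t))"
   by (intro continuous_on_compose2[OF smooth_cont[OF smooth_dy[OF \<psi>], of UNIV]] continuous_intros) auto
 qed (use out outy in auto)
 then show "(LINT p|lborel. dy \<psi> p) = 0" using fub_fst(1)[OF iy] by simp
qed

lemma smooth_mult_C_k: "C_k k f \<Longrightarrow> C_k k g \<Longrightarrow> smooth f \<Longrightarrow> smooth g \<Longrightarrow> C_k k (\<lambda>p. f p * g p)"
proof (induction k arbitrary: f g)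
 case 0
 then show ?case by (auto intro: continuous_on_mult)
next
 case (Suc k)
 have d: "f differentiable (at p)" "g differentiable (at p)" for p using Suc.prems smooth_differentiable by auto
 have e: "dx (\<lambda>q. f q * g q) = (\<lambda>p. dx f p * g p + 1 * (f p * dx g p))"
  "dy (\<lambda>q. f q * g q) = (\<lambda>p. dy f p * g p + 1 * (f p * dy g p))"
  using dx_mult[OF d] dy_mult[OF d] by (simp_all add: fun_eq_iff)
 have k: "C_k k w" if "smooth w" for w using that by (simp add: smooth_def)
 have "C_k k (dx (\<lambda>q. f q * g q))" "C_k k (dy (\<lambda>q. f q * g q))"
  unfolding e by (intro C_k_add Suc.IH k smooth_dx smooth_dy Suc.prems)+
 moreover have "\<forall>p. (\<lambda>q. f q * g q) differentiable (at p)" using d by (auto intro: differentiable_mult)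
 ultimately show ?case unfolding C_k.simps by blast
qed

lemma smooth_mult: "smooth f \<Longrightarrow> smooth g \<Longrightarrow> smooth (\<lambda>p. f p * g p)"
 using smooth_mult_C_k unfolding smooth_def by blast

text \<open>A smooth function has its classical derivatives as weak derivatives; with it, adding a smooth
 variation changes the chosen weak derivatives as expected.\<close>

lemma smooth_weak:
 assumes \<eta>: "smooth \<eta>" and \<phi>: "test_function U \<phi>" and U: "U \<in> sets borel"
 shows "(LINT p|lebesgue_on U. \<eta> p * dx \<phi> p) = - (LINT p|lebesgue_on U. dx \<eta> p * \<phi> p)"
  and "(LINT p|lebesgue_on U. \<eta> p * dy \<phi> p) = - (LINT p|lebesgue_on U. dy \<eta> p * \<phi> p)"
  and "integrable (lebesgue_on U) (\<lambda>p. \<eta> p * dx \<phi> p)" "integrable (lebesgue_on U) (\<lambda>p. dx \<eta> p * \<phi> p)"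
  and "integrable (lebesgue_on U) (\<lambda>p. \<eta> p * dy \<phi> p)" "integrable (lebesgue_on U) (\<lambda>p. dy \<eta> p * \<phi> p)"
proof -
 define K where "K = closure {p. \<phi> p \<noteq> 0}"
 have K: "compact K" "K \<subseteq> U" and s\<phi>: "smooth \<phi>" using \<phi> by (auto simp: test_function_def K_def)
 have out: "\<phi> p = 0" if "p \<notin> K" for p using that closure_subset[of "{p. \<phi> p \<noteq> 0}"] by (auto simp: K_def)
 have op: "open (- K)" using K(1) by (simp add: compact_imp_closed open_Compl)
 have outd: "dx \<phi> p = 0" "dy \<phi> p = 0" if p: "p \<notin> K" for p
 proof -
  have "open ((\<lambda>t. (t, snd p)) -` (- K))" "open ((\<lambda>t. (fst p, t)) -` (- K))"
   by (intro open_vimage[OF op] continuous_intros)+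
  then show "dx \<phi> p = 0" "dy \<phi> p = 0" unfolding dx_def dy_def
   using p out deriv_zero_on_open[of "(\<lambda>t. (t, snd p)) -` (- K)" "\<lambda>t. \<phi> (t, snd p)" "fst p"]
    deriv_zero_on_open[of "(\<lambda>t. (fst p, t)) -` (- K)" "\<lambda>t. \<phi> (fst p, t)" "snd p"] by auto
 qed
 have conv: "(LINT p|lebesgue_on U. w p) = (LINT p|lborel. w p) \<and> integrable (lebesgue_on U) w \<and> integrable lborel w"
  if w: "smooth w" "\<And>p. p \<notin> K \<Longrightarrow> w p = 0" for w
 proof -
  have z: "w p = 0" if "p \<notin> U" for p using w(2) K(2) that by blast
  have b: "w \<in> borel_measurable borel" by (rule smooth_borel[OF w(1)])
  have "integrable lborel (\<lambda>p. indicator K p *\<^sub>R w p)"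
   by (intro borel_integrable_compact K smooth_cont[OF w(1)])
  moreover have "(\<lambda>p. indicator K p *\<^sub>R w p) = w" using w(2) by (auto simp: fun_eq_iff indicator_def)
  ultimately have "integrable lborel w" by simp
  then show ?thesis using integral_lebesgue_on[OF U borel_to_lebesgue_on[OF b] b z] by simp
 qed
 define \<psi> where "\<psi> = (\<lambda>p. \<eta> p * \<phi> p)"
 have s\<psi>: "smooth \<psi>" unfolding \<psi>_def by (rule smooth_mult[OF \<eta> s\<phi>])
 have "{p. \<psi> p \<noteq> 0} \<subseteq> K" using out by (auto simp: \<psi>_def)
 then have "compact (closure {p. \<psi> p \<noteq> 0})"
  using compact_closure bounded_subset[OF compact_imp_bounded[OF K(1)]] by blast
 note I = integral_dx_compact[OF s\<psi> this]
 have c1: "(LINT p|lebesgue_on U. \<eta> p * dx \<phi> p) = (LINT p|lborel. \<eta> p * dx \<phi> p) \<and> integrable (lebesgue_on U) (\<lambda>p. \<eta> p * dx \<phi> p) \<and> integrable lborel (\<lambda>p. \<eta> p * dx \<phi> p)"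
  by (rule conv) (simp_all add: smooth_mult \<eta> s\<phi> smooth_dx outd)
 have c2: "(LINT p|lebesgue_on U. dx \<eta> p * \<phi> p) = (LINT p|lborel. dx \<eta> p * \<phi> p) \<and> integrable (lebesgue_on U) (\<lambda>p. dx \<eta> p * \<phi> p) \<and> integrable lborel (\<lambda>p. dx \<eta> p * \<phi> p)"
  by (rule conv) (simp_all add: smooth_mult \<eta> s\<phi> smooth_dx out)
 have c3: "(LINT p|lebesgue_on U. \<eta> p * dy \<phi> p) = (LINT p|lborel. \<eta> p * dy \<phi> p) \<and> integrable (lebesgue_on U) (\<lambda>p. \<eta> p * dy \<phi> p) \<and> integrable lborel (\<lambda>p. \<eta> p * dy \<phi> p)"
  by (rule conv) (simp_all add: smooth_mult \<eta> s\<phi> smooth_dy outd)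
 have c4: "(LINT p|lebesgue_on U. dy \<eta> p * \<phi> p) = (LINT p|lborel. dy \<eta> p * \<phi> p) \<and> integrable (lebesgue_on U) (\<lambda>p. dy \<eta> p * \<phi> p) \<and> integrable lborel (\<lambda>p. dy \<eta> p * \<phi> p)"
  by (rule conv) (simp_all add: smooth_mult \<eta> s\<phi> smooth_dy out)
 have "dx \<psi> = (\<lambda>p. dx \<eta> p * \<phi> p + \<eta> p * dx \<phi> p)" "dy \<psi> = (\<lambda>p. dy \<eta> p * \<phi> p + \<eta> p * dy \<phi> p)"
  unfolding \<psi>_def using dx_mult dy_mult smooth_differentiable[OF \<eta>] smooth_differentiable[OF s\<phi>] by (auto simp: fun_eq_iff)
 with I(1,3) c1 c2 c3 c4
 show "(LINT p|lebesgue_on U. \<eta> p * dx \<phi> p) = - (LINT p|lebesgue_on U. dx \<eta> p * \<phi> p)"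
  "(LINT p|lebesgue_on U. \<eta> p * dy \<phi> p) = - (LINT p|lebesgue_on U. dy \<eta> p * \<phi> p)"
  by auto
 show "integrable (lebesgue_on U) (\<lambda>p. \<eta> p * dx \<phi> p)" "integrable (lebesgue_on U) (\<lambda>p. dx \<eta> p * \<phi> p)"
  "integrable (lebesgue_on U) (\<lambda>p. \<eta> p * dy \<phi> p)" "integrable (lebesgue_on U) (\<lambda>p. dy \<eta> p * \<phi> p)"
  using c1 c2 c3 c4 by auto
qed

text \<open>Countability of the family lets exceptional null sets be collected in \<open>AE_open_from_rects\<close>.\<close>

lemma open_rational_rects:
 fixes U :: "(real \<times> real) set"
 assumes U: "open U" and p: "p \<in> U"
 obtains a b c d :: rat where "p \<in> {real_of_rat a<..<real_of_rat b} \<times> {real_of_rat c<..<real_of_rat d}"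
  "{real_of_rat a<..<real_of_rat b} \<times> {real_of_rat c<..<real_of_rat d} \<subseteq> U"
proof -
 obtain A B where AB: "open A" "open B" "p \<in> A \<times> B" "A \<times> B \<subseteq> U" using open_prod_elim[OF U p] by metis
 obtain e where e: "e > 0" "ball (fst p) e \<subseteq> A" using AB openE[of A "fst p"] by (auto simp: mem_Times_iff)
 obtain e' where e': "e' > 0" "ball (snd p) e' \<subseteq> B" using AB openE[of B "snd p"] by (auto simp: mem_Times_iff)
 obtain a where a: "fst p - e < real_of_rat a" "real_of_rat a < fst p" using rational_between[of "fst p - e" "fst p"] e by auto
 obtain b where b: "fst p < real_of_rat b" "real_of_rat b < fst p + e" using rational_between[of "fst p" "fst p + e"] e by auto
 obtain c where c: "snd p - e' < real_of_rat c" "real_of_rat c < snd p" using rational_between[of "snd p - e'" "snd p"] e' by auto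
 obtain d where d: "snd p < real_of_rat d" "real_of_rat d < snd p + e'" using rational_between[of "snd p" "snd p + e'"] e' by auto
 have "{real_of_rat a<..<real_of_rat b} \<subseteq> ball (fst p) e" "{real_of_rat c<..<real_of_rat d} \<subseteq> ball (snd p) e'"
  using a b c d by (auto simp: dist_real_def abs_if)
 with e e' AB(4) have "{real_of_rat a<..<real_of_rat b} \<times> {real_of_rat c<..<real_of_rat d} \<subseteq> U" by blast
 moreover have "p \<in> {real_of_rat a<..<real_of_rat b} \<times> {real_of_rat c<..<real_of_rat d}"
  using a b c d by (simp add: mem_Times_iff)
 ultimately show ?thesis using that by blast
qed

lemma AE_open_from_rects:
 fixes U :: "(real \<times> real) set"
 assumes U: "open U"
  and r: "\<And>a b c d. {a<..<b} \<times> {c<..<d} \<subseteq> U \<Longrightarrow> AE p in lborel. p \<in> {a<..<b} \<times> {c<..<d} \<longrightarrow> Q p"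
 shows "AE p in lborel. p \<in> U \<longrightarrow> Q p"
proof -
 have "AE p in lborel. \<forall>(q :: rat \<times> rat \<times> rat \<times> rat). case q of (a, b, c, d) \<Rightarrow>
   {real_of_rat a<..<real_of_rat b} \<times> {real_of_rat c<..<real_of_rat d} \<subseteq> U \<longrightarrow>
   p \<in> {real_of_rat a<..<real_of_rat b} \<times> {real_of_rat c<..<real_of_rat d} \<longrightarrow> Q p"
  unfolding AE_all_countable using r by (auto split: prod.split)
 then show ?thesis
 proof eventually_elim
  case (elim p)
  show ?case
  proof
   assume "p \<in> U"
   from open_rational_rects[OF U this] obtain a b c d :: rat where
    *: "p \<in> {real_of_rat a<..<real_of_rat b} \<times> {real_of_rat c<..<real_of_rat d}"
    "{real_of_rat a<..<real_of_rat b} \<times> {real_of_rat c<..<real_of_rat d} \<subseteq> U" by blast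
   then show "Q p" using elim[THEN spec, of "(a, b, c, d)"] by simp
  qed
 qed
qed

section \<open>Square integrable functions and weak derivatives\<close>

lemma L2_mult:
 assumes "L2_on U f" "L2_on U g" shows "integrable (lebesgue_on U) (\<lambda>p. f p * g p)"
proof (rule Bochner_Integration.integrable_bound[of _ "\<lambda>p. (f p)\<^sup>2 + (g p)\<^sup>2"])
 show "integrable (lebesgue_on U) (\<lambda>p. (f p)\<^sup>2 + (g p)\<^sup>2)" using assms by (auto simp: L2_on_def)
 show "(\<lambda>p. f p * g p) \<in> borel_measurable (lebesgue_on U)" using assms by (auto simp: L2_on_def)
 have "\<bar>a * b\<bar> \<le> a\<^sup>2 + b\<^sup>2" for a b :: real
 proof -
  have "2 * (\<bar>a\<bar> * \<bar>b\<bar>) \<le> a\<^sup>2 + b\<^sup>2" "0 \<le> \<bar>a\<bar> * \<bar>b\<bar>"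
   using zero_le_power2[of "\<bar>a\<bar> - \<bar>b\<bar>"] unfolding power2_diff by simp_all
  then show ?thesis unfolding abs_mult by linarith
 qed
 then show "AE p in lebesgue_on U. norm (f p * g p) \<le> norm ((f p)\<^sup>2 + (g p)\<^sup>2)" by simp
qed

lemma L2_add:
 assumes "L2_on U f" "L2_on U g" shows "L2_on U (\<lambda>p. f p + t * g p)"
proof -
 have "integrable (lebesgue_on U) (\<lambda>p. (f p)\<^sup>2 + 2 * t * (f p * g p) + t\<^sup>2 * (g p)\<^sup>2)"
  using L2_mult[OF assms] assms by (auto simp: L2_on_def)
 then show ?thesis using assms
  by (auto simp: L2_on_def power2_eq_square algebra_simps)
qed

lemma bounded_on_of_cont:
 fixes f :: "real \<times> real \<Rightarrow> real"
 assumes "continuous_on UNIV f" "bounded U" obtains M where "M > 0" "\<And>p. p \<in> U \<Longrightarrow> \<bar>f p\<bar> \<le> M"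
proof -
 have "compact (f ` closure U)"
  using assms by (intro compact_continuous_image) (auto intro: continuous_on_subset)
 then obtain M where "\<And>p. p \<in> closure U \<Longrightarrow> \<bar>f p\<bar> \<le> M"
  by (metis bounded_iff compact_imp_bounded imageI real_norm_def)
 then have "\<bar>f p\<bar> \<le> max M 1" if "p \<in> U" for p using that closure_subset[of U] by (meson le_max_iff_disj subsetD)
 then show ?thesis using that[of "max M 1"] by auto
qed

lemma finite_measure_lebesgue_on:
 fixes U :: "(real \<times> real) set"
 assumes "bounded U" "U \<in> sets borel" shows "finite_measure (lebesgue_on U)"
proof (rule finite_measureI)
 have "emeasure (lebesgue_on U) (space (lebesgue_on U)) = emeasure lborel U"
  using assms by (simp add: emeasure_restrict_space)
 also have "\<dots> < \<infinity>" using emeasure_bounded_finite[OF assms(1)] by simp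
 finally show "emeasure (lebesgue_on U) (space (lebesgue_on U)) \<noteq> \<infinity>" by simp
qed

lemma bounded_integrable_lebesgue_on:
 fixes U :: "(real \<times> real) set" and f :: "real \<times> real \<Rightarrow> real"
 assumes "bounded U" "U \<in> sets borel" "f \<in> borel_measurable (lebesgue_on U)" "\<And>p. p \<in> U \<Longrightarrow> \<bar>f p\<bar> \<le> M"
 shows "integrable (lebesgue_on U) f"
proof -
 interpret finite_measure "lebesgue_on U" by (rule finite_measure_lebesgue_on[OF assms(1,2)])
 show ?thesis by (rule integrable_const_bound[of _ M]) (use assms in \<open>auto simp: space_restrict_space\<close>)
qed

lemma L2_cont:
 assumes f: "continuous_on UNIV f" and U: "bounded U" "U \<in> sets borel" shows "L2_on U f"
proof -
 obtain M where M: "\<And>p. p \<in> U \<Longrightarrow> \<bar>f p\<bar> \<le> M" using bounded_on_of_cont[OF f U(1)] by metis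
 have m: "f \<in> borel_measurable (lebesgue_on U)"
  by (intro borel_to_lebesgue_on borel_measurable_continuous_onI f)
 have "integrable (lebesgue_on U) (\<lambda>p. (f p)\<^sup>2)"
 proof (rule bounded_integrable_lebesgue_on[OF U, of _ "M\<^sup>2"])
  show "\<bar>(f p)\<^sup>2\<bar> \<le> M\<^sup>2" if "p \<in> U" for p using power_mono[OF M[OF that], of 2] by simp
 qed (use m in simp)
 with m show ?thesis by (simp add: L2_on_def)
qed

lemma L2_smooth: "smooth f \<Longrightarrow> bounded U \<Longrightarrow> U \<in> sets borel \<Longrightarrow> L2_on U f"
 by (intro L2_cont smooth_cont)

lemma L2_integrable: assumes "L2_on U f" "bounded U" "U \<in> sets borel" shows "integrable (lebesgue_on U) f"
 using L2_mult[OF assms(1) L2_cont[of "\<lambda>_. 1"]] assms by simp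

lemma L2_rep:
 assumes f: "L2_on U f" and U: "bounded U" "U \<in> sets borel"
 obtains g where "g \<in> borel_measurable borel" "\<And>p. p \<notin> U \<Longrightarrow> g p = 0" "AE p in lborel. p \<in> U \<longrightarrow> f p = g p"
  "integrable lborel (\<lambda>p. (g p)\<^sup>2)" "integrable lborel g"
proof -
 have fm: "f \<in> borel_measurable (lebesgue_on U)" using f by (simp add: L2_on_def)
 obtain g where g: "g \<in> borel_measurable borel" "\<And>p. p \<notin> U \<Longrightarrow> g p = 0" "AE p in lborel. p \<in> U \<longrightarrow> f p = g p"
  using borel_rep[OF fm U(2)] by metis
 have "integrable lborel (\<lambda>p. (g p)\<^sup>2)"
 proof -
  have "AE p in lborel. p \<in> U \<longrightarrow> (f p)\<^sup>2 = (g p)\<^sup>2" using g(3) by eventually_elim auto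
  then show ?thesis
   using integral_lebesgue_on(2)[OF U(2), of "\<lambda>p. (f p)\<^sup>2" "\<lambda>p. (g p)\<^sup>2"] f g(1,2) fm by (simp add: L2_on_def)
 qed
 moreover have "integrable lborel g"
  using integral_lebesgue_on(2)[OF U(2) fm g] L2_integrable[OF f U] by simp
 ultimately show ?thesis using that g by blast
qed

lemma AE_zero_of_tests:
 assumes U: "open U" "bounded U" and w: "L2_on U w"
  and t: "\<And>\<phi>. test_function U \<phi> \<Longrightarrow> (LINT p|lebesgue_on U. w p * \<phi> p) = 0"
 shows "AE p in lborel. p \<in> U \<longrightarrow> w p = 0"
proof -
 have Ub: "U \<in> sets borel" using U by simp
 obtain g where g: "g \<in> borel_measurable borel" "\<And>p. p \<notin> U \<Longrightarrow> g p = 0" "AE p in lborel. p \<in> U \<longrightarrow> w p = g p"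
  "integrable lborel (\<lambda>p. (g p)\<^sup>2)" "integrable lborel g"
  by (rule L2_rep[OF w U(2) Ub]) blast
 have "AE p in lborel. p \<in> U \<longrightarrow> g p = 0"
 proof (rule AE_open_from_rects[OF U(1)])
  fix a b c d assume sub: "{a<..<b} \<times> {c<..<d} \<subseteq> U"
  show "AE p in lborel. p \<in> {a<..<b} \<times> {c<..<d} \<longrightarrow> g p = 0"
  proof (rule fundamental_lemma)
   have R: "{a<..<b} \<times> {c<..<d} \<in> sets (borel :: (real \<times> real) measure)" by (intro borel_open open_Times) auto
   show "integrable lborel (\<lambda>p. indicator ({a<..<b} \<times> {c<..<d}) p * g p)"
    using integrable_real_mult_indicator[of "{a<..<b} \<times> {c<..<d}" lborel g] g(5) R by (simp add: mult.commute)
   fix f h assume f: "bump a b f" and h: "bump c d h"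
   have m: "tens f h \<in> borel_measurable borel" by (intro borel_measurable_tens smooth1_borel bump_smooth[OF f] bump_smooth[OF h])
   have "(LINT p|lborel. indicator ({a<..<b} \<times> {c<..<d}) p * g p * tens f h p) = (LINT p|lborel. g p * tens f h p)"
    using tens_nz[OF _ f h] by (intro Bochner_Integration.integral_cong) (auto simp: indicator_def)
   also have "\<dots> = (LINT p|lebesgue_on U. w p * tens f h p)"
   proof (rule integral_lebesgue_on(1)[OF Ub, symmetric])
    show "(\<lambda>p. w p * tens f h p) \<in> borel_measurable (lebesgue_on U)"
     using w borel_to_lebesgue_on[OF m] by (auto simp: L2_on_def)
    show "(\<lambda>p. g p * tens f h p) \<in> borel_measurable borel" using g(1) m by simp
    show "AE p in lborel. p \<in> U \<longrightarrow> w p * tens f h p = g p * tens f h p"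
     using g(3) by eventually_elim auto
   qed (use g(2) in auto)
   also have "\<dots> = 0" by (rule t[OF test_function_tens[OF f h sub]])
   finally show "(LINT p|lborel. indicator ({a<..<b} \<times> {c<..<d}) p * g p * tens f h p) = 0" .
  qed
 qed
 with g(3) show ?thesis by eventually_elim auto
qed

lemma test_function_L2: assumes "test_function U \<phi>" "bounded U" "U \<in> sets borel"
 shows "L2_on U \<phi>" "L2_on U (dx \<phi>)" "L2_on U (dy \<phi>)"
 using assms by (auto simp: test_function_def intro!: L2_smooth smooth_dx smooth_dy)

lemma weak_unique:
 assumes U: "open U" "bounded U" and q: "AE p in lborel. p \<in> U \<longrightarrow> q p = q' p"
  and L2: "L2_on U q" "L2_on U q'" "L2_on U v" "L2_on U w" "\<And>\<phi>. test_function U \<phi> \<Longrightarrow> L2_on U (D \<phi>)"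
  and v: "\<And>\<phi>. test_function U \<phi> \<Longrightarrow> (LINT p|lebesgue_on U. q p * D \<phi> p) = - (LINT p|lebesgue_on U. v p * \<phi> p)"
  and w: "\<And>\<phi>. test_function U \<phi> \<Longrightarrow> (LINT p|lebesgue_on U. q' p * D \<phi> p) = - (LINT p|lebesgue_on U. w p * \<phi> p)"
 shows "AE p in lborel. p \<in> U \<longrightarrow> v p = w p"
proof -
 have Ub: "U \<in> sets borel" using U by simp
 have "AE p in lborel. p \<in> U \<longrightarrow> v p + (-1) * w p = 0"
 proof (rule AE_zero_of_tests[OF U])
  show "L2_on U (\<lambda>p. v p + (-1) * w p)" by (intro L2_add L2)
  fix \<phi> assume \<phi>: "test_function U \<phi>"
  note L = L2_mult[OF L2(3) test_function_L2(1)[OF \<phi> U(2) Ub]] L2_mult[OF L2(4) test_function_L2(1)[OF \<phi> U(2) Ub]]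
  have "(LINT p|lebesgue_on U. q p * D \<phi> p) = (LINT p|lebesgue_on U. q' p * D \<phi> p)"
  proof (rule integral_cong_AE)
   show "(\<lambda>p. q p * D \<phi> p) \<in> borel_measurable (lebesgue_on U)" "(\<lambda>p. q' p * D \<phi> p) \<in> borel_measurable (lebesgue_on U)"
    using L2_mult[OF L2(1) L2(5)[OF \<phi>]] L2_mult[OF L2(2) L2(5)[OF \<phi>]] by auto
   show "AE p in lebesgue_on U. q p * D \<phi> p = q' p * D \<phi> p"
    unfolding AE_lebesgue_on_iff[OF Ub] using q by eventually_elim auto
  qed
  with v[OF \<phi>] w[OF \<phi>] show "(LINT p|lebesgue_on U. (v p + - 1 * w p) * \<phi> p) = 0"
   using L by (simp add: left_diff_distrib)
 qed
 then show ?thesis by eventually_elim auto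
qed

lemma weak_dx_unique:
 assumes U: "open U" "bounded U" and q: "AE p in lborel. p \<in> U \<longrightarrow> q p = q' p"
  and v: "weak_dx_on U q v" and w: "weak_dx_on U q' w" and L2: "L2_on U q" "L2_on U q'"
 shows "AE p in lborel. p \<in> U \<longrightarrow> v p = w p"
 by (rule weak_unique[OF U q L2, where D = dx])
  (use v w test_function_L2(2)[OF _ U(2) borel_open[OF U(1)]] in \<open>auto simp: weak_dx_on_def\<close>)

lemma weak_dy_unique:
 assumes U: "open U" "bounded U" and q: "AE p in lborel. p \<in> U \<longrightarrow> q p = q' p"
  and v: "weak_dy_on U q v" and w: "weak_dy_on U q' w" and L2: "L2_on U q" "L2_on U q'"
 shows "AE p in lborel. p \<in> U \<longrightarrow> v p = w p"
 by (rule weak_unique[OF U q L2, where D = dy])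
  (use v w test_function_L2(3)[OF _ U(2) borel_open[OF U(1)]] in \<open>auto simp: weak_dy_on_def\<close>)

lemma W12_wd: assumes "W12 U q" shows "L2_on U q" "weak_dx_on U q (wdx U q)" "weak_dy_on U q (wdy U q)"
 "L2_on U (wdx U q)" "L2_on U (wdy U q)"
proof -
 show 1: "weak_dx_on U q (wdx U q)" unfolding wdx_def
  using assms someI_ex[of "weak_dx_on U q"] by (simp add: W12_def)
 show 2: "weak_dy_on U q (wdy U q)" unfolding wdy_def
  using assms someI_ex[of "weak_dy_on U q"] by (simp add: W12_def)
 show "L2_on U q" using assms by (simp add: W12_def)
 show "L2_on U (wdx U q)" "L2_on U (wdy U q)" using 1 2 by (simp_all add: weak_dx_on_def weak_dy_on_def)
qed

lemma W12_add_smooth: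
 assumes q: "W12 U q" and \<eta>: "smooth \<eta>" and U: "open U" "bounded U"
 shows "W12 U (\<lambda>p. q p + t * \<eta> p)"
  and "AE p in lborel. p \<in> U \<longrightarrow> wdx U (\<lambda>p. q p + t * \<eta> p) p = wdx U q p + t * dx \<eta> p"
  and "AE p in lborel. p \<in> U \<longrightarrow> wdy U (\<lambda>p. q p + t * \<eta> p) p = wdy U q p + t * dy \<eta> p"
proof -
 have Ub: "U \<in> sets borel" using U by simp
 note Q = W12_wd[OF q]
 have L\<eta>: "L2_on U \<eta>" "L2_on U (dx \<eta>)" "L2_on U (dy \<eta>)" using \<eta> U Ub by (auto intro!: L2_smooth smooth_dx smooth_dy)
 have L: "L2_on U (\<lambda>p. q p + t * \<eta> p)" by (intro L2_add Q L\<eta>)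
 have wx: "weak_dx_on U (\<lambda>p. q p + t * \<eta> p) (\<lambda>p. wdx U q p + t * dx \<eta> p)"
  unfolding weak_dx_on_def
 proof (intro conjI allI impI)
  show "L2_on U (\<lambda>p. wdx U q p + t * dx \<eta> p)" by (intro L2_add Q L\<eta>)
  fix \<phi> assume \<phi>: "test_function U \<phi>"
  note T = test_function_L2[OF \<phi> U(2) Ub] and S = smooth_weak[OF \<eta> \<phi> Ub]
  have e: "(LINT p|lebesgue_on U. q p * dx \<phi> p) = - (LINT p|lebesgue_on U. wdx U q p * \<phi> p)"
   using Q(2) \<phi> by (simp add: weak_dx_on_def)
  show "(LINT p|lebesgue_on U. (q p + t * \<eta> p) * dx \<phi> p) = - (LINT p|lebesgue_on U. (wdx U q p + t * dx \<eta> p) * \<phi> p)"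
   using e S(1,3,4) L2_mult[OF Q(1) T(2)] L2_mult[OF Q(4) T(1)] by (simp add: distrib_right mult.assoc)
 qed
 have wy: "weak_dy_on U (\<lambda>p. q p + t * \<eta> p) (\<lambda>p. wdy U q p + t * dy \<eta> p)"
  unfolding weak_dy_on_def
 proof (intro conjI allI impI)
  show "L2_on U (\<lambda>p. wdy U q p + t * dy \<eta> p)" by (intro L2_add Q L\<eta>)
  fix \<phi> assume \<phi>: "test_function U \<phi>"
  note T = test_function_L2[OF \<phi> U(2) Ub] and S = smooth_weak[OF \<eta> \<phi> Ub]
  have e: "(LINT p|lebesgue_on U. q p * dy \<phi> p) = - (LINT p|lebesgue_on U. wdy U q p * \<phi> p)"
   using Q(3) \<phi> by (simp add: weak_dy_on_def)
  show "(LINT p|lebesgue_on U. (q p + t * \<eta> p) * dy \<phi> p) = - (LINT p|lebesgue_on U. (wdy U q p + t * dy \<eta> p) * \<phi> p)"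
   using e S(2,5,6) L2_mult[OF Q(1) T(3)] L2_mult[OF Q(5) T(1)] by (simp add: distrib_right mult.assoc)
 qed
 show W: "W12 U (\<lambda>p. q p + t * \<eta> p)" unfolding W12_def using L wx wy by blast
 show "AE p in lborel. p \<in> U \<longrightarrow> wdx U (\<lambda>p. q p + t * \<eta> p) p = wdx U q p + t * dx \<eta> p"
  by (rule weak_dx_unique[OF U _ W12_wd(2)[OF W] wx L L]) simp
 show "AE p in lborel. p \<in> U \<longrightarrow> wdy U (\<lambda>p. q p + t * \<eta> p) p = wdy U q p + t * dy \<eta> p"
  by (rule weak_dy_unique[OF U _ W12_wd(3)[OF W] wy L L]) simp
qed

lemma W12_zero:
 assumes q: "W12 U q" and z: "AE p in lborel. p \<in> U \<longrightarrow> q p = 0" and U: "open U" "bounded U"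
 shows "AE p in lborel. p \<in> U \<longrightarrow> wdx U q p = 0" "AE p in lborel. p \<in> U \<longrightarrow> wdy U q p = 0"
proof -
 have L0: "L2_on U (\<lambda>_. 0)" by (simp add: L2_on_def)
 have "weak_dx_on U (\<lambda>_. 0) (\<lambda>_. 0)" "weak_dy_on U (\<lambda>_. 0) (\<lambda>_. 0)"
  using L0 by (simp_all add: weak_dx_on_def weak_dy_on_def)
 then show "AE p in lborel. p \<in> U \<longrightarrow> wdx U q p = 0" "AE p in lborel. p \<in> U \<longrightarrow> wdy U q p = 0"
  using weak_dx_unique[OF U z W12_wd(2)[OF q] _ W12_wd(1)[OF q] L0]
   weak_dy_unique[OF U z W12_wd(3)[OF q] _ W12_wd(1)[OF q] L0] by auto
qed

lemma trace_add_smooth: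
 assumes q: "W12 U q" and \<eta>: "smooth \<eta>" and U: "open U" "bounded U"
  and tr: "trace_on U q \<Gamma> g" and z: "\<And>p. p \<in> \<Gamma> \<Longrightarrow> \<eta> p = 0"
 shows "trace_on U (\<lambda>p. q p + t * \<eta> p) \<Gamma> g"
proof -
 have Ub: "U \<in> sets borel" using U by simp
 obtain \<phi> where \<phi>: "\<And>n. smooth (\<phi> n)"
  "(\<lambda>n. LINT p|lebesgue_on U. (\<phi> n p - q p)\<^sup>2 + (dx (\<phi> n) p - wdx U q p)\<^sup>2 + (dy (\<phi> n) p - wdy U q p)\<^sup>2) \<longlonglongrightarrow> 0"
  "\<And>a b. a \<noteq> b \<Longrightarrow> closed_segment a b \<subseteq> \<Gamma> \<Longrightarrow> (\<lambda>n. \<integral>\<^sup>+ t\<in>{0..1}.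
      ennreal ((\<phi> n (a + t *\<^sub>R (b - a)) - g (a + t *\<^sub>R (b - a)))\<^sup>2) \<partial>lborel) \<longlonglongrightarrow> 0"
  using tr unfolding trace_on_def by blast
 let ?q = "\<lambda>p. q p + t * \<eta> p"
 note Q = W12_wd[OF q] and W = W12_add_smooth[OF q \<eta> U, of t]
 note Q' = W12_wd[OF W(1)]
 define \<psi> where "\<psi> n = (\<lambda>p. \<phi> n p + t * \<eta> p)" for n
 have s\<psi>: "smooth (\<psi> n)" for n unfolding \<psi>_def by (rule smooth_add[OF \<phi>(1) \<eta>])
 have d: "dx (\<psi> n) p = dx (\<phi> n) p + t * dx \<eta> p" "dy (\<psi> n) p = dy (\<phi> n) p + t * dy \<eta> p" for n p
  unfolding \<psi>_def using dx_add dy_add smooth_differentiable \<phi>(1) \<eta> by blast+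
 have Lm: "L2_on U f \<Longrightarrow> f \<in> borel_measurable (lebesgue_on U)" for f by (simp add: L2_on_def)
 have ms: "smooth f \<Longrightarrow> f \<in> borel_measurable (lebesgue_on U)" for f using borel_to_lebesgue_on[OF smooth_borel] .
 have "(LINT p|lebesgue_on U. (\<psi> n p - ?q p)\<^sup>2 + (dx (\<psi> n) p - wdx U ?q p)\<^sup>2 + (dy (\<psi> n) p - wdy U ?q p)\<^sup>2)
  = (LINT p|lebesgue_on U. (\<phi> n p - q p)\<^sup>2 + (dx (\<phi> n) p - wdx U q p)\<^sup>2 + (dy (\<phi> n) p - wdy U q p)\<^sup>2)" for n
 proof (rule integral_cong_AE)
  show "(\<lambda>p. (\<psi> n p - ?q p)\<^sup>2 + (dx (\<psi> n) p - wdx U ?q p)\<^sup>2 + (dy (\<psi> n) p - wdy U ?q p)\<^sup>2) \<in> borel_measurable (lebesgue_on U)"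
   by (intro borel_measurable_add borel_measurable_power borel_measurable_diff Lm[OF Q'(1)] Lm[OF Q'(4)] Lm[OF Q'(5)]
     ms[OF s\<psi>] ms[OF smooth_dx[OF s\<psi>]] ms[OF smooth_dy[OF s\<psi>]])
  show "(\<lambda>p. (\<phi> n p - q p)\<^sup>2 + (dx (\<phi> n) p - wdx U q p)\<^sup>2 + (dy (\<phi> n) p - wdy U q p)\<^sup>2) \<in> borel_measurable (lebesgue_on U)"
   by (intro borel_measurable_add borel_measurable_power borel_measurable_diff Lm[OF Q(1)] Lm[OF Q(4)] Lm[OF Q(5)]
     ms[OF \<phi>(1)] ms[OF smooth_dx[OF \<phi>(1)]] ms[OF smooth_dy[OF \<phi>(1)]])
  show "AE p in lebesgue_on U. (\<psi> n p - ?q p)\<^sup>2 + (dx (\<psi> n) p - wdx U ?q p)\<^sup>2 + (dy (\<psi> n) p - wdy U ?q p)\<^sup>2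
   = (\<phi> n p - q p)\<^sup>2 + (dx (\<phi> n) p - wdx U q p)\<^sup>2 + (dy (\<phi> n) p - wdy U q p)\<^sup>2"
   unfolding AE_lebesgue_on_iff[OF Ub] using W(2,3)
   by eventually_elim (auto simp: d, auto simp: \<psi>_def)
 qed
 with \<phi>(2) have c: "(\<lambda>n. LINT p|lebesgue_on U. (\<psi> n p - ?q p)\<^sup>2 + (dx (\<psi> n) p - wdx U ?q p)\<^sup>2 + (dy (\<psi> n) p - wdy U ?q p)\<^sup>2) \<longlonglongrightarrow> 0"
  by simp
 have b: "(\<lambda>n. \<integral>\<^sup>+ t\<in>{0..1}. ennreal ((\<psi> n (a + t *\<^sub>R (b - a)) - g (a + t *\<^sub>R (b - a)))\<^sup>2) \<partial>lborel) \<longlonglongrightarrow> 0"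
  if ab: "a \<noteq> b" "closed_segment a b \<subseteq> \<Gamma>" for a b
 proof -
  have "\<eta> (a + r *\<^sub>R (b - a)) = 0" if "r \<in> {0..1}" for r
  proof (rule z)
   have "a + r *\<^sub>R (b - a) = (1 - r) *\<^sub>R a + r *\<^sub>R b" by (simp add: algebra_simps)
   then have "a + r *\<^sub>R (b - a) \<in> closed_segment a b" using that by (auto simp: closed_segment_def)
   with ab(2) show "a + r *\<^sub>R (b - a) \<in> \<Gamma>" by blast
  qed
  then have "(\<integral>\<^sup>+ t\<in>{0..1}. ennreal ((\<psi> n (a + t *\<^sub>R (b - a)) - g (a + t *\<^sub>R (b - a)))\<^sup>2) \<partial>lborel)
   = (\<integral>\<^sup>+ t\<in>{0..1}. ennreal ((\<phi> n (a + t *\<^sub>R (b - a)) - g (a + t *\<^sub>R (b - a)))\<^sup>2) \<partial>lborel)" for n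
   by (intro nn_integral_cong) (auto simp: \<psi>_def indicator_def)
  with \<phi>(3)[OF ab] show ?thesis by simp
 qed
 show ?thesis unfolding trace_on_def by (intro exI[of _ \<psi>] conjI allI impI s\<psi> c) (use b in blast)
qed

section \<open>Fourth powers of Sobolev functions with bounded boundary values\<close>

text \<open>From \<open>w(X)\<^sup>2 - w(x)\<^sup>2 = \<integral> 2 w w'\<close> and \<open>\<bar>2 w w'\<bar> \<le> w\<^sup>2 + w'\<^sup>2\<close>.\<close>

lemma sq_bound_ftc:
 fixes w w' :: "real \<Rightarrow> real"
 assumes w: "\<And>t. (w has_real_derivative w' t) (at t)" and c: "continuous_on UNIV w'" and x: "x \<le> X"
 shows "ennreal ((w x)\<^sup>2) \<le> ennreal ((w X)\<^sup>2) + (\<integral>\<^sup>+ s. indicator {x..X} s * ennreal ((w s)\<^sup>2 + (w' s)\<^sup>2) \<partial>lborel)"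
proof -
 have cw: "continuous_on S w" for S using w by (intro continuous_at_imp_continuous_on) (auto intro: DERIV_isCont)
 have cw': "continuous_on S w'" for S using c by (rule continuous_on_subset) simp
 define G where "G s = (w s)\<^sup>2 + (w' s)\<^sup>2" for s
 have iG: "integrable lborel (\<lambda>s. indicator {x..X} s *\<^sub>R G s)"
  unfolding G_def by (intro borel_integrable_compact continuous_intros cw cw') auto
 have iw: "integrable lborel (\<lambda>s. indicator {x..X} s *\<^sub>R (2 * w s * w' s))"
  by (intro borel_integrable_compact continuous_intros cw cw') auto
 have "(LINT s|lborel. indicator {x..X} s *\<^sub>R (2 * w s * w' s)) = (w X)\<^sup>2 - (w x)\<^sup>2"
 proof (rule integral_FTC_atLeastAtMost[OF x])
  fix t
  have "((\<lambda>t. (w t)\<^sup>2) has_real_derivative 2 * w t * w' t) (at t)"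
   using w[of t] by (auto intro!: derivative_eq_intros)
  then show "((\<lambda>t. (w t)\<^sup>2) has_vector_derivative 2 * w t * w' t) (at t within {x..X})"
   by (simp add: has_real_derivative_iff_has_vector_derivative[symmetric] has_field_derivative_at_within)
 qed (intro continuous_intros cw cw')
 moreover have "(LINT s|lborel. - (indicator {x..X} s *\<^sub>R (2 * w s * w' s))) \<le> (LINT s|lborel. indicator {x..X} s *\<^sub>R G s)"
 proof (rule integral_mono)
  fix s
  have "- (2 * w s * w' s) \<le> G s" using zero_le_power2[of "w s + w' s"] unfolding power2_sum G_def by simp
  then show "- (indicator {x..X} s *\<^sub>R (2 * w s * w' s)) \<le> indicator {x..X} s *\<^sub>R G s" by (simp add: indicator_def)
 qed (use iw iG in auto)
 ultimately have "(w x)\<^sup>2 \<le> (w X)\<^sup>2 + (LINT s|lborel. indicator {x..X} s *\<^sub>R G s)" using iw by simp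
 then have "ennreal ((w x)\<^sup>2) \<le> ennreal ((w X)\<^sup>2 + (LINT s|lborel. indicator {x..X} s *\<^sub>R G s))" by (rule ennreal_leI)
 also have "\<dots> = ennreal ((w X)\<^sup>2) + ennreal (LINT s|lborel. indicator {x..X} s *\<^sub>R G s)"
  by (rule ennreal_plus) (auto intro!: integral_nonneg_AE simp: G_def)
 also have "ennreal (LINT s|lborel. indicator {x..X} s *\<^sub>R G s) = (\<integral>\<^sup>+ s. ennreal (indicator {x..X} s *\<^sub>R G s) \<partial>lborel)"
  by (rule nn_integral_eq_integral[OF iG, symmetric]) (auto simp: G_def)
 also have "\<dots> = (\<integral>\<^sup>+ s. indicator {x..X} s * ennreal ((w s)\<^sup>2 + (w' s)\<^sup>2) \<partial>lborel)"
  by (intro nn_integral_cong) (auto simp: indicator_def G_def)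
 finally show ?thesis .
qed

lemma fub_nn_fst:
 fixes f :: "real \<times> real \<Rightarrow> ennreal"
 assumes "f \<in> borel_measurable borel"
 shows "(\<integral>\<^sup>+ x. \<integral>\<^sup>+ y. f (x, y) \<partial>lborel \<partial>lborel) = (\<integral>\<^sup>+ p. f p \<partial>lborel)"
  and "(\<integral>\<^sup>+ y. \<integral>\<^sup>+ x. f (x, y) \<partial>lborel \<partial>lborel) = (\<integral>\<^sup>+ p. f p \<partial>lborel)"
proof -
 interpret lborel_pair: pair_sigma_finite "lborel :: real measure" "lborel :: real measure" ..
 have m: "f \<in> borel_measurable (lborel \<Otimes>\<^sub>M lborel)" unfolding lborel_prod using assms by simp
 show "(\<integral>\<^sup>+ x. \<integral>\<^sup>+ y. f (x, y) \<partial>lborel \<partial>lborel) = (\<integral>\<^sup>+ p. f p \<partial>lborel)"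
  using lborel.nn_integral_fst[OF m] unfolding lborel_prod .
 show "(\<integral>\<^sup>+ y. \<integral>\<^sup>+ x. f (x, y) \<partial>lborel \<partial>lborel) = (\<integral>\<^sup>+ p. f p \<partial>lborel)"
  using lborel_pair.nn_integral_snd[OF m] unfolding lborel_prod .
qed

lemma diag_DERIV:
 assumes "smooth \<phi>"
 shows "((\<lambda>t. \<phi> (c + t, t)) has_real_derivative dx \<phi> (c + t, t) + dy \<phi> (c + t, t)) (at t)"
proof -
 have d: "\<phi> differentiable (at (c + t, t))" by (rule smooth_differentiable[OF assms])
 then obtain D where D: "(\<phi> has_derivative D) (at (c + t, t))" unfolding differentiable_def by blast
 have lin: "linear D" using has_derivative_linear[OF D] .
 have "((\<phi> \<circ> (\<lambda>s. (s, t))) has_derivative D \<circ> (\<lambda>h. (h, 0))) (at (c + t))"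
  by (intro diff_chain_at) (auto intro!: derivative_eq_intros D)
 then have "D (1, 0) = dx \<phi> (c + t, t)"
  using dx_DERIV[OF d] has_derivative_unique[of "\<lambda>s. \<phi> (s, t)" "D \<circ> (\<lambda>h. (h, 0))" "c + t" "(*) (dx \<phi> (c + t, t))"]
  by (auto simp: has_field_derivative_def o_def dest: fun_cong[of _ _ 1])
 moreover have "((\<phi> \<circ> (\<lambda>s. (c + t, s))) has_derivative D \<circ> (\<lambda>h. (0, h))) (at t)"
  by (intro diff_chain_at) (auto intro!: derivative_eq_intros D)
 then have "D (0, 1) = dy \<phi> (c + t, t)"
  using dy_DERIV[OF d] has_derivative_unique[of "\<lambda>s. \<phi> (c + t, s)" "D \<circ> (\<lambda>h. (0, h))" t "(*) (dy \<phi> (c + t, t))"]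
  by (auto simp: has_field_derivative_def o_def dest: fun_cong[of _ _ 1])
 moreover have "D (h, h) = h * (D (1, 0) + D (0, 1))" for h
  using linear_scale[OF lin, of h "(1, 1)"] linear_add[OF lin, of "(1, 0)" "(0, 1)"] by simp
 moreover have "((\<phi> \<circ> (\<lambda>s. (c + s, s))) has_derivative D \<circ> (\<lambda>h. (h, h))) (at t)"
  by (intro diff_chain_at) (auto intro!: derivative_eq_intros D)
 ultimately show ?thesis by (simp add: has_field_derivative_def o_def mult.commute[of _ "dx \<phi> _ + dy \<phi> _"])
qed

text \<open>Gagliardo's argument: \<open>\<phi>\<^sup>2\<close> is bounded by a function of \<open>y\<close> alone (integrating along the
 horizontal) and by a function of \<open>x - y\<close> alone (integrating along the direction of the diagonal);
 both kinds of lines leave the domain through the outer boundary.\<close>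

lemma gagliardo:
 assumes \<phi>: "smooth \<phi>" and e: "0 < \<epsilon>" "\<epsilon> < 1"
 defines "T1 \<equiv> \<integral>\<^sup>+ t. indicator {0..1} t * ennreal ((\<phi> (1, (1 - \<epsilon>) * t))\<^sup>2) \<partial>lborel"
  and "T2 \<equiv> \<integral>\<^sup>+ t. indicator {0..1} t * ennreal ((\<phi> (1 - t * \<epsilon> / 2, 1 - \<epsilon> + t * \<epsilon> / 2))\<^sup>2) \<partial>lborel"
  and "S \<equiv> \<integral>\<^sup>+ p. indicator (Omega_q \<epsilon>) p * ennreal ((\<phi> p)\<^sup>2 + (dx \<phi> p)\<^sup>2 + (dy \<phi> p)\<^sup>2) \<partial>lborel"
 shows "(\<integral>\<^sup>+ p. indicator (Omega_q \<epsilon>) p * ennreal (\<phi> p ^ 4) \<partial>lborel) \<le> (T1 + T2 + S) * (T1 + T2 + 2 * S)"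
proof -
 define U where "U = Omega_q \<epsilon>"
 have U: "(x, y) \<in> U \<longleftrightarrow> 0 < y \<and> y < x \<and> x < 1 \<and> x + y < 2 - \<epsilon>" for x y
  unfolding U_def by (rule mem_Omega_q[OF e])
 have Ub: "U \<in> sets (borel \<Otimes>\<^sub>M borel)" unfolding U_def borel_prod by (rule Omega_q_borel)
 have sm: "w \<in> borel_measurable (borel \<Otimes>\<^sub>M borel)" if "smooth w" for w using smooth_borel[OF that] by (simp add: borel_prod)
 note [measurable] = Ub sm[OF \<phi>] sm[OF smooth_dx[OF \<phi>]] sm[OF smooth_dy[OF \<phi>]]
 define X where "X y = min 1 (2 - \<epsilon> - y)" for y
 define Y where "Y c = min (1 - c) ((2 - \<epsilon> - c) / 2)" for c
 define Hx where "Hx p = indicator U p * ennreal ((\<phi> p)\<^sup>2 + (dx \<phi> p)\<^sup>2)" for p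
 define Hd where "Hd p = indicator U p * ennreal ((\<phi> p)\<^sup>2 + (dx \<phi> p + dy \<phi> p)\<^sup>2)" for p
 have Hm [measurable]: "Hx \<in> borel_measurable (borel \<Otimes>\<^sub>M borel)" "Hd \<in> borel_measurable (borel \<Otimes>\<^sub>M borel)"
  unfolding Hx_def[abs_def] Hd_def[abs_def] by measurable
 have Hb: "Hx \<in> borel_measurable borel" "Hd \<in> borel_measurable borel" using Hm by (simp_all add: borel_prod)
 define a where "a y = indicator {0<..<1 - \<epsilon> / 2} y * (ennreal ((\<phi> (X y, y))\<^sup>2) + (\<integral>\<^sup>+ s. Hx (s, y) \<partial>lborel))" for y
 define b where "b c = indicator {0<..<1} c * (ennreal ((\<phi> (c + Y c, Y c))\<^sup>2) + (\<integral>\<^sup>+ s. Hd (c + s, s) \<partial>lborel))" for c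
 have am [measurable]: "a \<in> borel_measurable borel" unfolding a_def[abs_def] X_def by measurable
 have bm [measurable]: "b \<in> borel_measurable borel" unfolding b_def[abs_def] Y_def by measurable
 have pa: "ennreal ((\<phi> (x, y))\<^sup>2) \<le> a y" if p: "(x, y) \<in> U" for x y
 proof -
  have xX: "x \<le> X y" using p U by (simp add: X_def)
  have "ennreal ((\<phi> (x, y))\<^sup>2) \<le> ennreal ((\<phi> (X y, y))\<^sup>2)
    + (\<integral>\<^sup>+ s. indicator {x..X y} s * ennreal ((\<phi> (s, y))\<^sup>2 + (dx \<phi> (s, y))\<^sup>2) \<partial>lborel)"
  proof (rule sq_bound_ftc[OF _ _ xX])
   show "((\<lambda>t. \<phi> (t, y)) has_real_derivative dx \<phi> (t, y)) (at t)" for t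
    using dx_DERIV[OF smooth_differentiable[OF \<phi>], of "(t, y)"] by simp
   show "continuous_on UNIV (\<lambda>t. dx \<phi> (t, y))"
    by (intro continuous_on_compose2[OF smooth_cont[OF smooth_dx[OF \<phi>], of UNIV]] continuous_intros) auto
  qed
  also have "(\<integral>\<^sup>+ s. indicator {x..X y} s * ennreal ((\<phi> (s, y))\<^sup>2 + (dx \<phi> (s, y))\<^sup>2) \<partial>lborel) \<le> (\<integral>\<^sup>+ s. Hx (s, y) \<partial>lborel)"
  proof (rule nn_integral_mono_AE)
   have "AE s in lborel. s \<noteq> X y" by (rule AE_lborel_singleton)
   then show "AE s in lborel. indicator {x..X y} s * ennreal ((\<phi> (s, y))\<^sup>2 + (dx \<phi> (s, y))\<^sup>2) \<le> Hx (s, y)"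
    by eventually_elim (use p U in \<open>auto simp: Hx_def indicator_def X_def\<close>)
  qed
  also have "ennreal ((\<phi> (X y, y))\<^sup>2) + (\<integral>\<^sup>+ s. Hx (s, y) \<partial>lborel) = a y" using p U by (simp add: a_def)
  finally show ?thesis by (simp add: add_left_mono)
 qed
 have pb: "ennreal ((\<phi> (x, y))\<^sup>2) \<le> b (x - y)" if p: "(x, y) \<in> U" for x y
 proof -
  define c where "c = x - y"
  have yY: "y \<le> Y c" using p U by (simp add: Y_def c_def)
  have "ennreal ((\<phi> (c + y, y))\<^sup>2) \<le> ennreal ((\<phi> (c + Y c, Y c))\<^sup>2)
    + (\<integral>\<^sup>+ s. indicator {y..Y c} s * ennreal ((\<phi> (c + s, s))\<^sup>2 + (dx \<phi> (c + s, s) + dy \<phi> (c + s, s))\<^sup>2) \<partial>lborel)"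
  proof (rule sq_bound_ftc[OF diag_DERIV[OF \<phi>] _ yY])
   show "continuous_on UNIV (\<lambda>t. dx \<phi> (c + t, t) + dy \<phi> (c + t, t))"
    by (intro continuous_on_add continuous_on_compose2[OF smooth_cont[OF smooth_dx[OF \<phi>], of UNIV]]
      continuous_on_compose2[OF smooth_cont[OF smooth_dy[OF \<phi>], of UNIV]] continuous_intros) auto
  qed
  also have "(\<integral>\<^sup>+ s. indicator {y..Y c} s * ennreal ((\<phi> (c + s, s))\<^sup>2 + (dx \<phi> (c + s, s) + dy \<phi> (c + s, s))\<^sup>2) \<partial>lborel)
    \<le> (\<integral>\<^sup>+ s. Hd (c + s, s) \<partial>lborel)"
  proof (rule nn_integral_mono_AE)
   have "AE s in lborel. s \<noteq> Y c" by (rule AE_lborel_singleton)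
   then show "AE s in lborel. indicator {y..Y c} s * ennreal ((\<phi> (c + s, s))\<^sup>2 + (dx \<phi> (c + s, s) + dy \<phi> (c + s, s))\<^sup>2) \<le> Hd (c + s, s)"
    by eventually_elim (use p U in \<open>auto simp: Hd_def indicator_def Y_def c_def\<close>)
  qed
  also have "ennreal ((\<phi> (c + Y c, Y c))\<^sup>2) + (\<integral>\<^sup>+ s. Hd (c + s, s) \<partial>lborel) = b c" using p U by (simp add: b_def c_def)
  finally show ?thesis by (simp add: add_left_mono c_def)
 qed
 define B where "B = (\<integral>\<^sup>+ c. b c \<partial>lborel)"
 have "(\<integral>\<^sup>+ p. indicator U p * ennreal (\<phi> p ^ 4) \<partial>lborel) = (\<integral>\<^sup>+ y. \<integral>\<^sup>+ x. indicator U (x, y) * ennreal (\<phi> (x, y) ^ 4) \<partial>lborel \<partial>lborel)"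
  by (rule fub_nn_fst(2)[symmetric]) (use smooth_borel[OF \<phi>] Omega_q_borel[of \<epsilon>] in \<open>simp add: U_def\<close>)
 also have "\<dots> \<le> (\<integral>\<^sup>+ y. \<integral>\<^sup>+ x. a y * b (x - y) \<partial>lborel \<partial>lborel)"
 proof (intro nn_integral_mono)
  fix x y :: real
  have "ennreal (\<phi> (x, y) ^ 4) = ennreal ((\<phi> (x, y))\<^sup>2) * ennreal ((\<phi> (x, y))\<^sup>2)"
   by (subst ennreal_mult[symmetric]) (auto simp: power4_eq_xxxx power2_eq_square mult.assoc)
  then show "indicator U (x, y) * ennreal (\<phi> (x, y) ^ 4) \<le> a y * b (x - y)"
   using mult_mono[OF pa pb] by (cases "(x, y) \<in> U") auto
 qed
 also have "\<dots> = (\<integral>\<^sup>+ y. a y * B \<partial>lborel)"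
 proof (intro nn_integral_cong)
  fix y :: real
  have "(\<integral>\<^sup>+ x. b (x - y) \<partial>lborel) = B"
   unfolding B_def using nn_integral_real_affine[OF bm, of 1 "- y"] by simp
  then show "(\<integral>\<^sup>+ x. a y * b (x - y) \<partial>lborel) = a y * B" by (subst nn_integral_cmult) auto
 qed
 also have "\<dots> = (\<integral>\<^sup>+ y. a y \<partial>lborel) * B" by (rule nn_integral_multc) simp
 also have "\<dots> \<le> (T1 + T2 + S) * (T1 + T2 + 2 * S)"
 proof (rule mult_mono)
  define f1 where "f1 y = indicator {0..1 - \<epsilon>} y * ennreal ((\<phi> (1, y))\<^sup>2)" for y
  define f2 where "f2 y = indicator {1 - \<epsilon>..1 - \<epsilon> / 2} y * ennreal ((\<phi> (2 - \<epsilon> - y, y))\<^sup>2)" for y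
  have [measurable]: "f1 \<in> borel_measurable borel" "f2 \<in> borel_measurable borel"
   unfolding f1_def[abs_def] f2_def[abs_def] by measurable
  have i1: "(\<integral>\<^sup>+ y. f1 y \<partial>lborel) \<le> T1"
  proof -
   have "(\<integral>\<^sup>+ y. f1 y \<partial>lborel) = ennreal (1 - \<epsilon>) * (\<integral>\<^sup>+ t. f1 ((1 - \<epsilon>) * t) \<partial>lborel)"
    using nn_integral_real_affine[of f1 "1 - \<epsilon>" 0] e by simp
   also have "(\<integral>\<^sup>+ t. f1 ((1 - \<epsilon>) * t) \<partial>lborel) = T1"
    unfolding T1_def f1_def using e
    by (intro nn_integral_cong) (auto simp: indicator_def zero_le_mult_iff mult_le_cancel_left1)
   also have "ennreal (1 - \<epsilon>) * T1 \<le> 1 * T1" using e by (intro mult_right_mono) auto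
   finally show ?thesis by simp
  qed
  have i2: "(\<integral>\<^sup>+ y. f2 y \<partial>lborel) \<le> T2"
  proof -
   have "(\<integral>\<^sup>+ y. f2 y \<partial>lborel) = ennreal (\<epsilon> / 2) * (\<integral>\<^sup>+ t. f2 (1 - \<epsilon> + \<epsilon> / 2 * t) \<partial>lborel)"
    using nn_integral_real_affine[of f2 "\<epsilon> / 2" "1 - \<epsilon>"] e by simp
   also have "(\<integral>\<^sup>+ t. f2 (1 - \<epsilon> + \<epsilon> / 2 * t) \<partial>lborel) = T2"
    unfolding T2_def
   proof (intro nn_integral_cong)
    fix t :: real
    have "1 - \<epsilon> + \<epsilon> / 2 * t \<in> {1 - \<epsilon>..1 - \<epsilon> / 2} \<longleftrightarrow> t \<in> {0..1}" using e by (auto simp: zero_le_mult_iff field_simps)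
    moreover have "2 - \<epsilon> - (1 - \<epsilon> + \<epsilon> / 2 * t) = 1 - t * \<epsilon> / 2" "1 - \<epsilon> + \<epsilon> / 2 * t = 1 - \<epsilon> + t * \<epsilon> / 2" by (simp_all add: field_simps)
    ultimately show "f2 (1 - \<epsilon> + \<epsilon> / 2 * t) = indicator {0..1} t * ennreal ((\<phi> (1 - t * \<epsilon> / 2, 1 - \<epsilon> + t * \<epsilon> / 2))\<^sup>2)"
     unfolding f2_def by (simp only: indicator_def)
   qed
   also have "ennreal (\<epsilon> / 2) * T2 \<le> 1 * T2" using e by (intro mult_right_mono) auto
   finally show ?thesis by simp
  qed
  have "(\<integral>\<^sup>+ y. a y \<partial>lborel) \<le> (\<integral>\<^sup>+ y. f1 y + f2 y + (\<integral>\<^sup>+ s. Hx (s, y) \<partial>lborel) \<partial>lborel)"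
  proof (rule nn_integral_mono)
   fix y
   show "a y \<le> f1 y + f2 y + (\<integral>\<^sup>+ s. Hx (s, y) \<partial>lborel)"
   proof (cases "y \<in> {0<..<1 - \<epsilon> / 2}")
    case True
    have "ennreal ((\<phi> (X y, y))\<^sup>2) \<le> f1 y + f2 y"
    proof (cases "y \<le> 1 - \<epsilon>")
     case True
     then have "X y = 1" using e by (simp add: X_def)
     then show ?thesis using True \<open>y \<in> _\<close> by (simp add: f1_def)
    next
     case False
     then have "X y = 2 - \<epsilon> - y" using e by (simp add: X_def)
     then show ?thesis using False \<open>y \<in> _\<close> by (simp add: f2_def)
    qed
    then show ?thesis using True by (simp add: a_def add_right_mono)
   qed (simp add: a_def)
  qed
  also have "\<dots> = (\<integral>\<^sup>+ y. f1 y \<partial>lborel) + (\<integral>\<^sup>+ y. f2 y \<partial>lborel) + (\<integral>\<^sup>+ y. \<integral>\<^sup>+ s. Hx (s, y) \<partial>lborel \<partial>lborel)"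
   by (simp add: nn_integral_add)
  also have "(\<integral>\<^sup>+ y. \<integral>\<^sup>+ s. Hx (s, y) \<partial>lborel \<partial>lborel) \<le> S"
   unfolding fub_nn_fst(2)[OF Hb(1)] S_def by (intro nn_integral_mono) (auto simp: Hx_def U_def indicator_def)
  finally show "(\<integral>\<^sup>+ y. a y \<partial>lborel) \<le> T1 + T2 + S" using i1 i2 by (meson add_mono order_trans order_refl)
  define g1 where "g1 c = f1 (1 - c)" for c
  define g2 where "g2 c = f2 ((2 - \<epsilon> - c) / 2)" for c
  have [measurable]: "g1 \<in> borel_measurable borel" "g2 \<in> borel_measurable borel"
   unfolding g1_def[abs_def] g2_def[abs_def] by measurable
  have j1: "(\<integral>\<^sup>+ c. g1 c \<partial>lborel) \<le> T1"
   using nn_integral_real_affine[of f1 "-1" 1] i1 by (simp add: g1_def)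
  have j2: "(\<integral>\<^sup>+ c. g2 c \<partial>lborel) \<le> T2"
  proof -
   have "(\<integral>\<^sup>+ c. g2 c \<partial>lborel) = ennreal \<epsilon> * (\<integral>\<^sup>+ t. g2 (\<epsilon> + (- \<epsilon>) * t) \<partial>lborel)"
    using nn_integral_real_affine[of g2 "- \<epsilon>" "\<epsilon>"] e by simp
   also have "(\<integral>\<^sup>+ t. g2 (\<epsilon> + (- \<epsilon>) * t) \<partial>lborel) = T2"
    unfolding T2_def
   proof (intro nn_integral_cong)
    fix t :: real
    have q: "(2 - \<epsilon> - (\<epsilon> + - \<epsilon> * t)) / 2 = 1 - \<epsilon> + t * \<epsilon> / 2" by (simp add: field_simps)
    have "1 - \<epsilon> + t * \<epsilon> / 2 \<in> {1 - \<epsilon>..1 - \<epsilon> / 2} \<longleftrightarrow> t \<in> {0..1}" using e by (auto simp: zero_le_mult_iff field_simps)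
    moreover have "2 - \<epsilon> - (1 - \<epsilon> + t * \<epsilon> / 2) = 1 - t * \<epsilon> / 2" by (simp add: field_simps)
    ultimately show "g2 (\<epsilon> + (- \<epsilon>) * t) = indicator {0..1} t * ennreal ((\<phi> (1 - t * \<epsilon> / 2, 1 - \<epsilon> + t * \<epsilon> / 2))\<^sup>2)"
     unfolding g2_def q f2_def by (simp only: indicator_def)
   qed
   also have "ennreal \<epsilon> * T2 \<le> 1 * T2" using e by (intro mult_right_mono) auto
   finally show ?thesis by simp
  qed
  have "B \<le> (\<integral>\<^sup>+ c. g1 c + g2 c + (\<integral>\<^sup>+ s. Hd (c + s, s) \<partial>lborel) \<partial>lborel)"
   unfolding B_def
  proof (rule nn_integral_mono)
   fix c
   show "b c \<le> g1 c + g2 c + (\<integral>\<^sup>+ s. Hd (c + s, s) \<partial>lborel)"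
   proof (cases "c \<in> {0<..<1}")
    case True
    have "ennreal ((\<phi> (c + Y c, Y c))\<^sup>2) \<le> g1 c + g2 c"
    proof (cases "\<epsilon> \<le> c")
     case True
     then have "Y c = 1 - c" using e by (simp add: Y_def)
     then show ?thesis using True \<open>c \<in> _\<close> by (simp add: g1_def f1_def)
    next
     case False
     then have y: "Y c = (2 - \<epsilon> - c) / 2" using e by (simp add: Y_def field_simps)
     then have z: "c + Y c = 2 - \<epsilon> - Y c" by (simp add: field_simps)
     moreover have "Y c \<in> {1 - \<epsilon>..1 - \<epsilon> / 2}" using False \<open>c \<in> _\<close> unfolding y by (simp add: field_simps)
     ultimately have "g2 c = ennreal ((\<phi> (c + Y c, Y c))\<^sup>2)" unfolding g2_def y[symmetric] f2_def z
      by (simp only: indicator_simps mult_1)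
     then show ?thesis by simp
    qed
    then show ?thesis using True by (simp add: b_def add_right_mono)
   qed (simp add: b_def)
  qed
  also have "\<dots> = (\<integral>\<^sup>+ y. g1 y \<partial>lborel) + (\<integral>\<^sup>+ y. g2 y \<partial>lborel) + (\<integral>\<^sup>+ c. \<integral>\<^sup>+ s. Hd (c + s, s) \<partial>lborel \<partial>lborel)"
   by (simp add: nn_integral_add)
  also have "(\<integral>\<^sup>+ c. \<integral>\<^sup>+ s. Hd (c + s, s) \<partial>lborel \<partial>lborel) \<le> 2 * S"
  proof -
   have m2: "(\<lambda>p. Hd (fst p + snd p, snd p)) \<in> borel_measurable borel"
   proof -
    have "(\<lambda>p. Hd (fst p + snd p, snd p)) \<in> borel_measurable (borel \<Otimes>\<^sub>M borel)" by measurable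
    then show ?thesis by (simp add: borel_prod)
   qed
   have "(\<integral>\<^sup>+ c. \<integral>\<^sup>+ s. Hd (c + s, s) \<partial>lborel \<partial>lborel) = (\<integral>\<^sup>+ s. \<integral>\<^sup>+ c. Hd (c + s, s) \<partial>lborel \<partial>lborel)"
    using fub_nn_fst[OF m2] by simp
   also have "\<dots> = (\<integral>\<^sup>+ s. \<integral>\<^sup>+ x. Hd (x, s) \<partial>lborel \<partial>lborel)"
   proof (rule nn_integral_cong)
    fix s :: real
    have "(\<lambda>x. Hd (x, s)) \<in> borel_measurable borel" by measurable
    from nn_integral_real_affine[OF this, of 1 s] show "(\<integral>\<^sup>+ c. Hd (c + s, s) \<partial>lborel) = (\<integral>\<^sup>+ x. Hd (x, s) \<partial>lborel)"
     by (simp add: add.commute)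
   qed
   also have "\<dots> = (\<integral>\<^sup>+ p. Hd p \<partial>lborel)" by (rule fub_nn_fst(2)[OF Hb(2)])
   also have "\<dots> \<le> (\<integral>\<^sup>+ p. 2 * (indicator U p * ennreal ((\<phi> p)\<^sup>2 + (dx \<phi> p)\<^sup>2 + (dy \<phi> p)\<^sup>2)) \<partial>lborel)"
   proof (rule nn_integral_mono)
    fix p
    have "(\<phi> p)\<^sup>2 + (dx \<phi> p + dy \<phi> p)\<^sup>2 \<le> 2 * ((\<phi> p)\<^sup>2 + (dx \<phi> p)\<^sup>2 + (dy \<phi> p)\<^sup>2)"
    proof -
     have "(dx \<phi> p + dy \<phi> p)\<^sup>2 \<le> 2 * (dx \<phi> p)\<^sup>2 + 2 * (dy \<phi> p)\<^sup>2"
      using zero_le_power2[of "dx \<phi> p - dy \<phi> p"] unfolding power2_sum power2_diff by simp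
     moreover have "0 \<le> (\<phi> p)\<^sup>2" by simp
     ultimately show ?thesis by (smt (verit))
    qed
    then have "ennreal ((\<phi> p)\<^sup>2 + (dx \<phi> p + dy \<phi> p)\<^sup>2) \<le> 2 * ennreal ((\<phi> p)\<^sup>2 + (dx \<phi> p)\<^sup>2 + (dy \<phi> p)\<^sup>2)"
     using ennreal_leI ennreal_mult[of 2 "(\<phi> p)\<^sup>2 + (dx \<phi> p)\<^sup>2 + (dy \<phi> p)\<^sup>2"] ennreal_numeral[of "num.Bit0 num.One"]
     by (metis add_nonneg_nonneg zero_le_numeral zero_le_power2)
    then show "Hd p \<le> 2 * (indicator U p * ennreal ((\<phi> p)\<^sup>2 + (dx \<phi> p)\<^sup>2 + (dy \<phi> p)\<^sup>2))"
     by (simp add: Hd_def indicator_def)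
   qed
   also have "\<dots> = 2 * S"
   proof -
    have "(\<lambda>p. indicator U p * ennreal ((\<phi> p)\<^sup>2 + (dx \<phi> p)\<^sup>2 + (dy \<phi> p)\<^sup>2)) \<in> borel_measurable (borel \<Otimes>\<^sub>M borel)" by measurable
    then have "(\<lambda>p. indicator U p * ennreal ((\<phi> p)\<^sup>2 + (dx \<phi> p)\<^sup>2 + (dy \<phi> p)\<^sup>2)) \<in> borel_measurable lborel" by (simp add: borel_prod)
    then show ?thesis unfolding S_def U_def[symmetric] by (rule nn_integral_cmult)
   qed
   finally show ?thesis .
  qed
  finally show "B \<le> T1 + T2 + 2 * S" using j1 j2 by (meson add_mono order_trans order_refl)
 qed simp_all
 finally show ?thesis unfolding U_def .
qed

lemma closed_segment_param:
 assumes "x \<in> closed_segment a (b :: real \<times> real)" obtains t where "0 \<le> t" "t \<le> 1" "x = a + t *\<^sub>R (b - a)"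
 using assms unfolding closed_segment_def by (auto simp: algebra_simps)

lemma segments_outer:
 assumes e: "0 < \<epsilon>" "\<epsilon> < 1"
 shows "closed_segment (1, 0) (1, 1 - \<epsilon>) \<subseteq> frontier (Omega_q \<epsilon>) \<inter> frontier (Omega \<epsilon>)"
  and "closed_segment (1, 1 - \<epsilon>) (1 - \<epsilon> / 2, 1 - \<epsilon> / 2) \<subseteq> frontier (Omega_q \<epsilon>) \<inter> frontier (Omega \<epsilon>)"
  and "closed_segment (0, 0) (1 - \<epsilon>, 1 - \<epsilon>) \<subseteq> frontier (Omega_q \<epsilon>) \<inter> {(x, y). y = x}"
proof safe
 fix x y :: real assume "(x, y) \<in> closed_segment (1, 0) (1, 1 - \<epsilon>)"
 then obtain t where t: "0 \<le> t" "t \<le> 1" "(x, y) = (1, t * (1 - \<epsilon>))"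
  by (rule closed_segment_param) (simp add: algebra_simps)
 have "t * (1 - \<epsilon>) \<le> 1 * (1 - \<epsilon>)" "0 \<le> t * (1 - \<epsilon>)" using t e by (intro mult_right_mono mult_nonneg_nonneg; simp)+
 then show "(x, y) \<in> frontier (Omega_q \<epsilon>)" "(x, y) \<in> frontier (Omega \<epsilon>)"
  using frontier_outer[OF e, of y x] t e by auto
next
 fix x y :: real assume "(x, y) \<in> closed_segment (1, 1 - \<epsilon>) (1 - \<epsilon> / 2, 1 - \<epsilon> / 2)"
 then obtain t where t: "0 \<le> t" "t \<le> 1" "(x, y) = (1 - t * \<epsilon> / 2, 1 - \<epsilon> + t * \<epsilon> / 2)"
  by (rule closed_segment_param) (simp add: algebra_simps)
 have "t * \<epsilon> \<le> 1 * \<epsilon>" "0 \<le> t * \<epsilon>" using t e by (intro mult_right_mono mult_nonneg_nonneg; simp)+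
 then show "(x, y) \<in> frontier (Omega_q \<epsilon>)" "(x, y) \<in> frontier (Omega \<epsilon>)"
  using frontier_outer[OF e, of y x] t e by auto
next
 fix x y :: real assume "(x, y) \<in> closed_segment (0, 0) (1 - \<epsilon>, 1 - \<epsilon>)"
 then obtain t where t: "0 \<le> t" "t \<le> 1" "(x, y) = (t * (1 - \<epsilon>), t * (1 - \<epsilon>))"
  by (rule closed_segment_param) (simp add: algebra_simps)
 have "t * (1 - \<epsilon>) \<le> 1 * (1 - \<epsilon>)" "0 \<le> t * (1 - \<epsilon>)" using t e by (intro mult_right_mono mult_nonneg_nonneg; simp)+
 then show "(x, y) \<in> frontier (Omega_q \<epsilon>)" "y = x" using frontier_diag[OF e, of x] t by auto
qed

lemma bounded_traces_nn:
 fixes f w :: "real \<Rightarrow> real"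
 assumes m: "f \<in> borel_measurable borel" "continuous_on {0..1} w" and G: "\<And>t. t \<in> {0..1} \<Longrightarrow> \<bar>w t\<bar> \<le> G"
  and le: "(\<integral>\<^sup>+ t\<in>{0..1}. ennreal ((f t - w t)\<^sup>2) \<partial>lborel) \<le> 1"
 shows "(\<integral>\<^sup>+ t. indicator {0..1} t * ennreal ((f t)\<^sup>2) \<partial>lborel) \<le> ennreal (2 + 2 * G\<^sup>2)"
proof -
 define W where "W t = indicator {0..1} t *\<^sub>R w t" for t
 have W: "W \<in> borel_measurable borel" unfolding W_def by (intro borel_measurable_continuous_on_indicator m) auto
 have "(\<integral>\<^sup>+ t. indicator {0..1} t * ennreal ((f t)\<^sup>2) \<partial>lborel)
   \<le> (\<integral>\<^sup>+ t. 2 * (ennreal ((f t - W t)\<^sup>2) * indicator {0..1} t) + ennreal (2 * G\<^sup>2) * indicator {0..1} t \<partial>lborel)"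
 proof (rule nn_integral_mono)
  fix t :: real
  show "indicator {0..1} t * ennreal ((f t)\<^sup>2) \<le> 2 * (ennreal ((f t - W t)\<^sup>2) * indicator {0..1} t) + ennreal (2 * G\<^sup>2) * indicator {0..1} t"
  proof (cases "t \<in> {0..1}")
   case True
   have "(w t)\<^sup>2 \<le> G\<^sup>2" using power_mono[OF G[OF True], of 2] by simp
   moreover have "(f t)\<^sup>2 \<le> 2 * (f t - w t)\<^sup>2 + 2 * (w t)\<^sup>2"
    using zero_le_power2[of "f t - 2 * w t"] by (simp add: power2_eq_square algebra_simps)
   ultimately have "(f t)\<^sup>2 \<le> 2 * (f t - w t)\<^sup>2 + 2 * G\<^sup>2" by simp
   then have "ennreal ((f t)\<^sup>2) \<le> ennreal (2 * (f t - w t)\<^sup>2 + 2 * G\<^sup>2)" by (rule ennreal_leI)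
   also have "\<dots> = 2 * ennreal ((f t - w t)\<^sup>2) + ennreal (2 * G\<^sup>2)"
    by (simp add: ennreal_plus ennreal_mult)
   finally show ?thesis using True by (simp add: W_def)
  qed simp
 qed
 also have "\<dots> = 2 * (\<integral>\<^sup>+ t. ennreal ((f t - W t)\<^sup>2) * indicator {0..1} t \<partial>lborel) + ennreal (2 * G\<^sup>2)"
  using m W by (simp add: nn_integral_add nn_integral_cmult)
 also have "(\<integral>\<^sup>+ t. ennreal ((f t - W t)\<^sup>2) * indicator {0..1} t \<partial>lborel) = (\<integral>\<^sup>+ t\<in>{0..1}. ennreal ((f t - w t)\<^sup>2) \<partial>lborel)"
  by (intro nn_integral_cong) (auto simp: W_def indicator_def)
 also have "2 * \<dots> + ennreal (2 * G\<^sup>2) \<le> 2 * 1 + ennreal (2 * G\<^sup>2)" using le by (intro add_right_mono mult_left_mono) auto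
 also have "\<dots> = ennreal (2 + 2 * G\<^sup>2)" by (simp add: ennreal_plus)
 finally show ?thesis .
qed

text \<open>The approximating sequence of the trace condition, rewritten for Borel representatives.\<close>

lemma trace_seq:
 assumes U: "U \<in> sets borel" "bounded U" and q: "W12 U q" and tr: "trace_on U q \<Gamma> g"
  and u: "u \<in> borel_measurable borel" "AE p in lborel. p \<in> U \<longrightarrow> q p = u p"
  and ux: "ux \<in> borel_measurable borel" "AE p in lborel. p \<in> U \<longrightarrow> wdx U q p = ux p"
  and uy: "uy \<in> borel_measurable borel" "AE p in lborel. p \<in> U \<longrightarrow> wdy U q p = uy p"
 obtains \<phi> where "\<And>n. smooth (\<phi> n)"
  "\<And>n. integrable lborel (\<lambda>p. indicator U p * ((\<phi> n p - u p)\<^sup>2 + (dx (\<phi> n) p - ux p)\<^sup>2 + (dy (\<phi> n) p - uy p)\<^sup>2))"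
  "(\<lambda>n. LINT p|lborel. indicator U p * ((\<phi> n p - u p)\<^sup>2 + (dx (\<phi> n) p - ux p)\<^sup>2 + (dy (\<phi> n) p - uy p)\<^sup>2)) \<longlonglongrightarrow> 0"
  "\<And>a b. a \<noteq> b \<Longrightarrow> closed_segment a b \<subseteq> \<Gamma> \<Longrightarrow> (\<lambda>n. \<integral>\<^sup>+ t\<in>{0..1}.
      ennreal ((\<phi> n (a + t *\<^sub>R (b - a)) - g (a + t *\<^sub>R (b - a)))\<^sup>2) \<partial>lborel) \<longlonglongrightarrow> 0"
proof -
 note Q = W12_wd[OF q]
 have Um: "indicator U \<in> borel_measurable (borel :: (real \<times> real) measure)" using U by simp
 obtain \<phi> where \<phi>: "\<And>n. smooth (\<phi> n)"
  "(\<lambda>n. LINT p|lebesgue_on U. (\<phi> n p - q p)\<^sup>2 + (dx (\<phi> n) p - wdx U q p)\<^sup>2 + (dy (\<phi> n) p - wdy U q p)\<^sup>2) \<longlonglongrightarrow> 0"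
  "\<And>a b. a \<noteq> b \<Longrightarrow> closed_segment a b \<subseteq> \<Gamma> \<Longrightarrow> (\<lambda>n. \<integral>\<^sup>+ t\<in>{0..1}.
      ennreal ((\<phi> n (a + t *\<^sub>R (b - a)) - g (a + t *\<^sub>R (b - a)))\<^sup>2) \<partial>lborel) \<longlonglongrightarrow> 0"
  using tr unfolding trace_on_def by blast
 note b\<phi> = smooth_borel[OF \<phi>(1)] smooth_borel[OF smooth_dx[OF \<phi>(1)]] smooth_borel[OF smooth_dy[OF \<phi>(1)]]
 note [measurable] = b\<phi> u(1) ux(1) uy(1) Um
 define d where "d n p = indicator U p * ((\<phi> n p - u p)\<^sup>2 + (dx (\<phi> n) p - ux p)\<^sup>2 + (dy (\<phi> n) p - uy p)\<^sup>2)" for n p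
 have dm: "d n \<in> borel_measurable borel" for n unfolding d_def[abs_def] by measurable
 have d_int: "integrable lborel (d n)" and D: "(LINT p|lebesgue_on U. (\<phi> n p - q p)\<^sup>2 + (dx (\<phi> n) p - wdx U q p)\<^sup>2 + (dy (\<phi> n) p - wdy U q p)\<^sup>2) = (LINT p|lborel. d n p)" for n
 proof -
  have L: "L2_on U (\<lambda>p. \<phi> n p + (-1) * q p)" "L2_on U (\<lambda>p. dx (\<phi> n) p + (-1) * wdx U q p)" "L2_on U (\<lambda>p. dy (\<phi> n) p + (-1) * wdy U q p)"
   by (intro L2_add L2_smooth smooth_dx smooth_dy \<phi>(1) U Q)+
  have i: "integrable (lebesgue_on U) (\<lambda>p. (\<phi> n p - q p)\<^sup>2 + (dx (\<phi> n) p - wdx U q p)\<^sup>2 + (dy (\<phi> n) p - wdy U q p)\<^sup>2)"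
   using L by (auto simp: L2_on_def)
  have ae: "AE p in lborel. p \<in> U \<longrightarrow> (\<phi> n p - q p)\<^sup>2 + (dx (\<phi> n) p - wdx U q p)\<^sup>2 + (dy (\<phi> n) p - wdy U q p)\<^sup>2 = d n p"
   using u(2) ux(2) uy(2) by eventually_elim (auto simp: d_def)
  have z: "d n p = 0" if "p \<notin> U" for p using that by (simp add: d_def)
  note X = integral_lebesgue_on[OF U(1) borel_measurable_integrable[OF i] dm z ae]
  from X i show "integrable lborel (d n)" "(LINT p|lebesgue_on U. (\<phi> n p - q p)\<^sup>2 + (dx (\<phi> n) p - wdx U q p)\<^sup>2 + (dy (\<phi> n) p - wdy U q p)\<^sup>2) = (LINT p|lborel. d n p)"
   by auto
 qed
 have Dlim: "(\<lambda>n. LINT p|lborel. d n p) \<longlonglongrightarrow> 0" using \<phi>(2) unfolding D .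
 show ?thesis by (rule that[OF \<phi>(1) d_int[unfolded d_def[abs_def]] Dlim[unfolded d_def[abs_def]] \<phi>(3)])
qed

text \<open>Gagliardo's inequality bounds the fourth powers of the smooth approximations uniformly, since their
 boundary values on the two outer edges converge; Fatou's lemma carries the bound to the limit.
 The quartic term of the energy is thereby integrable, so that the energy can be varied.\<close>

lemma W12_L4:
 assumes e: "0 < \<epsilon>" "\<epsilon> < 1" and q: "W12 (Omega_q \<epsilon>) q"
  and tr: "trace_on (Omega_q \<epsilon>) q (frontier (Omega_q \<epsilon>) \<inter> frontier (Omega \<epsilon>)) g"
  and w: "continuous_on {0..1} w1" "continuous_on {0..1} w2"
  and g1: "\<And>t. t \<in> {0..1} \<Longrightarrow> g (1, (1 - \<epsilon>) * t) = w1 t"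
  and g2: "\<And>t. t \<in> {0..1} \<Longrightarrow> g (1 - t * \<epsilon> / 2, 1 - \<epsilon> + t * \<epsilon> / 2) = w2 t"
  and u: "u \<in> borel_measurable borel" "\<And>p. p \<notin> Omega_q \<epsilon> \<Longrightarrow> u p = 0" "AE p in lborel. p \<in> Omega_q \<epsilon> \<longrightarrow> q p = u p"
 shows "integrable lborel (\<lambda>p. u p ^ 4)"
proof -
 define U where "U = Omega_q \<epsilon>"
 have Ub: "U \<in> sets borel" "bounded U" unfolding U_def by (rule Omega_q_borel, rule Omega_q_bounded)
 have Um: "indicator U \<in> borel_measurable (borel :: (real \<times> real) measure)" using Ub by simp
 note Q = W12_wd[OF q[folded U_def]]
 obtain ux where ux: "ux \<in> borel_measurable borel" "\<And>p. p \<notin> U \<Longrightarrow> ux p = 0" "AE p in lborel. p \<in> U \<longrightarrow> wdx U q p = ux p"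
  "integrable lborel (\<lambda>p. (ux p)\<^sup>2)" by (rule L2_rep[OF Q(4) Ub(2,1)]) blast
 obtain uy where uy: "uy \<in> borel_measurable borel" "\<And>p. p \<notin> U \<Longrightarrow> uy p = 0" "AE p in lborel. p \<in> U \<longrightarrow> wdy U q p = uy p"
  "integrable lborel (\<lambda>p. (uy p)\<^sup>2)" by (rule L2_rep[OF Q(5) Ub(2,1)]) blast
 note u' = u[folded U_def]
 have u2: "integrable lborel (\<lambda>p. (u p)\<^sup>2)"
 proof -
  have "AE p in lborel. p \<in> U \<longrightarrow> (q p)\<^sup>2 = (u p)\<^sup>2" using u'(3) by eventually_elim auto
  moreover have "(\<lambda>p. (q p)\<^sup>2) \<in> borel_measurable (lebesgue_on U)" using Q(1) by (auto simp: L2_on_def intro: borel_measurable_power)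
  ultimately show ?thesis using integral_lebesgue_on(2)[OF Ub(1), of "\<lambda>p. (q p)\<^sup>2" "\<lambda>p. (u p)\<^sup>2"] Q(1) u'(1,2) by (simp add: L2_on_def)
 qed
 obtain \<phi> where \<phi>: "\<And>n. smooth (\<phi> n)"
  "\<And>n. integrable lborel (\<lambda>p. indicator U p * ((\<phi> n p - u p)\<^sup>2 + (dx (\<phi> n) p - ux p)\<^sup>2 + (dy (\<phi> n) p - uy p)\<^sup>2))"
  "(\<lambda>n. LINT p|lborel. indicator U p * ((\<phi> n p - u p)\<^sup>2 + (dx (\<phi> n) p - ux p)\<^sup>2 + (dy (\<phi> n) p - uy p)\<^sup>2)) \<longlonglongrightarrow> 0"
  "\<And>a b. a \<noteq> b \<Longrightarrow> closed_segment a b \<subseteq> frontier U \<inter> frontier (Omega \<epsilon>) \<Longrightarrow> (\<lambda>n. \<integral>\<^sup>+ t\<in>{0..1}.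
      ennreal ((\<phi> n (a + t *\<^sub>R (b - a)) - g (a + t *\<^sub>R (b - a)))\<^sup>2) \<partial>lborel) \<longlonglongrightarrow> 0"
  by (rule trace_seq[OF Ub q[folded U_def] tr[folded U_def] u'(1,3) ux(1,3) uy(1,3)]) blast
 note b\<phi> = smooth_borel[OF \<phi>(1)] smooth_borel[OF smooth_dx[OF \<phi>(1)]] smooth_borel[OF smooth_dy[OF \<phi>(1)]]
 note [measurable] = b\<phi> u(1) ux(1) uy(1) Um
 define d where "d n p = indicator U p * ((\<phi> n p - u p)\<^sup>2 + (dx (\<phi> n) p - ux p)\<^sup>2 + (dy (\<phi> n) p - uy p)\<^sup>2)" for n p
 have d0: "d n p \<ge> 0" for n p by (simp add: d_def)
 have d_int: "integrable lborel (d n)" for n unfolding d_def[abs_def] by (rule \<phi>(2))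
 have Dlim: "(\<lambda>n. LINT p|lborel. d n p) \<longlonglongrightarrow> 0" unfolding d_def[abs_def] by (rule \<phi>(3))
 define W where "W = (LINT p|lborel. (u p)\<^sup>2 + (ux p)\<^sup>2 + (uy p)\<^sup>2)"
 have bdd: "\<exists>G. \<forall>t\<in>{0..1}. \<bar>w t\<bar> \<le> G" if "continuous_on {0..1} w" for w :: "real \<Rightarrow> real"
 proof -
  have "bounded (w ` {0..1})" by (intro compact_imp_bounded compact_continuous_image that) simp
  then show ?thesis by (auto simp: bounded_iff)
 qed
 obtain G1 G2 where G: "\<And>t. t \<in> {0..1} \<Longrightarrow> \<bar>w1 t\<bar> \<le> G1" "\<And>t. t \<in> {0..1} \<Longrightarrow> \<bar>w2 t\<bar> \<le> G2"
  using bdd[OF w(1)] bdd[OF w(2)] by blast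
 define K where "K = ((2 + 2 * G1\<^sup>2) + (2 + 2 * G2\<^sup>2) + (2 + 2 * W)) * ((2 + 2 * G1\<^sup>2) + (2 + 2 * G2\<^sup>2) + 2 * (2 + 2 * W))"
 have W0: "W \<ge> 0" unfolding W_def by (intro integral_nonneg_AE) auto
 have s1: "(\<lambda>n. \<integral>\<^sup>+ t\<in>{0..1}. ennreal ((\<phi> n (1, (1 - \<epsilon>) * t) - w1 t)\<^sup>2) \<partial>lborel) \<longlonglongrightarrow> 0"
 proof -
  have "(\<lambda>n. \<integral>\<^sup>+ t\<in>{0..1}. ennreal ((\<phi> n ((1, 0) + t *\<^sub>R ((1, 1 - \<epsilon>) - (1, 0))) - g ((1, 0) + t *\<^sub>R ((1, 1 - \<epsilon>) - (1, 0))))\<^sup>2) \<partial>lborel) \<longlonglongrightarrow> 0"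
   by (rule \<phi>(4)) (use e segments_outer(1)[OF e] in \<open>auto simp: U_def\<close>)
  moreover have "(\<integral>\<^sup>+ t\<in>{0..1}. ennreal ((\<phi> n ((1, 0) + t *\<^sub>R ((1, 1 - \<epsilon>) - (1, 0))) - g ((1, 0) + t *\<^sub>R ((1, 1 - \<epsilon>) - (1, 0))))\<^sup>2) \<partial>lborel)
    = (\<integral>\<^sup>+ t\<in>{0..1}. ennreal ((\<phi> n (1, (1 - \<epsilon>) * t) - w1 t)\<^sup>2) \<partial>lborel)" for n
   using g1 by (intro nn_integral_cong) (auto simp: indicator_def mult.commute)
  ultimately show ?thesis by simp
 qed
 have s2: "(\<lambda>n. \<integral>\<^sup>+ t\<in>{0..1}. ennreal ((\<phi> n (1 - t * \<epsilon> / 2, 1 - \<epsilon> + t * \<epsilon> / 2) - w2 t)\<^sup>2) \<partial>lborel) \<longlonglongrightarrow> 0"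
 proof -
  have "(\<lambda>n. \<integral>\<^sup>+ t\<in>{0..1}. ennreal ((\<phi> n ((1, 1 - \<epsilon>) + t *\<^sub>R ((1 - \<epsilon> / 2, 1 - \<epsilon> / 2) - (1, 1 - \<epsilon>))) - g ((1, 1 - \<epsilon>) + t *\<^sub>R ((1 - \<epsilon> / 2, 1 - \<epsilon> / 2) - (1, 1 - \<epsilon>))))\<^sup>2) \<partial>lborel) \<longlonglongrightarrow> 0"
   by (rule \<phi>(4)) (use e segments_outer(2)[OF e] in \<open>auto simp: U_def\<close>)
  moreover have "(1, 1 - \<epsilon>) + t *\<^sub>R ((1 - \<epsilon> / 2, 1 - \<epsilon> / 2) - (1, 1 - \<epsilon>)) = (1 - t * \<epsilon> / 2, 1 - \<epsilon> + t * \<epsilon> / 2)" for t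
   by (simp add: algebra_simps)
  ultimately have "(\<lambda>n. \<integral>\<^sup>+ t\<in>{0..1}. ennreal ((\<phi> n (1 - t * \<epsilon> / 2, 1 - \<epsilon> + t * \<epsilon> / 2) - g (1 - t * \<epsilon> / 2, 1 - \<epsilon> + t * \<epsilon> / 2))\<^sup>2) \<partial>lborel) \<longlonglongrightarrow> 0"
   by simp
  moreover have "(\<integral>\<^sup>+ t\<in>{0..1}. ennreal ((\<phi> n (1 - t * \<epsilon> / 2, 1 - \<epsilon> + t * \<epsilon> / 2) - g (1 - t * \<epsilon> / 2, 1 - \<epsilon> + t * \<epsilon> / 2))\<^sup>2) \<partial>lborel)
   = (\<integral>\<^sup>+ t\<in>{0..1}. ennreal ((\<phi> n (1 - t * \<epsilon> / 2, 1 - \<epsilon> + t * \<epsilon> / 2) - w2 t)\<^sup>2) \<partial>lborel)" for n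
   using g2 by (intro nn_integral_cong) (auto simp: indicator_def)
  ultimately show ?thesis by simp
 qed
 have bound: "\<forall>\<^sub>F n in sequentially. (\<integral>\<^sup>+ p. indicator U p * ennreal (\<phi> n p ^ 4) \<partial>lborel) \<le> ennreal K"
 proof -
  have "\<forall>\<^sub>F n in sequentially. (\<integral>\<^sup>+ t\<in>{0..1}. ennreal ((\<phi> n (1, (1 - \<epsilon>) * t) - w1 t)\<^sup>2) \<partial>lborel) < 1"
   "\<forall>\<^sub>F n in sequentially. (\<integral>\<^sup>+ t\<in>{0..1}. ennreal ((\<phi> n (1 - t * \<epsilon> / 2, 1 - \<epsilon> + t * \<epsilon> / 2) - w2 t)\<^sup>2) \<partial>lborel) < 1"
   "\<forall>\<^sub>F n in sequentially. (LINT p|lborel. d n p) < 1"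
   using order_tendstoD(2)[OF s1] order_tendstoD(2)[OF s2] order_tendstoD(2)[OF Dlim] by auto
  then show ?thesis
  proof eventually_elim
   case (elim n)
   have c: "continuous_on UNIV (\<phi> n)" by (rule smooth_cont[OF \<phi>(1)])
   have mm: "(\<lambda>t. \<phi> n (1, (1 - \<epsilon>) * t)) \<in> borel_measurable borel" "(\<lambda>t. \<phi> n (1 - t * \<epsilon> / 2, 1 - \<epsilon> + t * \<epsilon> / 2)) \<in> borel_measurable borel"
    by (intro borel_measurable_continuous_onI continuous_on_compose2[OF c] continuous_intros; simp)+
   have T1: "(\<integral>\<^sup>+ t. indicator {0..1} t * ennreal ((\<phi> n (1, (1 - \<epsilon>) * t))\<^sup>2) \<partial>lborel) \<le> ennreal (2 + 2 * G1\<^sup>2)"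
    by (rule bounded_traces_nn[OF mm(1) w(1) G(1)]) (use elim in auto)
   have T2: "(\<integral>\<^sup>+ t. indicator {0..1} t * ennreal ((\<phi> n (1 - t * \<epsilon> / 2, 1 - \<epsilon> + t * \<epsilon> / 2))\<^sup>2) \<partial>lborel) \<le> ennreal (2 + 2 * G2\<^sup>2)"
    by (rule bounded_traces_nn[OF mm(2) w(2) G(2)]) (use elim in auto)
   have iw: "integrable lborel (\<lambda>p. 2 * d n p + 2 * ((u p)\<^sup>2 + (ux p)\<^sup>2 + (uy p)\<^sup>2))" using d_int u2 ux(4) uy(4) by auto
   have "(\<integral>\<^sup>+ p. indicator U p * ennreal ((\<phi> n p)\<^sup>2 + (dx (\<phi> n) p)\<^sup>2 + (dy (\<phi> n) p)\<^sup>2) \<partial>lborel)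
    \<le> (\<integral>\<^sup>+ p. ennreal (2 * d n p + 2 * ((u p)\<^sup>2 + (ux p)\<^sup>2 + (uy p)\<^sup>2)) \<partial>lborel)"
   proof (rule nn_integral_mono)
    fix p
    have sq: "a\<^sup>2 \<le> 2 * (a - b)\<^sup>2 + 2 * b\<^sup>2" for a b :: real
     using zero_le_power2[of "a - 2 * b"] by (simp add: power2_eq_square algebra_simps)
    show "indicator U p * ennreal ((\<phi> n p)\<^sup>2 + (dx (\<phi> n) p)\<^sup>2 + (dy (\<phi> n) p)\<^sup>2)
     \<le> ennreal (2 * d n p + 2 * ((u p)\<^sup>2 + (ux p)\<^sup>2 + (uy p)\<^sup>2))"
    proof (cases "p \<in> U")
     case True
     then have "(\<phi> n p)\<^sup>2 + (dx (\<phi> n) p)\<^sup>2 + (dy (\<phi> n) p)\<^sup>2 \<le> 2 * d n p + 2 * ((u p)\<^sup>2 + (ux p)\<^sup>2 + (uy p)\<^sup>2)"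
      using sq[of "\<phi> n p" "u p"] sq[of "dx (\<phi> n) p" "ux p"] sq[of "dy (\<phi> n) p" "uy p"] by (simp add: d_def)
     from ennreal_leI[OF this] show ?thesis using True by (simp del: ennreal_plus)
    qed simp
   qed
   also have "\<dots> = ennreal (LINT p|lborel. 2 * d n p + 2 * ((u p)\<^sup>2 + (ux p)\<^sup>2 + (uy p)\<^sup>2))"
    by (rule nn_integral_eq_integral[OF iw]) (auto simp: d0)
   also have "(LINT p|lborel. 2 * d n p + 2 * ((u p)\<^sup>2 + (ux p)\<^sup>2 + (uy p)\<^sup>2)) = 2 * (LINT p|lborel. d n p) + 2 * W"
    using d_int u2 ux(4) uy(4) by (simp add: W_def)
   also have "ennreal \<dots> \<le> ennreal (2 + 2 * W)" using elim(3) by (intro ennreal_leI) simp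
   finally have S: "(\<integral>\<^sup>+ p. indicator U p * ennreal ((\<phi> n p)\<^sup>2 + (dx (\<phi> n) p)\<^sup>2 + (dy (\<phi> n) p)\<^sup>2) \<partial>lborel) \<le> ennreal (2 + 2 * W)" .
   have "(\<integral>\<^sup>+ p. indicator U p * ennreal (\<phi> n p ^ 4) \<partial>lborel)
    \<le> (ennreal (2 + 2 * G1\<^sup>2) + ennreal (2 + 2 * G2\<^sup>2) + ennreal (2 + 2 * W)) * (ennreal (2 + 2 * G1\<^sup>2) + ennreal (2 + 2 * G2\<^sup>2) + 2 * ennreal (2 + 2 * W))"
    by (rule order_trans[OF gagliardo[OF \<phi>(1) e, folded U_def]])
     (intro mult_mono add_mono T1 T2 S order_refl mult_left_mono; simp)
   also have "\<dots> = ennreal K"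
   proof -
    have w: "2 * ennreal (2 + 2 * W) = ennreal (2 * (2 + 2 * W))"
     using ennreal_mult[of 2 "2 + 2 * W"] W0 by (simp only: ennreal_numeral)
    show ?thesis unfolding w K_def using W0
     by (simp add: ennreal_mult[symmetric] ennreal_plus[symmetric] add_nonneg_nonneg del: ennreal_plus)
   qed
   finally show ?case .
  qed
 qed
 obtain r where r: "strict_mono r" "AE p in lborel. (\<lambda>n. d (r n) p) \<longlonglongrightarrow> 0"
  using tendsto_L1_AE_subseq[of lborel d] d_int Dlim d0 by auto
 have "(\<integral>\<^sup>+ p. ennreal (u p ^ 4) \<partial>lborel) \<le> (\<integral>\<^sup>+ p. liminf (\<lambda>n. indicator U p * ennreal (\<phi> (r n) p ^ 4)) \<partial>lborel)"
 proof (rule nn_integral_mono_AE)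
  from r(2) show "AE p in lborel. ennreal (u p ^ 4) \<le> liminf (\<lambda>n. indicator U p * ennreal (\<phi> (r n) p ^ 4))"
  proof eventually_elim
   case (elim p)
   show ?case
   proof (cases "p \<in> U")
    case True
    have "(\<lambda>n. (\<phi> (r n) p - u p)\<^sup>2) \<longlonglongrightarrow> 0"
    proof (rule tendsto_sandwich[OF _ _ tendsto_const elim])
     show "\<forall>\<^sub>F n in sequentially. (\<phi> (r n) p - u p)\<^sup>2 \<le> d (r n) p" using True by (intro always_eventually) (auto simp: d_def)
    qed simp
    then have "(\<lambda>n. sqrt ((\<phi> (r n) p - u p)\<^sup>2)) \<longlonglongrightarrow> sqrt 0" by (rule tendsto_real_sqrt)
    then have "(\<lambda>n. \<phi> (r n) p - u p) \<longlonglongrightarrow> 0" by (simp add: tendsto_rabs_zero_iff)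
    then have "(\<lambda>n. \<phi> (r n) p) \<longlonglongrightarrow> u p" by (simp add: LIM_zero_iff)
    then have "(\<lambda>n. indicator U p * ennreal (\<phi> (r n) p ^ 4)) \<longlonglongrightarrow> ennreal (u p ^ 4)"
     using True by (simp add: tendsto_power)
    then show ?thesis using lim_imp_Liminf[of sequentially] by (metis order_refl sequentially_bot)
   next
    case False
    then show ?thesis using u'(2) by simp
   qed
  qed
 qed
 also have "\<dots> \<le> liminf (\<lambda>n. \<integral>\<^sup>+ p. indicator U p * ennreal (\<phi> (r n) p ^ 4) \<partial>lborel)"
  by (rule nn_integral_liminf) measurable
 also have "\<dots> \<le> ennreal K"
 proof (rule Liminf_le)
  show "\<forall>\<^sub>F n in sequentially. (\<integral>\<^sup>+ p. indicator U p * ennreal (\<phi> (r n) p ^ 4) \<partial>lborel) \<le> ennreal K"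
   using bound r(1) eventually_subseq by blast
 qed simp
 finally have "(\<integral>\<^sup>+ p. ennreal (norm (u p ^ 4)) \<partial>lborel) \<le> ennreal K" by (simp add: power_even_abs)
 then show ?thesis by (intro integrableI_bounded) (auto simp: le_less_trans)
qed

section \<open>The first variation\<close>

lemma quartic_nonneg_linear_zero:
 fixes a b c d :: real
 assumes "\<And>t. 0 \<le> t * a + t\<^sup>2 * b + t ^ 3 * c + t ^ 4 * d"
 shows "a = 0"
proof -
 have "((\<lambda>t. t * a + t\<^sup>2 * b + t ^ 3 * c + t ^ 4 * d) has_real_derivative a) (at 0)"
  by (auto intro!: derivative_eq_intros)
 from DERIV_local_min[OF this, of 1] assms show ?thesis by auto
qed

text \<open>The coefficients are linear combinations of the values at \<open>t = 0, 1, -1, 2, -2\<close>, hence integrable.\<close>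

lemma quartic_first_variation:
 fixes G :: "real \<Rightarrow> 'a \<Rightarrow> real"
 assumes i: "\<And>t. integrable M (G t)"
  and G: "\<And>t p. G t p = e0 p + t * e1 p + t\<^sup>2 * e2 p + t ^ 3 * e3 p + t ^ 4 * e4 p"
  and m: "\<And>t. (LINT p|M. G 0 p) \<le> (LINT p|M. G t p)"
 shows "(LINT p|M. e1 p) = 0" "integrable M e1"
proof -
 have "e0 = G 0" by (simp add: G fun_eq_iff)
 then have i0: "integrable M e0" using i[of 0] by simp
 have "integrable M (\<lambda>p. (8 * (G 1 p - G (-1) p) - (G 2 p - G (-2) p)) / 12)" using i by auto
 moreover have "(8 * (G 1 p - G (-1) p) - (G 2 p - G (-2) p)) / 12 = e1 p" for p unfolding G by simp
 ultimately have i1: "integrable M e1" by simp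
 have "integrable M (\<lambda>p. (16 * (G 1 p + G (-1) p) - (G 2 p + G (-2) p) - 30 * G 0 p) / 24)" using i by auto
 moreover have "(16 * (G 1 p + G (-1) p) - (G 2 p + G (-2) p) - 30 * G 0 p) / 24 = e2 p" for p unfolding G by simp
 ultimately have i2: "integrable M e2" by simp
 have "integrable M (\<lambda>p. ((G 2 p - G (-2) p) - 2 * (G 1 p - G (-1) p)) / 12)" using i by auto
 moreover have "((G 2 p - G (-2) p) - 2 * (G 1 p - G (-1) p)) / 12 = e3 p" for p unfolding G by simp
 ultimately have i3: "integrable M e3" by simp
 have "integrable M (\<lambda>p. ((G 2 p + G (-2) p) - 4 * (G 1 p + G (-1) p) + 6 * G 0 p) / 24)" using i by auto
 moreover have "((G 2 p + G (-2) p) - 4 * (G 1 p + G (-1) p) + 6 * G 0 p) / 24 = e4 p" for p unfolding G by simp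
 ultimately have i4: "integrable M e4" by simp
 have "(LINT p|M. G t p) = (LINT p|M. e0 p) + t * (LINT p|M. e1 p) + t\<^sup>2 * (LINT p|M. e2 p)
   + t ^ 3 * (LINT p|M. e3 p) + t ^ 4 * (LINT p|M. e4 p)" for t
  unfolding G using i0 i1 i2 i3 i4 by simp
 then have "0 \<le> t * (LINT p|M. e1 p) + t\<^sup>2 * (LINT p|M. e2 p) + t ^ 3 * (LINT p|M. e3 p) + t ^ 4 * (LINT p|M. e4 p)" for t
  using m[of t] by simp
 then show "(LINT p|M. e1 p) = 0" by (rule quartic_nonneg_linear_zero)
 show "integrable M e1" by (rule i1)
qed

text \<open>The coefficient of \<open>t\<close> in \<open>f_el\<close> along the line \<open>q + t \<eta>\<close>.\<close>

definition f_el_polar where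
 "f_el_polar L2 x1 y1 x2 y2 x3 y3 h1x h1y h2x h2y h3x h3y =
   (2 + L2) * (x1 * h1x + y1 * h1y) + (2 + L2) * (x2 * h2x + y2 * h2y) + (6 + L2) * (x3 * h3x + y3 * h3y)
   + L2 * (y1 * h3y + h1y * y3 - x1 * h3x - h1x * x3 - y2 * h3x - h2y * x3 - x2 * h3y - h2x * y3)
   + \<bar>L2\<bar> * (y2 * h1x + h2y * x1 - y1 * h2x - h1y * x2 :: real)"

lemma f_el_expand:
 "f_el L2 (x1 + t * h1x) (y1 + t * h1y) (x2 + t * h2x) (y2 + t * h2y) (x3 + t * h3x) (y3 + t * h3y)
  = f_el L2 x1 y1 x2 y2 x3 y3 + t * f_el_polar L2 x1 y1 x2 y2 x3 y3 h1x h1y h2x h2y h3x h3y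
   + t\<^sup>2 * f_el L2 h1x h1y h2x h2y h3x h3y"
proof -
 have a: "\<bar>L2\<bar> * ((y2 + t * h2y) * (x1 + t * h1x) - (y1 + t * h1y) * (x2 + t * h2x))
  = \<bar>L2\<bar> * (y2 * x1 - y1 * x2) + t * (\<bar>L2\<bar> * (y2 * h1x + h2y * x1 - y1 * h2x - h1y * x2))
   + t\<^sup>2 * (\<bar>L2\<bar> * (h2y * h1x - h1y * h2x))" by (simp add: power2_eq_square algebra_simps)
 have b: "L2 * ((y1 + t * h1y) * (y3 + t * h3y) - (x1 + t * h1x) * (x3 + t * h3x) - (y2 + t * h2y) * (x3 + t * h3x) - (x2 + t * h2x) * (y3 + t * h3y))
  = L2 * (y1 * y3 - x1 * x3 - y2 * x3 - x2 * y3)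
   + t * (L2 * (y1 * h3y + h1y * y3 - x1 * h3x - h1x * x3 - y2 * h3x - h2y * x3 - x2 * h3y - h2x * y3))
   + t\<^sup>2 * (L2 * (h1y * h3y - h1x * h3x - h2y * h3x - h2x * h3y))" by (simp add: power2_eq_square algebra_simps)
 have c: "c * ((x + t * h)\<^sup>2 + (y + t * l)\<^sup>2) = c * (x\<^sup>2 + y\<^sup>2) + t * (2 * c * (x * h + y * l)) + t\<^sup>2 * (c * (h\<^sup>2 + l\<^sup>2))"
  for c x h y l :: real by (simp add: power2_eq_square algebra_simps)
 have d: "2 * (1 + L2 / 2) = 2 + L2" "2 * (3 + L2 / 2) = 6 + L2" by simp_all
 have g: "(a1 + t * b1 + r * c1) + (a2 + t * b2 + r * c2) + (a3 + t * b3 + r * c3) + (a4 + t * b4 + r * c4) + (a5 + t * b5 + r * c5)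
  = (a1 + a2 + a3 + a4 + a5) + t * (b1 + b2 + b3 + b4 + b5) + r * (c1 + c2 + c3 + c4 + c5)"
  for a1 a2 a3 a4 a5 b1 b2 b3 b4 b5 c1 c2 c3 c4 c5 r :: real by (simp add: distrib_left)
 show ?thesis unfolding f_el_def f_el_polar_def a b c d by (rule g)
qed

definition f_b_deriv where
 "f_b_deriv A B C u w v h1 h2 h3 =
   A * (2 * (u * h1 + w * h2 + 3 * v * h3))
   + 2 * C * (u\<^sup>2 + w\<^sup>2 + 3 * v\<^sup>2) * (2 * (u * h1 + w * h2 + 3 * v * h3))
   + 2 * B * (v * (2 * (u * h1 + w * h2 - v * h3)) + h3 * (u\<^sup>2 + w\<^sup>2 - v\<^sup>2) :: real)"

lemma f_b_expand:
 "\<exists>e2 e3 e4. \<forall>t. f_b A B C (u + t * h1) (w + t * h2) (v + t * h3)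
  = f_b A B C u w v + t * f_b_deriv A B C u w v h1 h2 h3 + t\<^sup>2 * e2 + t ^ 3 * e3 + t ^ 4 * e4"
proof -
 define N0 N1 N2 M0 M1 M2 where "N0 = u\<^sup>2 + w\<^sup>2 + 3 * v\<^sup>2" and "N1 = 2 * (u * h1 + w * h2 + 3 * v * h3)"
  and "N2 = h1\<^sup>2 + h2\<^sup>2 + 3 * h3\<^sup>2" and "M0 = u\<^sup>2 + w\<^sup>2 - v\<^sup>2"
  and "M1 = 2 * (u * h1 + w * h2 - v * h3)" and "M2 = h1\<^sup>2 + h2\<^sup>2 - h3\<^sup>2"
 have N: "(u + t * h1)\<^sup>2 + (w + t * h2)\<^sup>2 + 3 * (v + t * h3)\<^sup>2 = N0 + t * N1 + t\<^sup>2 * N2" for t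
  unfolding N0_def N1_def N2_def by (simp add: power2_eq_square algebra_simps)
 have M: "(u + t * h1)\<^sup>2 + (w + t * h2)\<^sup>2 - (v + t * h3)\<^sup>2 = M0 + t * M1 + t\<^sup>2 * M2" for t
  unfolding M0_def M1_def M2_def by (simp add: power2_eq_square algebra_simps)
 have "f_b A B C (u + t * h1) (w + t * h2) (v + t * h3)
  = f_b A B C u w v + t * f_b_deriv A B C u w v h1 h2 h3
   + t\<^sup>2 * (A * N2 + C * (N1\<^sup>2 + 2 * N0 * N2) + 2 * B * (v * M2 + h3 * M1))
   + t ^ 3 * (2 * C * N1 * N2 + 2 * B * h3 * M2) + t ^ 4 * (C * N2\<^sup>2)" for t
  unfolding f_b_def f_b_deriv_def N M N0_def[symmetric] N1_def[symmetric] M0_def[symmetric] M1_def[symmetric]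
  by (simp add: power2_eq_square power3_eq_cube power4_eq_xxxx algebra_simps)
 then show ?thesis by blast
qed

lemma energy_density_integrable:
 fixes U :: "(real \<times> real) set"
 assumes d: "L2_on U x1" "L2_on U y1" "L2_on U x2" "L2_on U y2" "L2_on U x3" "L2_on U y3"
  and q: "L2_on U q1" "L2_on U q2" "L2_on U q3"
   "L2_on U (\<lambda>p. (q1 p)\<^sup>2)" "L2_on U (\<lambda>p. (q2 p)\<^sup>2)" "L2_on U (\<lambda>p. (q3 p)\<^sup>2)"
 shows "integrable (lebesgue_on U) (\<lambda>p. f_el L2 (x1 p) (y1 p) (x2 p) (y2 p) (x3 p) (y3 p) + k * f_b A B C (q1 p) (q2 p) (q3 p))"
proof -
 have sq: "integrable (lebesgue_on U) (\<lambda>p. (f p)\<^sup>2)" if "L2_on U f" for f using that by (auto simp: L2_on_def)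
 have "integrable (lebesgue_on U) (\<lambda>p. f_el L2 (x1 p) (y1 p) (x2 p) (y2 p) (x3 p) (y3 p))"
  unfolding f_el_def
  by (intro Bochner_Integration.integrable_add Bochner_Integration.integrable_diff integrable_mult_right L2_mult sq d)
 moreover have "integrable (lebesgue_on U) (\<lambda>p. f_b A B C (q1 p) (q2 p) (q3 p))"
 proof -
  have n: "L2_on U (\<lambda>p. ((q1 p)\<^sup>2 + 1 * (q2 p)\<^sup>2) + 3 * (q3 p)\<^sup>2)" by (intro L2_add q)
  have m: "L2_on U (\<lambda>p. ((q1 p)\<^sup>2 + 1 * (q2 p)\<^sup>2) + (-1) * (q3 p)\<^sup>2)" by (intro L2_add q)
  have "integrable (lebesgue_on U) (\<lambda>p. A * ((q1 p)\<^sup>2 + (q2 p)\<^sup>2 + 3 * (q3 p)\<^sup>2)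
    + C * (((q1 p)\<^sup>2 + 1 * (q2 p)\<^sup>2) + 3 * (q3 p)\<^sup>2)\<^sup>2
    + 2 * B * (q3 p * (((q1 p)\<^sup>2 + 1 * (q2 p)\<^sup>2) + (-1) * (q3 p)\<^sup>2)))"
   by (intro Bochner_Integration.integrable_add integrable_mult_right L2_mult sq q n m)
  then show ?thesis unfolding f_b_def by (simp add: mult.assoc)
 qed
 ultimately show ?thesis by simp
qed

lemma L2_mult_smooth:
 assumes q: "L2_on U q" and \<eta>: "smooth \<eta>" and U: "bounded U" "U \<in> sets borel"
 shows "L2_on U (\<lambda>p. q p * \<eta> p)"
proof -
 obtain M where M: "M > 0" "\<And>p. p \<in> U \<Longrightarrow> \<bar>\<eta> p\<bar> \<le> M" by (rule bounded_on_of_cont[OF smooth_cont[OF \<eta>] U(1)]) blast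
 have m: "(\<lambda>p. q p * \<eta> p) \<in> borel_measurable (lebesgue_on U)"
  using q borel_to_lebesgue_on[OF smooth_borel[OF \<eta>]] by (auto simp: L2_on_def)
 have "integrable (lebesgue_on U) (\<lambda>p. (q p * \<eta> p)\<^sup>2)"
 proof (rule Bochner_Integration.integrable_bound[of _ "\<lambda>p. M\<^sup>2 * (q p)\<^sup>2"])
  show "integrable (lebesgue_on U) (\<lambda>p. M\<^sup>2 * (q p)\<^sup>2)" using q by (auto simp: L2_on_def)
  show "(\<lambda>p. (q p * \<eta> p)\<^sup>2) \<in> borel_measurable (lebesgue_on U)" using m by simp
  have "norm ((q p * \<eta> p)\<^sup>2) \<le> norm (M\<^sup>2 * (q p)\<^sup>2)" if "p \<in> U" for p
   using mult_right_mono[OF power_mono[OF M(2)[OF that], of 2], of "(q p)\<^sup>2"]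
   by (simp add: power_mult_distrib mult.commute)
  then show "AE p in lebesgue_on U. norm ((q p * \<eta> p)\<^sup>2) \<le> norm (M\<^sup>2 * (q p)\<^sup>2)"
   by (intro AE_I2) (simp add: space_restrict_space)
 qed
 with m show ?thesis by (simp add: L2_on_def)
qed

lemma L2_sq_add_smooth:
 assumes q: "L2_on U q" "L2_on U (\<lambda>p. (q p)\<^sup>2)" and \<eta>: "smooth \<eta>" and U: "bounded U" "U \<in> sets borel"
 shows "L2_on U (\<lambda>p. (q p + t * \<eta> p)\<^sup>2)"
proof -
 have "L2_on U (\<lambda>p. ((q p)\<^sup>2 + (2 * t) * (q p * \<eta> p)) + t\<^sup>2 * (\<eta> p * \<eta> p))"
  by (intro L2_add L2_mult_smooth L2_smooth smooth_mult q \<eta> U)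
 moreover have "((q p)\<^sup>2 + (2 * t) * (q p * \<eta> p)) + t\<^sup>2 * (\<eta> p * \<eta> p) = (q p + t * \<eta> p)\<^sup>2" for p
  by (simp add: power2_eq_square algebra_simps)
 ultimately show ?thesis by simp
qed

text \<open>Along \<open>q + t \<eta>\<close> the energy is a polynomial of degree 4 in \<open>t\<close> with minimum at 0, so its linear
 coefficient vanishes.\<close>

lemma first_variation:
 assumes U: "open U" "bounded U" and q: "W12 U q1" "W12 U q2" "W12 U q3"
  and q4: "L2_on U (\<lambda>p. (q1 p)\<^sup>2)" "L2_on U (\<lambda>p. (q2 p)\<^sup>2)" "L2_on U (\<lambda>p. (q3 p)\<^sup>2)"
  and \<eta>: "smooth \<eta>1" "smooth \<eta>2" "smooth \<eta>3"
  and m: "\<And>t. energy A B C L L2 lam U q1 q2 q3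
   \<le> energy A B C L L2 lam U (\<lambda>p. q1 p + t * \<eta>1 p) (\<lambda>p. q2 p + t * \<eta>2 p) (\<lambda>p. q3 p + t * \<eta>3 p)"
 shows "(LINT p|lebesgue_on U. f_el_polar L2 (wdx U q1 p) (wdy U q1 p) (wdx U q2 p) (wdy U q2 p) (wdx U q3 p) (wdy U q3 p)
   (dx \<eta>1 p) (dy \<eta>1 p) (dx \<eta>2 p) (dy \<eta>2 p) (dx \<eta>3 p) (dy \<eta>3 p)
   + lam\<^sup>2 / L * f_b_deriv A B C (q1 p) (q2 p) (q3 p) (\<eta>1 p) (\<eta>2 p) (\<eta>3 p)) = 0"
  (is "(LINT p|_. ?e p) = 0")
  and "integrable (lebesgue_on U) (\<lambda>p. f_el_polar L2 (wdx U q1 p) (wdy U q1 p) (wdx U q2 p) (wdy U q2 p) (wdx U q3 p) (wdy U q3 p)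
   (dx \<eta>1 p) (dy \<eta>1 p) (dx \<eta>2 p) (dy \<eta>2 p) (dx \<eta>3 p) (dy \<eta>3 p)
   + lam\<^sup>2 / L * f_b_deriv A B C (q1 p) (q2 p) (q3 p) (\<eta>1 p) (\<eta>2 p) (\<eta>3 p))"
proof -
 have Ub: "U \<in> sets borel" using U by simp
 define k where "k = lam\<^sup>2 / L"
 define G where "G t p = f_el L2 (wdx U q1 p + t * dx \<eta>1 p) (wdy U q1 p + t * dy \<eta>1 p) (wdx U q2 p + t * dx \<eta>2 p)
  (wdy U q2 p + t * dy \<eta>2 p) (wdx U q3 p + t * dx \<eta>3 p) (wdy U q3 p + t * dy \<eta>3 p)
  + k * f_b A B C (q1 p + t * \<eta>1 p) (q2 p + t * \<eta>2 p) (q3 p + t * \<eta>3 p)" for t p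
 note W1 = W12_wd[OF q(1)] and W2 = W12_wd[OF q(2)] and W3 = W12_wd[OF q(3)]
 note S = smooth_dx[OF \<eta>(1)] smooth_dx[OF \<eta>(2)] smooth_dx[OF \<eta>(3)] smooth_dy[OF \<eta>(1)] smooth_dy[OF \<eta>(2)] smooth_dy[OF \<eta>(3)]
 have i: "integrable (lebesgue_on U) (G t)" for t
  unfolding G_def
 proof (rule energy_density_integrable)
  show "L2_on U (\<lambda>p. wdx U q1 p + t * dx \<eta>1 p)" by (rule L2_add[OF W1(4) L2_smooth[OF S(1) U(2) Ub]])
  show "L2_on U (\<lambda>p. wdy U q1 p + t * dy \<eta>1 p)" by (rule L2_add[OF W1(5) L2_smooth[OF S(4) U(2) Ub]])
  show "L2_on U (\<lambda>p. wdx U q2 p + t * dx \<eta>2 p)" by (rule L2_add[OF W2(4) L2_smooth[OF S(2) U(2) Ub]])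
  show "L2_on U (\<lambda>p. wdy U q2 p + t * dy \<eta>2 p)" by (rule L2_add[OF W2(5) L2_smooth[OF S(5) U(2) Ub]])
  show "L2_on U (\<lambda>p. wdx U q3 p + t * dx \<eta>3 p)" by (rule L2_add[OF W3(4) L2_smooth[OF S(3) U(2) Ub]])
  show "L2_on U (\<lambda>p. wdy U q3 p + t * dy \<eta>3 p)" by (rule L2_add[OF W3(5) L2_smooth[OF S(6) U(2) Ub]])
  show "L2_on U (\<lambda>p. q1 p + t * \<eta>1 p)" by (rule L2_add[OF W1(1) L2_smooth[OF \<eta>(1) U(2) Ub]])
  show "L2_on U (\<lambda>p. q2 p + t * \<eta>2 p)" by (rule L2_add[OF W2(1) L2_smooth[OF \<eta>(2) U(2) Ub]])
  show "L2_on U (\<lambda>p. q3 p + t * \<eta>3 p)" by (rule L2_add[OF W3(1) L2_smooth[OF \<eta>(3) U(2) Ub]])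
  show "L2_on U (\<lambda>p. (q1 p + t * \<eta>1 p)\<^sup>2)" by (rule L2_sq_add_smooth[OF W1(1) q4(1) \<eta>(1) U(2) Ub])
  show "L2_on U (\<lambda>p. (q2 p + t * \<eta>2 p)\<^sup>2)" by (rule L2_sq_add_smooth[OF W2(1) q4(2) \<eta>(2) U(2) Ub])
  show "L2_on U (\<lambda>p. (q3 p + t * \<eta>3 p)\<^sup>2)" by (rule L2_sq_add_smooth[OF W3(1) q4(3) \<eta>(3) U(2) Ub])
 qed
 have E: "energy A B C L L2 lam U (\<lambda>p. q1 p + t * \<eta>1 p) (\<lambda>p. q2 p + t * \<eta>2 p) (\<lambda>p. q3 p + t * \<eta>3 p)
   = (LINT p|lebesgue_on U. G t p)" for t
  unfolding energy_def k_def[symmetric]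
 proof (rule integral_cong_AE)
  note V1 = W12_add_smooth[OF q(1) \<eta>(1) U, of t] and V2 = W12_add_smooth[OF q(2) \<eta>(2) U, of t] and V3 = W12_add_smooth[OF q(3) \<eta>(3) U, of t]
  show "G t \<in> borel_measurable (lebesgue_on U)" using i by simp
  note X = W12_wd[OF V1(1)] W12_wd[OF V2(1)] W12_wd[OF V3(1)]
  show "(\<lambda>p. f_el L2 (wdx U (\<lambda>p. q1 p + t * \<eta>1 p) p) (wdy U (\<lambda>p. q1 p + t * \<eta>1 p) p)
     (wdx U (\<lambda>p. q2 p + t * \<eta>2 p) p) (wdy U (\<lambda>p. q2 p + t * \<eta>2 p) p)
     (wdx U (\<lambda>p. q3 p + t * \<eta>3 p) p) (wdy U (\<lambda>p. q3 p + t * \<eta>3 p) p)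
    + k * f_b A B C (q1 p + t * \<eta>1 p) (q2 p + t * \<eta>2 p) (q3 p + t * \<eta>3 p)) \<in> borel_measurable (lebesgue_on U)"
   by (rule borel_measurable_integrable[OF energy_density_integrable[OF X(4,5,9,10,14,15,1,6,11)
     L2_sq_add_smooth[OF W1(1) q4(1) \<eta>(1) U(2) Ub] L2_sq_add_smooth[OF W2(1) q4(2) \<eta>(2) U(2) Ub]
     L2_sq_add_smooth[OF W3(1) q4(3) \<eta>(3) U(2) Ub]]])
  show "AE p in lebesgue_on U. f_el L2 (wdx U (\<lambda>p. q1 p + t * \<eta>1 p) p) (wdy U (\<lambda>p. q1 p + t * \<eta>1 p) p)
     (wdx U (\<lambda>p. q2 p + t * \<eta>2 p) p) (wdy U (\<lambda>p. q2 p + t * \<eta>2 p) p)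
     (wdx U (\<lambda>p. q3 p + t * \<eta>3 p) p) (wdy U (\<lambda>p. q3 p + t * \<eta>3 p) p)
    + k * f_b A B C (q1 p + t * \<eta>1 p) (q2 p + t * \<eta>2 p) (q3 p + t * \<eta>3 p) = G t p"
   unfolding AE_lebesgue_on_iff[OF Ub] using V1(2,3) V2(2,3) V3(2,3)
   by eventually_elim (simp add: G_def)
 qed
 have "\<forall>p. \<exists>e2 e3 e4. \<forall>t. f_b A B C (q1 p + t * \<eta>1 p) (q2 p + t * \<eta>2 p) (q3 p + t * \<eta>3 p)
  = f_b A B C (q1 p) (q2 p) (q3 p) + t * f_b_deriv A B C (q1 p) (q2 p) (q3 p) (\<eta>1 p) (\<eta>2 p) (\<eta>3 p)
   + t\<^sup>2 * e2 + t ^ 3 * e3 + t ^ 4 * e4"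
  using f_b_expand by blast
 then obtain e2 e3 e4 where e: "\<And>p t. f_b A B C (q1 p + t * \<eta>1 p) (q2 p + t * \<eta>2 p) (q3 p + t * \<eta>3 p)
  = f_b A B C (q1 p) (q2 p) (q3 p) + t * f_b_deriv A B C (q1 p) (q2 p) (q3 p) (\<eta>1 p) (\<eta>2 p) (\<eta>3 p)
   + t\<^sup>2 * e2 p + t ^ 3 * e3 p + t ^ 4 * e4 p"
  unfolding choice_iff by blast
 have m': "(LINT p|lebesgue_on U. G 0 p) \<le> (LINT p|lebesgue_on U. G t p)" for t
  using m[of t] E[of t] E[of 0] by simp
 have G: "G t p = (f_el L2 (wdx U q1 p) (wdy U q1 p) (wdx U q2 p) (wdy U q2 p) (wdx U q3 p) (wdy U q3 p) + k * f_b A B C (q1 p) (q2 p) (q3 p))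
   + t * (f_el_polar L2 (wdx U q1 p) (wdy U q1 p) (wdx U q2 p) (wdy U q2 p) (wdx U q3 p) (wdy U q3 p)
   (dx \<eta>1 p) (dy \<eta>1 p) (dx \<eta>2 p) (dy \<eta>2 p) (dx \<eta>3 p) (dy \<eta>3 p)
   + k * f_b_deriv A B C (q1 p) (q2 p) (q3 p) (\<eta>1 p) (\<eta>2 p) (\<eta>3 p))
   + t\<^sup>2 * (f_el L2 (dx \<eta>1 p) (dy \<eta>1 p) (dx \<eta>2 p) (dy \<eta>2 p) (dx \<eta>3 p) (dy \<eta>3 p) + k * e2 p)
   + t ^ 3 * (k * e3 p) + t ^ 4 * (k * e4 p)" for t p
  unfolding G_def f_el_expand e by (simp add: algebra_simps)
 show "(LINT p|lebesgue_on U. ?e p) = 0"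
  unfolding k_def[symmetric] by (rule quartic_first_variation(1)[OF i G m'])
 show "integrable (lebesgue_on U) ?e"
  unfolding k_def[symmetric] by (rule quartic_first_variation(2)[OF i G m'])
qed

section \<open>Integration by parts up to the boundary\<close>

lemma L2_weak_conv:
 fixes d :: "nat \<Rightarrow> 'a \<Rightarrow> real"
 assumes D: "\<And>n. integrable M (D n)" "(\<lambda>n. LINT p|M. D n p) \<longlonglongrightarrow> 0"
  and d: "\<And>n p. (d n p)\<^sup>2 \<le> D n p" and w: "integrable M (\<lambda>p. (w p)\<^sup>2)"
 shows "(\<lambda>n. LINT p|M. d n p * w p) \<longlonglongrightarrow> 0"
proof (rule LIMSEQ_I)
 fix r :: real assume r: "0 < r"
 define W where "W = (LINT p|M. (w p)\<^sup>2)"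
 have W: "W \<ge> 0" unfolding W_def by (intro integral_nonneg_AE) auto
 define e where "e = r / (2 * (W + 1))"
 have e: "e > 0" "e * W < r / 2 + 0"
 proof -
  show "e > 0" using r W by (simp add: e_def)
  have "e * W = (r / 2) * (W / (W + 1))" using W by (simp add: e_def)
  also have "\<dots> < (r / 2) * 1" using r W by (intro mult_strict_left_mono) auto
  finally show "e * W < r / 2 + 0" by simp
 qed
 have b: "\<bar>LINT p|M. d n p * w p\<bar> \<le> e * W + (LINT p|M. D n p) / e" for n
 proof (cases "integrable M (\<lambda>p. d n p * w p)")
  case True
  have "\<bar>LINT p|M. d n p * w p\<bar> \<le> (LINT p|M. \<bar>d n p * w p\<bar>)" by (rule integral_abs_bound)
  also have "\<dots> \<le> (LINT p|M. e * (w p)\<^sup>2 + D n p / e)"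
  proof (rule integral_mono)
   show "integrable M (\<lambda>p. \<bar>d n p * w p\<bar>)" using True by simp
   show "integrable M (\<lambda>p. e * (w p)\<^sup>2 + D n p / e)" using w D(1) by auto
   fix p
   have "e * (2 * (\<bar>d n p\<bar> * \<bar>w p\<bar>)) \<le> e * (e * (w p)\<^sup>2 + (d n p)\<^sup>2 / e)"
    using zero_le_power2[of "e * \<bar>w p\<bar> - \<bar>d n p\<bar>"] e(1) by (simp add: power2_eq_square algebra_simps)
   then have "2 * \<bar>d n p * w p\<bar> \<le> e * (w p)\<^sup>2 + (d n p)\<^sup>2 / e" using e(1) by (simp add: abs_mult)
   moreover have "(d n p)\<^sup>2 / e \<le> D n p / e" using d e(1) by (intro divide_right_mono) auto
   ultimately show "\<bar>d n p * w p\<bar> \<le> e * (w p)\<^sup>2 + D n p / e" using abs_ge_zero[of "d n p * w p"] by linarith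
  qed
  also have "\<dots> = e * W + (LINT p|M. D n p) / e" using w D(1) by (simp add: W_def)
  finally show ?thesis .
 next
  case False
  have "0 \<le> (LINT p|M. D n p)" using d[of n] by (intro integral_nonneg_AE AE_I2) (meson order_trans zero_le_power2)
  then show ?thesis using False W e(1) by (simp add: not_integrable_integral_eq)
 qed
 have "\<forall>\<^sub>F n in sequentially. (LINT p|M. D n p) < e * r / 2"
  using order_tendstoD(2)[OF D(2), of "e * r / 2"] e(1) r by simp
 then have "\<forall>\<^sub>F n in sequentially. norm ((LINT p|M. d n p * w p) - 0) < r"
 proof eventually_elim
  case (elim n)
  then have "(LINT p|M. D n p) / e < r / 2" using e(1) by (simp add: field_simps)
  then show ?case using b[of n] e(2) unfolding real_norm_def diff_zero by linarith
 qed
 then show "\<exists>no. \<forall>n\<ge>no. norm ((LINT p|M. d n p * w p) - 0) < r" by (simp add: eventually_sequentially)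
qed

lemma segment_weak_conv:
 fixes F :: "nat \<Rightarrow> real \<Rightarrow> real"
 assumes c: "(\<lambda>n. \<integral>\<^sup>+ t\<in>{0..1}. ennreal ((F n t)\<^sup>2) \<partial>lborel) \<longlonglongrightarrow> 0"
  and F: "\<And>n. continuous_on UNIV (F n)" and w: "continuous_on UNIV w"
 shows "(\<lambda>n. LINT t|lborel. (indicator {0..1} t * F n t) * (indicator {0..1} t * w t)) \<longlonglongrightarrow> 0"
proof (rule L2_weak_conv)
 have i: "integrable lborel (\<lambda>t. indicator {0..1} t * (G t)\<^sup>2)" if "continuous_on UNIV G" for G :: "real \<Rightarrow> real"
  using borel_integrable_compact[of "{0..1::real}" "\<lambda>t. (G t)\<^sup>2"] that
  by (simp add: continuous_on_subset continuous_on_power)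
 show "integrable lborel (\<lambda>t. indicator {0..1} t * (F n t)\<^sup>2)" for n by (rule i[OF F])
 have "(\<integral>\<^sup>+ t\<in>{0..1}. ennreal ((F n t)\<^sup>2) \<partial>lborel) = ennreal (LINT t|lborel. indicator {0..1} t * (F n t)\<^sup>2)" for n
  using nn_integral_eq_integral[OF i[OF F[of n]]]
  by (simp add: ennreal_mult ennreal_indicator mult.commute)
 then have "(\<lambda>n. ennreal (LINT t|lborel. indicator {0..1} t * (F n t)\<^sup>2)) \<longlonglongrightarrow> ennreal 0" using c by simp
 then show "(\<lambda>n. LINT t|lborel. indicator {0..1} t * (F n t)\<^sup>2) \<longlonglongrightarrow> 0"
  by (subst (asm) tendsto_ennreal_iff) (auto intro!: always_eventually integral_nonneg_AE)
 show "(indicator {0..1} t * F n t)\<^sup>2 \<le> indicator {0..1} t * (F n t)\<^sup>2" for n t by (auto simp: indicator_def)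
 have "(\<lambda>t. (indicator {0..1} t * w t)\<^sup>2) = (\<lambda>t. indicator {0..1} t * (w t)\<^sup>2)" by (auto simp: indicator_def)
 then show "integrable lborel (\<lambda>t. (indicator {0..1} t * w t)\<^sup>2)" using i[OF w] by simp
qed

lemma ftc_open:
 fixes w w' :: "real \<Rightarrow> real"
 assumes "a \<le> b" "\<And>x. (w has_real_derivative w' x) (at x)" "continuous_on UNIV w'"
 shows "(LINT x|lborel. indicator {a<..<b} x * w' x) = w b - w a"
proof -
 have "(LINT x|lborel. indicator {a<..<b} x * w' x) = (LINT x|lborel. w' x * indicator {a..b} x)"
 proof (rule integral_cong_AE)
  have m: "w' \<in> borel_measurable borel" using assms(3) by (rule borel_measurable_continuous_onI)
  show "(\<lambda>x. indicator {a<..<b} x * w' x) \<in> borel_measurable lborel" "(\<lambda>x. w' x * indicator {a..b} x) \<in> borel_measurable lborel"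
   using m by simp_all
  show "AE x in lborel. indicator {a<..<b} x * w' x = w' x * indicator {a..b} x"
   using AE_lborel_singleton[of a] AE_lborel_singleton[of b] by eventually_elim (auto simp: indicator_def)
 qed
 also have "\<dots> = w b - w a"
  using assms by (intro integral_FTC_Icc_real) (auto simp: continuous_on_eq_continuous_at)
 finally show ?thesis .
qed

lemma integrable_indicator_cont:
 fixes F :: "real \<times> real \<Rightarrow> real"
 assumes F: "continuous_on UNIV F" and E: "E \<in> sets borel" "bounded E"
 shows "integrable lborel (\<lambda>p. indicator E p * F p)"
proof -
 have Fm: "F \<in> borel_measurable borel" using F by (rule borel_measurable_continuous_onI)
 obtain M where M: "M > 0" "\<And>p. p \<in> E \<Longrightarrow> \<bar>F p\<bar> \<le> M" by (rule bounded_on_of_cont[OF F E(2)]) blast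
 have "integrable (lebesgue_on E) F" by (rule bounded_integrable_lebesgue_on[OF E(2,1) borel_to_lebesgue_on[OF Fm] M(2)])
 moreover have "(\<lambda>p. indicator E p * F p) \<in> borel_measurable borel" using Fm E(1) by simp
 ultimately show ?thesis
  using integral_lebesgue_on(2)[OF E(1) borel_to_lebesgue_on[OF Fm], of "\<lambda>p. indicator E p * F p"] by simp
qed

lemma smooth_sections_DERIV:
 assumes "smooth \<Phi>"
 shows "((\<lambda>t. \<Phi> (t, y)) has_real_derivative dx \<Phi> (x, y)) (at x)" "((\<lambda>t. \<Phi> (x, t)) has_real_derivative dy \<Phi> (x, y)) (at y)"
  "continuous_on UNIV (\<lambda>t. dx \<Phi> (t, y))" "continuous_on UNIV (\<lambda>t. dy \<Phi> (x, t))"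
 using dx_DERIV[OF smooth_differentiable[OF assms], of "(x, y)"] dy_DERIV[OF smooth_differentiable[OF assms], of "(x, y)"]
 by (auto intro!: continuous_on_compose2[OF smooth_cont[OF smooth_dx[OF assms], of UNIV]]
   continuous_on_compose2[OF smooth_cont[OF smooth_dy[OF assms], of UNIV]] continuous_intros)

text \<open>Only the edge \<open>x = 1\<close> contributes a boundary term.\<close>

lemma green_right:
 assumes \<Phi>: "smooth \<Phi>" and b: "b < 1" and z: "\<And>y. \<Phi> (b, y) = 0" "\<And>y. y \<notin> {0<..<b} \<Longrightarrow> \<Phi> (1, y) = 0"
 shows "(LINT p|lborel. indicator ({b<..<1} \<times> {0<..<b}) p * dx \<Phi> p) = (LINT y|lborel. \<Phi> (1, y))"
proof -
 have i: "integrable lborel (\<lambda>p. indicator ({b<..<1} \<times> {0<..<b}) p * dx \<Phi> p)"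
  by (intro integrable_indicator_cont smooth_cont smooth_dx \<Phi>) (auto simp: bounded_Times borel_prod[symmetric])
 have "(LINT x|lborel. indicator ({b<..<1} \<times> {0<..<b}) (x, y) * dx \<Phi> (x, y)) = \<Phi> (1, y)" for y
 proof (cases "y \<in> {0<..<b}")
  case True
  then have "(LINT x|lborel. indicator ({b<..<1} \<times> {0<..<b}) (x, y) * dx \<Phi> (x, y)) = (LINT x|lborel. indicator {b<..<1} x * dx \<Phi> (x, y))"
   by (simp add: indicator_times)
  also have "\<dots> = \<Phi> (1, y) - \<Phi> (b, y)" using b by (intro ftc_open smooth_sections_DERIV \<Phi>) simp
  finally show ?thesis using z by simp
 qed (use z in simp)
 then show ?thesis using fub_snd(1)[OF i] by simp
qed

text \<open>The boundary terms come from the diagonal, which is the left end of rows and the upper end of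
 columns; this gives the two signs.\<close>

lemma green_diag:
 assumes \<Phi>: "smooth \<Phi>" and e: "0 < \<epsilon>" "\<epsilon> < 1"
  and z: "\<And>x y. x \<notin> {0<..<1 - \<epsilon>} \<Longrightarrow> \<Phi> (x, y) = 0" "\<And>x. \<Phi> (x, 0) = 0"
 shows "(LINT p|lborel. indicator (Omega_q \<epsilon>) p * dx \<Phi> p) = - (LINT y|lborel. \<Phi> (y, y))"
  and "(LINT p|lborel. indicator (Omega_q \<epsilon>) p * dy \<Phi> p) = (LINT y|lborel. \<Phi> (y, y))"
proof -
 have i: "integrable lborel (\<lambda>p. indicator (Omega_q \<epsilon>) p * dx \<Phi> p)" "integrable lborel (\<lambda>p. indicator (Omega_q \<epsilon>) p * dy \<Phi> p)"
  by (intro integrable_indicator_cont smooth_cont smooth_dx smooth_dy \<Phi> Omega_q_borel Omega_q_bounded)+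
 have y0: "dy \<Phi> (x, y) = 0" if "x \<notin> {0<..<1 - \<epsilon>}" for x y
  by (rule dy_eqI) (use z(1)[OF that] in simp)
 have x0: "dx \<Phi> (x, y) = 0" if "1 - \<epsilon> \<le> x" for x y
 proof -
  have "\<And>x. 1 - \<epsilon> < x \<Longrightarrow> dx \<Phi> (x, y) = 0"
  proof -
   fix x assume "1 - \<epsilon> < x"
   then show "dx \<Phi> (x, y) = 0" using deriv_zero_on_open[of "{1 - \<epsilon><..}" "\<lambda>t. \<Phi> (t, y)" x] z(1) by (simp add: dx_def)
  qed
  moreover have "1 - \<epsilon> < x + 1 / real (Suc n)" for n
  proof -
   have "0 < 1 / real (Suc n)" by simp
   then show ?thesis using that by linarith
  qed
  ultimately have "\<forall>n. dx \<Phi> (x + 1 / real (Suc n), y) = 0" by blast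
  moreover have "(\<lambda>n. dx \<Phi> (x + 1 / real (Suc n), y)) \<longlonglongrightarrow> dx \<Phi> (x + 0, y)"
  proof (rule continuous_on_tendsto_compose[OF smooth_sections_DERIV(3)[OF \<Phi>]])
   show "(\<lambda>n. x + 1 / real (Suc n)) \<longlonglongrightarrow> x + 0" by (intro tendsto_intros LIMSEQ_Suc lim_1_over_n)
  qed auto
  ultimately show ?thesis by (simp only: LIMSEQ_const_iff add_0_right)
 qed
 have "(LINT x|lborel. indicator (Omega_q \<epsilon>) (x, y) * dx \<Phi> (x, y)) = - \<Phi> (y, y)" for y
 proof (cases "y \<in> {0<..<1 - \<epsilon>}")
  case True
  then have "indicator (Omega_q \<epsilon>) (x, y) * dx \<Phi> (x, y) = indicator {y<..<1 - \<epsilon>} x * dx \<Phi> (x, y)" for x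
   using x0[of x y] e by (cases "x < 1 - \<epsilon>") (auto simp: indicator_def mem_Omega_q[OF e])
  then have "(LINT x|lborel. indicator (Omega_q \<epsilon>) (x, y) * dx \<Phi> (x, y)) = (LINT x|lborel. indicator {y<..<1 - \<epsilon>} x * dx \<Phi> (x, y))" by (simp only:)
  also have "\<dots> = \<Phi> (1 - \<epsilon>, y) - \<Phi> (y, y)" using True by (intro ftc_open smooth_sections_DERIV \<Phi>) simp
  finally show ?thesis using z(1) by simp
 next
  case False
  have "indicator (Omega_q \<epsilon>) (x, y) * dx \<Phi> (x, y) = 0" for x
   using x0[of x y] e False by (cases "x < 1 - \<epsilon>") (auto simp: indicator_def mem_Omega_q[OF e])
  then have "(LINT x|lborel. indicator (Omega_q \<epsilon>) (x, y) * dx \<Phi> (x, y)) = (LINT x|(lborel :: real measure). 0)" by (simp only:)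
  then show ?thesis using z(1)[OF False] by simp
 qed
 then show "(LINT p|lborel. indicator (Omega_q \<epsilon>) p * dx \<Phi> p) = - (LINT y|lborel. \<Phi> (y, y))" using fub_snd(1)[OF i(1)] by simp
 have "(LINT y|lborel. indicator (Omega_q \<epsilon>) (x, y) * dy \<Phi> (x, y)) = \<Phi> (x, x)" for x
 proof (cases "x \<in> {0<..<1 - \<epsilon>}")
  case True
  then have "indicator (Omega_q \<epsilon>) (x, y) = (indicator {0<..<x} y :: real)" for y
   using e by (auto simp: indicator_def mem_Omega_q[OF e])
  then have "(LINT y|lborel. indicator (Omega_q \<epsilon>) (x, y) * dy \<Phi> (x, y)) = (LINT y|lborel. indicator {0<..<x} y * dy \<Phi> (x, y))" by simp
  also have "\<dots> = \<Phi> (x, x) - \<Phi> (x, 0)" using True by (intro ftc_open smooth_sections_DERIV \<Phi>) simp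
  finally show ?thesis using z(2) by simp
 qed (use z(1) y0 in simp)
 then show "(LINT p|lborel. indicator (Omega_q \<epsilon>) p * dy \<Phi> p) = (LINT y|lborel. \<Phi> (y, y))" using fub_fst(1)[OF i(2)] by simp
qed

text \<open>Passage to the limit in an identity of the form \<open>\<integral> A w1 + B w2 = (boundary term)\<close> when the boundary
 term tends to 0.\<close>

lemma weak_limit_pair:
 fixes A B :: "nat \<Rightarrow> real \<times> real \<Rightarrow> real"
 assumes D: "\<And>n. integrable lborel (D n)" "(\<lambda>n. LINT p|lborel. D n p) \<longlonglongrightarrow> 0" "\<And>n p. 0 \<le> D n p"
  and A: "\<And>n. continuous_on UNIV (A n)" "\<And>n p. p \<in> E \<Longrightarrow> (A n p - a p)\<^sup>2 \<le> D n p"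
  and B: "\<And>n. continuous_on UNIV (B n)" "\<And>n p. p \<in> E \<Longrightarrow> (B n p - b p)\<^sup>2 \<le> D n p"
  and w: "continuous_on UNIV w1" "continuous_on UNIV w2" and E: "E \<in> sets borel" "bounded E"
  and i: "integrable lborel (\<lambda>p. indicator E p * (a p * w1 p))" "integrable lborel (\<lambda>p. indicator E p * (b p * w2 p))"
  and lim: "(\<lambda>n. LINT p|lborel. indicator E p * (A n p * w1 p + B n p * w2 p)) \<longlonglongrightarrow> 0"
 shows "(LINT p|lborel. indicator E p * (a p * w1 p)) = - (LINT p|lborel. indicator E p * (b p * w2 p))"
proof -
 have sq: "integrable lborel (\<lambda>p. (indicator E p * w p)\<^sup>2)" if "continuous_on UNIV w" for w :: "real \<times> real \<Rightarrow> real"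
 proof -
  have "(\<lambda>p. (indicator E p * w p)\<^sup>2) = (\<lambda>p. indicator E p * (w p)\<^sup>2)" by (rule ext) (simp split: split_indicator)
  then show ?thesis using integrable_indicator_cont[of "\<lambda>p. (w p)\<^sup>2", OF continuous_on_power[OF that] E] by simp
 qed
 have bd: "(indicator E p * (A n p - a p))\<^sup>2 \<le> D n p" "(indicator E p * (B n p - b p))\<^sup>2 \<le> D n p" for n p
  using A(2)[of p n] B(2)[of p n] D(3)[of n p] by (auto simp: indicator_def)
 note l1 = L2_weak_conv[OF D(1,2) bd(1) sq[OF w(1)]] and l2 = L2_weak_conv[OF D(1,2) bd(2) sq[OF w(2)]]
 have iA: "integrable lborel (\<lambda>p. indicator E p * (A n p * w1 p))" and iB: "integrable lborel (\<lambda>p. indicator E p * (B n p * w2 p))" for n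
  by (intro integrable_indicator_cont continuous_on_mult A B w E)+
 define I J where "I = (LINT p|lborel. indicator E p * (a p * w1 p))" and "J = (LINT p|lborel. indicator E p * (b p * w2 p))"
 have r1: "(indicator E p * (A n p - a p)) * (indicator E p * w1 p) = indicator E p * (A n p * w1 p) - indicator E p * (a p * w1 p)" for n p
  by (simp add: indicator_def algebra_simps)
 have r2: "(indicator E p * (B n p - b p)) * (indicator E p * w2 p) = indicator E p * (B n p * w2 p) - indicator E p * (b p * w2 p)" for n p
  by (simp add: indicator_def algebra_simps)
 have x1: "(\<lambda>n. (LINT p|lborel. indicator E p * (A n p * w1 p)) - I) \<longlonglongrightarrow> 0"
  using l1 unfolding r1 I_def Bochner_Integration.integral_diff[OF iA i(1)] .
 have x2: "(\<lambda>n. (LINT p|lborel. indicator E p * (B n p * w2 p)) - J) \<longlonglongrightarrow> 0"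
  using l2 unfolding r2 J_def Bochner_Integration.integral_diff[OF iB i(2)] .
 have s: "(LINT p|lborel. indicator E p * (A n p * w1 p + B n p * w2 p))
   = (LINT p|lborel. indicator E p * (A n p * w1 p)) + (LINT p|lborel. indicator E p * (B n p * w2 p))" for n
  unfolding distrib_left by (rule Bochner_Integration.integral_add[OF iA iB])
 have "(\<lambda>n. (LINT p|lborel. indicator E p * (A n p * w1 p + B n p * w2 p))
   - (((LINT p|lborel. indicator E p * (A n p * w1 p)) - I) + ((LINT p|lborel. indicator E p * (B n p * w2 p)) - J))) \<longlonglongrightarrow> 0 - (0 + 0)"
  by (intro tendsto_diff tendsto_add lim x1 x2)
 then have "(\<lambda>n::nat. I + J) \<longlonglongrightarrow> 0" unfolding s by simp
 then have "I + J = 0" by (simp add: LIMSEQ_const_iff)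
 then show ?thesis by (simp add: I_def J_def)
qed

lemma segment_limit:
 fixes F :: "nat \<Rightarrow> real \<Rightarrow> real"
 assumes l: "0 < l" and c: "(\<lambda>n. \<integral>\<^sup>+ t\<in>{0..1}. ennreal ((F n (l * t))\<^sup>2) \<partial>lborel) \<longlonglongrightarrow> 0"
  and F: "\<And>n. continuous_on UNIV (F n)" and w: "continuous_on UNIV w" "\<And>y. y \<notin> {0<..<l} \<Longrightarrow> w y = 0"
 shows "(\<lambda>n. LINT y|lborel. F n y * w y) \<longlonglongrightarrow> 0"
proof -
 have cl: "continuous_on UNIV (\<lambda>t. G (l * t))" if "continuous_on UNIV G" for G :: "real \<Rightarrow> real"
  by (intro continuous_on_compose2[OF that] continuous_intros) auto
 have "(\<lambda>n. LINT t|lborel. (indicator {0..1} t * F n (l * t)) * (indicator {0..1} t * w (l * t))) \<longlonglongrightarrow> 0"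
  by (rule segment_weak_conv[OF c cl[OF F] cl[OF w(1)]])
 moreover have "(indicator {0..1} t * F n (l * t)) * (indicator {0..1} t * w (l * t)) = F n (0 + l * t) * w (0 + l * t)" for n t
 proof (cases "t \<in> {0..1}")
  case False
  then have "l * t \<notin> {0<..<l}" using l by (auto simp: zero_less_mult_iff)
  then show ?thesis using False w(2)[of "l * t"] by simp
 qed simp
 ultimately have "(\<lambda>n. \<bar>l\<bar> *\<^sub>R (LINT t|lborel. F n (0 + l * t) * w (0 + l * t))) \<longlonglongrightarrow> \<bar>l\<bar> *\<^sub>R 0"
  by (intro tendsto_scaleR tendsto_const) simp
 then show ?thesis using l lborel_integral_real_affine[of l "\<lambda>y. F _ y * w y" 0] by simp
qed

text \<open>For the smooth approximations the boundary term is an integral of \<open>\<phi> - c\<close> over the right edge,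
 which tends to 0 by the definition of the trace.\<close>

lemma trace_right:
 assumes e: "0 < \<epsilon>" "\<epsilon> < 1" and q: "W12 (Omega_q \<epsilon>) q"
  and tr: "trace_on (Omega_q \<epsilon>) q (frontier (Omega_q \<epsilon>) \<inter> frontier (Omega \<epsilon>)) \<gamma>"
  and \<gamma>: "\<And>t. t \<in> {0..1} \<Longrightarrow> \<gamma> (1, (1 - \<epsilon>) * t) = c"
  and u: "u \<in> borel_measurable borel" "AE p in lborel. p \<in> Omega_q \<epsilon> \<longrightarrow> q p = u p" "integrable lborel u"
  and ux: "ux \<in> borel_measurable borel" "AE p in lborel. p \<in> Omega_q \<epsilon> \<longrightarrow> wdx (Omega_q \<epsilon>) q p = ux p" "integrable lborel ux"
  and uy: "uy \<in> borel_measurable borel" "AE p in lborel. p \<in> Omega_q \<epsilon> \<longrightarrow> wdy (Omega_q \<epsilon>) q p = uy p"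
  and b: "0 < b" "b \<le> 1 - \<epsilon>" and f: "bump b 2 f" and g: "bump 0 b g"
 shows "tst (\<lambda>p. indicator ({b<..<1} \<times> {0<..<b}) p * (u p - c)) (deriv f) g
   = - tst (\<lambda>p. indicator ({b<..<1} \<times> {0<..<b}) p * ux p) f g"
proof -
 define E where "E = {b<..<1} \<times> {0<..<b}"
 have b1: "b < 1" using b e by simp
 have E: "E \<in> sets borel" "bounded E" unfolding E_def by (auto simp: bounded_Times borel_prod[symmetric])
 have EU: "E \<subseteq> Omega_q \<epsilon>" using b e by (auto simp: E_def mem_Omega_q[OF e])
 obtain \<phi> where \<phi>: "\<And>n. smooth (\<phi> n)"
  "\<And>n. integrable lborel (\<lambda>p. indicator (Omega_q \<epsilon>) p * ((\<phi> n p - u p)\<^sup>2 + (dx (\<phi> n) p - ux p)\<^sup>2 + (dy (\<phi> n) p - uy p)\<^sup>2))"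
  "(\<lambda>n. LINT p|lborel. indicator (Omega_q \<epsilon>) p * ((\<phi> n p - u p)\<^sup>2 + (dx (\<phi> n) p - ux p)\<^sup>2 + (dy (\<phi> n) p - uy p)\<^sup>2)) \<longlonglongrightarrow> 0"
  "\<And>a b. a \<noteq> b \<Longrightarrow> closed_segment a b \<subseteq> frontier (Omega_q \<epsilon>) \<inter> frontier (Omega \<epsilon>) \<Longrightarrow> (\<lambda>n. \<integral>\<^sup>+ t\<in>{0..1}.
      ennreal ((\<phi> n (a + t *\<^sub>R (b - a)) - \<gamma> (a + t *\<^sub>R (b - a)))\<^sup>2) \<partial>lborel) \<longlonglongrightarrow> 0"
  by (rule trace_seq[OF Omega_q_borel Omega_q_bounded q tr u(1,2) ux(1,2) uy]) blast
 have sf: "smooth1 f" "smooth1 g" "smooth1 (deriv f)" using f g bump_smooth bump_deriv by blast+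
 have ct: "continuous_on UNIV (tens f' g)" if "smooth1 f'" for f' by (intro smooth_cont smooth_tens that sf)
 have "(\<lambda>n. \<integral>\<^sup>+ t\<in>{0..1}. ennreal ((\<phi> n ((1, 0) + t *\<^sub>R ((1, 1 - \<epsilon>) - (1, 0))) - \<gamma> ((1, 0) + t *\<^sub>R ((1, 1 - \<epsilon>) - (1, 0))))\<^sup>2) \<partial>lborel) \<longlonglongrightarrow> 0"
  by (rule \<phi>(4)) (use e segments_outer(1)[OF e] in auto)
 moreover have "(\<integral>\<^sup>+ t\<in>{0..1}. ennreal ((\<phi> n ((1, 0) + t *\<^sub>R ((1, 1 - \<epsilon>) - (1, 0))) - \<gamma> ((1, 0) + t *\<^sub>R ((1, 1 - \<epsilon>) - (1, 0))))\<^sup>2) \<partial>lborel)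
   = (\<integral>\<^sup>+ t\<in>{0..1}. ennreal ((\<phi> n (1, (1 - \<epsilon>) * t) - c)\<^sup>2) \<partial>lborel)" for n
  using \<gamma> by (intro nn_integral_cong) (auto simp: indicator_def mult.commute)
 ultimately have seg: "(\<lambda>n. \<integral>\<^sup>+ t\<in>{0..1}. ennreal ((\<phi> n (1, (1 - \<epsilon>) * t) - c)\<^sup>2) \<partial>lborel) \<longlonglongrightarrow> 0" by simp
 have seg2: "(\<lambda>n. LINT y|lborel. (\<phi> n (1, y) - c) * (f 1 * g y)) \<longlonglongrightarrow> 0"
 proof (rule segment_limit[OF _ seg])
  show "continuous_on UNIV (\<lambda>y. \<phi> n (1, y) - c)" for n
   by (intro continuous_intros continuous_on_compose2[OF smooth_cont[OF \<phi>(1), of UNIV]]) auto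
  show "continuous_on UNIV (\<lambda>y. f 1 * g y)" by (intro continuous_intros smooth1_cont sf)
  show "f 1 * g y = 0" if "y \<notin> {0<..<1 - \<epsilon>}" for y using that bump_zero[OF g, of y] b by auto
 qed (use e in simp)
 have lim: "(\<lambda>n. LINT p|lborel. indicator E p * ((\<phi> n p - c) * tens (deriv f) g p + dx (\<phi> n) p * tens f g p)) \<longlonglongrightarrow> 0"
 proof -
  have "(LINT p|lborel. indicator E p * ((\<phi> n p - c) * tens (deriv f) g p + dx (\<phi> n) p * tens f g p))
   = (LINT y|lborel. (\<phi> n (1, y) - c) * (f 1 * g y))" for n
  proof -
   define \<Phi> where "\<Phi> p = \<phi> n p * tens f g p + (- c) * tens f g p" for p
   have sT: "smooth (tens f g)" by (rule smooth_tens[OF sf(1,2)])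
   have s: "smooth \<Phi>" unfolding \<Phi>_def[abs_def] by (intro smooth_add smooth_mult \<phi>(1) sT)
   have d1: "dx \<Phi> p = (\<phi> n p - c) * tens (deriv f) g p + dx (\<phi> n) p * tens f g p" for p
    unfolding \<Phi>_def[abs_def]
    by (subst dx_add, (intro smooth_differentiable smooth_mult \<phi>(1) sT)+, subst dx_mult, (intro smooth_differentiable \<phi>(1) sT)+)
     (simp add: dx_tens[OF sf(1)] algebra_simps)
   have d2: "(LINT p|lborel. indicator E p * dx \<Phi> p) = (LINT y|lborel. \<Phi> (1, y))"
    unfolding E_def
   proof (rule green_right[OF s b1])
    show "\<Phi> (b, y) = 0" for y using bump_zero[OF f, of b] by (simp add: \<Phi>_def tens_def)
    show "\<Phi> (1, y) = 0" if "y \<notin> {0<..<b}" for y using bump_zero[OF g that] by (simp add: \<Phi>_def tens_def)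
   qed
   have r: "\<Phi> (1, y) = (\<phi> n (1, y) - c) * (f 1 * g y)" for y by (simp add: \<Phi>_def tens_def algebra_simps)
   show ?thesis using d2 unfolding d1 r .
  qed
  then show ?thesis using seg2 by simp
 qed
 have "(LINT p|lborel. indicator E p * ((u p - c) * tens (deriv f) g p)) = - (LINT p|lborel. indicator E p * (ux p * tens f g p))"
 proof (rule weak_limit_pair[OF \<phi>(2,3) _ _ _ _ _ ct[OF sf(3)] ct[OF sf(1)] E _ _ lim])
  show "0 \<le> indicator (Omega_q \<epsilon>) p * ((\<phi> n p - u p)\<^sup>2 + (dx (\<phi> n) p - ux p)\<^sup>2 + (dy (\<phi> n) p - uy p)\<^sup>2)" for n p by simp
  show "continuous_on UNIV (\<lambda>p. \<phi> n p - c)" for n by (intro continuous_intros smooth_cont \<phi>(1))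
  show "continuous_on UNIV (dx (\<phi> n))" for n by (intro smooth_cont smooth_dx \<phi>(1))
  show "(\<phi> n p - c - (u p - c))\<^sup>2 \<le> indicator (Omega_q \<epsilon>) p * ((\<phi> n p - u p)\<^sup>2 + (dx (\<phi> n) p - ux p)\<^sup>2 + (dy (\<phi> n) p - uy p)\<^sup>2)"
   if "p \<in> E" for n p using that EU by (auto simp: indicator_def)
  show "(dx (\<phi> n) p - ux p)\<^sup>2 \<le> indicator (Omega_q \<epsilon>) p * ((\<phi> n p - u p)\<^sup>2 + (dx (\<phi> n) p - ux p)\<^sup>2 + (dy (\<phi> n) p - uy p)\<^sup>2)"
   if "p \<in> E" for n p using that EU by (auto simp: indicator_def)
  have iE: "integrable lborel (\<lambda>p. indicator E p * w p)" if "integrable lborel w" for w :: "real \<times> real \<Rightarrow> real"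
   using integrable_real_mult_indicator[of E lborel w] that E by (simp add: mult.commute)
  have "integrable lborel (\<lambda>p. indicator E p * u p * tens (deriv f) g p)" "integrable lborel (\<lambda>p. indicator E p * ux p * tens f g p)"
   by (rule integrable_mult_bumps[OF iE[OF u(3)] bump_deriv[OF f] g], rule integrable_mult_bumps[OF iE[OF ux(3)] f g])
  moreover have "integrable lborel (\<lambda>p. indicator E p * tens (deriv f) g p)"
   by (rule integrable_indicator_cont[OF ct[OF sf(3)] E])
  ultimately have "integrable lborel (\<lambda>p. indicator E p * u p * tens (deriv f) g p - c * (indicator E p * tens (deriv f) g p))"
   by simp
  then show "integrable lborel (\<lambda>p. indicator E p * ((u p - c) * tens (deriv f) g p))" by (simp add: algebra_simps)
  show "integrable lborel (\<lambda>p. indicator E p * (ux p * tens f g p))"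
   using \<open>integrable lborel (\<lambda>p. indicator E p * ux p * tens f g p)\<close> by (simp add: mult.assoc)
 qed
 then show ?thesis by (simp add: tst_def E_def mult.assoc)
qed

lemma trace_diag:
 assumes e: "0 < \<epsilon>" "\<epsilon> < 1" and q: "W12 (Omega_q \<epsilon>) q"
  and tr: "trace_on (Omega_q \<epsilon>) q (frontier (Omega_q \<epsilon>) \<inter> {(x, y). y = x}) (\<lambda>_. 0)"
  and u: "u \<in> borel_measurable borel" "AE p in lborel. p \<in> Omega_q \<epsilon> \<longrightarrow> q p = u p" "integrable lborel u"
  and ux: "ux \<in> borel_measurable borel" "AE p in lborel. p \<in> Omega_q \<epsilon> \<longrightarrow> wdx (Omega_q \<epsilon>) q p = ux p" "integrable lborel ux"
  and uy: "uy \<in> borel_measurable borel" "AE p in lborel. p \<in> Omega_q \<epsilon> \<longrightarrow> wdy (Omega_q \<epsilon>) q p = uy p" "integrable lborel uy"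
  and supp: "\<And>p. p \<notin> Omega_q \<epsilon> \<Longrightarrow> u p = 0 \<and> ux p = 0 \<and> uy p = 0"
  and f: "bump 0 (1 - \<epsilon>) f" and g: "bump 0 2 g"
 shows "tst u (deriv f) g = - tst ux f g" and "tst u f (deriv g) = - tst uy f g"
proof -
 define E where "E = Omega_q \<epsilon>"
 have E: "E \<in> sets borel" "bounded E" unfolding E_def by (rule Omega_q_borel, rule Omega_q_bounded)
 obtain \<phi> where \<phi>: "\<And>n. smooth (\<phi> n)"
  "\<And>n. integrable lborel (\<lambda>p. indicator (Omega_q \<epsilon>) p * ((\<phi> n p - u p)\<^sup>2 + (dx (\<phi> n) p - ux p)\<^sup>2 + (dy (\<phi> n) p - uy p)\<^sup>2))"
  "(\<lambda>n. LINT p|lborel. indicator (Omega_q \<epsilon>) p * ((\<phi> n p - u p)\<^sup>2 + (dx (\<phi> n) p - ux p)\<^sup>2 + (dy (\<phi> n) p - uy p)\<^sup>2)) \<longlonglongrightarrow> 0"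
  "\<And>a b. a \<noteq> b \<Longrightarrow> closed_segment a b \<subseteq> frontier (Omega_q \<epsilon>) \<inter> {(x, y). y = x} \<Longrightarrow> (\<lambda>n. \<integral>\<^sup>+ t\<in>{0..1}.
      ennreal ((\<phi> n (a + t *\<^sub>R (b - a)) - 0)\<^sup>2) \<partial>lborel) \<longlonglongrightarrow> 0"
  by (rule trace_seq[OF Omega_q_borel Omega_q_bounded q tr u(1,2) ux(1,2) uy(1,2)]) blast
 have sf: "smooth1 f" "smooth1 g" "smooth1 (deriv f)" "smooth1 (deriv g)" using f g bump_smooth bump_deriv by blast+
 have ct: "continuous_on UNIV (tens f' g')" if "smooth1 f'" "smooth1 g'" for f' g' by (intro smooth_cont smooth_tens that)
 have "(\<lambda>n. \<integral>\<^sup>+ t\<in>{0..1}. ennreal ((\<phi> n ((0, 0) + t *\<^sub>R ((1 - \<epsilon>, 1 - \<epsilon>) - (0, 0))) - 0)\<^sup>2) \<partial>lborel) \<longlonglongrightarrow> 0"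
  by (rule \<phi>(4)) (use e segments_outer(3)[OF e] in auto)
 then have seg: "(\<lambda>n. \<integral>\<^sup>+ t\<in>{0..1}. ennreal ((\<phi> n ((1 - \<epsilon>) * t, (1 - \<epsilon>) * t))\<^sup>2) \<partial>lborel) \<longlonglongrightarrow> 0"
  by (simp add: mult.commute)
 have seg2: "(\<lambda>n. LINT y|lborel. \<phi> n (y, y) * (f y * g y)) \<longlonglongrightarrow> 0"
 proof (rule segment_limit[OF _ seg])
  show "continuous_on UNIV (\<lambda>y. \<phi> n (y, y))" for n
   by (intro continuous_intros continuous_on_compose2[OF smooth_cont[OF \<phi>(1), of UNIV]]) auto
  show "continuous_on UNIV (\<lambda>y. f y * g y)" by (intro continuous_intros smooth1_cont sf)
  show "f y * g y = 0" if "y \<notin> {0<..<1 - \<epsilon>}" for y using bump_zero[OF f that] by simp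
 qed (use e in simp)
 define \<Phi> where "\<Phi> n p = \<phi> n p * tens f g p" for n p
 have sT: "smooth (tens f g)" by (rule smooth_tens[OF sf(1,2)])
 have s: "smooth (\<Phi> n)" for n unfolding \<Phi>_def[abs_def] by (intro smooth_mult \<phi>(1) sT)
 have d: "dx (\<Phi> n) p = \<phi> n p * tens (deriv f) g p + dx (\<phi> n) p * tens f g p"
  "dy (\<Phi> n) p = \<phi> n p * tens f (deriv g) p + dy (\<phi> n) p * tens f g p" for n p
  unfolding \<Phi>_def[abs_def]
  by (subst dx_mult dy_mult, (intro smooth_differentiable \<phi>(1) sT)+, simp add: dx_tens[OF sf(1)] dy_tens[OF sf(2)])+
 have gr: "(LINT p|lborel. indicator (Omega_q \<epsilon>) p * dx (\<Phi> n) p) = - (LINT y|lborel. \<Phi> n (y, y))"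
  "(LINT p|lborel. indicator (Omega_q \<epsilon>) p * dy (\<Phi> n) p) = (LINT y|lborel. \<Phi> n (y, y))" for n
  by (rule green_diag[OF s e]; simp add: \<Phi>_def tens_def bump_zero[OF f] bump_zero[OF g, of 0])+
 have lim: "(\<lambda>n. LINT p|lborel. indicator E p * (\<phi> n p * tens (deriv f) g p + dx (\<phi> n) p * tens f g p)) \<longlonglongrightarrow> 0"
  "(\<lambda>n. LINT p|lborel. indicator E p * (\<phi> n p * tens f (deriv g) p + dy (\<phi> n) p * tens f g p)) \<longlonglongrightarrow> 0"
  unfolding d[symmetric] E_def gr using seg2 tendsto_minus[OF seg2] by (simp_all add: \<Phi>_def tens_def)
 have ind: "indicator E p * (w p * z) = w p * z" if "w = u \<or> w = ux \<or> w = uy" for w p and z :: real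
  using that supp[of p] by (auto simp: E_def indicator_def)
 have cp: "continuous_on UNIV (\<phi> n)" "continuous_on UNIV (dx (\<phi> n))" "continuous_on UNIV (dy (\<phi> n))" for n
  by (intro smooth_cont smooth_dx smooth_dy \<phi>(1))+
 note i = integrable_mult_bumps[OF _ _ bump_deriv[OF g]] integrable_mult_bumps[OF _ _ g]
 have "(LINT p|lborel. indicator E p * (u p * tens (deriv f) g p)) = - (LINT p|lborel. indicator E p * (ux p * tens f g p))"
  by (rule weak_limit_pair[OF \<phi>(2,3) _ cp(1) _ cp(2) _ ct[OF sf(3,2)] ct[OF sf(1,2)] E _ _ lim(1)])
   (use i u(3) ux(3) f bump_deriv[OF f] in \<open>auto simp: ind ind[unfolded E_def] E_def\<close>)
 then show "tst u (deriv f) g = - tst ux f g" by (simp add: tst_def ind)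
 have "(LINT p|lborel. indicator E p * (u p * tens f (deriv g) p)) = - (LINT p|lborel. indicator E p * (uy p * tens f g p))"
  by (rule weak_limit_pair[OF \<phi>(2,3) _ cp(1) _ cp(3) _ ct[OF sf(1,4)] ct[OF sf(1,2)] E _ _ lim(2)])
   (use i u(3) uy(3) f in \<open>auto simp: ind ind[unfolded E_def] E_def\<close>)
 then show "tst u f (deriv g) = - tst uy f g" by (simp add: tst_def ind)
qed

section \<open>The symmetric critical point\<close>

text \<open>The reflection is odd about \<open>y = 0\<close>, so the constant equals its own negative.\<close>

lemma reflect2_constant_zero:
 assumes e: "0 < \<epsilon>" "\<epsilon> < 1" and c: "ae_constant_on (Omega \<epsilon>) (reflect2 q)"
 shows "AE p in lborel. p \<in> Omega_q \<epsilon> \<longrightarrow> q p = 0"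
proof -
 have Ob: "Omega \<epsilon> \<in> sets borel" using Omega_open by simp
 obtain c where c: "AE p in lborel. p \<in> Omega \<epsilon> \<longrightarrow> reflect2 q p = c"
  using c AE_lebesgue_on_iff[OF Ob] by (auto simp: ae_constant_on_def)
 have "0 < 1 - \<epsilon>" using e by simp
 then obtain x where x: "0 < x" "x < 1 - \<epsilon>" "AE y in lborel. (x, y) \<in> Omega \<epsilon> \<longrightarrow> reflect2 q (x, y) = c"
  by (rule AE_lborel_witness[OF AE_sections_fst[OF c]])
 have "AE y in lborel. (x, - y) \<in> Omega \<epsilon> \<longrightarrow> reflect2 q (x, - y) = c"
 proof -
  have "AE y in distr lborel borel uminus. (x, y) \<in> Omega \<epsilon> \<longrightarrow> reflect2 q (x, y) = c"
   using x(3) unfolding lborel_distr_uminus .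
  from AE_distrD[OF _ this] show ?thesis by simp
 qed
 with x(3) have "AE y in lborel. ((x, y) \<in> Omega \<epsilon> \<longrightarrow> reflect2 q (x, y) = c) \<and> ((x, - y) \<in> Omega \<epsilon> \<longrightarrow> reflect2 q (x, - y) = c)"
  by eventually_elim simp
 from AE_lborel_witness[OF this x(1)] obtain y where y: "0 < y" "y < x"
  "(x, y) \<in> Omega \<epsilon> \<longrightarrow> reflect2 q (x, y) = c" "(x, - y) \<in> Omega \<epsilon> \<longrightarrow> reflect2 q (x, - y) = c" by auto
 have "(x, y) \<in> Omega \<epsilon>" "(x, - y) \<in> Omega \<epsilon>" using x y e by (auto simp: Omega_def)
 then have "q (x, y) = c" "- q (x, y) = c" using x y by (auto simp: reflect2_def)
 then have c0: "c = 0" by simp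
 from c show ?thesis
 proof eventually_elim
  case (elim p)
  obtain x y where p: "p = (x, y)" by (cases p)
  show ?case using elim c0 unfolding p by (auto simp: Omega_q_def reflect2_def)
 qed
qed

lemma weak_tst:
 assumes U: "U \<in> sets borel" "bounded U" and q: "W12 U q"
  and u: "u \<in> borel_measurable borel" "AE p in lborel. p \<in> U \<longrightarrow> q p = u p"
  and ux: "ux \<in> borel_measurable borel" "AE p in lborel. p \<in> U \<longrightarrow> wdx U q p = ux p"
  and uy: "uy \<in> borel_measurable borel" "AE p in lborel. p \<in> U \<longrightarrow> wdy U q p = uy p"
  and supp: "\<And>p. p \<notin> U \<Longrightarrow> u p = 0 \<and> ux p = 0 \<and> uy p = 0"
  and s: "smooth1 f" "smooth1 g" and t: "test_function U (tens f g)"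
 shows "tst ux f g = - tst u (deriv f) g" "tst uy f g = - tst u f (deriv g)"
proof -
 note Q = W12_wd[OF q] and T = test_function_L2[OF t U(2,1)]
 have cv: "(LINT p|lebesgue_on U. w p * h p) = (LINT p|lborel. w' p * h p)"
  if "L2_on U w" "L2_on U h" "h \<in> borel_measurable borel" "w' \<in> borel_measurable borel" "AE p in lborel. p \<in> U \<longrightarrow> w p = w' p"
   "\<And>p. p \<notin> U \<Longrightarrow> w' p = 0" for w w' h
 proof (rule integral_lebesgue_on(1)[OF U(1)])
  show "(\<lambda>p. w p * h p) \<in> borel_measurable (lebesgue_on U)" using L2_mult[OF that(1,2)] by (rule borel_measurable_integrable)
  from that(5) show "AE p in lborel. p \<in> U \<longrightarrow> w p * h p = w' p * h p" by eventually_elim simp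
 qed (use that in auto)
 have m: "tens f g \<in> borel_measurable borel" "dx (tens f g) \<in> borel_measurable borel" "dy (tens f g) \<in> borel_measurable borel"
  by (intro smooth_borel smooth_dx smooth_dy smooth_tens s)+
 have "tst u (deriv f) g = (LINT p|lebesgue_on U. q p * dx (tens f g) p)"
  unfolding tst_def dx_tens[OF s(1), symmetric] using supp by (intro cv[symmetric] Q T m u) auto
 also have "\<dots> = - (LINT p|lebesgue_on U. wdx U q p * tens f g p)" using Q(2) t unfolding weak_dx_on_def by blast
 also have "(LINT p|lebesgue_on U. wdx U q p * tens f g p) = tst ux f g"
  unfolding tst_def using supp by (intro cv Q T m ux) auto
 finally show "tst ux f g = - tst u (deriv f) g" by simp
 have "tst u f (deriv g) = (LINT p|lebesgue_on U. q p * dy (tens f g) p)"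
  unfolding tst_def dy_tens[OF s(2), symmetric] using supp by (intro cv[symmetric] Q T m u) auto
 also have "\<dots> = - (LINT p|lebesgue_on U. wdy U q p * tens f g p)" using Q(3) t unfolding weak_dy_on_def by blast
 also have "(LINT p|lebesgue_on U. wdy U q p * tens f g p) = tst uy f g"
  unfolding tst_def using supp by (intro cv Q T m uy) auto
 finally show "tst uy f g = - tst u f (deriv g)" by simp
qed

text \<open>The integrability of \<open>w\<close> is inherited from the whole combination.\<close>

lemma integral_combination:
 fixes a b c d w :: "real \<times> real \<Rightarrow> real"
 assumes i: "integrable lborel a" "integrable lborel b" "integrable lborel c" "integrable lborel d"
  and W: "integrable lborel W" "(LINT p|lborel. W p) = 0" "\<And>p. W p = r * (a p + b p) + t * (c p - d p) + k * w p"
 shows "r * ((LINT p|lborel. a p) + (LINT p|lborel. b p)) + t * ((LINT p|lborel. c p) - (LINT p|lborel. d p)) + k * (LINT p|lborel. w p) = 0"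
proof -
 have "integrable lborel (\<lambda>p. W p - (r * (a p + b p) + t * (c p - d p)))" using i W(1) by simp
 then have kw: "integrable lborel (\<lambda>p. k * w p)" unfolding W(3) by simp
 have "0 = (LINT p|lborel. r * (a p + b p) + t * (c p - d p) + k * w p)" using W(2,3) by simp
 also have "\<dots> = (LINT p|lborel. r * (a p + b p) + t * (c p - d p)) + (LINT p|lborel. k * w p)"
  using i kw by (intro Bochner_Integration.integral_add) auto
 finally show ?thesis using i by simp
qed

lemma q_b_right: "0 < \<epsilon> \<Longrightarrow> \<epsilon> < 1 \<Longrightarrow> t \<in> {0..1} \<Longrightarrow> q_b \<epsilon> s (1, (1 - \<epsilon>) * t) = - s / 2"
proof -
 assume e: "0 < \<epsilon>" "\<epsilon> < 1" and t: "t \<in> {0..1}"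
 have "(1 - \<epsilon>) * t \<le> (1 - \<epsilon>) * 1" "0 \<le> (1 - \<epsilon>) * t" using e t by (intro mult_left_mono mult_nonneg_nonneg; simp)+
 then have "\<bar>(1 - \<epsilon>) * t\<bar> \<le> 1 - \<epsilon>" by (simp only: abs_of_nonneg mult_1_right)
 then have n: "\<not> \<bar>(1 - \<epsilon>) * t\<bar> = 1" using e by linarith
 show ?thesis unfolding q_b_def split if_not_P[OF n] by simp
qed

lemma q_b_short:
 assumes e: "0 < \<epsilon>" "\<epsilon> < 1" and t: "t \<in> {0..1}"
 shows "q_b \<epsilon> s (1 - t * \<epsilon> / 2, 1 - \<epsilon> + t * \<epsilon> / 2) = s / (2 * \<epsilon>) * (t * \<epsilon> - \<epsilon>)"
proof -
 have b: "t * \<epsilon> \<le> 1 * \<epsilon>" "0 \<le> t * \<epsilon>" using e t by (intro mult_right_mono mult_nonneg_nonneg; simp)+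
 show ?thesis
 proof (cases "t = 0")
  case True
  then show ?thesis using e by (simp add: q_b_def)
 next
  case False
  then have "0 < t * \<epsilon>" using e t by simp
  then have n: "\<not> \<bar>1 - \<epsilon> + t * \<epsilon> / 2\<bar> = 1" "\<not> \<bar>1 - t * \<epsilon> / 2\<bar> = 1"
   "\<not> 1 - \<epsilon> + t * \<epsilon> / 2 - (1 - t * \<epsilon> / 2) = 2 - \<epsilon>"
   and y: "1 - t * \<epsilon> / 2 + (1 - \<epsilon> + t * \<epsilon> / 2) = 2 - \<epsilon>" using b e by linarith+
  show ?thesis unfolding q_b_def split if_not_P[OF n(1)] if_not_P[OF n(2)] if_not_P[OF n(3)] if_P[OF y] g_short_def
   by (simp add: algebra_simps)
 qed
qed

lemma tens_zero_smooth: "smooth (\<lambda>_. 0)"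
proof -
 have "smooth (tens (\<lambda>_. 0) (\<lambda>_. 0))" by (intro smooth_tens) (auto simp: smooth1_def C1_k_const)
 then show ?thesis by (simp add: tens_def[abs_def])
qed

lemma dxy_zero: "dx (\<lambda>_. 0) p = 0" "dy (\<lambda>_. 0) p = 0"
 by (simp_all add: dx_def dy_def)

lemma L2_square:
 assumes U: "U \<in> sets borel" and q: "L2_on U q" and u: "u \<in> borel_measurable borel" "\<And>p. p \<notin> U \<Longrightarrow> u p = 0"
  "AE p in lborel. p \<in> U \<longrightarrow> q p = u p" and i: "integrable lborel (\<lambda>p. u p ^ 4)"
 shows "L2_on U (\<lambda>p. (q p)\<^sup>2)"
proof -
 have m: "(\<lambda>p. (q p)\<^sup>2) \<in> borel_measurable (lebesgue_on U)" using q by (auto simp: L2_on_def intro: borel_measurable_power)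
 have m2: "(\<lambda>p. ((q p)\<^sup>2)\<^sup>2) \<in> borel_measurable (lebesgue_on U)" using m by (rule borel_measurable_power)
 have "AE p in lborel. p \<in> U \<longrightarrow> ((q p)\<^sup>2)\<^sup>2 = u p ^ 4" using u(3) by eventually_elim (simp flip: power_mult)
 then have "integrable (lebesgue_on U) (\<lambda>p. ((q p)\<^sup>2)\<^sup>2)"
  using integral_lebesgue_on(2)[OF U m2, of "\<lambda>p. u p ^ 4"] u i by simp
 with m show ?thesis by (simp add: L2_on_def)
qed

lemma s_plus_pos: assumes "A < 0" "B > 0" "C > 0" shows "s_plus A B C > 0"
proof -
 have "0 \<le> B\<^sup>2 + 24 * \<bar>A\<bar> * C" using assms by (intro add_nonneg_nonneg mult_nonneg_nonneg) auto
 then show ?thesis using assms unfolding s_plus_def by (intro divide_pos_pos add_pos_nonneg) auto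
qed

text \<open>The hypotheses of \<open>reduced_system\<close> are obtained by choosing variations that vanish on the parts of the
 boundary where the component is prescribed: bumps \<open>f\<close> on \<open>(b, 1)\<close> and \<open>g\<close> below \<open>b \<le> 1 - \<epsilon>\<close> have a
 product that vanishes on the diagonal and on both outer edges, and bumps \<open>f\<close> on \<open>(0, 1 - \<epsilon>)\<close> keep away
 from the outer edges.\<close>

lemma minimizer_not_q2_zero:
 assumes par: "A < 0" "B > 0" "C > 0" "L > 0" "L2 > - 1" "L2 \<noteq> 0" "lam > 0" and e: "0 < \<epsilon>" "\<epsilon> < 1"
  and min: "minimizer_q A B C L L2 lam \<epsilon> q1 q2 q3"
  and q2: "AE p in lborel. p \<in> Omega_q \<epsilon> \<longrightarrow> q2 p = 0"
 shows False
proof -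
 define U where "U = Omega_q \<epsilon>"
 define s where "s = s_plus A B C"
 define k where "k = lam\<^sup>2 / L"
 have sp: "s > 0" unfolding s_def using par by (intro s_plus_pos)
 have kp: "k > 0" unfolding k_def using par by simp
 have Ub: "U \<in> sets borel" "bounded U" and Uo: "open U" unfolding U_def by (rule Omega_q_borel Omega_q_bounded Omega_q_open)+
 have adm: "admissible_q \<epsilon> s q1 q2 q3" using min unfolding minimizer_q_def s_def by blast
 then have W: "W12 U q1" "W12 U q2" "W12 U q3"
  and t: "trace_on U q1 (frontier U \<inter> frontier (Omega \<epsilon>)) (q_b \<epsilon> s)" "trace_on U q2 (frontier U \<inter> frontier (Omega \<epsilon>)) (\<lambda>_. 0)"
   "trace_on U q3 (frontier U \<inter> frontier (Omega \<epsilon>)) (\<lambda>_. - s / 6)"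
   "trace_on U q1 (frontier U \<inter> {(x, y). y = x}) (\<lambda>_. 0)" "trace_on U q2 (frontier U \<inter> {(x, y). y = 0}) (\<lambda>_. 0)"
  unfolding admissible_q_def U_def by blast+
 note Q1 = W12_wd[OF W(1)] and Q2 = W12_wd[OF W(2)] and Q3 = W12_wd[OF W(3)]
 obtain u where u: "u \<in> borel_measurable borel" "\<And>p. p \<notin> U \<Longrightarrow> u p = 0" "AE p in lborel. p \<in> U \<longrightarrow> q1 p = u p"
  "integrable lborel u" by (rule L2_rep[OF Q1(1) Ub(2,1)]) blast
 obtain ux where ux: "ux \<in> borel_measurable borel" "\<And>p. p \<notin> U \<Longrightarrow> ux p = 0" "AE p in lborel. p \<in> U \<longrightarrow> wdx U q1 p = ux p"
  "integrable lborel ux" by (rule L2_rep[OF Q1(4) Ub(2,1)]) blast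
 obtain uy where uy: "uy \<in> borel_measurable borel" "\<And>p. p \<notin> U \<Longrightarrow> uy p = 0" "AE p in lborel. p \<in> U \<longrightarrow> wdy U q1 p = uy p"
  "integrable lborel uy" by (rule L2_rep[OF Q1(5) Ub(2,1)]) blast
 obtain v where v: "v \<in> borel_measurable borel" "\<And>p. p \<notin> U \<Longrightarrow> v p = 0" "AE p in lborel. p \<in> U \<longrightarrow> q3 p = v p"
  "integrable lborel v" by (rule L2_rep[OF Q3(1) Ub(2,1)]) blast
 obtain vx where vx: "vx \<in> borel_measurable borel" "\<And>p. p \<notin> U \<Longrightarrow> vx p = 0" "AE p in lborel. p \<in> U \<longrightarrow> wdx U q3 p = vx p"
  "integrable lborel vx" by (rule L2_rep[OF Q3(4) Ub(2,1)]) blast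
 obtain vy where vy: "vy \<in> borel_measurable borel" "\<And>p. p \<notin> U \<Longrightarrow> vy p = 0" "AE p in lborel. p \<in> U \<longrightarrow> wdy U q3 p = vy p"
  "integrable lborel vy" by (rule L2_rep[OF Q3(5) Ub(2,1)]) blast
 have q2d: "AE p in lborel. p \<in> U \<longrightarrow> wdx U q2 p = 0" "AE p in lborel. p \<in> U \<longrightarrow> wdy U q2 p = 0"
  by (rule W12_zero[OF W(2) q2[folded U_def] Uo Ub(2)])+
 have u4: "integrable lborel (\<lambda>p. u p ^ 4)"
 proof (rule W12_L4[OF e W(1)[unfolded U_def] t(1)[unfolded U_def] _ _ q_b_right[OF e] q_b_short[OF e] u(1) u(2)[unfolded U_def] u(3)[unfolded U_def]])
  show "continuous_on {0..1} (\<lambda>t. s / (2 * \<epsilon>) * (t * \<epsilon> - \<epsilon>))" by (rule continuous_on_mult_left) (intro continuous_intros)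
 qed simp_all
 have v4: "integrable lborel (\<lambda>p. v p ^ 4)"
  by (rule W12_L4[OF e W(3)[unfolded U_def] t(3)[unfolded U_def] _ _ refl refl v(1) v(2)[unfolded U_def] v(3)[unfolded U_def]]) simp_all
 have q4: "L2_on U (\<lambda>p. (q1 p)\<^sup>2)" by (rule L2_square[OF Ub(1) Q1(1) u(1-3) u4])
 have q42: "L2_on U (\<lambda>p. (q2 p)\<^sup>2)" by (rule L2_square[OF Ub(1) Q2(1) _ _ q2[folded U_def]]) simp_all
 have q43: "L2_on U (\<lambda>p. (q3 p)\<^sup>2)" by (rule L2_square[OF Ub(1) Q3(1) v(1-3) v4])
 define W where "W \<eta>1 \<eta>2 \<eta>3 p = f_el_polar L2 (ux p) (uy p) 0 0 (vx p) (vy p) (dx \<eta>1 p) (dy \<eta>1 p) (dx \<eta>2 p) (dy \<eta>2 p) (dx \<eta>3 p) (dy \<eta>3 p)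
  + k * f_b_deriv A B C (u p) 0 (v p) (\<eta>1 p) (\<eta>2 p) (\<eta>3 p)" for \<eta>1 \<eta>2 \<eta>3 p
 have EL: "integrable lborel (W \<eta>1 \<eta>2 \<eta>3)" "(LINT p|lborel. W \<eta>1 \<eta>2 \<eta>3 p) = 0"
  if \<eta>: "smooth \<eta>1" "smooth \<eta>2" "smooth \<eta>3"
   and out: "\<And>p. p \<in> frontier U \<inter> frontier (Omega \<epsilon>) \<Longrightarrow> \<eta>1 p = 0 \<and> \<eta>2 p = 0 \<and> \<eta>3 p = 0"
   and di: "\<And>p. p \<in> frontier U \<inter> {(x, y). y = x} \<Longrightarrow> \<eta>1 p = 0"
   and bo: "\<And>p. p \<in> frontier U \<inter> {(x, y). y = 0} \<Longrightarrow> \<eta>2 p = 0" for \<eta>1 \<eta>2 \<eta>3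
 proof -
  have m: "energy A B C L L2 lam U q1 q2 q3
   \<le> energy A B C L L2 lam U (\<lambda>p. q1 p + t * \<eta>1 p) (\<lambda>p. q2 p + t * \<eta>2 p) (\<lambda>p. q3 p + t * \<eta>3 p)" for t
  proof -
   have "admissible_q \<epsilon> s (\<lambda>p. q1 p + t * \<eta>1 p) (\<lambda>p. q2 p + t * \<eta>2 p) (\<lambda>p. q3 p + t * \<eta>3 p)"
    unfolding admissible_q_def U_def[symmetric]
   proof (intro conjI)
    show "W12 U (\<lambda>p. q1 p + t * \<eta>1 p)" "W12 U (\<lambda>p. q2 p + t * \<eta>2 p)" "W12 U (\<lambda>p. q3 p + t * \<eta>3 p)"
     by (rule W12_add_smooth(1)[OF W(1) \<eta>(1) Uo Ub(2)] W12_add_smooth(1)[OF W(2) \<eta>(2) Uo Ub(2)] W12_add_smooth(1)[OF W(3) \<eta>(3) Uo Ub(2)])+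
    show "trace_on U (\<lambda>p. q1 p + t * \<eta>1 p) (frontier U \<inter> frontier (Omega \<epsilon>)) (q_b \<epsilon> s)"
     by (rule trace_add_smooth[OF W(1) \<eta>(1) Uo Ub(2) t(1)]) (use out in blast)
    show "trace_on U (\<lambda>p. q2 p + t * \<eta>2 p) (frontier U \<inter> frontier (Omega \<epsilon>)) (\<lambda>_. 0)"
     by (rule trace_add_smooth[OF W(2) \<eta>(2) Uo Ub(2) t(2)]) (use out in blast)
    show "trace_on U (\<lambda>p. q3 p + t * \<eta>3 p) (frontier U \<inter> frontier (Omega \<epsilon>)) (\<lambda>_. - s / 6)"
     by (rule trace_add_smooth[OF W(3) \<eta>(3) Uo Ub(2) t(3)]) (use out in blast)
    show "trace_on U (\<lambda>p. q1 p + t * \<eta>1 p) (frontier U \<inter> {(x, y). y = x}) (\<lambda>_. 0)"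
     by (rule trace_add_smooth[OF W(1) \<eta>(1) Uo Ub(2) t(4)]) (use di in blast)
    show "trace_on U (\<lambda>p. q2 p + t * \<eta>2 p) (frontier U \<inter> {(x, y). y = 0}) (\<lambda>_. 0)"
     by (rule trace_add_smooth[OF W(2) \<eta>(2) Uo Ub(2) t(5)]) (use bo in blast)
   qed
   then show ?thesis using min unfolding minimizer_q_def s_def U_def by blast
  qed
  note FV = first_variation[OF Uo Ub(2) W q4 q42 q43 \<eta> m, folded k_def]
  note [measurable] = u(1) ux(1) uy(1) v(1) vx(1) vy(1) smooth_borel[OF \<eta>(1)] smooth_borel[OF \<eta>(2)] smooth_borel[OF \<eta>(3)]
   smooth_borel[OF smooth_dx[OF \<eta>(1)]] smooth_borel[OF smooth_dx[OF \<eta>(2)]] smooth_borel[OF smooth_dx[OF \<eta>(3)]]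
   smooth_borel[OF smooth_dy[OF \<eta>(1)]] smooth_borel[OF smooth_dy[OF \<eta>(2)]] smooth_borel[OF smooth_dy[OF \<eta>(3)]]
  have Wm: "W \<eta>1 \<eta>2 \<eta>3 \<in> borel_measurable borel"
   unfolding W_def[abs_def] f_el_polar_def f_b_deriv_def by measurable
  have z: "W \<eta>1 \<eta>2 \<eta>3 p = 0" if "p \<notin> U" for p
   using that u(2) ux(2) uy(2) v(2) vx(2) vy(2) by (simp add: W_def f_el_polar_def f_b_deriv_def)
  have ae: "AE p in lborel. p \<in> U \<longrightarrow> f_el_polar L2 (wdx U q1 p) (wdy U q1 p) (wdx U q2 p) (wdy U q2 p) (wdx U q3 p) (wdy U q3 p)
   (dx \<eta>1 p) (dy \<eta>1 p) (dx \<eta>2 p) (dy \<eta>2 p) (dx \<eta>3 p) (dy \<eta>3 p)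
   + k * f_b_deriv A B C (q1 p) (q2 p) (q3 p) (\<eta>1 p) (\<eta>2 p) (\<eta>3 p) = W \<eta>1 \<eta>2 \<eta>3 p"
   using u(3) ux(3) uy(3) v(3) vx(3) vy(3) q2d q2[folded U_def]
   by eventually_elim (simp add: W_def)
  note X = integral_lebesgue_on[OF Ub(1) borel_measurable_integrable[OF FV(2)] Wm z ae]
  show "integrable lborel (W \<eta>1 \<eta>2 \<eta>3)" using X(2) FV(2) by simp
  show "(LINT p|lborel. W \<eta>1 \<eta>2 \<eta>3 p) = 0" using X(1) FV(1) by simp
 qed
 have outer: "0 \<le> snd p \<and> snd p \<le> fst p \<and> fst p \<le> 1 \<and> (fst p = 1 \<or> fst p + snd p = 2 - \<epsilon>)" if "p \<in> frontier U \<inter> frontier (Omega \<epsilon>)" for p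
  using frontier_outer_D[of "fst p" "snd p" \<epsilon>] that e by (simp add: U_def)
 have tz: "tens f g p = 0" if "fst p = 1 \<or> fst p + snd p = 2 - \<epsilon> \<or> fst p = snd p" "fst p \<le> 1"
  "b \<le> 1 - \<epsilon>" "bump b 1 f" "bump c b g" for f g b c p
 proof (rule ccontr)
  assume "tens f g p \<noteq> 0"
  then have "fst p \<in> {b<..<1}" "snd p \<in> {c<..<b}" using bump_zero[OF that(4), of "fst p"] bump_zero[OF that(5), of "snd p"] by (auto simp: tens_def)
  then show False using that by auto
 qed
 have diag_le: "fst p \<le> 1" if "p \<in> frontier U" for p
 proof -
  have "closure U \<subseteq> {p. fst p \<le> 1}" unfolding U_def
   by (intro closure_minimal closed_Collect_le continuous_intros) (auto simp: mem_Omega_q[OF e])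
  then show ?thesis using that by (auto simp: frontier_def)
 qed
 note supp = u(2) ux(2) uy(2) v(2) vx(2) vy(2)
 have "reduced_system \<epsilon> L2 k A B C s u ux uy v vx vy"
 proof (rule reduced_system.intro)
  show "0 < \<epsilon>" "\<epsilon> < 1" "A < 0" "0 < C" "0 < k" "- 1 < L2" "L2 \<noteq> 0" "s \<noteq> 0" using e par kp sp by auto
  show "u \<in> borel_measurable borel" "v \<in> borel_measurable borel" by (rule u v)+
  show "integrable lborel ux" "integrable lborel uy" "integrable lborel vx" "integrable lborel vy" by (rule ux uy vx vy)+
  show "integrable lborel (\<lambda>p. u p ^ 4)" "integrable lborel (\<lambda>p. v p ^ 4)" by (rule u4 v4)+
  show "u p = 0 \<and> v p = 0 \<and> ux p = 0 \<and> uy p = 0 \<and> vx p = 0 \<and> vy p = 0" if "p \<notin> Omega_q \<epsilon>" for p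
   using supp that by (simp add: U_def)
 next
  fix b f g assume b: "0 < b" "b \<le> 1 - \<epsilon>" and f: "bump b 1 f" and g: "bump (- 1) b g"
  have s1: "smooth1 f" "smooth1 g" using f g bump_smooth by blast+
  have sT: "smooth (tens f g)" by (rule smooth_tens[OF s1])
  have out: "tens f g p = 0" if "p \<in> frontier U \<inter> frontier (Omega \<epsilon>)" for p
   by (rule tz[OF _ _ b(2) f g]) (use outer[OF that] in auto)
  have dia: "tens f g p = 0" if "p \<in> frontier U \<inter> {(x, y). y = x}" for p
   by (rule tz[OF _ _ b(2) f g]) (use that diag_le[of p] in auto)
  have E1: "integrable lborel (W (tens f g) (\<lambda>_. 0) (\<lambda>_. 0))" "(LINT p|lborel. W (tens f g) (\<lambda>_. 0) (\<lambda>_. 0) p) = 0"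
   by (rule EL[OF sT tens_zero_smooth tens_zero_smooth]; simp add: out dia)+
  have E3: "integrable lborel (W (\<lambda>_. 0) (\<lambda>_. 0) (tens f g))" "(LINT p|lborel. W (\<lambda>_. 0) (\<lambda>_. 0) (tens f g) p) = 0"
   by (rule EL[OF tens_zero_smooth tens_zero_smooth sT]; simp add: out)+
  note i = integrable_mult_bumps[OF ux(4) bump_deriv[OF f] g] integrable_mult_bumps[OF uy(4) f bump_deriv[OF g]]
   integrable_mult_bumps[OF vx(4) bump_deriv[OF f] g] integrable_mult_bumps[OF vy(4) f bump_deriv[OF g]]
  have W1: "W (tens f g) (\<lambda>_. 0) (\<lambda>_. 0) p = (2 + L2) * (ux p * tens (deriv f) g p + uy p * tens f (deriv g) p)
   + L2 * (vy p * tens f (deriv g) p - vx p * tens (deriv f) g p) + k * (Phi1 A B C (u p) (v p) * tens f g p)" for p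
   by (simp add: W_def f_el_polar_def f_b_deriv_def Phi1_def dx_tens[OF s1(1)] dy_tens[OF s1(2)] dxy_zero algebra_simps)
  show "(2 + L2) * (tst ux (deriv f) g + tst uy f (deriv g)) + L2 * (tst vy f (deriv g) - tst vx (deriv f) g)
   + k * tst (\<lambda>p. Phi1 A B C (u p) (v p)) f g = 0"
   unfolding tst_def by (rule integral_combination[OF i(1,2,4,3) E1 W1])
  have W3: "W (\<lambda>_. 0) (\<lambda>_. 0) (tens f g) p = (6 + L2) * (vx p * tens (deriv f) g p + vy p * tens f (deriv g) p)
   + L2 * (uy p * tens f (deriv g) p - ux p * tens (deriv f) g p) + k * (Phi3 A B C (u p) (v p) * tens f g p)" for p
   by (simp add: W_def f_el_polar_def f_b_deriv_def Phi3_def dx_tens[OF s1(1)] dy_tens[OF s1(2)] dxy_zero power2_eq_square algebra_simps)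
  show "(6 + L2) * (tst vx (deriv f) g + tst vy f (deriv g)) + L2 * (tst uy f (deriv g) - tst ux (deriv f) g)
   + k * tst (\<lambda>p. Phi3 A B C (u p) (v p)) f g = 0"
   unfolding tst_def by (rule integral_combination[OF i(3,4,2,1) E3 W3])
 next
  have EL2: "- L2 * (tst vx f (deriv g) + tst vy (deriv f) g) + \<bar>L2\<bar> * (tst ux f (deriv g) - tst uy (deriv f) g) = 0"
   if f: "bump a b f" and g: "bump 0 c g" and out: "\<And>p. p \<in> frontier U \<inter> frontier (Omega \<epsilon>) \<Longrightarrow> tens f g p = 0"
   for a b c f g
  proof -
   have s1: "smooth1 f" "smooth1 g" using f g bump_smooth by blast+
   have sT: "smooth (tens f g)" by (rule smooth_tens[OF s1])
   have W': "W (\<lambda>_. 0) (tens f g) (\<lambda>_. 0) p = - L2 * (vx p * tens f (deriv g) p + vy p * tens (deriv f) g p)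
    + \<bar>L2\<bar> * (ux p * tens f (deriv g) p - uy p * tens (deriv f) g p) + 0 * 0" for p
    by (simp add: W_def f_el_polar_def f_b_deriv_def dx_tens[OF s1(1)] dy_tens[OF s1(2)] dxy_zero algebra_simps)
   have bo: "tens f g p = 0" if "p \<in> frontier U \<inter> {(x, y). y = 0}" for p
    using that bump_zero[OF g, of 0] by (auto simp: tens_def)
   have E: "integrable lborel (W (\<lambda>_. 0) (tens f g) (\<lambda>_. 0))" "(LINT p|lborel. W (\<lambda>_. 0) (tens f g) (\<lambda>_. 0) p) = 0"
    by (rule EL[OF tens_zero_smooth sT tens_zero_smooth]; use out bo in blast)+
   show ?thesis
    using integral_combination[OF integrable_mult_bumps[OF vx(4) f bump_deriv[OF g]] integrable_mult_bumps[OF vy(4) bump_deriv[OF f] g]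
     integrable_mult_bumps[OF ux(4) f bump_deriv[OF g]] integrable_mult_bumps[OF uy(4) bump_deriv[OF f] g] E W']
    by (simp add: tst_def)
  qed
  show "- L2 * (tst vx f (deriv g) + tst vy (deriv f) g) + \<bar>L2\<bar> * (tst ux f (deriv g) - tst uy (deriv f) g) = 0"
   if b: "0 < b" "b \<le> 1 - \<epsilon>" and f: "bump b 1 f" and g: "bump 0 b g" for b f g
   by (rule EL2[OF f g]) (rule tz[OF _ _ b(2) f g], use outer in auto)
  show "- L2 * (tst vx f (deriv g) + tst vy (deriv f) g) + \<bar>L2\<bar> * (tst ux f (deriv g) - tst uy (deriv f) g) = 0"
   if f: "bump 0 (1 - \<epsilon>) f" and g: "bump 0 1 g" for f g
  proof (rule EL2[OF f g])
   fix p assume "p \<in> frontier U \<inter> frontier (Omega \<epsilon>)"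
   from outer[OF this] have "fst p \<notin> {0<..<1 - \<epsilon>}" using e by auto
   then show "tens f g p = 0" using bump_zero[OF f] by (simp add: tens_def)
  qed
 next
  fix b f g assume b: "0 < b" "b \<le> 1 - \<epsilon>" and f: "bump b 1 f" and g: "bump 0 b g"
  have s1: "smooth1 f" "smooth1 g" using f g bump_smooth by blast+
  have T: "test_function U (tens f g)"
   by (rule test_function_tens[OF f g]) (use b e in \<open>auto simp: U_def mem_Omega_q[OF e]\<close>)
  show "tst ux f g = - tst u (deriv f) g \<and> tst uy f g = - tst u f (deriv g) \<and>
   tst vx f g = - tst v (deriv f) g \<and> tst vy f g = - tst v f (deriv g)"
   using weak_tst[OF Ub W(1) u(1,3) ux(1,3) uy(1,3) _ s1 T] weak_tst[OF Ub W(3) v(1,3) vx(1,3) vy(1,3) _ s1 T] supp by simp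
 next
  fix b f g assume b: "0 < b" "b \<le> 1 - \<epsilon>" and f: "bump b 2 f" and g: "bump 0 b g"
  show "tst (\<lambda>p. indicator ({b<..<1} \<times> {0<..<b}) p * (u p + s / 2)) (deriv f) g
    = - tst (\<lambda>p. indicator ({b<..<1} \<times> {0<..<b}) p * ux p) f g"
   using trace_right[OF e W(1)[unfolded U_def] t(1)[unfolded U_def] q_b_right[OF e] u(1,3)[unfolded U_def] u(4)
    ux(1,3)[unfolded U_def] ux(4) uy(1,3)[unfolded U_def] b f g] by simp
  show "tst (\<lambda>p. indicator ({b<..<1} \<times> {0<..<b}) p * (v p + s / 6)) (deriv f) g
    = - tst (\<lambda>p. indicator ({b<..<1} \<times> {0<..<b}) p * vx p) f g"
   using trace_right[OF e W(3)[unfolded U_def] t(3)[unfolded U_def] refl v(1,3)[unfolded U_def] v(4)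
    vx(1,3)[unfolded U_def] vx(4) vy(1,3)[unfolded U_def] b f g] by simp
 next
  fix f g assume f: "bump 0 (1 - \<epsilon>) f" and g: "bump 0 2 g"
  show "tst u (deriv f) g = - tst ux f g \<and> tst u f (deriv g) = - tst uy f g"
   by (intro conjI; rule trace_diag[OF e W(1)[unfolded U_def] t(4)[unfolded U_def] u(1,3)[unfolded U_def] u(4)
    ux(1,3)[unfolded U_def] ux(4) uy(1,3)[unfolded U_def] uy(4) _ f g]; use supp in \<open>simp add: U_def\<close>)
 qed
 then show False by (rule reduced_system.contradiction)
qed

theorem proposition3p3:
  fixes A B C L L2 \<epsilon> lam :: real
    and q1s q2s q3s :: "real \<times> real \<Rightarrow> real"
  assumes "A < 0" and "B > 0" and "C > 0" and "L > 0"
    and "L2 > - 1" and "L2 \<noteq> 0"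
    and "0 < \<epsilon>" and "\<epsilon> < 1"
    and "lam > 0"
    and "symmetric_critical_point A B C L L2 lam \<epsilon> q1s q2s q3s"
  shows "\<not> ae_constant_on (Omega \<epsilon>) q2s"
proof
  assume c: "ae_constant_on (Omega \<epsilon>) q2s"
  obtain q1 q2 q3 where min: "minimizer_q A B C L L2 lam \<epsilon> q1 q2 q3" and r: "q2s = reflect2 q2"
    using assms(10) unfolding symmetric_critical_point_def by blast
  show False
    by (rule minimizer_not_q2_zero[OF assms(1-6,9,7,8) min reflect2_constant_zero[OF assms(7,8) c[unfolded r]]])
qed

end
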